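(* Let $\mathbb K$ be an arbitrary field with $\mathbb Q\subset\mathbb K\subset\mathbb C$. (a) For every virtually cyclic group $G$, all positive integers $r,s$ and every matrix $A\in M(r,s;\mathbb K G)$ with $\overline\alpha^{(2)}(A)<\infty^+$ we have \[\overline\alpha^{(2)}(A)=\limsup_{i\in\mathcal F}\alpha(A_i),\] where $\mathcal F$ is the directed set of all finite index normal subgroups of $G$. (b) The corresponding statement for lower limits is false: there exist a virtually cyclic group $G$ and a matrix $A$ over $\mathbb K G$ with $\overline\alpha^{(2)}(A)<\infty^+$ such that \[\underline\alpha^{(2)}(A)\neq\liminf_{i\in\mathcal F}\alpha(A_i).\]
   Context: Spectral distribution function and Novikov--Shubin numbers. For a countable discrete group $G$ and $A\in M(r,s;\mathbb C G)$, let $A^*$ be obtained from $A$ by transposing and applying the involution $(\sum\lambda_g g)^*=\sum\overline{\lambda_g}g^{-1}$ to the entries. Let $r^{(2)}_{AA^*}\colon(\ell^2G)^r\to(\ell^2G)^r$, $x\mapsto xAA^*$, let $E^{AA^*}_\lambda=\chi_{[0,\lambda]}(r^{(2)}_{AA^*})$ be its spectral projections, and set $F_A(\lambda)=\operatorname{tr}_{\mathcal N(G)}E^{AA^*}_{\lambda^2}$ for $\lambda\ge0$, where $\operatorname{tr}_{\mathcal N(G)}$ is the von Neumann trace of the group von Neumann algebra, extended diagonally to matrices. If $F_A(\lambda)=F_A(0)$ for some $\lambda>0$, both the upper and the lower Novikov--Shubin number of $A$ are the formal symbol $\infty^+$. Otherwise the upper Novikov--Shubin number is \[\overline\alpha^{(2)}(A)=\limsup_{\lambda\to0^+}\frac{\log(F_A(\lambda)-F_A(0))}{\log\lambda}\in[0,\infty]\]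 and the lower Novikov--Shubin number $\underline\alpha^{(2)}(A)$ is defined with $\liminf$ instead. By convention $c<\infty<\infty^+$ for all $c\in[0,\infty)$. Alpha numbers. For a finite index normal subgroup $G_i\trianglelefteq G$, let $A_i\in M(r,s;\mathbb C(G/G_i))$ be the image of $A$ under $\mathbb C G\to\mathbb C(G/G_i)$ applied entrywise. Via the regular representation of $G/G_i$ (i.e. as the linear map $\mathbb C(G/G_i)^r\to\mathbb C(G/G_i)^s$, $x\mapsto xA_i$, in the bases of group elements), view $A_i$ as a complex matrix of size $r[G:G_i]\times s[G:G_i]$. If $A_i\neq0$, let $\sigma^+(A_i)$ be its smallest positive singular value and $m^+(A_i)=\dim_{\mathbb C}\ker(A_iA_i^*-\sigma^+(A_i)^2)$ its multiplicity. The alpha number is \[\alpha(A_i)=\frac{\log\left(m^+(A_i)/[G:G_i]\right)}{\log\sigma^+(A_i)}.\] If the Novikov--Shubin number of $A$ is $<\infty^+$, then $\sigma^+(A_i)\to0$ along the net of all finite index normal subgroups, so $\alpha(A_i)$ is defined for all sufficiently large $i$; only these matter for upper and lower limits. Nets. $\mathcal F$ is directed by reverse inclusion of subgroups ($i\le j$ iff $G_j\subseteq G_i$). For a net $(x_i)$ of real numbers, $\limsup_{i}x_i=\inf_{i}\sup_{j\ge i}x_j$ and $\liminf_i x_i=\sup_i\inf_{j\ge i}x_j$. *)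

theory Defs
  imports
    "HOL-Analysis.Analysis"
    "HOL-Algebra.Elementary_Groups"
    "HOL-Algebra.Subrings"
    "Jordan_Normal_Form.Char_Poly"
    "Jordan_Normal_Form.Matrix_Kernel"
    "Jordan_Normal_Form.Schur_Decomposition"
begin

section \<open>Virtually cyclic groups and finite index normal subgroups\<close>

definition virtually_cyclic :: "('a, 'b) monoid_scheme \<Rightarrow> bool" where
  "virtually_cyclic G \<longleftrightarrow> group G \<and>
     (\<exists>H. subgroup H G \<and> cyclic_group (G\<lparr>carrier := H\<rparr>) \<and> finite (rcosets\<^bsub>G\<^esub> H))"

definition finite_index_normal :: "('a, 'b) monoid_scheme \<Rightarrow> 'a set set" where
  "finite_index_normal G = {N. N \<lhd> G \<and> finite (rcosets\<^bsub>G\<^esub> N)}"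

definition group_index :: "('a, 'b) monoid_scheme \<Rightarrow> 'a set \<Rightarrow> nat" where
  "group_index G N = card (rcosets\<^bsub>G\<^esub> N)"

text \<open>Upper and lower limits along the net of finite index normal subgroups, directed by
  reverse inclusion.\<close>

definition limsup_fin :: "('a, 'b) monoid_scheme \<Rightarrow> ('a set \<Rightarrow> real) \<Rightarrow> ereal" where
  "limsup_fin G x = (INF N\<in>finite_index_normal G.
      SUP M\<in>{M \<in> finite_index_normal G. M \<subseteq> N}. ereal (x M))"

definition liminf_fin :: "('a, 'b) monoid_scheme \<Rightarrow> ('a set \<Rightarrow> real) \<Rightarrow> ereal" where
  "liminf_fin G x = (SUP N\<in>finite_index_normal G.
      INF M\<in>{M \<in> finite_index_normal G. M \<subseteq> N}. ereal (x M))"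

section \<open>Matrices over the group ring\<close>

text \<open>Elements of the group ring are finitely supported functions on the group.\<close>

definition group_ring :: "complex set \<Rightarrow> ('a, 'b) monoid_scheme \<Rightarrow> ('a \<Rightarrow> complex) set" where
  "group_ring K G = {a. finite {g. a g \<noteq> 0} \<and> {g. a g \<noteq> 0} \<subseteq> carrier G \<and> range a \<subseteq> K}"

definition group_ring_mats ::
  "complex set \<Rightarrow> ('a, 'b) monoid_scheme \<Rightarrow> nat \<Rightarrow> nat \<Rightarrow> ('a \<Rightarrow> complex) mat set" where
  "group_ring_mats K G r s =
     {A \<in> carrier_mat r s. \<forall>i<r. \<forall>j<s. A $$ (i, j) \<in> group_ring K G}"

text \<open>The product \<open>x \<cdot> a\<close> of an arbitrary function \<open>x\<close> on the group, read as a formal sum, with a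
  finitely supported \<open>a\<close>.\<close>

definition conv ::
  "('a, 'b) monoid_scheme \<Rightarrow> ('a \<Rightarrow> complex) \<Rightarrow> ('a \<Rightarrow> complex) \<Rightarrow> 'a \<Rightarrow> complex" where
  "conv G x a g = (if g \<in> carrier G
     then \<Sum>h\<in>{h \<in> carrier G. a h \<noteq> 0}. x (g \<otimes>\<^bsub>G\<^esub> inv\<^bsub>G\<^esub> h) * a h else 0)"

definition gr_mult ::
  "('a, 'b) monoid_scheme \<Rightarrow> ('a \<Rightarrow> complex) mat \<Rightarrow> ('a \<Rightarrow> complex) mat \<Rightarrow> ('a \<Rightarrow> complex) mat"
  where
  "gr_mult G A B = Matrix.mat (dim_row A) (dim_col B)
     (\<lambda>(i, k). \<lambda>g. \<Sum>j<dim_col A. conv G (A $$ (i, j)) (B $$ (j, k)) g)"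

definition gr_star ::
  "('a, 'b) monoid_scheme \<Rightarrow> ('a \<Rightarrow> complex) mat \<Rightarrow> ('a \<Rightarrow> complex) mat" where
  "gr_star G A = Matrix.mat (dim_col A) (dim_row A)
     (\<lambda>(j, i). \<lambda>g. if g \<in> carrier G then cnj ((A $$ (i, j)) (inv\<^bsub>G\<^esub> g)) else 0)"

text \<open>Row vectors of length \<open>r\<close> of functions on the group are functions on
  \<open>{..<r} \<times> carrier G\<close>; \<open>right_mult G A\<close> is the map \<open>x \<mapsto> x A\<close>.\<close>

definition right_mult ::
  "('a, 'b) monoid_scheme \<Rightarrow> ('a \<Rightarrow> complex) mat \<Rightarrow> (nat \<times> 'a \<Rightarrow> complex) \<Rightarrow> nat \<times> 'a \<Rightarrow> complex"
  where
  "right_mult G A x = (\<lambda>(j, g). if j < dim_col A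
     then \<Sum>i<dim_row A. conv G (\<lambda>h. x (i, h)) (A $$ (i, j)) g else 0)"

definition unit_fun :: "'i \<Rightarrow> 'i \<Rightarrow> complex" where
  "unit_fun i = (\<lambda>j. if j = i then 1 else 0)"

section \<open>Hilbert spaces of square summable functions and spectral projections\<close>

definition ell2 :: "'i set \<Rightarrow> ('i \<Rightarrow> complex) set" where
  "ell2 I = {x. (\<forall>i. i \<notin> I \<longrightarrow> x i = 0) \<and> (\<lambda>i. (cmod (x i))\<^sup>2) summable_on I}"

definition ell2_inner :: "'i set \<Rightarrow> ('i \<Rightarrow> complex) \<Rightarrow> ('i \<Rightarrow> complex) \<Rightarrow> complex" where
  "ell2_inner I x y = (\<Sum>\<^sub>\<infinity>i\<in>I. x i * cnj (y i))"

text \<open>Linearity and boundedness on \<open>ell2 I\<close> follow from the conditions below.\<close>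

definition orth_projection ::
  "'i set \<Rightarrow> (('i \<Rightarrow> complex) \<Rightarrow> ('i \<Rightarrow> complex)) \<Rightarrow> bool" where
  "orth_projection I P \<longleftrightarrow>
     (\<forall>x\<in>ell2 I. P x \<in> ell2 I \<and> P (P x) = P x) \<and>
     (\<forall>x\<in>ell2 I. \<forall>y\<in>ell2 I. ell2_inner I (P x) y = ell2_inner I x (P y))"

text \<open>\<open>E\<close> is the projection-valued measure of the bounded self-adjoint operator \<open>T\<close> on
  \<open>ell2 I\<close>: it is compactly supported and \<open>T = \<integral>t dE(t)\<close>. By polarization the latter may be
  tested on the scalar measures \<open>B \<mapsto> \<langle>E(B) x, x\<rangle>\<close>.\<close>

definition spectral_measure ::
  "'i set \<Rightarrow> (('i \<Rightarrow> complex) \<Rightarrow> ('i \<Rightarrow> complex)) \<Rightarrow>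
   (real set \<Rightarrow> ('i \<Rightarrow> complex) \<Rightarrow> ('i \<Rightarrow> complex)) \<Rightarrow> bool" where
  "spectral_measure I T E \<longleftrightarrow>
     (\<forall>B\<in>sets borel. orth_projection I (E B)) \<and>
     (\<exists>R. \<forall>x\<in>ell2 I. E {-R..R} x = x) \<and>
     (\<forall>x\<in>ell2 I. E UNIV x = x) \<and>
     (\<forall>B\<in>sets borel. \<forall>C\<in>sets borel. \<forall>x\<in>ell2 I. E (B \<inter> C) x = E B (E C x)) \<and>
     (\<forall>B::nat \<Rightarrow> real set. range B \<subseteq> sets borel \<longrightarrow> disjoint_family B \<longrightarrow>
        (\<forall>x\<in>ell2 I. \<forall>y\<in>ell2 I.
           (\<lambda>n. ell2_inner I (E (B n) x) y) sums ell2_inner I (E (\<Union>n. B n) x) y)) \<and>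
     (\<forall>x\<in>ell2 I. ell2_inner I (T x) x = complex_of_real
        (integral\<^sup>L (measure_of UNIV (sets borel) (\<lambda>B. ennreal (Re (ell2_inner I (E B x) x))))
           (\<lambda>t. t)))"

text \<open>\<open>\<chi>\<^sub>B(T)\<close> for a bounded self-adjoint operator \<open>T\<close>. By the spectral theorem the
  projection-valued measure exists and is unique as far as Borel sets and vectors of \<open>ell2 I\<close> are
  concerned.\<close>

definition spectral_projection ::
  "'i set \<Rightarrow> (('i \<Rightarrow> complex) \<Rightarrow> ('i \<Rightarrow> complex)) \<Rightarrow> real set \<Rightarrow> ('i \<Rightarrow> complex) \<Rightarrow> ('i \<Rightarrow> complex)"
  where
  "spectral_projection I T = (SOME E. spectral_measure I T E)"

section \<open>Spectral distribution function and Novikov--Shubin numbers\<close>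

abbreviation index_set :: "('a, 'b) monoid_scheme \<Rightarrow> nat \<Rightarrow> (nat \<times> 'a) set" where
  "index_set G r \<equiv> {..<r} \<times> carrier G"

definition vn_trace ::
  "('a, 'b) monoid_scheme \<Rightarrow> nat \<Rightarrow>
   ((nat \<times> 'a \<Rightarrow> complex) \<Rightarrow> (nat \<times> 'a \<Rightarrow> complex)) \<Rightarrow> complex" where
  "vn_trace G r P =
     (\<Sum>k<r. ell2_inner (index_set G r) (P (unit_fun (k, \<one>\<^bsub>G\<^esub>))) (unit_fun (k, \<one>\<^bsub>G\<^esub>)))"

text \<open>The trace of a projection is real, so that taking the real part loses nothing.\<close>

definition spectral_distribution ::
  "('a, 'b) monoid_scheme \<Rightarrow> ('a \<Rightarrow> complex) mat \<Rightarrow> real \<Rightarrow> real" where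
  "spectral_distribution G A l = Re (vn_trace G (dim_row A)
     (spectral_projection (index_set G (dim_row A))
        (right_mult G (gr_mult G A (gr_star G A))) {0..l\<^sup>2}))"

text \<open>Extended reals with a further element \<open>\<infinity>\<^sup>+\<close> on top.\<close>

datatype ns_number = NS ereal | InfPlus (\<open>\<infinity>\<^sup>+\<close>)

instantiation ns_number :: linorder
begin

definition less_eq_ns_number :: "ns_number \<Rightarrow> ns_number \<Rightarrow> bool" where
  "less_eq_ns_number a b = (case b of InfPlus \<Rightarrow> True
     | NS y \<Rightarrow> (case a of InfPlus \<Rightarrow> False | NS x \<Rightarrow> x \<le> y))"

definition less_ns_number :: "ns_number \<Rightarrow> ns_number \<Rightarrow> bool" where
  "less_ns_number a b = (a \<le> b \<and> \<not> b \<le> a)"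

instance
  by standard (auto simp: less_eq_ns_number_def less_ns_number_def split: ns_number.splits)

end

lemma less_InfPlus_iff: "a < \<infinity>\<^sup>+ \<longleftrightarrow> a \<noteq> \<infinity>\<^sup>+"
  by (cases a) (auto simp: less_ns_number_def less_eq_ns_number_def)

definition spectral_gap :: "('a, 'b) monoid_scheme \<Rightarrow> ('a \<Rightarrow> complex) mat \<Rightarrow> bool" where
  "spectral_gap G A \<longleftrightarrow>
     (\<exists>l>0. spectral_distribution G A l = spectral_distribution G A 0)"

definition upper_NS :: "('a, 'b) monoid_scheme \<Rightarrow> ('a \<Rightarrow> complex) mat \<Rightarrow> ns_number" where
  "upper_NS G A = (if spectral_gap G A then \<infinity>\<^sup>+ else NS (Limsup (at_right 0)
     (\<lambda>l. ereal (ln (spectral_distribution G A l - spectral_distribution G A 0) / ln l))))"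

definition lower_NS :: "('a, 'b) monoid_scheme \<Rightarrow> ('a \<Rightarrow> complex) mat \<Rightarrow> ns_number" where
  "lower_NS G A = (if spectral_gap G A then \<infinity>\<^sup>+ else NS (Liminf (at_right 0)
     (\<lambda>l. ereal (ln (spectral_distribution G A l - spectral_distribution G A 0) / ln l))))"

section \<open>Alpha numbers\<close>

definition singular_values :: "complex mat \<Rightarrow> real set" where
  "singular_values M = {t. 0 \<le> t \<and> eigenvalue (M * mat_adjoint M) (complex_of_real (t\<^sup>2))}"

definition sigma_plus :: "complex mat \<Rightarrow> real" where
  "sigma_plus M = Min {t \<in> singular_values M. 0 < t}"

definition m_plus :: "complex mat \<Rightarrow> nat" where
  "m_plus M = kernel_dim
     (M * mat_adjoint M - complex_of_real ((sigma_plus M)\<^sup>2) \<cdot>\<^sub>m 1\<^sub>m (dim_row M))"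

text \<open>The image of a matrix under the projection to the group ring of \<open>G Mod N\<close>.\<close>

definition quotient_mat ::
  "('a, 'b) monoid_scheme \<Rightarrow> 'a set \<Rightarrow> ('a \<Rightarrow> complex) mat \<Rightarrow> ('a set \<Rightarrow> complex) mat" where
  "quotient_mat G N A = map_mat
     (\<lambda>a c. if c \<in> carrier (G Mod N) then \<Sum>g\<in>{g \<in> c. a g \<noteq> 0}. a g else 0) A"

text \<open>The matrix of \<open>x \<mapsto> x A\<close> for a finite group \<open>H\<close> in the bases of group elements; its rows are
  the images of the basis vectors. Another enumeration of \<open>H\<close> would permute the basis elements and
  hence change neither singular values nor multiplicities.\<close>

definition basis_index :: "('a, 'b) monoid_scheme \<Rightarrow> nat \<Rightarrow> nat \<times> 'a" where
  "basis_index H k = (k div order H, from_nat_into (carrier H) (k mod order H))"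

definition regular_matrix ::
  "('a, 'b) monoid_scheme \<Rightarrow> ('a \<Rightarrow> complex) mat \<Rightarrow> complex mat" where
  "regular_matrix H A = Matrix.mat (dim_row A * order H) (dim_col A * order H)
     (\<lambda>(k, l). right_mult H A (unit_fun (basis_index H k)) (basis_index H l))"

text \<open>The value is meaningless if the image of \<open>A\<close> over \<open>G Mod N\<close> is zero or its smallest positive
  singular value is \<open>1\<close>. This does not affect the limits along the net when the Novikov--Shubin
  numbers are less than \<open>\<infinity>\<^sup>+\<close>, as then the smallest positive singular values tend to \<open>0\<close>.\<close>

definition alpha_number ::
  "('a, 'b) monoid_scheme \<Rightarrow> ('a \<Rightarrow> complex) mat \<Rightarrow> 'a set \<Rightarrow> real" where
  "alpha_number G A N = (let M = regular_matrix (G Mod N) (quotient_mat G N A) in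
     ln (real (m_plus M) / real (group_index G N)) / ln (sigma_plus M))"

end

theory Submission
  imports
    Defs
    "HOL-Probability.Helly_Selection"
    "HOL-Analysis.Kronecker_Approximation_Theorem"
    "Jordan_Normal_Form.Jordan_Normal_Form_Existence"
    "Jordan_Normal_Form.Jordan_Normal_Form_Uniqueness"
    "HOL-Real_Asymp.Real_Asymp"
begin

text \<open>Let \<open>G\<close> be infinite and virtually cyclic, with a normal infinite cyclic subgroup \<open>Z\<close> of index
  \<open>d\<close>. The finite index normal subgroups contained in \<open>Z\<close> are the \<open>m Z\<close>, and inducing the characters
  of \<open>Z\<close> turns \<open>A\<close> into a matrix of Laurent polynomials on the unit circle such that \<open>F\<^sub>A\<close> is the
  averaged eigenvalue distribution of \<open>A(z) A(z)\<^sup>*\<close> over the circle, while the squared singular values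
  of \<open>A\<^sub>i\<close> are the eigenvalues at the \<open>m\<close>-th roots of unity. As all moments of the two distributions
  agree for large \<open>m\<close>, the limit behaviour of \<open>F\<^sub>A\<close> can be read off from the counting functions at
  roots of unity.

  The smallest positive eigenvalue of \<open>A(z) A(z)\<^sup>*\<close> is comparable to \<open>\<bar>p(z)\<bar>\<close> for some
  polynomial \<open>p\<close>, off finitely many \<open>z\<close>. If \<open>b\<close> is the largest order of a zero of \<open>p\<close> on the circle,
  then \<open>F\<^sub>A(\<lambda>) - F\<^sub>A(0)\<close> is comparable to \<open>\<lambda>\<close> to the power \<open>2 / b\<close>, so both Novikov--Shubin numbers are
  \<open>2 / b\<close>. Some \<open>m\<close>-th root of unity is as close as a multiple of \<open>1 / m\<close> to the worst zero, which
  bounds the alpha numbers by \<open>2 / b + o(1)\<close>. Conversely, by a pigeonhole argument there are infinitely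
  many \<open>m\<close> for which no \<open>m\<close>-th root of unity other than the zeros themselves is much closer than
  \<open>1 / m\<close> to a zero, and along these the alpha numbers tend to \<open>2 / b\<close>.

  For lower limits take \<open>5 + 6 g + 5 g\<^sup>2\<close> over the integers. Its zeros lie on the circle, are simple and
  not roots of unity. By Dirichlet's theorem they are approximated by \<open>m\<close>-th roots of unity up to
  \<open>O(1 / m\<^sup>2)\<close> for infinitely many \<open>m\<close>, which makes the lower limit at most \<open>1 / 2\<close>, whereas the lower
  Novikov--Shubin number is \<open>1\<close>.\<close>

section \<open>Square summable functions\<close>

text \<open>The spectral projections come from a choice operator among all projection-valued
  measures that reproduce the quadratic form of the operator. So two things are shown: such a
  measure exists, obtained by solving a Hausdorff moment problem for each vector and polarizing; and
  every such measure has the moments of the powers of the operator, for which its projections are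
  first shown to commute with the operator. From then on moments are compared, and moments are
  traces. The trace of a power of a Gram matrix depends on the character of the representation
  alone, so the induced representations at all \<open>m\<close>-th roots of unity together and the
  regular representation of the finite quotient give the same eigenvalues. Hence no eigenvalue is
  followed along the circle: the lists are chosen pointwise, and averages over roots of unity stand
  in for integrals over the circle. The finitely many exceptional points change a counting function
  by a bounded amount, which disappears after division by \<open>m\<close>. Finite groups fall
  outside this scheme, but there every matrix has a spectral gap.\<close>

lemma ell2_add:
  assumes "x \<in> ell2 I" "y \<in> ell2 I"
  shows "(\<lambda>i. x i + y i) \<in> ell2 I"
proof -
  have s: "(\<lambda>i. 2 * (cmod (x i))\<^sup>2 + 2 * (cmod (y i))\<^sup>2) summable_on I"
    using assms by (auto simp: ell2_def intro!: summable_on_add summable_on_cmult_right)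
  have "(cmod (x i + y i))\<^sup>2 \<le> 2 * (cmod (x i))\<^sup>2 + 2 * (cmod (y i))\<^sup>2" for i
  proof -
    have "(cmod (x i + y i))\<^sup>2 \<le> (cmod (x i) + cmod (y i))\<^sup>2"
      by (simp add: norm_triangle_ineq power_mono)
    also have "\<dots> \<le> 2 * (cmod (x i))\<^sup>2 + 2 * (cmod (y i))\<^sup>2"
      using sum_squares_bound[of "cmod (x i)" "cmod (y i)"] by (simp add: power2_sum)
    finally show ?thesis .
  qed
  then have "(\<lambda>i. (cmod (x i + y i))\<^sup>2) summable_on I"
    by (intro summable_on_comparison_test[OF s]) simp_all
  then show ?thesis using assms by (auto simp: ell2_def)
qed

lemma ell2_scale: "x \<in> ell2 I \<Longrightarrow> (\<lambda>i. c * x i) \<in> ell2 I"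
  by (auto simp: ell2_def norm_mult power_mult_distrib intro!: summable_on_cmult_right)

lemma ell2_zero: "(\<lambda>i. 0) \<in> ell2 I"
  by (auto simp: ell2_def)

lemma ell2_uminus: "x \<in> ell2 I \<Longrightarrow> (\<lambda>i. - x i) \<in> ell2 I"
  using ell2_scale[of x I "-1"] by simp

lemma ell2_diff:
  "x \<in> ell2 I \<Longrightarrow> y \<in> ell2 I \<Longrightarrow> (\<lambda>i. x i - y i) \<in> ell2 I"
  using ell2_add[OF _ ell2_uminus, of x I y] by simp

lemma ell2_finite_support:
  assumes "finite {i. x i \<noteq> 0}" "{i. x i \<noteq> 0} \<subseteq> I"
  shows "x \<in> ell2 I"
proof -
  have "(\<lambda>i. (cmod (x i))\<^sup>2) summable_on {i. x i \<noteq> 0}"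
    using assms by simp
  then have "(\<lambda>i. (cmod (x i))\<^sup>2) summable_on I"
    by (rule summable_on_cong_neutral[THEN iffD1, rotated 3]) (use assms in auto)
  then show ?thesis using assms by (auto simp: ell2_def)
qed

lemma ell2_unit_fun: "i \<in> I \<Longrightarrow> unit_fun i \<in> ell2 I"
  by (rule ell2_finite_support) (auto simp: unit_fun_def)

lemma ell2_inner_summable:
  assumes "x \<in> ell2 I" "y \<in> ell2 I"
  shows "(\<lambda>i. x i * cnj (y i)) summable_on I"
proof -
  have s: "(\<lambda>i. (cmod (x i))\<^sup>2 + (cmod (y i))\<^sup>2) summable_on I"
    using assms by (auto simp: ell2_def intro!: summable_on_add)
  have "norm (x i * cnj (y i)) \<le> (cmod (x i))\<^sup>2 + (cmod (y i))\<^sup>2" for i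
  proof -
    have "0 \<le> cmod (x i) * cmod (y i)" by simp
    then show ?thesis
      using sum_squares_bound[of "cmod (x i)" "cmod (y i)"] by (simp only: norm_mult complex_mod_cnj)
  qed
  then have "(\<lambda>i. norm (x i * cnj (y i))) summable_on I"
    by (intro Infinite_Sum.abs_summable_on_comparison_test'[OF s]) simp
  then show ?thesis by (rule Infinite_Sum.abs_summable_summable)
qed

lemma ell2_inner_add_left:
  assumes "x \<in> ell2 I" "y \<in> ell2 I" "z \<in> ell2 I"
  shows "ell2_inner I (\<lambda>i. x i + y i) z = ell2_inner I x z + ell2_inner I y z"
  unfolding ell2_inner_def ring_distribs
  by (intro infsum_add ell2_inner_summable assms)

lemma ell2_inner_scale_left: "ell2_inner I (\<lambda>i. c * x i) z = c * ell2_inner I x z"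
  unfolding ell2_inner_def by (simp add: mult.assoc infsum_cmult_right')

lemma ell2_inner_commute: "ell2_inner I y x = cnj (ell2_inner I x y)"
  unfolding ell2_inner_def by (simp add: infsum_cnj[symmetric] mult.commute)

lemma ell2_inner_add_right:
  assumes "x \<in> ell2 I" "y \<in> ell2 I" "z \<in> ell2 I"
  shows "ell2_inner I z (\<lambda>i. x i + y i) = ell2_inner I z x + ell2_inner I z y"
  by (subst (1 2 3) ell2_inner_commute) (simp add: ell2_inner_add_left[OF assms])

lemma ell2_inner_scale_right: "ell2_inner I z (\<lambda>i. c * x i) = cnj c * ell2_inner I z x"
  by (subst (1 2) ell2_inner_commute) (simp add: ell2_inner_scale_left)

lemma ell2_inner_diff_left:
  assumes "x \<in> ell2 I" "y \<in> ell2 I" "z \<in> ell2 I"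
  shows "ell2_inner I (\<lambda>i. x i - y i) z = ell2_inner I x z - ell2_inner I y z"
  using ell2_inner_add_left[OF assms(1) ell2_scale[OF assms(2), of "-1"] assms(3)]
  by (simp add: ell2_inner_scale_left[of I "-1", simplified])

lemma ell2_inner_diff_right:
  assumes "x \<in> ell2 I" "y \<in> ell2 I" "z \<in> ell2 I"
  shows "ell2_inner I z (\<lambda>i. x i - y i) = ell2_inner I z x - ell2_inner I z y"
  by (subst (1 2 3) ell2_inner_commute) (simp add: ell2_inner_diff_left[OF assms])

lemma ell2_inner_self: "ell2_inner I x x = of_real (\<Sum>\<^sub>\<infinity>i\<in>I. (cmod (x i))\<^sup>2)"
proof -
  have "ell2_inner I x x = (\<Sum>\<^sub>\<infinity>i\<in>I. complex_of_real ((cmod (x i))\<^sup>2))"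
    unfolding ell2_inner_def by (simp only: complex_norm_square)
  also have "\<dots> = of_real (\<Sum>\<^sub>\<infinity>i\<in>I. (cmod (x i))\<^sup>2)"
  proof (cases "(\<lambda>i. (cmod (x i))\<^sup>2) summable_on I")
    case True
    then show ?thesis by (intro infsumI) (simp only: has_sum_of_real_iff has_sum_infsum)
  next
    case False
    then have "\<not> (\<lambda>i. complex_of_real ((cmod (x i))\<^sup>2)) summable_on I"
      using summable_on_Re by fastforce
    then show ?thesis using False by (metis infsum_not_exists of_real_0)
  qed
  finally show ?thesis .
qed

lemma ell2_inner_unit_right: "i \<in> I \<Longrightarrow> ell2_inner I x (unit_fun i) = x i"
  unfolding ell2_inner_def unit_fun_def
  by (subst infsum_cong_neutral[where T="{i}" and g="\<lambda>i. x i"]) auto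

definition ell2_sq :: "'i set \<Rightarrow> ('i \<Rightarrow> complex) \<Rightarrow> real" where
  "ell2_sq I x = (\<Sum>\<^sub>\<infinity>i\<in>I. (cmod (x i))\<^sup>2)"

lemma ell2_inner_same: "ell2_inner I x x = of_real (ell2_sq I x)"
  by (simp add: ell2_inner_self ell2_sq_def)

lemma ell2_sq_nonneg: "0 \<le> ell2_sq I x"
  by (simp add: ell2_sq_def infsum_nonneg)

lemma ell2_sq_alt: "ell2_sq I x = Re (ell2_inner I x x)"
  by (simp add: ell2_inner_same)

lemma ell2_ext:
  assumes "x \<in> ell2 I" "y \<in> ell2 I" "\<And>z. z \<in> ell2 I \<Longrightarrow> ell2_inner I x z = ell2_inner I y z"
  shows "x = y"
proof
  fix i show "x i = y i"
  proof (cases "i \<in> I")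
    case True
    then show ?thesis
      using assms(3)[OF ell2_unit_fun[OF True]] by (simp add: ell2_inner_unit_right)
  qed (use assms in \<open>auto simp: ell2_def\<close>)
qed

text \<open>An arbitrary positive semidefinite Hermitian form is considered because the inequality
  serves twice: for the inner product and for the forms \<open>q (indicator B)\<close> from which
  the spectral projections are made. The latter may be degenerate, whence the case of a vanishing
  \<open>Re (q y y)\<close>.\<close>

lemma Cauchy_Schwarz_form:
  fixes q :: "('i \<Rightarrow> complex) \<Rightarrow> ('i \<Rightarrow> complex) \<Rightarrow> complex"
  assumes x: "x \<in> ell2 I" and y: "y \<in> ell2 I"
    and add: "\<And>x y z. x \<in> ell2 I \<Longrightarrow> y \<in> ell2 I \<Longrightarrow> z \<in> ell2 I \<Longrightarrow>
       q (\<lambda>i. x i + y i) z = q x z + q y z"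
    and scale: "\<And>c x z. x \<in> ell2 I \<Longrightarrow> z \<in> ell2 I \<Longrightarrow> q (\<lambda>i. c * x i) z = c * q x z"
    and comm: "\<And>x y. x \<in> ell2 I \<Longrightarrow> y \<in> ell2 I \<Longrightarrow> q y x = cnj (q x y)"
    and pos: "\<And>x. x \<in> ell2 I \<Longrightarrow> 0 \<le> Re (q x x)"
  shows "(cmod (q x y))\<^sup>2 \<le> Re (q x x) * Re (q y y)"
proof -
  have addr: "q z (\<lambda>i. x i + y i) = q z x + q z y"
    if "x \<in> ell2 I" "y \<in> ell2 I" "z \<in> ell2 I" for x y z
    using that add[of x y z] comm[of "\<lambda>i. x i + y i" z] comm[of x z] comm[of y z]
    by (simp add: ell2_add)
  have scaler: "q z (\<lambda>i. c * x i) = cnj c * q z x" if "x \<in> ell2 I" "z \<in> ell2 I" for c x z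
    using that scale[of x z c] comm[of "\<lambda>i. c * x i" z] comm[of x z] by (simp add: ell2_scale)
  have real: "Im (q x x) = 0" if "x \<in> ell2 I" for x
    using arg_cong[OF comm[OF that that], of Im] by simp
  have ineq: "0 \<le> Re (q x x) + (cmod c)\<^sup>2 * Re (q y y) + 2 * Re (cnj c * q x y)" for c
  proof -
    let ?w = "\<lambda>i. x i + c * y i"
    have cy: "(\<lambda>i. c * y i) \<in> ell2 I" using y by (rule ell2_scale)
    have "0 \<le> Re (q ?w ?w)" using pos ell2_add[OF x cy] by blast
    also have "q ?w ?w = q x x + cnj c * q x y + c * q y x + c * (cnj c * q y y)"
      using x y cy by (simp add: add addr scale scaler ell2_add algebra_simps)
    also have "q y x = cnj (q x y)" using comm x y by blast
    also have "Re (q x x + cnj c * q x y + c * cnj (q x y) + c * (cnj c * q y y)) =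
      Re (q x x) + (cmod c)\<^sup>2 * Re (q y y) + 2 * Re (cnj c * q x y)"
      using real[OF y] unfolding cmod_power2 by (simp add: algebra_simps power2_eq_square)
    finally show ?thesis .
  qed
  show ?thesis
  proof (cases "Re (q y y) = 0")
    case True
    have "q x y = 0"
    proof (rule ccontr)
      assume nz: "q x y \<noteq> 0"
      \<comment> \<open>With this multiple of \<open>q x y\<close> the cross term in
        \<open>ineq\<close> is \<open>- (Re (q x x) + 1)\<close>; twice this outweighs
        \<open>Re (q x x)\<close>.\<close>
      define c where "c = of_real (- (Re (q x x) + 1) / (cmod (q x y))\<^sup>2) * q x y"
      have "cnj c * q x y = of_real (- (Re (q x x) + 1) / (cmod (q x y))\<^sup>2) * (cnj (q x y) * q x y)"
        by (simp add: c_def)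
      also have "cnj (q x y) * q x y = of_real ((cmod (q x y))\<^sup>2)"
        using complex_norm_square[of "q x y"] by (simp add: mult.commute)
      finally have "cnj c * q x y = of_real (- (Re (q x x) + 1))"
        using nz by (simp flip: of_real_mult)
      then have "0 \<le> Re (q x x) + 2 * (- (Re (q x x) + 1))"
        using ineq[of c] True by simp
      with pos[OF x] show False by simp
    qed
    then show ?thesis using pos[OF x] pos[OF y] by simp
  next
    case False
    then have p: "Re (q y y) > 0" using pos[OF y] by simp
    \<comment> \<open>The quadratic expression in \<open>ineq\<close> attains its minimum
      here.\<close>
    define c where "c = of_real (- 1 / Re (q y y)) * q x y"
    have "cnj c * q x y = of_real (- 1 / Re (q y y)) * (cnj (q x y) * q x y)"
      by (simp add: c_def)
    also have "cnj (q x y) * q x y = of_real ((cmod (q x y))\<^sup>2)"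
      using complex_norm_square[of "q x y"] by (simp add: mult.commute)
    finally have 1: "Re (cnj c * q x y) = - (cmod (q x y))\<^sup>2 / Re (q y y)"
      by simp
    have 2: "(cmod c)\<^sup>2 * Re (q y y) = (cmod (q x y))\<^sup>2 / Re (q y y)"
      using p by (simp add: c_def norm_divide power_divide power2_eq_square)
    from ineq[of c] 1 2 have "(cmod (q x y))\<^sup>2 / Re (q y y) \<le> Re (q x x)" by simp
    then show ?thesis using p by (simp add: field_simps)
  qed
qed

lemma ell2_Cauchy_Schwarz:
  assumes "x \<in> ell2 I" "y \<in> ell2 I"
  shows "(cmod (ell2_inner I x y))\<^sup>2 \<le> ell2_sq I x * ell2_sq I y"
proof -
  have "(cmod (ell2_inner I x y))\<^sup>2 \<le> Re (ell2_inner I x x) * Re (ell2_inner I y y)"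
  proof (rule Cauchy_Schwarz_form[where q = "ell2_inner I", OF assms])
    show "ell2_inner I (\<lambda>i. x i + y i) z = ell2_inner I x z + ell2_inner I y z"
      if "x \<in> ell2 I" "y \<in> ell2 I" "z \<in> ell2 I" for x y z
      using that by (rule ell2_inner_add_left)
    show "ell2_inner I (\<lambda>i. c * x i) z = c * ell2_inner I x z" for c x z
      by (rule ell2_inner_scale_left)
    show "ell2_inner I y x = cnj (ell2_inner I x y)" for x y
      by (rule ell2_inner_commute)
    show "0 \<le> Re (ell2_inner I x x)" for x
      by (simp add: ell2_inner_same ell2_sq_nonneg)
  qed
  then show ?thesis by (simp add: ell2_sq_alt)
qed

section \<open>Truncations and the Riesz representation\<close>

lemma ell2_restrict:
  assumes x: "x \<in> ell2 I"
  shows "(\<lambda>i. if i \<in> F then x i else 0) \<in> ell2 I"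
proof -
  have s: "(\<lambda>i. (cmod (x i))\<^sup>2) summable_on I"
    using x by (simp add: ell2_def)
  have "(\<lambda>i. (cmod (if i \<in> F then x i else 0))\<^sup>2) summable_on I"
    by (rule summable_on_comparison_test[OF s]) simp_all
  moreover have "\<forall>i. i \<notin> I \<longrightarrow> (if i \<in> F then x i else 0) = 0"
    using x by (simp add: ell2_def)
  ultimately show ?thesis unfolding ell2_def by blast
qed

lemma ell2_restrict_compl: "x \<in> ell2 I \<Longrightarrow> (\<lambda>i. if i \<in> F then 0 else x i) \<in> ell2 I"
proof -
  have "(\<lambda>i. if i \<in> F then 0 else x i) = (\<lambda>i. if i \<in> - F then x i else 0)" by auto
  then show "x \<in> ell2 I \<Longrightarrow> ?thesis" using ell2_restrict[of x I "- F"] by simp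
qed

lemma ell2_tail:
  assumes x: "x \<in> ell2 I"
  shows "((\<lambda>F. ell2_sq I (\<lambda>i. if i \<in> F then 0 else x i)) \<longlongrightarrow> 0) (finite_subsets_at_top I)"
proof -
  have s: "(\<lambda>i. (cmod (x i))\<^sup>2) summable_on I" using x by (auto simp: ell2_def)
  have eq: "ell2_sq I x - (\<Sum>i\<in>F. (cmod (x i))\<^sup>2) = ell2_sq I (\<lambda>i. if i \<in> F then 0 else x i)"
    if F: "finite F" "F \<subseteq> I" for F
  proof -
    have "ell2_sq I (\<lambda>i. if i \<in> F then 0 else x i) = (\<Sum>\<^sub>\<infinity>i\<in>I - F. (cmod (x i))\<^sup>2)"
      unfolding ell2_sq_def by (rule infsum_cong_neutral) auto
    also have "\<dots> = ell2_sq I x - (\<Sum>\<^sub>\<infinity>i\<in>F. (cmod (x i))\<^sup>2)"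
      unfolding ell2_sq_def using F by (intro infsum_Diff s) auto
    finally show ?thesis using F by simp
  qed
  have "((\<lambda>F. ell2_sq I x - (\<Sum>i\<in>F. (cmod (x i))\<^sup>2)) \<longlongrightarrow> ell2_sq I x - ell2_sq I x)
     (finite_subsets_at_top I)"
    using infsum_tendsto[OF s] unfolding ell2_sq_def by (intro tendsto_intros)
  moreover have "\<forall>\<^sub>F F in finite_subsets_at_top I.
      ell2_sq I x - (\<Sum>i\<in>F. (cmod (x i))\<^sup>2) = ell2_sq I (\<lambda>i. if i \<in> F then 0 else x i)"
    by (rule eventually_finite_subsets_at_top_weakI) (rule eq)
  ultimately show ?thesis unfolding diff_self by (rule Lim_transform_eventually)
qed

text \<open>The coordinates of the representing vector are forced to be the values at the unit
  vectors. Testing \<phi> on a finite truncation of \<open>v\<close> itself gives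
  \<open>?s\<^sup>2 \<le> C * ?s\<close>, so the partial sums of squares are at most
  \<open>C\<close>. The identity for general \<open>y\<close> follows from finite truncations, as
  the bound makes \<phi> of the tails tend to 0. The functional is conjugate linear because
  \<open>ell2_inner\<close> is so in its second argument.\<close>

lemma ell2_Riesz:
  fixes \<phi> :: "('i \<Rightarrow> complex) \<Rightarrow> complex"
  assumes add: "\<And>x y. x \<in> ell2 I \<Longrightarrow> y \<in> ell2 I \<Longrightarrow> \<phi> (\<lambda>i. x i + y i) = \<phi> x + \<phi> y"
    and scale: "\<And>c x. x \<in> ell2 I \<Longrightarrow> \<phi> (\<lambda>i. c * x i) = cnj c * \<phi> x"
    and bound: "\<And>x. x \<in> ell2 I \<Longrightarrow> (cmod (\<phi> x))\<^sup>2 \<le> C * ell2_sq I x"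
    and C: "0 \<le> C"
  defines "v \<equiv> (\<lambda>i. if i \<in> I then \<phi> (unit_fun i) else 0)"
  shows "v \<in> ell2 I" "\<forall>y\<in>ell2 I. ell2_inner I v y = \<phi> y"
proof -
  have fin: "\<phi> (\<lambda>i. if i \<in> F then z i else 0) = (\<Sum>i\<in>F. cnj (z i) * v i)"
    if "finite F" "F \<subseteq> I" for F z
    using that
  proof (induction F rule: finite_induct)
    case empty
    show ?case using scale[OF ell2_zero, of 0] by simp
  next
    case (insert j F)
    have eq: "(\<lambda>i. if i \<in> insert j F then z i else 0) =
       (\<lambda>i. z j * unit_fun j i + (if i \<in> F then z i else 0))"
      using insert.hyps by (auto simp: unit_fun_def)
    have F: "(\<lambda>i. if i \<in> F then z i else 0) \<in> ell2 I"
      by (rule ell2_finite_support) (use insert in \<open>auto split: if_splits intro: finite_subset\<close>)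
    show ?case unfolding eq using insert F
      by (subst add) (auto intro: ell2_unit_fun ell2_scale simp: scale v_def ell2_unit_fun)
  qed
  have bd: "(\<Sum>i\<in>F. (cmod (v i))\<^sup>2) \<le> C" if F: "finite F" "F \<subseteq> I" for F
  proof -
    let ?s = "\<Sum>i\<in>F. (cmod (v i))\<^sup>2" and ?z = "\<lambda>i. if i \<in> F then v i else 0"
    have z: "?z \<in> ell2 I"
      by (rule ell2_finite_support) (use F in \<open>auto split: if_splits intro: finite_subset\<close>)
    have "\<phi> ?z = of_real ?s"
      unfolding fin[OF F] of_real_sum
      by (intro sum.cong refl) (metis complex_norm_square mult.commute of_real_power)
    moreover have "ell2_sq I ?z = ?s"
    proof -
      have "ell2_sq I ?z = (\<Sum>\<^sub>\<infinity>i\<in>F. (cmod (v i))\<^sup>2)"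
        unfolding ell2_sq_def by (rule infsum_cong_neutral) (use F in auto)
      then show ?thesis using F by simp
    qed
    ultimately have le: "?s\<^sup>2 \<le> C * ?s"
      using bound[OF z] by (simp only: norm_of_real power2_abs)
    have s: "?s \<ge> 0" by (simp add: sum_nonneg)
    show ?thesis
    proof (cases "?s = 0")
      case True then show ?thesis using C by simp
    next
      case False
      with s le show ?thesis by (simp add: power2_eq_square)
    qed
  qed
  have "(\<lambda>i. (cmod (v i))\<^sup>2) summable_on I"
    by (rule nonneg_bdd_above_summable_on) (auto intro!: bdd_aboveI2 bd)
  then show v: "v \<in> ell2 I" by (auto simp: ell2_def v_def)
  show "\<forall>y\<in>ell2 I. ell2_inner I v y = \<phi> y"
  proof
    fix y assume y: "y \<in> ell2 I"
    let ?F = "finite_subsets_at_top I"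
    have 1: "((\<lambda>F. \<Sum>i\<in>F. v i * cnj (y i)) \<longlongrightarrow> ell2_inner I v y) ?F"
      unfolding ell2_inner_def by (rule infsum_tendsto[OF ell2_inner_summable[OF v y]])
    have "((\<lambda>F. (cmod (\<phi> (\<lambda>i. if i \<in> F then 0 else y i)))\<^sup>2) \<longlongrightarrow> 0) ?F"
    proof (rule tendsto_sandwich[of "\<lambda>_. 0" _ ?F "\<lambda>F. C * ell2_sq I (\<lambda>i. if i \<in> F then 0 else y i)"])
      have "(\<lambda>i. if i \<in> F then 0 else y i) \<in> ell2 I" for F
        using y by (rule ell2_restrict_compl)
      then show "\<forall>\<^sub>F F in ?F. (cmod (\<phi> (\<lambda>i. if i \<in> F then 0 else y i)))\<^sup>2
         \<le> C * ell2_sq I (\<lambda>i. if i \<in> F then 0 else y i)"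
        using bound by auto
      show "((\<lambda>F. C * ell2_sq I (\<lambda>i. if i \<in> F then 0 else y i)) \<longlongrightarrow> 0) ?F"
        using tendsto_mult_left[OF ell2_tail[OF y], of C] by simp
    qed auto
    from tendsto_real_sqrt[OF this]
    have "((\<lambda>F. cmod (\<phi> (\<lambda>i. if i \<in> F then 0 else y i))) \<longlongrightarrow> 0) ?F"
      by simp
    then have 0: "((\<lambda>F. \<phi> (\<lambda>i. if i \<in> F then 0 else y i)) \<longlongrightarrow> 0) ?F"
      by (rule tendsto_norm_zero_cancel)
    have "((\<lambda>F. \<phi> y - \<phi> (\<lambda>i. if i \<in> F then 0 else y i)) \<longlongrightarrow> \<phi> y - 0) ?F"
      by (intro tendsto_intros 0)
    moreover have "\<phi> y - \<phi> (\<lambda>i. if i \<in> F then 0 else y i) = (\<Sum>i\<in>F. v i * cnj (y i))"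
      if F: "finite F" "F \<subseteq> I" for F
    proof -
      have "\<phi> y = \<phi> (\<lambda>i. (if i \<in> F then y i else 0) + (if i \<in> F then 0 else y i))"
        by (rule arg_cong[of _ _ \<phi>]) auto
      also have "\<dots> = \<phi> (\<lambda>i. if i \<in> F then y i else 0) + \<phi> (\<lambda>i. if i \<in> F then 0 else y i)"
        by (rule add[OF ell2_restrict[OF y] ell2_restrict_compl[OF y]])
      finally have "\<phi> y = \<phi> (\<lambda>i. if i \<in> F then y i else 0) + \<phi> (\<lambda>i. if i \<in> F then 0 else y i)" .
      then show ?thesis using fin[OF F, of y] by (simp add: mult.commute)
    qed
    then have "\<forall>\<^sub>F F in ?F.
        \<phi> y - \<phi> (\<lambda>i. if i \<in> F then 0 else y i) = (\<Sum>i\<in>F. v i * cnj (y i))"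
      by (rule eventually_finite_subsets_at_top_weakI)
    ultimately have 2: "((\<lambda>F. \<Sum>i\<in>F. v i * cnj (y i)) \<longlongrightarrow> \<phi> y) ?F"
      unfolding diff_zero by (rule Lim_transform_eventually)
    have "?F \<noteq> bot" by simp
    then show "ell2_inner I v y = \<phi> y" using 1 2 by (rule tendsto_unique)
  qed
qed

section \<open>Measures on a compact interval\<close>

definition finite_on :: "real \<Rightarrow> real measure \<Rightarrow> bool" where
  "finite_on R M \<longleftrightarrow> finite_measure M \<and> sets M = sets borel \<and> emeasure M (- {-R..R}) = 0"

lemma finite_onD:
  assumes "finite_on R M"
  shows "finite_measure M" "sets M = sets borel" "emeasure M (- {-R..R}) = 0"
    "space M = UNIV" "measurable M N = measurable borel N"
  using assms sets_eq_imp_space_eq[of M borel] measurable_cong_sets[of M borel N N]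
  by (auto simp: finite_on_def)

lemma finite_on_AE: "finite_on R M \<Longrightarrow> AE t in M. t \<in> {-R..R}"
  by (rule AE_I[of _ _ "- {-R..R}"]) (auto dest: finite_onD)

lemma finite_on_mono: "finite_on R M \<Longrightarrow> R \<le> S \<Longrightarrow> finite_on S M"
proof -
  assume M: "finite_on R M" and RS: "R \<le> S"
  have "emeasure M (- {-S..S}) \<le> emeasure M (- {-R..R})"
    by (rule emeasure_mono) (use RS finite_onD(2)[OF M] in auto)
  then show ?thesis using M by (simp add: finite_on_def)
qed

lemma finite_on_integrable:
  fixes f :: "real \<Rightarrow> 'b::{banach, second_countable_topology}"
  assumes "finite_on R M" "f \<in> borel_measurable borel" "\<And>t. t \<in> {-R..R} \<Longrightarrow> norm (f t) \<le> K"
  shows "integrable M f"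
proof -
  interpret finite_measure M using assms by (auto dest: finite_onD)
  show ?thesis
  proof (rule integrable_const_bound[of _ K])
    show "AE t in M. norm (f t) \<le> K"
      using finite_on_AE[OF assms(1)] assms(3) by auto
    show "f \<in> borel_measurable M" using assms finite_onD(5) by blast
  qed
qed

lemma finite_on_bounded_convergence:
  fixes f :: "real \<Rightarrow> 'b::{banach, second_countable_topology}"
  assumes M: "finite_on R M" and f: "f \<in> borel_measurable borel" "\<And>n. s n \<in> borel_measurable borel"
    and K: "\<And>n t. t \<in> {-R..R} \<Longrightarrow> norm (s n t) \<le> K"
    and lim: "\<And>t. t \<in> {-R..R} \<Longrightarrow> (\<lambda>n. s n t) \<longlonglongrightarrow> f t"
  shows "(\<lambda>n. integral\<^sup>L M (s n)) \<longlonglongrightarrow> integral\<^sup>L M f"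
proof (rule integral_dominated_convergence[where w="\<lambda>_. K"])
  interpret finite_measure M using M by (auto dest: finite_onD)
  show "integrable M (\<lambda>_. K)" by simp
  show "f \<in> borel_measurable M" "s n \<in> borel_measurable M" for n
    using f finite_onD(5)[OF M] by blast+
  show "AE t in M. (\<lambda>n. s n t) \<longlonglongrightarrow> f t" "AE t in M. norm (s n t) \<le> K" for n
    using finite_on_AE[OF M] K lim by auto
qed

definition bdd_on :: "real \<Rightarrow> (real \<Rightarrow> real) \<Rightarrow> bool" where
  "bdd_on R f \<longleftrightarrow> f \<in> borel_measurable borel \<and> (\<exists>K. \<forall>t\<in>{-R..R}. \<bar>f t\<bar> \<le> K)"

lemma bdd_on_continuous: "continuous_on UNIV f \<Longrightarrow> bdd_on R f"
proof -
  assume f: "continuous_on UNIV f"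
  have "compact (f ` {-R..R})"
    using f by (intro compact_continuous_image continuous_on_subset[OF f]) auto
  then have "bounded (f ` {-R..R})" by (rule compact_imp_bounded)
  then show ?thesis using f
    by (auto simp: bdd_on_def bounded_iff intro: borel_measurable_continuous_onI)
qed

lemma bdd_on_power: "bdd_on R (\<lambda>t. t ^ j)"
  by (intro bdd_on_continuous continuous_intros)

lemma bdd_on_id: "bdd_on R (\<lambda>t. t)"
  by (intro bdd_on_continuous continuous_intros)

lemma bdd_on_indicator: "B \<in> sets borel \<Longrightarrow> bdd_on R (indicator B)"
  by (auto simp: bdd_on_def indicator_def intro!: exI[of _ 1])

lemma bdd_on_mult:
  assumes "bdd_on R f" "bdd_on R h"
  shows "bdd_on R (\<lambda>t. f t * h t)"
proof -
  obtain K L where K: "\<forall>t\<in>{-R..R}. \<bar>f t\<bar> \<le> K" and L: "\<forall>t\<in>{-R..R}. \<bar>h t\<bar> \<le> L"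
    using assms by (auto simp: bdd_on_def)
  have "\<forall>t\<in>{-R..R}. \<bar>f t * h t\<bar> \<le> \<bar>K\<bar> * \<bar>L\<bar>"
    unfolding abs_mult using K L by (intro ballI mult_mono) (auto intro: order_trans[OF _ abs_ge_self])
  moreover have "(\<lambda>t. f t * h t) \<in> borel_measurable borel"
    using assms unfolding bdd_on_def by (intro borel_measurable_times) auto
  ultimately show ?thesis unfolding bdd_on_def by blast
qed

lemma bdd_on_cmult: "bdd_on R f \<Longrightarrow> bdd_on R (\<lambda>t. c * f t)"
  by (rule bdd_on_mult[OF bdd_on_continuous[OF continuous_on_const]])

lemma bdd_on_integrable: "finite_on R M \<Longrightarrow> bdd_on R f \<Longrightarrow> integrable M f"
  unfolding bdd_on_def by (metis finite_on_integrable real_norm_def)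

text \<open>An axiomatic form of integration against a complex measure on \<open>{-R..R}\<close>:
  linearity and bounded convergence. Polarized forms, differences of measures and measures with a
  bounded density are all of this kind, so one uniqueness statement covers every comparison of
  moments below.\<close>

definition signed_functional :: "real \<Rightarrow> ((real \<Rightarrow> real) \<Rightarrow> complex) \<Rightarrow> bool" where
  "signed_functional R \<Lambda> \<longleftrightarrow>
     (\<forall>f h. bdd_on R f \<longrightarrow> bdd_on R h \<longrightarrow> \<Lambda> (\<lambda>t. f t + h t) = \<Lambda> f + \<Lambda> h) \<and>
     (\<forall>c f. bdd_on R f \<longrightarrow> \<Lambda> (\<lambda>t. c * f t) = of_real c * \<Lambda> f) \<and>
     (\<forall>f s K. f \<in> borel_measurable borel \<longrightarrow> (\<forall>n. s n \<in> borel_measurable borel) \<longrightarrow>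
        (\<forall>n. \<forall>t\<in>{-R..R}. \<bar>s n t\<bar> \<le> K) \<longrightarrow> (\<forall>t\<in>{-R..R}. (\<lambda>n::nat. s n t) \<longlonglongrightarrow> f t) \<longrightarrow>
        (\<lambda>n. \<Lambda> (s n)) \<longlonglongrightarrow> \<Lambda> f)"

lemma signed_integral:
  assumes M: "finite_on R M"
  shows "signed_functional R (\<lambda>f. complex_of_real (\<integral>t. f t \<partial>M))"
proof -
  have "(\<lambda>n. complex_of_real (\<integral>t. s n t \<partial>M)) \<longlonglongrightarrow> complex_of_real (\<integral>t. f t \<partial>M)"
    if "f \<in> borel_measurable borel" "\<forall>n. s n \<in> borel_measurable borel"
      "\<forall>n. \<forall>t\<in>{-R..R}. \<bar>s n t\<bar> \<le> K" "\<forall>t\<in>{-R..R}. (\<lambda>n::nat. s n t) \<longlonglongrightarrow> f t" for f s K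
    by (intro tendsto_of_real finite_on_bounded_convergence[OF M, where K=K]) (use that in auto)
  then show ?thesis
    unfolding signed_functional_def using bdd_on_integrable[OF M] by simp
qed

lemma signed_add:
  assumes "signed_functional R \<Lambda>" "signed_functional R \<Lambda>'"
  shows "signed_functional R (\<lambda>f. \<Lambda> f + \<Lambda>' f)"
proof -
  have "(\<lambda>n. \<Lambda> (s n) + \<Lambda>' (s n)) \<longlonglongrightarrow> \<Lambda> f + \<Lambda>' f"
    if "f \<in> borel_measurable borel" "\<forall>n. s n \<in> borel_measurable borel"
      "\<forall>n. \<forall>t\<in>{-R..R}. \<bar>s n t\<bar> \<le> K" "\<forall>t\<in>{-R..R}. (\<lambda>n::nat. s n t) \<longlonglongrightarrow> f t" for f s K
    by (intro tendsto_add) (use assms that in \<open>unfold signed_functional_def, blast+\<close>)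
  then show ?thesis
    using assms unfolding signed_functional_def by (simp add: ring_distribs)
qed

lemma signed_scale:
  assumes "signed_functional R \<Lambda>"
  shows "signed_functional R (\<lambda>f. c * \<Lambda> f)"
proof -
  have "(\<lambda>n. c * \<Lambda> (s n)) \<longlonglongrightarrow> c * \<Lambda> f"
    if "f \<in> borel_measurable borel" "\<forall>n. s n \<in> borel_measurable borel"
      "\<forall>n. \<forall>t\<in>{-R..R}. \<bar>s n t\<bar> \<le> K" "\<forall>t\<in>{-R..R}. (\<lambda>n::nat. s n t) \<longlonglongrightarrow> f t" for f s K
    by (intro tendsto_mult_left) (use assms that in \<open>unfold signed_functional_def, blast\<close>)
  then show ?thesis
    using assms unfolding signed_functional_def by (simp add: ring_distribs)
qed

lemma signed_diff:
  "signed_functional R \<Lambda> \<Longrightarrow> signed_functional R \<Lambda>' \<Longrightarrow> signed_functional R (\<lambda>f. \<Lambda> f - \<Lambda>' f)"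
  using signed_add[OF _ signed_scale, of R \<Lambda> \<Lambda>' "-1"] by simp

lemma signed_cnj:
  assumes "signed_functional R \<Lambda>"
  shows "signed_functional R (\<lambda>f. cnj (\<Lambda> f))"
proof -
  have "(\<lambda>n. cnj (\<Lambda> (s n))) \<longlonglongrightarrow> cnj (\<Lambda> f)"
    if "f \<in> borel_measurable borel" "\<forall>n. s n \<in> borel_measurable borel"
      "\<forall>n. \<forall>t\<in>{-R..R}. \<bar>s n t\<bar> \<le> K" "\<forall>t\<in>{-R..R}. (\<lambda>n::nat. s n t) \<longlonglongrightarrow> f t" for f s K
    by (intro tendsto_cnj) (use assms that in \<open>unfold signed_functional_def, blast\<close>)
  then show ?thesis
    using assms unfolding signed_functional_def by simp
qed

lemma signed_mult:
  assumes "signed_functional R \<Lambda>" and g: "bdd_on R g"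
  shows "signed_functional R (\<lambda>f. \<Lambda> (\<lambda>t. g t * f t))"
proof -
  obtain L where L: "\<forall>t\<in>{-R..R}. \<bar>g t\<bar> \<le> L" and gm: "g \<in> borel_measurable borel"
    using g by (auto simp: bdd_on_def)
  have "(\<lambda>n. \<Lambda> (\<lambda>t. g t * s n t)) \<longlonglongrightarrow> \<Lambda> (\<lambda>t. g t * f t)"
    if f: "f \<in> borel_measurable borel" "\<forall>n. s n \<in> borel_measurable borel" and
      K: "\<forall>n. \<forall>t\<in>{-R..R}. \<bar>s n t\<bar> \<le> K" and lim: "\<forall>t\<in>{-R..R}. (\<lambda>n::nat. s n t) \<longlonglongrightarrow> f t" for f s K
  proof -
    have K': "\<forall>n. \<forall>t\<in>{-R..R}. \<bar>g t * s n t\<bar> \<le> \<bar>L\<bar> * \<bar>K\<bar>"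
      unfolding abs_mult using K L by (intro allI ballI mult_mono) (auto intro: order_trans[OF _ abs_ge_self])
    have lim': "\<forall>t\<in>{-R..R}. (\<lambda>n. g t * s n t) \<longlonglongrightarrow> g t * f t"
      using lim by (auto intro: tendsto_mult_left)
    have "(\<lambda>t. g t * f t) \<in> borel_measurable borel" "\<forall>n. (\<lambda>t. g t * s n t) \<in> borel_measurable borel"
      using borel_measurable_times[OF gm f(1)] borel_measurable_times[OF gm spec[OF f(2)]] by auto
    from assms(1)[unfolded signed_functional_def, THEN conjunct2, THEN conjunct2, rule_format,
        of "\<lambda>t. g t * f t" "\<lambda>n t. g t * s n t"] this K' lim'
    show ?thesis by blast
  qed
  then show ?thesis
    using assms unfolding signed_functional_def
    by (simp add: ring_distribs bdd_on_mult[OF g] mult.left_commute)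
qed

lemma signed_zero: "signed_functional R (\<lambda>f. 0)"
  unfolding signed_functional_def by simp

lemma signed_sum:
  "(\<And>k. k \<in> J \<Longrightarrow> signed_functional R (\<Lambda> k)) \<Longrightarrow> signed_functional R (\<lambda>f. \<Sum>k\<in>J. \<Lambda> k f)"
  by (induction J rule: infinite_finite_induct) (auto intro: signed_add signed_zero)

context
  fixes R :: real and \<Phi> :: "(real \<Rightarrow> real) \<Rightarrow> complex"
  assumes \<Phi>: "signed_functional R \<Phi>"
begin

abbreviation "bd \<equiv> bdd_on R"

lemma \<Phi>_add: "bd f \<Longrightarrow> bd h \<Longrightarrow> \<Phi> (\<lambda>t. f t + h t) = \<Phi> f + \<Phi> h"
  using \<Phi> unfolding signed_functional_def by blast

lemma \<Phi>_scale: "bd f \<Longrightarrow> \<Phi> (\<lambda>t. c * f t) = of_real c * \<Phi> f"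
  using \<Phi> unfolding signed_functional_def by blast

lemma \<Phi>_diff: "bd f \<Longrightarrow> bd h \<Longrightarrow> \<Phi> (\<lambda>t. f t - h t) = \<Phi> f - \<Phi> h"
  using \<Phi>_add[of f "\<lambda>t. (-1) * h t"] \<Phi>_scale[of h "-1"] bdd_on_cmult[of R h "-1"] by simp

lemma \<Phi>_lim:
  assumes "f \<in> borel_measurable borel" "\<And>n. s n \<in> borel_measurable borel"
    and K: "\<And>n t. t \<in> {-R..R} \<Longrightarrow> \<bar>s n t\<bar> \<le> K"
    and lim: "\<And>t. t \<in> {-R..R} \<Longrightarrow> (\<lambda>n. s n t) \<longlonglongrightarrow> f t"
  shows "(\<lambda>n. \<Phi> (s n)) \<longlonglongrightarrow> \<Phi> f"
  using \<Phi> assms unfolding signed_functional_def by blast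

text \<open>Bounded convergence, applied to the constant sequence \<open>f\<close> with limit
  \<open>h\<close>, sees only the values on \<open>{-R..R}\<close>.\<close>

lemma \<Phi>_cong:
  assumes eq: "\<And>t. t \<in> {-R..R} \<Longrightarrow> f t = h t" and f: "bd f" and h: "bd h"
  shows "\<Phi> f = \<Phi> h"
proof -
  obtain K where "\<forall>t\<in>{-R..R}. \<bar>f t\<bar> \<le> K" using f by (auto simp: bdd_on_def)
  then have "(\<lambda>n::nat. \<Phi> f) \<longlonglongrightarrow> \<Phi> h"
    by (intro \<Phi>_lim[where K=K]) (use eq f h in \<open>auto simp: bdd_on_def\<close>)
  then show ?thesis by (simp add: LIMSEQ_const_iff)
qed

lemma \<Phi>_0: "\<Phi> (\<lambda>t. 0) = 0"
  using \<Phi>_scale[of "\<lambda>t. 0" 0] bdd_on_continuous[of "\<lambda>t. 0"] by simp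

text \<open>Weierstrass approximation with error below \<open>inverse (Suc n)\<close> gives
  polynomials with the common bound \<open>K + 1\<close> on the interval. Each is sent to 0 by
  linearity, and bounded convergence passes to \<open>f\<close>.\<close>

lemma \<Phi>_eq_0_continuous:
  assumes mom: "\<And>j. \<Phi> (\<lambda>t. t ^ j) = 0" and f: "continuous_on UNIV f"
  shows "\<Phi> f = 0"
proof -
  obtain K where K: "\<And>t. t \<in> {-R..R} \<Longrightarrow> \<bar>f t\<bar> \<le> K"
    using bdd_on_continuous[OF f, of R] unfolding bdd_on_def by blast
  have "\<exists>p. (\<exists>a m. p = (\<lambda>x. \<Sum>i\<le>m. a i * x ^ i)) \<and> (\<forall>x\<in>{-R..R}. \<bar>f x - p x\<bar> < inverse (Suc n))"
    for n :: nat
  proof -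
    have "continuous_on {-R..R} f" using f by (rule continuous_on_subset) simp
    moreover have "0 < inverse (real (Suc n))" by simp
    ultimately obtain p where "real_polynomial_function p"
      "\<And>x. x \<in> {-R..R} \<Longrightarrow> \<bar>f x - p x\<bar> < inverse (Suc n)"
      using Stone_Weierstrass_real_polynomial_function[OF compact_Icc] by metis
    then show ?thesis unfolding real_polynomial_function_iff_sum by blast
  qed
  then obtain p where p_poly: "\<And>n::nat. \<exists>a m. p n = (\<lambda>x. \<Sum>i\<le>m. a i * x ^ i)"
    and p: "\<And>n x. x \<in> {-R..R} \<Longrightarrow> \<bar>f x - p n x\<bar> < inverse (Suc n)"
    by metis
  have poly0: "\<Phi> (\<lambda>x. \<Sum>i\<le>m. a i * x ^ i) = 0" for a and m :: nat
  proof (induction m)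
    case 0 show ?case using \<Phi>_scale[OF bdd_on_power, of "a 0" 0] mom[of 0] by simp
  next
    case (Suc m)
    have "\<Phi> (\<lambda>x. (\<Sum>i\<le>m. a i * x ^ i) + a (Suc m) * x ^ Suc m) =
       \<Phi> (\<lambda>x. \<Sum>i\<le>m. a i * x ^ i) + \<Phi> (\<lambda>x. a (Suc m) * x ^ Suc m)"
      by (intro \<Phi>_add bdd_on_continuous continuous_intros)
    then show ?case using Suc mom[of "Suc m"] \<Phi>_scale[OF bdd_on_power, of "a (Suc m)" "Suc m"] by simp
  qed
  have p0: "\<Phi> (p n) = 0" for n using p_poly[of n] poly0 by auto
  have "(\<lambda>n. \<Phi> (p n)) \<longlonglongrightarrow> \<Phi> f"
  proof (rule \<Phi>_lim)
    show "f \<in> borel_measurable borel" using f by (rule borel_measurable_continuous_onI)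
    have "continuous_on UNIV (p n)" for n
      using p_poly[of n] by (auto intro!: continuous_intros)
    then show "p n \<in> borel_measurable borel" for n by (rule borel_measurable_continuous_onI)
    show "\<bar>p n t\<bar> \<le> K + 1" if "t \<in> {-R..R}" for n t
    proof -
      have "inverse (real (Suc n)) \<le> 1" by (simp add: field_simps)
      then show ?thesis using p[OF that, of n] K[OF that] by linarith
    qed
    show "(\<lambda>n. p n t) \<longlonglongrightarrow> f t" if "t \<in> {-R..R}" for t
    proof (rule LIM_zero_cancel, rule Lim_null_comparison)
      show "(\<lambda>n. inverse (real (Suc n))) \<longlonglongrightarrow> 0" by (rule LIMSEQ_inverse_real_of_nat)
      show "\<forall>\<^sub>F n in sequentially. norm (p n t - f t) \<le> inverse (real (Suc n))"
        using p[OF that] by (auto simp: abs_minus_commute intro!: less_imp_le always_eventually)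
    qed
  qed
  then show ?thesis by (simp add: p0 LIMSEQ_const_iff)
qed

lemma \<Phi>_eq_0_of_indicator:
  assumes ind: "\<And>B. B \<in> sets borel \<Longrightarrow> \<Phi> (indicator B) = 0" and f: "bd f"
  shows "\<Phi> f = 0"
proof -
  \<comment> \<open>The bound is quantified inside the induction predicate: the monotone limit step
    needs a common bound for the approximating functions before bounded convergence applies, and
    nonnegativity hands the bound down to them.\<close>
  have nonneg: "(\<forall>K. (\<forall>x. u x \<le> K) \<longrightarrow> \<Phi> u = 0)"
    if "u \<in> borel_measurable borel" "\<And>x. 0 \<le> u x" for u
    using that
  proof (induction rule: borel_measurable_induct_real)
    case (set A) then show ?case using ind by simp
  next
    case (mult u c)
    show ?case
    proof (intro allI impI)
      fix K assume K: "\<forall>x. c * u x \<le> K"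
      show "\<Phi> (\<lambda>x. c * u x) = 0"
      proof (cases "c = 0")
        case True then show ?thesis using \<Phi>_0 by simp
      next
        case False
        then have "\<forall>x. u x \<le> K / c" using K mult.hyps(1) by (simp add: field_simps)
        then have "\<Phi> u = 0" using mult.IH by blast
        moreover have "bd u"
          unfolding bdd_on_def
        proof (intro conjI exI ballI)
          show "u \<in> borel_measurable borel" by (rule mult.hyps)
          show "\<bar>u t\<bar> \<le> K / c" for t using mult.hyps(3)[of t] \<open>\<forall>x. u x \<le> K / c\<close> by simp
        qed
        ultimately show ?thesis by (simp add: \<Phi>_scale)
      qed
    qed
  next
    case (add u v)
    show ?case
    proof (intro allI impI)
      fix K assume K: "\<forall>x. v x + u x \<le> K"
      have le: "u x \<le> K" "v x \<le> K" for x
        using spec[OF K, of x] add.hyps(2)[of x] add.hyps(4)[of x] by linarith+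
      have "bd u" "bd v"
        using add.hyps le unfolding bdd_on_def by (auto intro!: exI[of _ K])
      moreover have "\<Phi> u = 0" "\<Phi> v = 0" using add.IH le by blast+
      ultimately show "\<Phi> (\<lambda>x. v x + u x) = 0" by (simp add: \<Phi>_add)
    qed
  next
    case (seq U)
    show ?case
    proof (intro allI impI)
      fix K assume K: "\<forall>x. u x \<le> K"
      have le: "U i x \<le> K" for i x
      proof -
        have "U i x \<le> u x"
          using seq.hyps(3) seq.hyps(4)[of x] by (intro incseq_le) (auto simp: incseq_def le_fun_def)
        then show ?thesis using K by (meson order_trans)
      qed
      have "(\<lambda>i. \<Phi> (U i)) \<longlonglongrightarrow> \<Phi> u"
        by (rule \<Phi>_lim[where K=K]) (use seq.hyps that le in auto)
      moreover have "\<Phi> (U i) = 0" for i using seq.IH le by blast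
      ultimately show "\<Phi> u = 0" by (simp add: LIMSEQ_const_iff)
    qed
  qed
  obtain K where K: "\<forall>t\<in>{-R..R}. \<bar>f t\<bar> \<le> K" and f': "f \<in> borel_measurable borel"
    using f by (auto simp: bdd_on_def)
  \<comment> \<open>Adding \<open>\<bar>K\<bar>\<close> makes \<open>f\<close> nonnegative on the
    interval, and the indicator cuts off the rest, where \<open>f\<close> may be unbounded. The
    added constant is a multiple of \<open>indicator UNIV\<close> and contributes 0.\<close>
  let ?u = "\<lambda>t. indicator {-R..R} t * (f t + \<bar>K\<bar>) :: real"
  have meas: "?u \<in> borel_measurable borel" using f' by simp
  have Kt: "\<bar>f t\<bar> \<le> \<bar>K\<bar>" if "t \<in> {-R..R}" for t using K that by fastforce
  have u0: "0 \<le> ?u t" and uK: "?u t \<le> 2 * \<bar>K\<bar>" for t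
  proof -
    show "0 \<le> ?u t"
    proof (cases "t \<in> {-R..R}")
      case True then show ?thesis using Kt[OF True] by simp
    qed simp
    show "?u t \<le> 2 * \<bar>K\<bar>"
    proof (cases "t \<in> {-R..R}")
      case True then show ?thesis using Kt[OF True] by simp
    qed simp
  qed
  have "\<bar>?u t\<bar> \<le> 2 * \<bar>K\<bar>" for t using u0[of t] uK[of t] by linarith
  then have bdu: "bd ?u" unfolding bdd_on_def using meas by blast
  have u: "\<Phi> ?u = 0" using nonneg[OF meas u0] uK by blast
  have c: "\<Phi> (\<lambda>t. \<bar>K\<bar>) = 0"
    using \<Phi>_scale[OF bdd_on_indicator[of UNIV], of "\<bar>K\<bar>"] ind[of UNIV] by simp
  have bdc: "bd (\<lambda>t. \<bar>K\<bar>)" by (intro bdd_on_continuous continuous_intros)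
  have "\<bar>f t + \<bar>K\<bar>\<bar> \<le> 2 * \<bar>K\<bar>" if "t \<in> {-R..R}" for t using Kt[OF that] by linarith
  then have "bd (\<lambda>t. f t + \<bar>K\<bar>)"
    using f' unfolding bdd_on_def by (intro conjI exI[of _ "2 * \<bar>K\<bar>"] ballI) simp_all
  then have "\<Phi> (\<lambda>t. f t + \<bar>K\<bar>) = \<Phi> ?u"
    by (intro \<Phi>_cong bdu) auto
  with u c show ?thesis using \<Phi>_add[OF f bdc] by simp
qed

lemma signed_sums:
  assumes A: "\<And>i. A i \<in> sets borel" and disj: "disjoint_family A"
  shows "(\<lambda>i. \<Phi> (indicator (A i))) sums \<Phi> (indicator (\<Union>i. A i))"
proof -
  have eq: "(\<Sum>i<n. indicator (A i) t) = (indicator (\<Union>i<n. A i) t :: real)" for n t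
    using disj by (subst indicator_UN_disjoint) (auto simp: disjoint_family_on_def)
  have fin: "\<Phi> (indicator (\<Union>i<n. A i)) = (\<Sum>i<n. \<Phi> (indicator (A i)))" for n
  proof (induction n)
    case 0 show ?case using \<Phi>_0 by (simp add: indicator_def)
  next
    case (Suc n)
    have "bd (indicator (\<Union>i<n. A i))" using A by (intro bdd_on_indicator) auto
    then have "\<Phi> (\<lambda>t. indicator (\<Union>i<n. A i) t + indicator (A n) t) = (\<Sum>i<Suc n. \<Phi> (indicator (A i)))"
      using \<Phi>_add[OF _ bdd_on_indicator[OF A[of n]]] Suc by simp
    moreover have "(\<lambda>t. indicator (\<Union>i<n. A i) t + indicator (A n) t) =
        (indicator (\<Union>i<Suc n. A i) :: real \<Rightarrow> real)"
    proof
      fix t show "indicator (\<Union>i<n. A i) t + indicator (A n) t = (indicator (\<Union>i<Suc n. A i) t :: real)"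
        using eq[of t "Suc n"] eq[of t n] by simp
    qed
    ultimately show ?case by simp
  qed
  have "(\<lambda>n. \<Phi> (indicator (\<Union>i<n. A i))) \<longlonglongrightarrow> \<Phi> (indicator (\<Union>i. A i))"
  proof (rule \<Phi>_lim[where K=1])
    show "(\<lambda>n. indicator (\<Union>i<n. A i) t) \<longlonglongrightarrow> (indicator (\<Union>i. A i) t :: real)" for t
      using indicator_sums[of A t] disj unfolding sums_def eq
      by (auto simp: disjoint_family_on_def)
  qed (use A in \<open>auto simp: indicator_def\<close>)
  then show ?thesis by (simp add: sums_def fin)
qed

text \<open>Vanishing moments give 0 on continuous functions, hence on closed half-lines by
  approximation with ramps, hence on all Borel sets by a Dynkin system argument, hence on bounded
  measurable functions.\<close>

lemma signed_functional_eq_0: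
  assumes mom: "\<And>j. \<Phi> (\<lambda>t. t ^ j) = 0" and f: "bd f"
  shows "\<Phi> f = 0"
proof (rule \<Phi>_eq_0_of_indicator[OF _ f])
  fix B :: "real set" assume "B \<in> sets borel"
  then have B: "B \<in> sigma_sets UNIV (range (\<lambda>a::real. {..a}))"
    by (simp add: borel_eq_atMost)
  have stable: "Int_stable (range (\<lambda>a::real. {..a}))"
    by (auto simp: Int_stable_def)
  have closed: "range (\<lambda>a::real. {..a}) \<subseteq> Pow UNIV" by simp
  from stable closed B show "\<Phi> (indicator B) = 0"
  proof (induction rule: sigma_sets_induct_disjoint)
    case (basic A)
    then obtain a where A: "A = {..a}" by auto
    \<comment> \<open>A ramp that is 1 up to \<open>a\<close> and falls to 0 over a length of
      \<open>1 / n\<close>; it converges to the indicator of \<open>{..a}\<close>.\<close>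
    let ?f = "\<lambda>n t. max 0 (min 1 (1 - real n * (t - a)))"
    have "(\<lambda>n. \<Phi> (?f n)) \<longlonglongrightarrow> \<Phi> (indicator A)"
    proof (rule \<Phi>_lim[where K=1])
      show "(\<lambda>n. ?f n t) \<longlonglongrightarrow> indicator A t" for t
      proof (cases "t \<le> a")
        case True
        then have "?f n t = 1" for n
          by (simp add: mult_nonneg_nonpos)
        then show ?thesis using True by (simp add: A)
      next
        case False
        then have "\<forall>\<^sub>F n in sequentially. 1 / (t - a) \<le> real n"
          using filterlim_real_sequentially unfolding filterlim_at_top by blast
        then have "\<forall>\<^sub>F n in sequentially. ?f n t = 0"
          by eventually_elim (use False in \<open>simp add: field_simps\<close>)
        then show ?thesis using False by (simp add: A tendsto_eventually)
      qed
    qed (auto simp: A)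
    moreover have "\<Phi> (?f n) = 0" for n
      by (rule \<Phi>_eq_0_continuous[OF mom]) (intro continuous_intros)
    ultimately show ?case by (simp add: LIMSEQ_const_iff)
  next
    case empty show ?case using \<Phi>_0 by (simp add: indicator_def)
  next
    case (compl A)
    then have "A \<in> sets borel" by (simp add: borel_eq_atMost)
    then have "\<Phi> (\<lambda>t. indicator UNIV t - indicator A t) = \<Phi> (indicator UNIV) - \<Phi> (indicator A)"
      by (intro \<Phi>_diff bdd_on_indicator) auto
    also have "\<Phi> (indicator UNIV) = 0" using mom[of 0] by (simp add: indicator_def)
    also have "(\<lambda>t. indicator UNIV t - indicator A t) = (indicator (UNIV - A) :: real \<Rightarrow> real)"
      by (auto simp: indicator_def)
    finally show ?case using compl by simp
  next
    case (union A)
    then have "A i \<in> sets borel" for i by (auto simp: borel_eq_atMost)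
    from signed_sums[OF this union.hyps(1)] show ?case
      using union.IH by (simp add: sums_iff)
  qed
qed

end


lemma signed_functional_eqI:
  assumes "signed_functional R \<Lambda>" "signed_functional R \<Lambda>'" "bdd_on R f"
    and "\<And>j. \<Lambda> (\<lambda>t. t ^ j) = \<Lambda>' (\<lambda>t. t ^ j)"
  shows "\<Lambda> f = \<Lambda>' f"
  using signed_functional_eq_0[OF signed_diff[OF assms(1,2)] _ assms(3)] assms(4) by simp

section \<open>Hausdorff moment problem\<close>

text \<open>If the \<open>m k\<close> are the moments of a measure on the unit interval, this is the
  integral of \<open>t ^ k * (1 - t) ^ l\<close>. Its nonnegativity is Hausdorff's
  criterion.\<close>

fun moment_diff :: "(nat \<Rightarrow> real) \<Rightarrow> nat \<Rightarrow> nat \<Rightarrow> real" where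
  "moment_diff m k 0 = m k"
| "moment_diff m k (Suc l) = moment_diff m k l - moment_diff m (Suc k) l"

text \<open>Formally, \<open>t ^ k\<close> is multiplied by the binomial expansion of
  \<open>(t + (1 - t)) ^ l = 1\<close>; the induction is Pascal's rule.\<close>

lemma sum_moment_diff:
  "(\<Sum>i\<le>l. real (l choose i) * moment_diff m (k + i) (l - i)) = m k"
proof (induction l arbitrary: k)
  case (Suc l)
  let ?D = "moment_diff m"
  have "(\<Sum>i\<le>Suc l. real (Suc l choose i) * ?D (k + i) (Suc l - i)) =
      ?D k (Suc l) + (\<Sum>i\<le>l. real (Suc l choose Suc i) * ?D (k + Suc i) (l - i))"
    by (subst sum.atMost_Suc_shift) simp
  also have "\<dots> = (?D k (Suc l) + (\<Sum>i\<le>l. real (l choose Suc i) * ?D (k + Suc i) (l - i))) +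
      (\<Sum>i\<le>l. real (l choose i) * ?D (k + Suc i) (l - i))"
    by (simp add: ring_distribs sum.distrib)
  also have "?D k (Suc l) + (\<Sum>i\<le>l. real (l choose Suc i) * ?D (k + Suc i) (l - i)) =
      (\<Sum>i\<le>Suc l. real (l choose i) * ?D (k + i) (Suc l - i))"
    by (subst sum.atMost_Suc_shift) simp
  also have "\<dots> = (\<Sum>i\<le>l. real (l choose i) * ?D (k + i) (Suc l - i))"
    by simp
  also have "\<dots> = (\<Sum>i\<le>l. real (l choose i) * (?D (k + i) (l - i) - ?D (k + Suc i) (l - i)))"
    by (intro sum.cong refl) (simp add: Suc_diff_le)
  finally show ?case using Suc.IH[of k] by (simp add: ring_distribs sum_subtractf)
qed simp

text \<open>The weights that will form the discrete approximations reproduce exactly a falling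
  factorial version of the \<open>j\<close>-th moment. The identity \<open>choose_mult\<close>
  cancels the denominator, and \<open>sum_moment_diff\<close> remains.\<close>

lemma sum_choose_moment_diff:
  assumes "j \<le> n"
  shows "(\<Sum>k\<le>n. real (n choose k) * moment_diff m k (n - k) * (real (k choose j) / real (n choose j))) = m j"
proof -
  have nj: "real (n choose j) \<noteq> 0" using assms by simp
  have "(\<Sum>k\<le>n. real (n choose k) * moment_diff m k (n - k) * (real (k choose j) / real (n choose j))) =
      (\<Sum>k\<in>{j..n}. real (n choose k) * moment_diff m k (n - k) * (real (k choose j) / real (n choose j)))"
    by (rule sum.mono_neutral_right) auto
  also have "\<dots> = (\<Sum>k\<in>{j..n}. real (n - j choose (k - j)) * moment_diff m k (n - k))"
  proof (intro sum.cong refl)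
    fix k assume k: "k \<in> {j..n}"
    then have "real (n choose k) * real (k choose j) = real (n choose j) * real (n - j choose (k - j))"
      using choose_mult[of j k n] by (simp flip: of_nat_mult)
    then show "real (n choose k) * moment_diff m k (n - k) * (real (k choose j) / real (n choose j)) =
        real (n - j choose (k - j)) * moment_diff m k (n - k)"
      using nj by (simp add: field_simps)
  qed
  also have "\<dots> = (\<Sum>i\<le>n - j. real (n - j choose i) * moment_diff m (j + i) (n - j - i))"
    by (rule sum.reindex_bij_witness[of _ "\<lambda>i. i + j" "\<lambda>k. k - j"]) (use assms in auto)
  finally show ?thesis by (simp only: sum_moment_diff)
qed

lemma binomial_ratio:
  assumes "j \<le> n"
  shows "real (k choose j) / real (n choose j) = (\<Prod>i<j. real (k - i) / real (n - i))"
  using assms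
proof (induction j)
  case (Suc j)
  have rec: "real (p choose Suc j) = real (p choose j) * real (p - j) / real (Suc j)" for p
  proof -
    have "Suc j * (p choose Suc j) = (p choose j) * (p - j)"
      using binomial_absorb_comp[of p j] binomial_absorption[of j p] by (simp add: mult.commute)
    then have "real (Suc j) * real (p choose Suc j) = real (p choose j) * real (p - j)"
      by (simp only: flip: of_nat_mult)
    then show ?thesis by (simp add: field_simps)
  qed
  have "real (k choose Suc j) / real (n choose Suc j) =
     (real (k choose j) / real (n choose j)) * (real (k - j) / real (n - j))"
    by (simp add: rec del: binomial_Suc_Suc)
  with Suc show ?case by simp
qed simp

text \<open>Both sides are products of \<open>j\<close> factors in the unit interval, and replacing
  one factor costs at most \<open>j / n\<close>. If \<open>k < i\<close>, truncated subtraction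
  makes the second factor 0, while \<open>k / n\<close> is itself below
  \<open>j / n\<close>.\<close>

lemma binomial_ratio_approx:
  assumes "j \<le> n" "k \<le> n" "0 < n"
  shows "\<bar>(real k / real n) ^ j - real (k choose j) / real (n choose j)\<bar> \<le> real j * real j / real n"
proof -
  have "norm ((\<Prod>i<j. real k / real n) - (\<Prod>i<j. real (k - i) / real (n - i)))
     \<le> (\<Sum>i<j. norm (real k / real n - real (k - i) / real (n - i)))"
    by (rule norm_prod_diff) (use assms in \<open>auto simp: divide_le_eq_1\<close>)
  also have "\<dots> \<le> (\<Sum>i<j. real j / real n)"
  proof (rule sum_mono)
    fix i assume i: "i \<in> {..<j}"
    show "norm (real k / real n - real (k - i) / real (n - i)) \<le> real j / real n"
    proof (cases "i \<le> k")
      case True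
      have n: "real n > 0" "real n - real i > 0" using i assms by auto
      have "real k / real n - real (k - i) / real (n - i) =
         real i * (real n - real k) / (real n * (real n - real i))"
        using True i assms n by (simp add: of_nat_diff field_simps)
      also have "\<bar>\<dots>\<bar> = real i / real n * ((real n - real k) / (real n - real i))"
        using n assms by (simp add: abs_mult)
      also have "\<dots> \<le> real i / real n * 1"
        using n True assms by (intro mult_left_mono) (auto simp: divide_le_eq_1)
      also have "\<dots> \<le> real j / real n" using i n by (simp add: divide_right_mono)
      finally show ?thesis by simp
    next
      case False
      then show ?thesis using i assms by (simp add: divide_right_mono)
    qed
  qed
  finally show ?thesis using assms by (simp add: binomial_ratio)
qed

text \<open>Discrete measures with mass \<open>w n k\<close> at \<open>k / n\<close> have moments
  that converge to the prescribed ones. They are tight, so by Helly selection a subsequence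
  converges weakly, and the limit has these moments. The weights are divided by \<open>m 0\<close>
  to obtain probability measures; a vanishing \<open>m 0\<close> forces all moments to
  vanish.\<close>

theorem Hausdorff_moment_unit_interval:
  assumes nonneg: "\<And>k l. 0 \<le> moment_diff m k l"
  shows "\<exists>M. finite_on 1 M \<and> (\<forall>j. (\<integral>t. t ^ j \<partial>M) = m j)"
proof (cases "m 0 = 0")
  case True
  have "m j = 0" for j
  proof (induction j)
    case (Suc j)
    have "0 \<le> m (Suc j)" "m (Suc j) \<le> m j"
      using nonneg[of "Suc j" 0] nonneg[of j 1] by simp_all
    with Suc show ?case by simp
  qed (use True in simp)
  then show ?thesis
    by (intro exI[of _ "null_measure borel"]) (auto simp: finite_on_def intro!: finite_measureI)
next
  case False
  then have m0: "m 0 > 0" using nonneg[of 0 0] by simp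
  define w where "w n k = real (n choose k) * moment_diff m k (n - k) / m 0" for n k
  have w0: "0 \<le> w n k" for n k using nonneg m0 by (simp add: w_def)
  have wsum: "(\<Sum>k\<le>n. w n k) = 1" for n
    using sum_choose_moment_diff[of 0 n m] m0 by (simp add: w_def flip: sum_divide_distrib)
  define \<mu> where "\<mu> n = distr (point_measure {..n} (w n)) borel (\<lambda>k. real k / real n)" for n
  have meas: "(\<lambda>k. real k / real n) \<in> measurable (point_measure {..n} (w n)) borel" for n
    by simp
  have int: "(\<integral>t. f t \<partial>\<mu> n) = (\<Sum>k\<le>n. w n k * f (real k / real n))"
    if "f \<in> borel_measurable borel" for f :: "real \<Rightarrow> real" and n
    unfolding \<mu>_def using that w0
    by (subst integral_distr[OF meas]) (simp_all add: lebesgue_integral_point_measure_finite)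
  have prob: "prob_space (\<mu> n)" for n
    unfolding \<mu>_def
    by (rule prob_space.prob_space_distr[OF prob_space_point_measure meas]) (use w0 wsum in auto)
  then have rd: "real_distribution (\<mu> n)" for n
    by (auto simp: real_distribution_def real_distribution_axioms_def \<mu>_def)
  have supp: "measure (\<mu> n) {0..1} = 1" for n
  proof -
    have "measure (\<mu> n) {0..1} = (\<integral>t. indicator {0..1} t \<partial>\<mu> n)"
      using rd[of n] by (simp add: real_distribution.space_eq_univ)
    also have "\<dots> = (\<Sum>k\<le>n. w n k * indicator {0..1} (real k / real n))"
      by (rule int) simp
    also have "\<dots> = (\<Sum>k\<le>n. w n k)"
      by (intro sum.cong refl) (auto simp: indicator_def divide_le_eq_1)
    finally show ?thesis by (simp add: wsum)
  qed
  have "tight \<mu>"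
    unfolding tight_def
  proof (intro conjI allI impI rd)
    fix \<epsilon> :: real assume "0 < \<epsilon>"
    have "1 \<le> measure (\<mu> n) {-1<..1}" for n
    proof -
      interpret real_distribution "\<mu> n" by (rule rd)
      have "measure (\<mu> n) {0..1} \<le> measure (\<mu> n) {-1<..1}"
        by (rule finite_measure_mono) auto
      then show ?thesis by (simp add: supp)
    qed
    then have "1 - \<epsilon> < measure (\<mu> n) {-1<..1}" for n
      using \<open>0 < \<epsilon>\<close> by (meson diff_less_eq less_add_same_cancel1 less_le_trans)
    then show "\<exists>a b. a < b \<and> (\<forall>n. 1 - \<epsilon> < measure (\<mu> n) {a<..b})"
      by (intro exI[of _ "-1"] exI[of _ 1]) simp
  qed
  from tight_imp_convergent_subsubsequence[OF this strict_mono_id]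
  obtain r M where r: "strict_mono (r :: nat \<Rightarrow> nat)" and M: "real_distribution M"
    and conv: "weak_conv_m (\<mu> \<circ> id \<circ> r) M" by auto
  interpret M: real_distribution M by (rule M)
  have lim: "(\<lambda>n. \<integral>t. f t \<partial>\<mu> (r n)) \<longlonglongrightarrow> (\<integral>t. f t \<partial>M)"
    if "\<And>x. isCont f x" "\<And>x. norm (f x) \<le> 1" for f :: "real \<Rightarrow> real"
    using weak_conv_imp_integral_bdd_continuous_conv[OF rd M conv[unfolded comp_def id_def] that]
    by simp
  \<comment> \<open>This bounded continuous function vanishes exactly on the unit interval, so its
    integral detects mass of the limit outside.\<close>
  let ?d = "\<lambda>t::real. min 1 (max 0 (max (- t) (t - 1)))"
  have d: "(\<integral>t. ?d t \<partial>M) = 0"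
  proof -
    have "(\<lambda>n. \<integral>t. ?d t \<partial>\<mu> (r n)) \<longlonglongrightarrow> (\<integral>t. ?d t \<partial>M)"
      by (rule lim) (auto intro!: continuous_intros)
    moreover have "(\<integral>t. ?d t \<partial>\<mu> n) = 0" for n
    proof -
      have "?d (real k / real n) = 0" if "k \<le> n" for k
      proof -
        have "0 \<le> real k / real n" "real k / real n \<le> 1"
          using that by (auto simp: divide_le_eq_1)
        then show ?thesis by linarith
      qed
      then show ?thesis by (subst int) (auto intro!: sum.neutral)
    qed
    ultimately show ?thesis by (simp add: LIMSEQ_const_iff)
  qed
  have "AE t in M. ?d t = 0"
    using d by (subst (asm) integral_nonneg_eq_0_iff_AE)
      (auto intro!: M.integrable_const_bound[where B=1])
  then have AE: "AE t in M. t \<in> {0..1}"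
    by (rule AE_mp) (auto simp: max_def min_def split: if_splits)
  have mom: "(\<integral>t. t ^ j \<partial>M) = m j / m 0" for j
  proof -
    \<comment> \<open>Weak convergence is used for continuous functions bounded by 1, so the power
      is clamped to the unit interval, where all the measures live.\<close>
    let ?f = "\<lambda>t::real. (max 0 (min 1 t)) ^ j"
    have cont: "(\<lambda>n. \<integral>t. ?f t \<partial>\<mu> (r n)) \<longlonglongrightarrow> (\<integral>t. ?f t \<partial>M)"
      by (rule lim) (auto intro!: continuous_intros power_le_one)
    have "(\<integral>t. ?f t \<partial>M) = (\<integral>t. t ^ j \<partial>M)"
      by (rule integral_cong_AE) (use AE in auto)
    moreover have "(\<lambda>n. \<integral>t. ?f t \<partial>\<mu> n) \<longlonglongrightarrow> m j / m 0"
    proof (rule LIM_zero_cancel, rule Lim_null_comparison)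
      show "(\<lambda>n. real j * real j / real n) \<longlonglongrightarrow> 0" by real_asymp
      show "\<forall>\<^sub>F n in sequentially. norm ((\<integral>t. ?f t \<partial>\<mu> n) - m j / m 0) \<le> real j * real j / real n"
        using eventually_ge_at_top[of "max 1 j"]
      proof eventually_elim
        case (elim n)
        have "(\<integral>t. ?f t \<partial>\<mu> n) = (\<Sum>k\<le>n. w n k * (real k / real n) ^ j)"
        proof (subst int)
          have "max 0 (min 1 (real k / real n)) = real k / real n" if "k \<le> n" for k
          proof -
            have "0 \<le> real k / real n" "real k / real n \<le> 1"
              using that by (auto simp: divide_le_eq_1)
            then show ?thesis by linarith
          qed
          then show "(\<Sum>k\<le>n. w n k * ?f (real k / real n)) = (\<Sum>k\<le>n. w n k * (real k / real n) ^ j)"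
            by (intro sum.cong refl) (simp only: atMost_iff)
        qed simp
        moreover have "m j / m 0 = (\<Sum>k\<le>n. w n k * (real (k choose j) / real (n choose j)))"
        proof -
          have "m j / m 0 =
              (\<Sum>k\<le>n. real (n choose k) * moment_diff m k (n - k) * (real (k choose j) / real (n choose j))) / m 0"
            using elim by (simp only: sum_choose_moment_diff)
          also have "\<dots> = (\<Sum>k\<le>n. w n k * (real (k choose j) / real (n choose j)))"
            unfolding sum_divide_distrib w_def by (intro sum.cong refl) simp
          finally show ?thesis .
        qed
        ultimately have "(\<integral>t. ?f t \<partial>\<mu> n) - m j / m 0 =
            (\<Sum>k\<le>n. w n k * ((real k / real n) ^ j - real (k choose j) / real (n choose j)))"
          by (simp add: sum_subtractf ring_distribs)
        also have "norm \<dots> \<le> (\<Sum>k\<le>n. w n k * (real j * real j / real n))"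
        proof (rule sum_norm_le)
          fix k assume "k \<in> {..n}"
          then show "norm (w n k * ((real k / real n) ^ j - real (k choose j) / real (n choose j)))
             \<le> w n k * (real j * real j / real n)"
            using mult_left_mono[OF binomial_ratio_approx[of j n k] w0[of n k]] elim w0[of n k]
            by (simp add: abs_mult)
        qed
        also have "\<dots> = real j * real j / real n"
          using wsum[of n] by (simp only: sum_distrib_right[symmetric] mult_1)
        finally show ?case .
      qed
    qed
    from LIMSEQ_subseq_LIMSEQ[OF this r]
    have "(\<lambda>n. \<integral>t. ?f t \<partial>\<mu> (r n)) \<longlonglongrightarrow> m j / m 0"
      by (simp only: o_def)
    ultimately show ?thesis using LIMSEQ_unique[OF cont] by simp
  qed
  \<comment> \<open>The factor \<open>m 0\<close> undoes the normalization.\<close>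
  define N where "N = density M (\<lambda>_. ennreal (m 0))"
  have N: "(\<integral>t. t ^ j \<partial>N) = m j" for j
    unfolding N_def using mom[of j] m0 by (subst integral_density) auto
  have "emeasure M (- {0..1}) = 0"
    using AE by (subst (asm) AE_iff_measurable[of "- {0..1}"]) auto
  then have "emeasure N (- {-1..1}) = 0"
    unfolding N_def by (subst emeasure_density_const) (auto intro: emeasure_eq_0[of "- {0..1}"])
  moreover have "finite_measure N"
    by (intro finite_measureI) (simp add: N_def emeasure_density_const M.emeasure_eq_measure ennreal_mult_eq_top_iff)
  ultimately have "finite_on 1 N"
    by (auto simp: finite_on_def N_def)
  with N show ?thesis by blast
qed

section \<open>Spectral measures of positive operators\<close>

locale positive_operator =
  fixes I :: "'i set" and T :: "('i \<Rightarrow> complex) \<Rightarrow> ('i \<Rightarrow> complex)" and R :: real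
  assumes T_ell2: "x \<in> ell2 I \<Longrightarrow> T x \<in> ell2 I"
    and T_add: "x \<in> ell2 I \<Longrightarrow> y \<in> ell2 I \<Longrightarrow> T (\<lambda>i. x i + y i) = (\<lambda>i. T x i + T y i)"
    and T_scale: "x \<in> ell2 I \<Longrightarrow> T (\<lambda>i. c * x i) = (\<lambda>i. c * T x i)"
    and T_sym: "x \<in> ell2 I \<Longrightarrow> y \<in> ell2 I \<Longrightarrow> ell2_inner I (T x) y = ell2_inner I x (T y)"
    and T_nonneg: "x \<in> ell2 I \<Longrightarrow> 0 \<le> Re (ell2_inner I (T x) x)"
    and T_le: "x \<in> ell2 I \<Longrightarrow> Re (ell2_inner I (T x) x) \<le> R * ell2_sq I x"
    and R_pos: "0 < R"
begin

lemma T_diff: "x \<in> ell2 I \<Longrightarrow> y \<in> ell2 I \<Longrightarrow> T (\<lambda>i. x i - y i) = (\<lambda>i. T x i - T y i)"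
  using T_add[OF _ ell2_scale, of x y "-1"] T_scale[of y "-1"] by simp

lemma Tpow_ell2: "x \<in> ell2 I \<Longrightarrow> (T ^^ j) x \<in> ell2 I"
  by (induction j) (auto intro: T_ell2)

lemma Tpow_add: "x \<in> ell2 I \<Longrightarrow> y \<in> ell2 I \<Longrightarrow>
    (T ^^ j) (\<lambda>i. x i + y i) = (\<lambda>i. (T ^^ j) x i + (T ^^ j) y i)"
  by (induction j) (auto simp: T_add Tpow_ell2)

lemma Tpow_scale: "x \<in> ell2 I \<Longrightarrow> (T ^^ j) (\<lambda>i. c * x i) = (\<lambda>i. c * (T ^^ j) x i)"
  by (induction j) (auto simp: T_scale Tpow_ell2)

lemma Tpow_diff: "x \<in> ell2 I \<Longrightarrow> y \<in> ell2 I \<Longrightarrow>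
    (T ^^ j) (\<lambda>i. x i - y i) = (\<lambda>i. (T ^^ j) x i - (T ^^ j) y i)"
  by (induction j) (auto simp: T_diff Tpow_ell2)

lemma Tpow_sym:
  "x \<in> ell2 I \<Longrightarrow> y \<in> ell2 I \<Longrightarrow> ell2_inner I ((T ^^ j) x) y = ell2_inner I x ((T ^^ j) y)"
proof (induction j arbitrary: y)
  case (Suc j)
  have "ell2_inner I ((T ^^ Suc j) x) y = ell2_inner I x ((T ^^ j) (T y))"
    using Suc by (simp add: T_sym Tpow_ell2 T_ell2)
  then show ?case by (simp only: funpow_Suc_right o_def)
qed simp

definition r :: complex where "r = of_real (1 / R)"

lemma r_simps [simp]: "cnj r = r" "Re r = 1 / R" "Im r = 0"
  by (simp_all add: r_def)

text \<open>The operator \<open>1 - T / R\<close>, which is again positive. The iterated differences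
  of the moments of \<open>T / R\<close> at \<open>x\<close> are the forms of
  \<open>T ^ k U ^ l\<close> divided by \<open>R ^ k\<close>, so Hausdorff's criterion becomes
  positivity of these products.\<close>

definition U :: "('i \<Rightarrow> complex) \<Rightarrow> 'i \<Rightarrow> complex" where
  "U x = (\<lambda>i. x i - r * T x i)"

lemma U_ell2: "x \<in> ell2 I \<Longrightarrow> U x \<in> ell2 I"
  unfolding U_def by (intro ell2_diff ell2_scale T_ell2)

lemma Upow_ell2: "x \<in> ell2 I \<Longrightarrow> (U ^^ j) x \<in> ell2 I"
  by (induction j) (auto intro: U_ell2)

lemma U_sym: "x \<in> ell2 I \<Longrightarrow> y \<in> ell2 I \<Longrightarrow> ell2_inner I (U x) y = ell2_inner I x (U y)"
  unfolding U_def
  by (simp add: ell2_inner_diff_left ell2_inner_diff_right ell2_scale T_ell2 ell2_inner_scale_left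
      ell2_inner_scale_right T_sym)

lemma TU_commute: "x \<in> ell2 I \<Longrightarrow> T (U x) = U (T x)"
  unfolding U_def by (simp add: T_diff ell2_scale T_ell2 T_scale)

lemma T_Upow_commute: "x \<in> ell2 I \<Longrightarrow> T ((U ^^ l) x) = (U ^^ l) (T x)"
  by (induction l) (auto simp: TU_commute Upow_ell2)

lemma Tpow_U_commute: "x \<in> ell2 I \<Longrightarrow> (T ^^ k) (U x) = U ((T ^^ k) x)"
  by (induction k) (auto simp: TU_commute Tpow_ell2)

lemma U_nonneg: "x \<in> ell2 I \<Longrightarrow> 0 \<le> Re (ell2_inner I (U x) x)"
  using T_le[of x] R_pos unfolding U_def
  by (simp add: ell2_inner_diff_left ell2_scale T_ell2 ell2_inner_scale_left ell2_inner_same field_simps)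

text \<open>Splitting the second argument as \<open>x = r T x + U x\<close> gives \<open>r\<close>
  times the form of \<open>U\<close> at \<open>T x\<close> plus the form of \<open>T\<close> at
  \<open>U x\<close>. This takes the place of commuting square roots.\<close>

lemma TU_nonneg:
  assumes x: "x \<in> ell2 I"
  shows "0 \<le> Re (ell2_inner I (T (U x)) x)"
proof -
  have "x = (\<lambda>i. r * T x i + U x i)" by (simp add: U_def)
  then have "ell2_inner I (T (U x)) x = ell2_inner I (T (U x)) (\<lambda>i. r * T x i + U x i)"
    by simp
  also have "\<dots> = r * ell2_inner I (T (U x)) (T x) + ell2_inner I (T (U x)) (U x)"
    using x by (simp add: ell2_inner_add_right ell2_inner_scale_right ell2_scale T_ell2 U_ell2)
  also have "ell2_inner I (T (U x)) (T x) = ell2_inner I (U (T x)) (T x)"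
    by (simp add: TU_commute x)
  finally show ?thesis
    using U_nonneg[OF T_ell2[OF x]] T_nonneg[OF U_ell2[OF x]] R_pos by simp
qed

text \<open>Of two factors \<open>T\<close>, or two factors \<open>U\<close>, one can be moved to
  the other side of the inner product, which leaves the form at \<open>T x\<close> or
  \<open>U x\<close> with an exponent lowered by 2. In the end both exponents are at most 1.\<close>

lemma TU_pow_nonneg: "x \<in> ell2 I \<Longrightarrow> 0 \<le> Re (ell2_inner I ((T ^^ k) ((U ^^ l) x)) x)"
proof (induction "k + l" arbitrary: k l x rule: less_induct)
  case less
  note x = less.prems
  show ?case
  proof (cases "k \<ge> 2")
    case True
    then obtain k' where k: "k = Suc (Suc k')" using le_Suc_ex[OF True] by auto
    have "ell2_inner I ((T ^^ k) ((U ^^ l) x)) x = ell2_inner I (T ((T ^^ k') (T ((U ^^ l) x)))) x"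
      by (simp add: k funpow_swap1)
    also have "\<dots> = ell2_inner I ((T ^^ k') ((U ^^ l) (T x))) (T x)"
      using x by (simp add: T_sym Tpow_ell2 Upow_ell2 T_ell2 T_Upow_commute)
    finally show ?thesis using less.hyps[of k' l "T x"] T_ell2[OF x] by (simp add: k)
  next
    case k2: False
    show ?thesis
    proof (cases "l \<ge> 2")
      case True
      then obtain l' where l: "l = Suc (Suc l')" using le_Suc_ex[OF True] by auto
      have "ell2_inner I ((T ^^ k) ((U ^^ l) x)) x = ell2_inner I ((T ^^ k) (U ((U ^^ l') (U x)))) x"
        by (simp add: l funpow_swap1)
      also have "\<dots> = ell2_inner I ((T ^^ k) ((U ^^ l') (U x))) (U x)"
        using x by (simp add: Tpow_U_commute U_sym Tpow_ell2 Upow_ell2 U_ell2)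
      finally show ?thesis using less.hyps[of k l' "U x"] U_ell2[OF x] by (simp add: l)
    next
      case False
      with k2 have "k = 0 \<or> k = 1" "l = 0 \<or> l = 1" by auto
      then show ?thesis
        using x T_nonneg[OF x] U_nonneg[OF x] TU_nonneg[OF x]
        by (auto simp: ell2_inner_same ell2_sq_nonneg)
    qed
  qed
qed

lemma moment_measure_exists:
  assumes x: "x \<in> ell2 I"
  shows "\<exists>M. finite_on R M \<and> (\<forall>j. (\<integral>t. t ^ j \<partial>M) = Re (ell2_inner I ((T ^^ j) x) x))"
proof -
  define m where "m j = Re (ell2_inner I ((T ^^ j) x) x) / R ^ j" for j
  have "moment_diff m k l = Re (ell2_inner I ((T ^^ k) ((U ^^ l) x)) x) / R ^ k" for k l
  proof (induction l arbitrary: k)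
    case 0 show ?case by (simp add: m_def)
  next
    case (Suc l)
    let ?y = "(U ^^ l) x"
    have y: "?y \<in> ell2 I" using x by (rule Upow_ell2)
    have eq: "U ?y = (\<lambda>i. ?y i - r * T ?y i)" by (rule U_def)
    have "(T ^^ k) (U ?y) = (\<lambda>i. (T ^^ k) ?y i - r * (T ^^ Suc k) ?y i)"
      unfolding eq using y by (simp only: Tpow_diff Tpow_scale T_ell2 ell2_scale funpow_Suc_right o_def)
    then have "ell2_inner I ((T ^^ k) (U ?y)) x =
       ell2_inner I ((T ^^ k) ?y) x - r * ell2_inner I ((T ^^ Suc k) ?y) x"
      using x y by (simp only: ell2_inner_diff_left Tpow_ell2 ell2_scale ell2_inner_scale_left)
    then have "Re (ell2_inner I ((T ^^ k) (U ?y)) x) =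
       Re (ell2_inner I ((T ^^ k) ?y) x) - Re (ell2_inner I ((T ^^ Suc k) ?y) x) / R"
      by (simp only: minus_complex.sel) simp
    then show ?case using Suc.IH[of k] Suc.IH[of "Suc k"] R_pos
      by (simp add: diff_divide_distrib)
  qed
  then have "0 \<le> moment_diff m k l" for k l
    using TU_pow_nonneg[OF x] R_pos by simp
  from Hausdorff_moment_unit_interval[OF this]
  obtain M where M: "finite_on 1 M" and mom: "\<And>j. (\<integral>t. t ^ j \<partial>M) = m j" by blast
  interpret M: finite_measure M using M by (rule finite_onD)
  have meas: "(\<lambda>t. R * t) \<in> measurable M borel" by (subst finite_onD(5)[OF M]) simp
  let ?N = "distr M borel (\<lambda>t. R * t)"
  have "(\<integral>t. t ^ j \<partial>?N) = Re (ell2_inner I ((T ^^ j) x) x)" for j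
    using mom[of j] R_pos by (subst integral_distr[OF meas]) (simp_all add: power_mult_distrib m_def)
  moreover have "finite_on R ?N"
  proof -
    have "R * t \<le> R \<longleftrightarrow> t \<le> 1" "- R \<le> R * t \<longleftrightarrow> - 1 \<le> t" for t
      using mult_le_cancel_left_pos[OF R_pos, of t 1] mult_le_cancel_left_pos[OF R_pos, of "-1" t] by simp_all
    then have "(\<lambda>t. R * t) -` (- {-R..R}) \<inter> space M = - {-1..1}"
      using finite_onD(4)[OF M] by auto
    then have "emeasure ?N (- {-R..R}) = 0"
      using finite_onD(3)[OF M] by (subst emeasure_distr[OF meas]) auto
    then show ?thesis using M.finite_measure_distr[OF meas] by (simp add: finite_on_def)
  qed
  ultimately show ?thesis by blast
qed

section \<open>Functional calculus by polarization of the moment measures\<close>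

definition \<mu> :: "('i \<Rightarrow> complex) \<Rightarrow> real measure" where
  "\<mu> x = (SOME M. finite_on R M \<and> (\<forall>j. (\<integral>t. t ^ j \<partial>M) = Re (ell2_inner I ((T ^^ j) x) x)))"

lemma \<mu>:
  assumes "x \<in> ell2 I"
  shows "finite_on R (\<mu> x)" "(\<integral>t. t ^ j \<partial>\<mu> x) = Re (ell2_inner I ((T ^^ j) x) x)"
  using someI_ex[OF moment_measure_exists[OF assms]] unfolding \<mu>_def by blast+

text \<open>This is the sesquilinear form of \<open>f(T)\<close>: polarization makes it a
  combination of four integrals, hence a \<open>signed_functional\<close> in \<open>f\<close> for
  fixed vectors.\<close>

definition q :: "(real \<Rightarrow> real) \<Rightarrow> ('i \<Rightarrow> complex) \<Rightarrow> ('i \<Rightarrow> complex) \<Rightarrow> complex" where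
  "q f x y = 1/4 * (\<Sum>k<4. \<i> ^ k * of_real (\<integral>t. f t \<partial>\<mu> (\<lambda>i. x i + \<i> ^ k * y i)))"

lemma signed_q: "x \<in> ell2 I \<Longrightarrow> y \<in> ell2 I \<Longrightarrow> signed_functional R (\<lambda>f. q f x y)"
  unfolding q_def by (intro signed_scale signed_sum signed_integral \<mu> ell2_add ell2_scale)

lemma inner_Tpow_real: "x \<in> ell2 I \<Longrightarrow>
  complex_of_real (Re (ell2_inner I ((T ^^ j) x) x)) = ell2_inner I ((T ^^ j) x) x"
proof -
  assume x: "x \<in> ell2 I"
  have "ell2_inner I ((T ^^ j) x) x = cnj (ell2_inner I ((T ^^ j) x) x)"
    using ell2_inner_commute[of I "(T ^^ j) x" x] Tpow_sym[OF x x, of j] by simp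
  from arg_cong[OF this, of Im] show ?thesis by (simp add: complex_eq_iff)
qed

lemma q_moment:
  assumes x: "x \<in> ell2 I" and y: "y \<in> ell2 I"
  shows "q (\<lambda>t. t ^ j) x y = ell2_inner I ((T ^^ j) x) y"
proof -
  let ?A = "T ^^ j"
  have key: "complex_of_real (\<integral>t. t ^ j \<partial>\<mu> (\<lambda>i. x i + c * y i)) =
     ell2_inner I (?A x) x + cnj c * ell2_inner I (?A x) y + c * ell2_inner I (?A y) x
       + c * (cnj c * ell2_inner I (?A y) y)" for c
  proof -
    have v: "(\<lambda>i. x i + c * y i) \<in> ell2 I" using x y by (intro ell2_add ell2_scale)
    have "complex_of_real (\<integral>t. t ^ j \<partial>\<mu> (\<lambda>i. x i + c * y i)) =
       ell2_inner I (\<lambda>i. ?A x i + c * ?A y i) (\<lambda>i. x i + c * y i)"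
      using x y by (simp only: \<mu>(2)[OF v] inner_Tpow_real[OF v]) (simp add: Tpow_add Tpow_scale ell2_scale)
    also have "\<dots> = ell2_inner I (?A x) x + cnj c * ell2_inner I (?A x) y + c * ell2_inner I (?A y) x
       + c * (cnj c * ell2_inner I (?A y) y)"
      using x y v by (simp add: ell2_inner_add_left ell2_inner_add_right ell2_scale Tpow_ell2
        ell2_inner_scale_left ell2_inner_scale_right ring_distribs)
    finally show ?thesis .
  qed
  show ?thesis unfolding q_def key by (simp add: numeral_eq_Suc algebra_simps)
qed

text \<open>The measures of \<open>x\<close>, \<open>x'\<close> and their sum are chosen
  independently of each other, so additivity is not visible in the definition of \<open>q\<close>.
  For powers of \<open>t\<close> it is additivity of \<open>T ^^ j\<close>, and moments determine
  signed functionals. The next rules for \<open>q\<close> are obtained in the same way.\<close>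

lemma q_add:
  assumes x: "x \<in> ell2 I" and x': "x' \<in> ell2 I" and y: "y \<in> ell2 I" and f: "bdd_on R f"
  shows "q f (\<lambda>i. x i + x' i) y = q f x y + q f x' y"
proof (rule signed_functional_eqI[where \<Lambda> = "\<lambda>f. q f (\<lambda>i. x i + x' i) y" and
      \<Lambda>' = "\<lambda>f. q f x y + q f x' y", OF _ _ f])
  show "signed_functional R (\<lambda>f. q f (\<lambda>i. x i + x' i) y)"
    by (rule signed_q[OF ell2_add[OF x x'] y])
  show "signed_functional R (\<lambda>f. q f x y + q f x' y)"
    by (rule signed_add[OF signed_q[OF x y] signed_q[OF x' y]])
  show "q (\<lambda>t. t ^ j) (\<lambda>i. x i + x' i) y = q (\<lambda>t. t ^ j) x y + q (\<lambda>t. t ^ j) x' y" for j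
    using x x' y by (simp add: q_moment ell2_add Tpow_add ell2_inner_add_left Tpow_ell2)
qed

lemma q_scale:
  assumes x: "x \<in> ell2 I" and y: "y \<in> ell2 I" and f: "bdd_on R f"
  shows "q f (\<lambda>i. c * x i) y = c * q f x y"
proof (rule signed_functional_eqI[where \<Lambda> = "\<lambda>f. q f (\<lambda>i. c * x i) y" and
      \<Lambda>' = "\<lambda>f. c * q f x y", OF _ _ f])
  show "signed_functional R (\<lambda>f. q f (\<lambda>i. c * x i) y)"
    by (rule signed_q[OF ell2_scale[OF x] y])
  show "signed_functional R (\<lambda>f. c * q f x y)"
    by (rule signed_scale[OF signed_q[OF x y]])
  show "q (\<lambda>t. t ^ j) (\<lambda>i. c * x i) y = c * q (\<lambda>t. t ^ j) x y" for j
    using x y by (simp add: q_moment ell2_scale Tpow_scale ell2_inner_scale_left)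
qed

lemma q_commute:
  assumes x: "x \<in> ell2 I" and y: "y \<in> ell2 I" and f: "bdd_on R f"
  shows "q f y x = cnj (q f x y)"
proof (rule signed_functional_eqI[where \<Lambda> = "\<lambda>f. q f y x" and \<Lambda>' = "\<lambda>f. cnj (q f x y)",
      OF signed_q[OF y x] signed_cnj[OF signed_q[OF x y]] f])
  show "q (\<lambda>t. t ^ j) y x = cnj (q (\<lambda>t. t ^ j) x y)" for j
    using ell2_inner_commute[of I "(T ^^ j) y" x] by (simp add: q_moment x y Tpow_sym)
qed

lemma q_self:
  assumes x: "x \<in> ell2 I" and f: "bdd_on R f"
  shows "q f x x = of_real (\<integral>t. f t \<partial>\<mu> x)"
proof (rule signed_functional_eqI[where \<Lambda> = "\<lambda>f. q f x x" and
      \<Lambda>' = "\<lambda>f. of_real (\<integral>t. f t \<partial>\<mu> x)", OF signed_q[OF x x] signed_integral[OF \<mu>(1)[OF x]] f])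
  show "q (\<lambda>t. t ^ j) x x = of_real (\<integral>t. t ^ j \<partial>\<mu> x)" for j
    by (simp only: q_moment[OF x x] \<mu>(2)[OF x] inner_Tpow_real[OF x])
qed

lemma q_T:
  assumes x: "x \<in> ell2 I" and y: "y \<in> ell2 I" and f: "bdd_on R f"
  shows "q f (T x) y = q (\<lambda>t. t * f t) x y"
proof (rule signed_functional_eqI[where \<Lambda> = "\<lambda>f. q f (T x) y" and
      \<Lambda>' = "\<lambda>f. q (\<lambda>t. t * f t) x y",
      OF signed_q[OF T_ell2[OF x] y] signed_mult[OF signed_q[OF x y] bdd_on_id] f])
  show "q (\<lambda>t. t ^ j) (T x) y = q (\<lambda>t. t * t ^ j) x y" for j
    unfolding power_Suc[symmetric] q_moment[OF x y] q_moment[OF T_ell2[OF x] y]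
    by (simp only: funpow_Suc_right o_def)
qed

lemma q_Tpow_right:
  assumes x: "x \<in> ell2 I" and y: "y \<in> ell2 I" and f: "bdd_on R f"
  shows "q f x ((T ^^ j) y) = q (\<lambda>t. t ^ j * f t) x y"
  using f
proof (induction j arbitrary: f)
  case (Suc j)
  note Tj = Tpow_ell2[OF y, of j]
  note bd = bdd_on_mult[OF bdd_on_id Suc.prems]
  have "q f x (T ((T ^^ j) y)) = cnj (q f (T ((T ^^ j) y)) x)"
    by (rule q_commute[OF T_ell2[OF Tj] x Suc.prems])
  also have "\<dots> = cnj (q (\<lambda>t. t * f t) ((T ^^ j) y) x)"
    by (simp only: q_T[OF Tj x Suc.prems])
  also have "\<dots> = q (\<lambda>t. t * f t) x ((T ^^ j) y)"
    by (rule q_commute[OF Tj x bd, symmetric])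
  also have "\<dots> = q (\<lambda>t. t ^ j * (t * f t)) x y"
    by (rule Suc.IH[OF bd])
  finally show ?case by (simp add: mult_ac)
qed simp

text \<open>This is the boundedness that \<open>ell2_Riesz\<close> asks for. Cauchy-Schwarz for the
  form of the indicator reduces it to the diagonal, where the mass of \<open>B\<close> is at most
  the total mass, which is the zeroth moment.\<close>

lemma q_norm_le:
  assumes x: "x \<in> ell2 I" and y: "y \<in> ell2 I" and B: "B \<in> sets borel"
  shows "(cmod (q (indicator B) x y))\<^sup>2 \<le> ell2_sq I x * ell2_sq I y"
proof -
  note bd = bdd_on_indicator[OF B, of R]
  have self: "0 \<le> Re (q (indicator B) x x)" "Re (q (indicator B) x x) \<le> ell2_sq I x"
    if x: "x \<in> ell2 I" for x
  proof -
    interpret finite_measure "\<mu> x" using \<mu>(1)[OF x] by (rule finite_onD)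
    show "0 \<le> Re (q (indicator B) x x)" by (simp add: q_self[OF x bd])
    have "Re (q (indicator B) x x) = measure (\<mu> x) B"
      using B finite_onD(2,4)[OF \<mu>(1)[OF x]] by (simp add: q_self[OF x bd])
    also have "\<dots> \<le> measure (\<mu> x) UNIV"
      using finite_onD(2,4)[OF \<mu>(1)[OF x]] bounded_measure[of B] by simp
    also have "\<dots> = ell2_sq I x"
      using \<mu>(2)[OF x, of 0] finite_onD(4)[OF \<mu>(1)[OF x]] by (simp add: ell2_sq_alt)
    finally show "Re (q (indicator B) x x) \<le> ell2_sq I x" .
  qed
  have "(cmod (q (indicator B) x y))\<^sup>2 \<le> Re (q (indicator B) x x) * Re (q (indicator B) y y)"
    by (rule Cauchy_Schwarz_form[where q = "q (indicator B)", OF x y q_add q_scale q_commute self(1)])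
      (assumption | rule bd)+
  also have "\<dots> \<le> ell2_sq I x * ell2_sq I y"
    using self[OF x] self[OF y] by (intro mult_mono) (auto simp: ell2_sq_nonneg)
  finally show ?thesis .
qed

text \<open>The coordinates are those of the vector that represents the functional
  \<open>q (indicator B) x\<close> according to \<open>ell2_Riesz\<close>.\<close>

definition E :: "real set \<Rightarrow> ('i \<Rightarrow> complex) \<Rightarrow> 'i \<Rightarrow> complex" where
  "E B x = (\<lambda>i. if i \<in> I then q (indicator B) x (unit_fun i) else 0)"

lemma E:
  assumes x: "x \<in> ell2 I" and B: "B \<in> sets borel"
  shows "E B x \<in> ell2 I" and E_inner: "y \<in> ell2 I \<Longrightarrow> ell2_inner I (E B x) y = q (indicator B) x y"
proof -
  note bd = bdd_on_indicator[OF B, of R]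
  have add: "q (indicator B) x (\<lambda>i. y i + z i) = q (indicator B) x y + q (indicator B) x z"
    if "y \<in> ell2 I" "z \<in> ell2 I" for y z
    using that x q_commute[of _ x "indicator B"] bd by (simp add: ell2_add q_add)
  have scale: "q (indicator B) x (\<lambda>i. c * y i) = cnj c * q (indicator B) x y" if "y \<in> ell2 I" for c y
    using that x q_commute[of _ x "indicator B"] bd by (simp add: ell2_scale q_scale)
  note R = ell2_Riesz[of I "\<lambda>y. q (indicator B) x y" "ell2_sq I x",
      OF add scale q_norm_le[OF x _ B] ell2_sq_nonneg]
  show "E B x \<in> ell2 I" unfolding E_def by (rule R(1))
  show "ell2_inner I (E B x) y = q (indicator B) x y" if "y \<in> ell2 I"
    unfolding E_def using R(2) that by blast
qed

text \<open>Multiplicativity of the calculus: applying \<open>E C\<close> first multiplies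
  \<open>f\<close> by the indicator of \<open>C\<close>. It suffices to test powers, and for these
  the powers of \<open>T\<close> are moved to \<open>y\<close>, where \<open>E_inner\<close> and
  \<open>q_Tpow_right\<close> apply.\<close>

lemma q_E:
  assumes x: "x \<in> ell2 I" and y: "y \<in> ell2 I" and C: "C \<in> sets borel" and f: "bdd_on R f"
  shows "q f (E C x) y = q (\<lambda>t. indicator C t * f t) x y"
proof (rule signed_functional_eqI[where \<Lambda> = "\<lambda>f. q f (E C x) y" and
      \<Lambda>' = "\<lambda>f. q (\<lambda>t. indicator C t * f t) x y", OF _ _ f])
  note bd = bdd_on_indicator[OF C, of R]
  show "signed_functional R (\<lambda>f. q f (E C x) y)"
    by (rule signed_q[OF E(1)[OF x C] y])
  show "signed_functional R (\<lambda>f. q (\<lambda>t. indicator C t * f t) x y)"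
    by (rule signed_mult[OF signed_q[OF x y] bd])
  fix j
  have "q (\<lambda>t. t ^ j) (E C x) y = ell2_inner I (E C x) ((T ^^ j) y)"
    by (simp add: q_moment E x y C Tpow_sym)
  also have "\<dots> = q (indicator C) x ((T ^^ j) y)"
    by (rule E_inner[OF x C Tpow_ell2[OF y]])
  finally show "q (\<lambda>t. t ^ j) (E C x) y = q (\<lambda>t. indicator C t * t ^ j) x y"
    by (simp add: q_Tpow_right[OF x y bd] mult.commute)
qed

theorem spectral_measure_E: "spectral_measure I T E"
  unfolding spectral_measure_def
proof (intro conjI ballI allI impI)
  have Int: "E (B \<inter> C) x = E B (E C x)"
    if B: "B \<in> sets borel" and C: "C \<in> sets borel" and x: "x \<in> ell2 I" for B C x
  proof (rule ell2_ext)
    show "E (B \<inter> C) x \<in> ell2 I" "E B (E C x) \<in> ell2 I" using B C x by (auto intro!: E)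
    fix z assume z: "z \<in> ell2 I"
    have "ell2_inner I (E B (E C x)) z = q (\<lambda>t. indicator C t * indicator B t) x z"
      using B C x z by (simp add: E q_E bdd_on_indicator)
    also have "(\<lambda>t. indicator C t * indicator B t) = (indicator (B \<inter> C) :: real \<Rightarrow> real)"
      by (auto simp: indicator_def)
    finally show "ell2_inner I (E (B \<inter> C) x) z = ell2_inner I (E B (E C x)) z"
      using B C x z by (simp add: E)
  qed
  then show "E (B \<inter> C) x = E B (E C x)"
    if "B \<in> sets borel" "C \<in> sets borel" "x \<in> ell2 I" for B C x using that .
  show "orth_projection I (E B)" if B: "B \<in> sets borel" for B
    unfolding orth_projection_def
  proof (intro conjI ballI)
    fix x assume x: "x \<in> ell2 I"
    show "E B x \<in> ell2 I" by (rule E[OF x B])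
    show "E B (E B x) = E B x" using Int[OF B B x] by simp
    fix y assume y: "y \<in> ell2 I"
    have "ell2_inner I (E B x) y = cnj (q (indicator B) y x)"
      using q_commute[OF y x bdd_on_indicator[OF B]] by (simp add: E x y B)
    also have "\<dots> = ell2_inner I x (E B y)"
      using ell2_inner_commute[of I x "E B y"] by (simp add: E x y B)
    finally show "ell2_inner I (E B x) y = ell2_inner I x (E B y)" .
  qed
  have UNIV: "E UNIV x = x" if x: "x \<in> ell2 I" for x
  proof (rule ell2_ext)
    fix z assume z: "z \<in> ell2 I"
    show "ell2_inner I (E UNIV x) z = ell2_inner I x z"
      using q_moment[OF x z, of 0] E_inner[OF x _ z, of UNIV] by (simp add: indicator_def)
  qed (use x in \<open>auto intro: E\<close>)
  then show "E UNIV x = x" if "x \<in> ell2 I" for x using that .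
  have "E {-R..R} x = x" if x: "x \<in> ell2 I" for x
  proof (rule ell2_ext)
    fix z assume z: "z \<in> ell2 I"
    have "q (indicator {-R..R}) x z = q (indicator UNIV) x z"
      by (rule \<Phi>_cong[OF signed_q[OF x z] _ bdd_on_indicator bdd_on_indicator]) simp_all
    then show "ell2_inner I (E {-R..R} x) z = ell2_inner I x z"
      using UNIV[OF x] E_inner[OF x _ z, of UNIV] x z by (simp add: E)
  qed (use x in \<open>auto intro: E\<close>)
  then show "\<exists>R. \<forall>x\<in>ell2 I. E {-R..R} x = x" by blast
  show "(\<lambda>n. ell2_inner I (E (B n) x) y) sums ell2_inner I (E (\<Union>n. B n) x) y"
    if B: "range B \<subseteq> sets borel" "disjoint_family B" and x: "x \<in> ell2 I" and y: "y \<in> ell2 I"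
    for B :: "nat \<Rightarrow> real set" and x y
  proof -
    have Bn: "B n \<in> sets borel" for n using B by auto
    show ?thesis
      using signed_sums[OF signed_q[OF x y] Bn B(2)] Bn by (simp add: E x y)
  qed
  show "ell2_inner I (T x) x = complex_of_real
      (\<integral>t. t \<partial>measure_of UNIV (sets borel) (\<lambda>B. ennreal (Re (ell2_inner I (E B x) x))))"
    if x: "x \<in> ell2 I" for x
  proof -
    note M = finite_onD[OF \<mu>(1)[OF x]]
    interpret finite_measure "\<mu> x" by (rule M)
    have "ennreal (Re (ell2_inner I (E B x) x)) = emeasure (\<mu> x) B" if B: "B \<in> sets borel" for B
      using B M(2,4) by (simp add: E x q_self bdd_on_indicator emeasure_eq_measure)
    moreover have "sigma_sets UNIV (sets borel) = sets (borel :: real measure)"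
      using sets.sigma_sets_eq[of "borel :: real measure"] by simp
    ultimately have "measure_of UNIV (sets borel) (\<lambda>B. ennreal (Re (ell2_inner I (E B x) x))) =
      measure_of UNIV (sets borel) (emeasure (\<mu> x))"
      by (intro measure_of_eq) (simp_all only: subset_Pow_Union Union_UNIV subset_UNIV Pow_UNIV)
    also have "\<dots> = \<mu> x"
      using measure_of_of_measure[of "\<mu> x"] M(2,4) by simp
    finally show ?thesis
      using \<mu>(2)[OF x, of 1] inner_Tpow_real[OF x, of 1] by simp
  qed
qed

end

section \<open>Moments of a spectral measure\<close>

lemma signed_functional_eqI_indicator:
  assumes "signed_functional R \<Lambda>" "signed_functional R \<Lambda>'" "bdd_on R f"
    and "\<And>B. B \<in> sets borel \<Longrightarrow> \<Lambda> (indicator B) = \<Lambda>' (indicator B)"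
  shows "\<Lambda> f = \<Lambda>' f"
  using \<Phi>_eq_0_of_indicator[OF signed_diff[OF assms(1,2)] _ assms(3)] assms(4) by simp

text \<open>The measure \<open>F\<close> is arbitrary, because the projections in
  \<open>spectral_distribution\<close> come from a choice operator. What ties \<open>F\<close> to
  \<open>T\<close> is the integral formula for \<open>ell2_inner I (T x) x\<close>; commutation and
  higher moments are derived from it.\<close>

locale positive_operator_spectral = positive_operator +
  fixes F
  assumes F: "spectral_measure I T F"
begin

lemma F_ell2: "x \<in> ell2 I \<Longrightarrow> B \<in> sets borel \<Longrightarrow> F B x \<in> ell2 I"
  and F_idem: "x \<in> ell2 I \<Longrightarrow> B \<in> sets borel \<Longrightarrow> F B (F B x) = F B x"
  and F_sym: "x \<in> ell2 I \<Longrightarrow> y \<in> ell2 I \<Longrightarrow> B \<in> sets borel \<Longrightarrow>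
     ell2_inner I (F B x) y = ell2_inner I x (F B y)"
  and F_UNIV: "x \<in> ell2 I \<Longrightarrow> F UNIV x = x"
  and F_Int: "x \<in> ell2 I \<Longrightarrow> B \<in> sets borel \<Longrightarrow> C \<in> sets borel \<Longrightarrow> F (B \<inter> C) x = F B (F C x)"
  and F_sums: "range A \<subseteq> sets borel \<Longrightarrow> disjoint_family A \<Longrightarrow> x \<in> ell2 I \<Longrightarrow> y \<in> ell2 I \<Longrightarrow>
     (\<lambda>n. ell2_inner I (F (A n) x) y) sums ell2_inner I (F (\<Union>n. A n) x) y"
proof -
  note F' = F[unfolded spectral_measure_def orth_projection_def]
  note P = F'[THEN conjunct1, rule_format]
  note rest = F'[THEN conjunct2, THEN conjunct2]
  show "x \<in> ell2 I \<Longrightarrow> B \<in> sets borel \<Longrightarrow> F B x \<in> ell2 I"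
    "x \<in> ell2 I \<Longrightarrow> B \<in> sets borel \<Longrightarrow> F B (F B x) = F B x"
    "x \<in> ell2 I \<Longrightarrow> y \<in> ell2 I \<Longrightarrow> B \<in> sets borel \<Longrightarrow>
     ell2_inner I (F B x) y = ell2_inner I x (F B y)"
    using P[of B] by simp_all
  show "x \<in> ell2 I \<Longrightarrow> F UNIV x = x"
    by (rule rest[THEN conjunct1, rule_format])
  show "x \<in> ell2 I \<Longrightarrow> B \<in> sets borel \<Longrightarrow> C \<in> sets borel \<Longrightarrow> F (B \<inter> C) x = F B (F C x)"
    by (rule rest[THEN conjunct2, THEN conjunct1, rule_format])
  show "range A \<subseteq> sets borel \<Longrightarrow> disjoint_family A \<Longrightarrow> x \<in> ell2 I \<Longrightarrow> y \<in> ell2 I \<Longrightarrow>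
     (\<lambda>n. ell2_inner I (F (A n) x) y) sums ell2_inner I (F (\<Union>n. A n) x) y"
    by (rule rest[THEN conjunct2, THEN conjunct2, THEN conjunct1, rule_format])
qed

text \<open>Countable additivity is applied to a sequence of empty sets: a constant series converges
  only if its term is 0.\<close>

lemma F_empty_inner: "x \<in> ell2 I \<Longrightarrow> y \<in> ell2 I \<Longrightarrow> ell2_inner I (F {} x) y = 0"
proof -
  assume x: "x \<in> ell2 I" and y: "y \<in> ell2 I"
  have "disjoint_family (\<lambda>n::nat. {} :: real set)" by (simp add: disjoint_family_on_def)
  then have "summable (\<lambda>n::nat. ell2_inner I (F {} x) y)"
    using F_sums[of "\<lambda>_. {}" x y] x y by (auto intro: sums_summable)
  then show ?thesis by (simp only: summable_const_iff)
qed

lemma F_compl_inner: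
  assumes x: "x \<in> ell2 I" and y: "y \<in> ell2 I" and B: "B \<in> sets borel"
  shows "ell2_inner I (F B x) y + ell2_inner I (F (- B) x) y = ell2_inner I x y"
proof -
  define A where "A n = (if n = 0 then B else if n = 1 then - B else {})" for n :: nat
  have "disjoint_family A" by (auto simp: disjoint_family_on_def A_def)
  moreover have "range A \<subseteq> sets borel" using B by (auto simp: A_def)
  moreover have "(\<Union>n. A n) = UNIV"
  proof -
    have "B \<union> - B \<subseteq> A 0 \<union> A 1" by (simp add: A_def)
    then show ?thesis by blast
  qed
  ultimately have "(\<lambda>n. ell2_inner I (F (A n) x) y) sums ell2_inner I x y"
    using F_sums[of A x y] x y by (simp add: F_UNIV)
  moreover have "(\<lambda>n. ell2_inner I (F (A n) x) y) sums (\<Sum>n\<in>{0,1}. ell2_inner I (F (A n) x) y)"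
    by (rule sums_finite) (auto simp: A_def F_empty_inner x y)
  ultimately have "(\<Sum>n\<in>{0,1}. ell2_inner I (F (A n) x) y) = ell2_inner I x y"
    by (rule sums_unique2[symmetric])
  then show ?thesis by (simp add: A_def)
qed

lemma F_inner_self: "x \<in> ell2 I \<Longrightarrow> B \<in> sets borel \<Longrightarrow> ell2_inner I (F B x) x = of_real (ell2_sq I (F B x))"
  using F_sym[of "F B x" x B] F_idem[of x B] F_ell2[of x B] by (simp add: ell2_inner_same)

section \<open>The scalar measures of a spectral measure\<close>

definition N :: "('a \<Rightarrow> complex) \<Rightarrow> real measure" where
  "N x = measure_of UNIV (sets borel) (\<lambda>B. ennreal (Re (ell2_inner I (F B x) x)))"

lemma emeasure_N:
  assumes x: "x \<in> ell2 I" and B: "B \<in> sets borel"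
  shows "emeasure (N x) B = ennreal (Re (ell2_inner I (F B x) x))"
proof (rule emeasure_measure_of[OF N_def])
  show "sets borel \<subseteq> Pow (UNIV :: real set)" by simp
  have sets_N: "sets (N x) = sets borel"
    unfolding N_def using sets.sigma_sets_eq[of "borel :: real measure"] by simp
  then show "B \<in> sets (N x)" using B by simp
  show "positive (sets (N x)) (\<lambda>B. ennreal (Re (ell2_inner I (F B x) x)))"
    by (simp add: positive_def F_empty_inner x)
  show "countably_additive (sets (N x)) (\<lambda>B. ennreal (Re (ell2_inner I (F B x) x)))"
    unfolding sets_N
  proof (rule countably_additiveI)
    fix A :: "nat \<Rightarrow> real set"
    assume A: "range A \<subseteq> sets borel" "disjoint_family A"
    have "(\<lambda>n. Re (ell2_inner I (F (A n) x) x)) sums Re (ell2_inner I (F (\<Union>n. A n) x) x)"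
      by (rule sums_Re[OF F_sums[OF A x x]])
    moreover have "0 \<le> Re (ell2_inner I (F (A n) x) x)" for n
      using A x by (subst F_inner_self) (auto simp: ell2_sq_nonneg)
    ultimately show "(\<Sum>i. ennreal (Re (ell2_inner I (F (A i) x) x))) =
        ennreal (Re (ell2_inner I (F (\<Union> (range A)) x) x))"
      by (intro suminf_ennreal_eq) auto
  qed
qed

lemma sets_N: "sets (N x) = sets borel"
  unfolding N_def using sets.sigma_sets_eq[of "borel :: real measure"] by simp

lemma measure_N:
  assumes "x \<in> ell2 I" "B \<in> sets borel"
  shows "measure (N x) B = Re (ell2_inner I (F B x) x)"
  unfolding measure_def emeasure_N[OF assms] F_inner_self[OF assms] by (simp add: ell2_sq_nonneg)

text \<open>A support radius of \<open>F\<close>, chosen independently of the bound \<open>R\<close>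
  of the quadratic form.\<close>

definition S :: real where
  "S = (SOME S. \<forall>x\<in>ell2 I. F {-S..S} x = x)"

lemma F_S: "x \<in> ell2 I \<Longrightarrow> F {-S..S} x = x"
proof -
  have "\<exists>S. \<forall>x\<in>ell2 I. F {-S..S} x = x"
    using F unfolding spectral_measure_def by blast
  then have "\<forall>x\<in>ell2 I. F {-S..S} x = x"
    unfolding S_def by (rule someI_ex)
  then show "x \<in> ell2 I \<Longrightarrow> F {-S..S} x = x" by blast
qed

lemma finite_on_N:
  assumes x: "x \<in> ell2 I"
  shows "finite_on S (N x)"
  unfolding finite_on_def
proof (intro conjI finite_measureI)
  have "space (N x) = UNIV" using sets_eq_imp_space_eq[OF sets_N[of x]] by simp
  then show "emeasure (N x) (space (N x)) \<noteq> \<infinity>" by (simp add: emeasure_N x)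
  show "sets (N x) = sets borel" by (rule sets_N)
  have "F (- {-S..S} \<inter> {-S..S}) x = F (- {-S..S}) (F {-S..S} x)"
    by (rule F_Int[OF x]) auto
  then have "F (- {-S..S}) x = F {} x" by (simp add: F_S x)
  then show "emeasure (N x) (- {-S..S}) = 0"
    by (subst emeasure_N[OF x]) (auto simp: F_empty_inner x)
qed

lemma space_N [simp]: "space (N x) = UNIV"
  using sets_eq_imp_space_eq[OF sets_N[of x]] by simp

lemma signed_N: "x \<in> ell2 I \<Longrightarrow> signed_functional S (\<lambda>f. complex_of_real (\<integral>t. f t \<partial>N x))"
  by (rule signed_integral[OF finite_on_N])

lemma T_inner: "x \<in> ell2 I \<Longrightarrow> ell2_inner I (T x) x = complex_of_real (\<integral>t. t \<partial>N x)"
  using F unfolding spectral_measure_def N_def by blast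

text \<open>Since \<open>F C (F B (F C x)) = F (C \<inter> B) x\<close>, the scalar measure of
  \<open>F C x\<close> is the restriction of that of \<open>x\<close> to \<open>C\<close>.\<close>

lemma T_inner_F:
  assumes x: "x \<in> ell2 I" and C: "C \<in> sets borel"
  shows "ell2_inner I (T (F C x)) (F C x) = complex_of_real (\<integral>t. indicator C t * t \<partial>N x)"
proof -
  have Cx: "F C x \<in> ell2 I" using x C by (rule F_ell2)
  have "complex_of_real (\<integral>t. t \<partial>N (F C x)) = complex_of_real (\<integral>t. indicator C t * t \<partial>N x)"
  proof (rule signed_functional_eqI_indicator[where \<Lambda> = "\<lambda>f. complex_of_real (\<integral>t. f t \<partial>N (F C x))" and
      \<Lambda>' = "\<lambda>f. complex_of_real (\<integral>t. indicator C t * f t \<partial>N x)", OF signed_N[OF Cx] _ bdd_on_id])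
    show "signed_functional S (\<lambda>f. complex_of_real (\<integral>t. indicator C t * f t \<partial>N x))"
      by (rule signed_mult[OF signed_N[OF x] bdd_on_indicator[OF C]])
    fix B :: "real set" assume B: "B \<in> sets borel"
    have "F C (F B (F C x)) = F (C \<inter> B) x"
    proof -
      have "F C (F B (F C x)) = F (C \<inter> (B \<inter> C)) x" using x B C by (simp add: F_Int)
      also have "C \<inter> (B \<inter> C) = C \<inter> B" by blast
      finally show ?thesis .
    qed
    then have "ell2_inner I (F B (F C x)) (F C x) = ell2_inner I (F (C \<inter> B) x) x"
      using F_sym[OF F_ell2[OF Cx B] x C] by simp
    moreover have "(\<lambda>t. indicator C t * indicator B t) = (indicator (C \<inter> B) :: real \<Rightarrow> real)"
      by (auto simp: indicator_def)
    ultimately show "complex_of_real (\<integral>t. indicator B t \<partial>N (F C x)) =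
        complex_of_real (\<integral>t. indicator C t * indicator B t \<partial>N x)"
      using B C x Cx by (simp add: measure_N)
  qed
  then show ?thesis by (simp add: T_inner[OF Cx])
qed

lemma F_add_inner:
  assumes "x \<in> ell2 I" "y \<in> ell2 I" "z \<in> ell2 I" "B \<in> sets borel"
  shows "ell2_inner I (F B (\<lambda>i. x i + y i)) z = ell2_inner I (F B x) z + ell2_inner I (F B y) z"
  using assms by (simp add: F_sym ell2_add ell2_inner_add_left F_ell2)

lemma F_scale_inner:
  assumes "x \<in> ell2 I" "z \<in> ell2 I" "B \<in> sets borel"
  shows "ell2_inner I (F B (\<lambda>i. c * x i)) z = c * ell2_inner I (F B x) z"
  using assms by (simp add: F_sym ell2_scale ell2_inner_scale_left F_ell2)

text \<open>For \<open>a\<close> and \<open>b\<close> in the ranges of disjoint projections all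
  cross terms of \<open>F\<close> vanish, so the scalar measure of \<open>a + c b\<close> is the sum
  of those of \<open>a\<close> and \<open>b\<close> whenever \<open>c\<close> has modulus 1. The
  form of \<open>T\<close> is then additive too, so its two cross terms cancel; \<open>c = 1\<close>
  and \<open>c = \<i>\<close> together make each of them 0.\<close>

lemma T_F_disjoint:
  assumes u: "u \<in> ell2 I" and v: "v \<in> ell2 I" and C: "C \<in> sets borel" and D: "D \<in> sets borel"
    and CD: "C \<inter> D = {}"
  shows "ell2_inner I (T (F C u)) (F D v) = 0"
proof -
  define a where "a = F C u"
  define b where "b = F D v"
  have a: "a \<in> ell2 I" and b: "b \<in> ell2 I" using u v C D by (auto simp: a_def b_def F_ell2)
  have cross: "ell2_inner I (F B a) b = 0" if B: "B \<in> sets borel" for B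
  proof -
    have "ell2_inner I (F B a) b = ell2_inner I (F D (F B (F C u))) v"
      unfolding a_def b_def using u v B C D by (simp add: F_sym F_ell2)
    also have "F D (F B (F C u)) = F (D \<inter> (B \<inter> C)) u"
      using u B C D by (simp add: F_Int)
    also have "D \<inter> (B \<inter> C) = {}" using CD by blast
    finally show ?thesis by (simp add: F_empty_inner u v)
  qed
  have cross': "ell2_inner I (F B b) a = 0" if B: "B \<in> sets borel" for B
    using cross[OF B] F_sym[OF b a B] ell2_inner_commute[of I b "F B a"] by simp
  have key: "cnj c * ell2_inner I (T a) b + c * ell2_inner I (T b) a = 0" if c: "c * cnj c = 1" for c
  proof -
    define w where "w = (\<lambda>i. a i + c * b i)"
    have cb: "(\<lambda>i. c * b i) \<in> ell2 I" using b by (rule ell2_scale)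
    have w: "w \<in> ell2 I" unfolding w_def by (rule ell2_add[OF a cb])
    have "complex_of_real (\<integral>t. t \<partial>N w) = complex_of_real (\<integral>t. t \<partial>N a) + complex_of_real (\<integral>t. t \<partial>N b)"
    proof (rule signed_functional_eqI_indicator[where \<Lambda> = "\<lambda>f. complex_of_real (\<integral>t. f t \<partial>N w)" and
        \<Lambda>' = "\<lambda>f. complex_of_real (\<integral>t. f t \<partial>N a) + complex_of_real (\<integral>t. f t \<partial>N b)",
        OF signed_N[OF w] signed_add[OF signed_N[OF a] signed_N[OF b]] bdd_on_id])
      fix B :: "real set" assume B: "B \<in> sets borel"
      have "ell2_inner I (F B w) w = ell2_inner I (F B a) a + cnj c * ell2_inner I (F B a) b
          + c * ell2_inner I (F B b) a + (c * cnj c) * ell2_inner I (F B b) b"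
        unfolding w_def using a b cb w B
        by (simp add: w_def F_add_inner F_scale_inner ell2_inner_add_right ell2_inner_scale_right F_ell2
            ring_distribs mult_ac)
      also have "\<dots> = ell2_inner I (F B a) a + ell2_inner I (F B b) b"
        by (simp add: cross cross' B c)
      finally show "complex_of_real (\<integral>t. indicator B t \<partial>N w) =
          complex_of_real (\<integral>t. indicator B t \<partial>N a) + complex_of_real (\<integral>t. indicator B t \<partial>N b)"
        using B w a b by (simp add: measure_N)
    qed
    then have "ell2_inner I (T w) w = ell2_inner I (T a) a + ell2_inner I (T b) b"
      by (simp add: T_inner w a b)
    moreover have "ell2_inner I (T w) w = ell2_inner I (T a) a + cnj c * ell2_inner I (T a) b
          + c * ell2_inner I (T b) a + (c * cnj c) * ell2_inner I (T b) b"
    proof -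
      have "T w = (\<lambda>i. T a i + c * T b i)" unfolding w_def using a b cb by (simp add: T_add T_scale)
      then show ?thesis
        unfolding w_def using a b cb w
        by (simp add: w_def ell2_inner_add_left ell2_inner_scale_left ell2_inner_add_right
            ell2_inner_scale_right T_ell2 ell2_scale ring_distribs mult_ac)
    qed
    ultimately show ?thesis by (simp add: c)
  qed
  have "ell2_inner I (T a) b + ell2_inner I (T b) a = 0" using key[of 1] by simp
  moreover have "ell2_inner I (T b) a = ell2_inner I (T a) b"
    using key[of \<i>] by simp
  ultimately show ?thesis by (simp add: a_def b_def)
qed

lemma T_F_inner:
  assumes x: "x \<in> ell2 I" and y: "y \<in> ell2 I" and C: "C \<in> sets borel"
  shows "ell2_inner I (T (F C x)) y = ell2_inner I (T (F C x)) (F C y)"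
proof -
  have C': "- C \<in> sets borel" using C by simp
  have TCx: "T (F C x) \<in> ell2 I" using x C by (simp add: T_ell2 F_ell2)
  have "ell2_inner I (T (F C x)) y =
      ell2_inner I (F C (T (F C x))) y + ell2_inner I (F (- C) (T (F C x))) y"
    by (rule F_compl_inner[OF TCx y C, symmetric])
  also have "ell2_inner I (F (- C) (T (F C x))) y = 0"
    using T_F_disjoint[OF x y C C'] F_sym[OF TCx y C'] by simp
  finally show ?thesis using F_sym[OF TCx y C] by simp
qed

text \<open>By \<open>T_F_disjoint\<close> the operator maps the range of \<open>F C\<close> into
  itself; the symmetry of \<open>T\<close> and of \<open>F C\<close> turns this invariance into
  commutation.\<close>

lemma T_F_commute:
  assumes x: "x \<in> ell2 I" and C: "C \<in> sets borel"
  shows "T (F C x) = F C (T x)"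
proof (rule ell2_ext)
  show "T (F C x) \<in> ell2 I" "F C (T x) \<in> ell2 I" using x C by (auto intro: T_ell2 F_ell2)
  fix y assume y: "y \<in> ell2 I"
  have Cx: "F C x \<in> ell2 I" and Cy: "F C y \<in> ell2 I" using x y C by (auto intro: F_ell2)
  have "ell2_inner I (F C (T x)) y = ell2_inner I x (T (F C y))"
    using F_sym[OF T_ell2[OF x] y C] T_sym[OF x Cy] by simp
  also have "\<dots> = cnj (ell2_inner I (T (F C y)) x)" by (rule ell2_inner_commute)
  also have "\<dots> = cnj (ell2_inner I (T (F C y)) (F C x))" using T_F_inner[OF y x C] by simp
  also have "\<dots> = ell2_inner I (F C x) (T (F C y))" by (rule ell2_inner_commute[symmetric])
  also have "\<dots> = ell2_inner I (T (F C x)) (F C y)" using T_sym[OF Cx Cy] by simp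
  also have "\<dots> = ell2_inner I (T (F C x)) y" using T_F_inner[OF x y C] by simp
  finally show "ell2_inner I (T (F C x)) y = ell2_inner I (F C (T x)) y" by simp
qed

lemma F_T_inner:
  assumes x: "x \<in> ell2 I" and C: "C \<in> sets borel"
  shows "ell2_inner I (F C (T x)) x = complex_of_real (\<integral>t. indicator C t * t \<partial>N x)"
  using T_F_inner[OF x x C] T_inner_F[OF x C] T_F_commute[OF x C] by simp

text \<open>The density \<open>t\<^sup>2\<close> is reached in two steps, because the formula for
  \<open>T\<close> supplies one factor \<open>t\<close> at a time. The vectors \<open>p\<close> and
  \<open>m\<close> isolate the cross term of \<open>x\<close> and \<open>T x\<close>, which yields
  the measure of \<open>x\<close> with density \<open>t\<close>. Then \<open>pm\<close> is applied
  to a function that carries a second factor \<open>t\<close>.\<close>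

lemma integral_N_T:
  assumes x: "x \<in> ell2 I" and f: "bdd_on S f"
  shows "(\<integral>t. f t \<partial>N (T x)) = (\<integral>t. t\<^sup>2 * f t \<partial>N x)"
proof -
  note Tx = T_ell2[OF x]
  define p where "p = (\<lambda>i. x i + T x i)"
  define m where "m = (\<lambda>i. x i - T x i)"
  have p: "p \<in> ell2 I" and m: "m \<in> ell2 I"
    unfolding p_def m_def using x Tx by (auto intro: ell2_add ell2_diff)
  have diff_inner: "ell2_inner I (F B (\<lambda>i. u i - v i)) z = ell2_inner I (F B u) z - ell2_inner I (F B v) z"
    if "u \<in> ell2 I" "v \<in> ell2 I" "z \<in> ell2 I" "B \<in> sets borel" for u v z B
    using that by (simp add: F_sym ell2_diff ell2_inner_diff_left F_ell2)
  have pm: "complex_of_real (\<integral>t. f t \<partial>N p) - complex_of_real (\<integral>t. f t \<partial>N m) =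
      4 * complex_of_real (\<integral>t. t * f t \<partial>N x)" if f: "bdd_on S f" for f
  proof (rule signed_functional_eqI_indicator[where
        \<Lambda> = "\<lambda>f. complex_of_real (\<integral>t. f t \<partial>N p) - complex_of_real (\<integral>t. f t \<partial>N m)" and
        \<Lambda>' = "\<lambda>f. 4 * complex_of_real (\<integral>t. t * f t \<partial>N x)",
        OF signed_diff[OF signed_N[OF p] signed_N[OF m]]
          signed_scale[OF signed_mult[OF signed_N[OF x] bdd_on_id]] f])
    fix B :: "real set" assume B: "B \<in> sets borel"
    have "ell2_inner I (F B p) p - ell2_inner I (F B m) m =
        2 * ell2_inner I (F B (T x)) x + 2 * ell2_inner I (F B x) (T x)"
      using x Tx p m B unfolding p_def m_def
      by (simp add: F_add_inner diff_inner ell2_inner_add_right ell2_inner_diff_right F_ell2 ell2_add ell2_diff)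
    also have "ell2_inner I (F B x) (T x) = cnj (ell2_inner I (F B (T x)) x)"
      using F_sym[OF x Tx B] ell2_inner_commute[of I x "F B (T x)"] by simp
    finally have "ell2_inner I (F B p) p - ell2_inner I (F B m) m =
        4 * complex_of_real (\<integral>t. t * indicator B t \<partial>N x)"
      by (simp add: F_T_inner[OF x B] mult.commute)
    then show "complex_of_real (\<integral>t. indicator B t \<partial>N p) - complex_of_real (\<integral>t. indicator B t \<partial>N m) =
        4 * complex_of_real (\<integral>t. t * indicator B t \<partial>N x)"
      using B p m F_inner_self[OF p B] F_inner_self[OF m B] by (simp add: measure_N)
  qed
  have "complex_of_real (\<integral>t. f t \<partial>N (T x)) = complex_of_real (\<integral>t. t\<^sup>2 * f t \<partial>N x)"
  proof (rule signed_functional_eqI_indicator[where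
        \<Lambda> = "\<lambda>f. complex_of_real (\<integral>t. f t \<partial>N (T x))" and
        \<Lambda>' = "\<lambda>f. complex_of_real (\<integral>t. t\<^sup>2 * f t \<partial>N x)",
        OF signed_N[OF Tx] signed_mult[OF signed_N[OF x] bdd_on_power] f])
    fix B :: "real set" assume B: "B \<in> sets borel"
    let ?f = "\<lambda>t. indicator B t * t :: real"
    have f: "bdd_on S ?f" by (rule bdd_on_mult[OF bdd_on_indicator[OF B] bdd_on_id])
    note TTx = T_ell2[OF Tx]
    have Tp: "T p = (\<lambda>i. T x i + T (T x) i)" and Tm: "T m = (\<lambda>i. T x i - T (T x) i)"
      unfolding p_def m_def using x Tx by (simp_all add: T_add T_diff)
    have "4 * complex_of_real (\<integral>t. t * ?f t \<partial>N x) =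
        ell2_inner I (F B (T p)) p - ell2_inner I (F B (T m)) m"
      unfolding pm[OF f, symmetric] by (simp only: F_T_inner p m B)
    also have "\<dots> = 2 * ell2_inner I (F B (T x)) (T x) + 2 * ell2_inner I (F B (T (T x))) x"
      unfolding Tp Tm using x Tx TTx p m B
      by (simp add: p_def m_def F_add_inner diff_inner ell2_inner_add_right ell2_inner_diff_right
          F_ell2 ell2_add ell2_diff)
    also have "ell2_inner I (F B (T (T x))) x = ell2_inner I (F B (T x)) (T x)"
      using T_F_commute[OF Tx B] T_sym[OF F_ell2[OF Tx B] x] by simp
    finally have "ell2_inner I (F B (T x)) (T x) = complex_of_real (\<integral>t. t * ?f t \<partial>N x)" by simp
    then show "complex_of_real (\<integral>t. indicator B t \<partial>N (T x)) =
        complex_of_real (\<integral>t. t\<^sup>2 * indicator B t \<partial>N x)"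
      using B Tx by (simp add: measure_N power2_eq_square mult_ac)
  qed
  then show ?thesis by simp
qed

lemma integral_N_Tpow:
  assumes x: "x \<in> ell2 I" and f: "bdd_on S f"
  shows "(\<integral>t. f t \<partial>N ((T ^^ j) x)) = (\<integral>t. t ^ (2 * j) * f t \<partial>N x)"
  using f
proof (induction j arbitrary: f)
  case (Suc j)
  have "(\<integral>t. f t \<partial>N ((T ^^ Suc j) x)) = (\<integral>t. t\<^sup>2 * f t \<partial>N ((T ^^ j) x))"
    using integral_N_T[OF Tpow_ell2[OF x] Suc.prems] by simp
  also have "\<dots> = (\<integral>t. t ^ (2 * j) * (t\<^sup>2 * f t) \<partial>N x)"
    by (rule Suc.IH[OF bdd_on_mult[OF bdd_on_power Suc.prems]])
  finally show ?case by (simp add: power_add mult_ac power2_eq_square)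
qed simp

text \<open>Half of the powers are moved to the other argument. This leaves the total mass of the
  measure of \<open>(T ^^ i) x\<close> for even \<open>j\<close> and its first moment for odd
  \<open>j\<close>, and \<open>integral_N_Tpow\<close> expresses both by the measure of
  \<open>x\<close>.\<close>

theorem N_moment:
  assumes x: "x \<in> ell2 I"
  shows "(\<integral>t. t ^ j \<partial>N x) = Re (ell2_inner I ((T ^^ j) x) x)"
proof (cases "even j")
  case True
  then obtain i where j: "j = 2 * i" by blast
  note Ti = Tpow_ell2[OF x, of i]
  have "(T ^^ j) x = (T ^^ i) ((T ^^ i) x)"
    by (simp add: j mult_2 funpow_add)
  then have "ell2_inner I ((T ^^ j) x) x = ell2_inner I ((T ^^ i) x) ((T ^^ i) x)"
    by (simp add: Tpow_sym[OF Ti x])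
  also have "\<dots> = complex_of_real (\<integral>t. indicator UNIV t \<partial>N ((T ^^ i) x))"
    using Ti by (simp add: measure_N F_UNIV ell2_inner_same)
  also have "\<dots> = complex_of_real (\<integral>t. t ^ j * indicator UNIV t \<partial>N x)"
    by (subst integral_N_Tpow[OF x bdd_on_indicator]) (simp_all add: j)
  finally show ?thesis by simp
next
  case False
  then obtain i where j: "j = Suc (2 * i)" by (metis oddE Suc_eq_plus1)
  note Ti = Tpow_ell2[OF x, of i]
  have "(T ^^ j) x = (T ^^ i) (T ((T ^^ i) x))"
    by (simp add: j mult_2 funpow_add funpow_swap1)
  then have "ell2_inner I ((T ^^ j) x) x = ell2_inner I (T ((T ^^ i) x)) ((T ^^ i) x)"
    by (simp add: Tpow_sym[OF T_ell2[OF Ti] x])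
  also have "\<dots> = complex_of_real (\<integral>t. t \<partial>N ((T ^^ i) x))"
    by (rule T_inner[OF Ti])
  also have "\<dots> = complex_of_real (\<integral>t. t ^ (2 * i) * t \<partial>N x)"
    by (subst integral_N_Tpow[OF x bdd_on_id]) simp
  finally show ?thesis by (simp add: j mult.commute)
qed

end

section \<open>Traces and eigenvalues of Gram matrices\<close>

definition mtrace :: "'a::comm_monoid_add mat \<Rightarrow> 'a" where
  "mtrace A = (\<Sum>i<dim_row A. A $$ (i, i))"

lemma mat_mult_entry:
  assumes "A \<in> carrier_mat n k" "B \<in> carrier_mat k l" "i < n" "j < l"
  shows "(A * B) $$ (i, j) = (\<Sum>h<k. A $$ (i, h) * B $$ (h, j))"
  using assms by (simp add: scalar_prod_def atLeast0LessThan)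

lemma mtrace_mult_commute:
  fixes A B :: "'a::comm_semiring_0 mat"
  assumes A: "A \<in> carrier_mat n k" and B: "B \<in> carrier_mat k n"
  shows "mtrace (A * B) = mtrace (B * A)"
proof -
  have "mtrace (A * B) = (\<Sum>i<n. \<Sum>h<k. A $$ (i, h) * B $$ (h, i))"
    using A by (auto simp: mtrace_def mat_mult_entry[OF A B] simp del: index_mult_mat(1) intro!: sum.cong)
  also have "\<dots> = (\<Sum>h<k. \<Sum>i<n. B $$ (h, i) * A $$ (i, h))"
    by (subst sum.swap) (simp add: mult.commute)
  also have "\<dots> = mtrace (B * A)"
    using B by (auto simp: mtrace_def mat_mult_entry[OF B A] simp del: index_mult_mat(1) intro!: sum.cong)
  finally show ?thesis .
qed

lemma upper_triangular_mult_entry: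
  fixes A B :: "'a::comm_semiring_0 mat"
  assumes A: "A \<in> carrier_mat n n" "upper_triangular A" and B: "B \<in> carrier_mat n n" "upper_triangular B"
    and ij: "i < n" "j \<le> i"
  shows "(A * B) $$ (i, j) = (if i = j then A $$ (i, i) * B $$ (i, i) else 0)"
proof -
  have "(A * B) $$ (i, j) = (\<Sum>h<n. A $$ (i, h) * B $$ (h, j))"
    using ij by (intro mat_mult_entry[OF A(1) B(1)]) auto
  also have "\<dots> = (\<Sum>h<n. if h = i then A $$ (i, i) * B $$ (i, j) else 0)"
  proof (rule sum.cong[OF refl])
    fix h assume h: "h \<in> {..<n}"
    show "A $$ (i, h) * B $$ (h, j) = (if h = i then A $$ (i, i) * B $$ (i, j) else 0)"
    proof (cases h i rule: linorder_cases)
      case less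
      then have "A $$ (i, h) = 0" using A ij by (intro upper_triangularD) auto
      then show ?thesis using less by simp
    next
      case greater
      then have "B $$ (h, j) = 0" using B ij h by (intro upper_triangularD) auto
      then show ?thesis using greater by simp
    qed simp
  qed
  also have "\<dots> = A $$ (i, i) * B $$ (i, j)" using ij by simp
  also have "\<dots> = (if i = j then A $$ (i, i) * B $$ (i, i) else 0)"
  proof (cases "i = j")
    case False
    then have "B $$ (i, j) = 0" using B ij by (intro upper_triangularD) auto
    then show ?thesis using False by simp
  qed simp
  finally show ?thesis .
qed

lemma upper_triangular_pow:
  fixes A :: "'a::comm_semiring_1 mat"
  assumes A: "A \<in> carrier_mat n n" "upper_triangular A"
  shows "upper_triangular (A ^\<^sub>m k) \<and> (\<forall>i<n. (A ^\<^sub>m k) $$ (i, i) = (A $$ (i, i)) ^ k)"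
proof (induction k)
  case (Suc k)
  have C: "A ^\<^sub>m k \<in> carrier_mat n n" using A by simp
  have entry: "(A ^\<^sub>m Suc k) $$ (i, j) = (if i = j then (A ^\<^sub>m k) $$ (i, i) * A $$ (i, i) else 0)"
    if "i < n" "j \<le> i" for i j
    using upper_triangular_mult_entry[OF C _ A that] Suc by simp
  have "upper_triangular (A ^\<^sub>m Suc k)"
    unfolding upper_triangular_def using entry A(1) by auto
  then show ?case using entry Suc by (simp add: mult.commute)
qed (use A in simp)

text \<open>Schur triangularization: the trace is invariant under similarity, and the diagonal of a
  power of a triangular matrix consists of the powers of its diagonal.\<close>

lemma mtrace_pow:
  fixes A :: "complex mat"
  assumes A: "A \<in> carrier_mat n n" and c: "char_poly A = (\<Prod>e\<leftarrow>as. [:- e, 1:])"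
  shows "mtrace (A ^\<^sub>m k) = (\<Sum>e\<leftarrow>as. e ^ k)"
proof -
  obtain B P Q where "schur_decomposition A as = (B, P, Q)"
    by (cases "schur_decomposition A as") auto
  from schur_decomposition[OF A c this] have wit: "similar_mat_wit A B P Q"
    and ut: "upper_triangular B" and diag: "diag_mat B = as" by auto
  note W = similar_mat_witD2[OF A wit]
  have Bk: "B ^\<^sub>m k \<in> carrier_mat n n" using W by simp
  have "mtrace (A ^\<^sub>m k) = mtrace (P * (B ^\<^sub>m k * Q))"
    unfolding similar_mat_wit_pow_id[OF wit] using assoc_mult_mat[OF W(6) Bk W(7)] by simp
  also have "\<dots> = mtrace ((B ^\<^sub>m k * Q) * P)"
    using W Bk by (intro mtrace_mult_commute) auto
  also have "(B ^\<^sub>m k * Q) * P = B ^\<^sub>m k * (Q * P)"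
    using W Bk by (intro assoc_mult_mat) auto
  also have "\<dots> = B ^\<^sub>m k" using W Bk by simp
  also have "mtrace (B ^\<^sub>m k) = (\<Sum>i<n. (B $$ (i, i)) ^ k)"
    using upper_triangular_pow[OF W(5) ut, of k] Bk by (auto simp: mtrace_def intro!: sum.cong)
  also have "\<dots> = (\<Sum>e\<leftarrow>as. e ^ k)"
    unfolding diag[symmetric] diag_mat_def using W(5)
    by (simp add: sum_list_sum_nth atLeast0LessThan o_def)
  finally show ?thesis .
qed

section \<open>Eigenvalues of Hermitian and Gram matrices\<close>

lemma mat_vec_entry:
  assumes "A \<in> carrier_mat n k" "v \<in> carrier_vec k" "i < n"
  shows "(A *\<^sub>v v) $ i = (\<Sum>j<k. A $$ (i, j) * v $ j)"
  using assms by (simp add: scalar_prod_def atLeast0LessThan)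

lemma mat_adjoint_entry:
  assumes "M \<in> carrier_mat n k" "i < k" "j < n"
  shows "mat_adjoint M $$ (i, j) = cnj (M $$ (j, i))"
  using assms by (simp add: mat_adjoint_def mat_of_rows_def)

lemma mat_adjoint_carrier: "M \<in> carrier_mat n k \<Longrightarrow> mat_adjoint M \<in> carrier_mat k n"
  by (auto simp: mat_adjoint_def)

lemma hermitian_scalar_prod:
  assumes H: "H \<in> carrier_mat n n" and herm: "\<And>i j. i < n \<Longrightarrow> j < n \<Longrightarrow> H $$ (i, j) = cnj (H $$ (j, i))"
    and v: "v \<in> carrier_vec n" and w: "w \<in> carrier_vec n"
  shows "(H *\<^sub>v v) \<bullet>c w = v \<bullet>c (H *\<^sub>v w)"
proof -
  have "(H *\<^sub>v v) \<bullet>c w = (\<Sum>i<n. \<Sum>j<n. H $$ (i, j) * v $ j * cnj (w $ i))"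
    using H v w by (simp add: scalar_prod_def atLeast0LessThan sum_distrib_right)
  also have "\<dots> = (\<Sum>j<n. \<Sum>i<n. v $ j * (cnj (H $$ (j, i)) * cnj (w $ i)))"
  proof (subst sum.swap, intro sum.cong refl)
    fix i j assume "i \<in> {..<n}" "j \<in> {..<n}"
    then show "H $$ (i, j) * v $ j * cnj (w $ i) = v $ j * (cnj (H $$ (j, i)) * cnj (w $ i))"
      using herm[of i j] by simp
  qed
  also have "\<dots> = v \<bullet>c (H *\<^sub>v w)"
    using H v w by (simp add: scalar_prod_def atLeast0LessThan sum_distrib_left)
  finally show ?thesis .
qed

lemma gram_entry:
  assumes M: "M \<in> carrier_mat n k" and ij: "i < n" "j < n"
  shows "(M * mat_adjoint M) $$ (i, j) = (\<Sum>l<k. M $$ (i, l) * cnj (M $$ (j, l)))"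
  using mat_mult_entry[OF M mat_adjoint_carrier[OF M] ij] ij by (simp add: mat_adjoint_entry[OF M])

lemma gram_hermitian:
  assumes M: "M \<in> carrier_mat n k" and ij: "i < n" "j < n"
  shows "(M * mat_adjoint M) $$ (i, j) = cnj ((M * mat_adjoint M) $$ (j, i))"
  using ij by (simp only: gram_entry[OF M]) (simp add: mult.commute)

lemma gram_eigenvalue_nonneg:
  assumes M: "M \<in> carrier_mat n k" and ev: "eigenvalue (M * mat_adjoint M) a"
  shows "\<exists>e\<ge>0. a = complex_of_real e"
proof -
  let ?B = "M * mat_adjoint M"
  have B: "?B \<in> carrier_mat n n" using M mat_adjoint_carrier[OF M] by simp
  obtain v where v: "v \<in> carrier_vec n" "v \<noteq> 0\<^sub>v n" and eq: "?B *\<^sub>v v = a \<cdot>\<^sub>v v"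
    using ev B unfolding eigenvalue_def eigenvector_def by auto
  define s where "s = (\<Sum>i<n. (cmod (v $ i))\<^sup>2)"
  have "(?B *\<^sub>v v) \<bullet>c v = a * of_real s"
    unfolding eq using v
    by (simp add: scalar_prod_def atLeast0LessThan s_def sum_distrib_left mult.assoc flip: complex_norm_square)
  moreover have "(?B *\<^sub>v v) \<bullet>c v = of_real (\<Sum>l<k. (cmod (\<Sum>i<n. M $$ (i, l) * cnj (v $ i)))\<^sup>2)"
  proof -
    have "(?B *\<^sub>v v) \<bullet>c v = (\<Sum>i<n. (\<Sum>j<n. (\<Sum>l<k. M $$ (i, l) * cnj (M $$ (j, l))) * v $ j) * cnj (v $ i))"
    proof -
      have "(?B *\<^sub>v v) $ i = (\<Sum>j<n. (\<Sum>l<k. M $$ (i, l) * cnj (M $$ (j, l))) * v $ j)" if i: "i < n" for i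
        unfolding mat_vec_entry[OF B v(1) i] by (intro sum.cong refl) (use i in \<open>simp only: gram_entry[OF M] lessThan_iff\<close>)
      moreover have "(?B *\<^sub>v v) \<bullet>c v = (\<Sum>i<n. (?B *\<^sub>v v) $ i * cnj (v $ i))"
        using v by (simp add: scalar_prod_def atLeast0LessThan del: index_mult_mat_vec)
      ultimately show ?thesis by simp
    qed
    also have "\<dots> = (\<Sum>i<n. \<Sum>j<n. \<Sum>l<k. (M $$ (i, l) * cnj (v $ i)) * (cnj (M $$ (j, l)) * v $ j))"
      by (simp add: sum_distrib_left sum_distrib_right mult_ac)
    also have "\<dots> = (\<Sum>l<k. \<Sum>i<n. \<Sum>j<n. (M $$ (i, l) * cnj (v $ i)) * (cnj (M $$ (j, l)) * v $ j))"
      by (subst (2) sum.swap, subst sum.swap, rule refl)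
    also have "\<dots> = (\<Sum>l<k. (\<Sum>i<n. M $$ (i, l) * cnj (v $ i)) * cnj (\<Sum>i<n. M $$ (i, l) * cnj (v $ i)))"
      by (simp only: sum_product cnj_sum complex_cnj_mult complex_cnj_cnj)
    also have "\<dots> = (\<Sum>l<k. complex_of_real ((cmod (\<Sum>i<n. M $$ (i, l) * cnj (v $ i)))\<^sup>2))"
      by (simp only: complex_norm_square)
    finally show ?thesis by (simp only: of_real_sum)
  qed
  ultimately have eq: "a * of_real s = of_real (\<Sum>l<k. (cmod (\<Sum>i<n. M $$ (i, l) * cnj (v $ i)))\<^sup>2)" (is "_ = of_real ?t")
    by simp
  have "s > 0"
  proof -
    obtain i where "i < n" "v $ i \<noteq> 0" using v by (metis carrier_vecD eq_vecI index_zero_vec)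
    then show ?thesis unfolding s_def by (intro sum_pos2[of _ i]) auto
  qed
  then have "a = of_real (?t / s)" using eq by (simp add: field_simps)
  moreover have "?t / s \<ge> 0" using \<open>s > 0\<close> by (intro divide_nonneg_pos sum_nonneg) auto
  ultimately show ?thesis by blast
qed

text \<open>If \<open>H\<close> annihilates \<open>H u\<close>, then the square norm of
  \<open>H u\<close> is 0 by symmetry, so the kernels of the powers do not grow. This excludes
  nontrivial Jordan blocks.\<close>

lemma kernel_dim_hermitian_pow:
  assumes H: "H \<in> carrier_mat n n" and herm: "\<And>i j. i < n \<Longrightarrow> j < n \<Longrightarrow> H $$ (i, j) = cnj (H $$ (j, i))"
  shows "kernel_dim (H ^\<^sub>m Suc k) = kernel_dim H"
proof -
  have ker: "mat_kernel (H ^\<^sub>m Suc k) = mat_kernel H" for k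
  proof (induction k)
    case 0 show ?case using H by simp
  next
    case (Suc k)
    have Hp: "H ^\<^sub>m k \<in> carrier_mat n n" for k by (rule pow_carrier_mat[OF H])
    have comm: "H ^\<^sub>m Suc k = H * H ^\<^sub>m k" for k
    proof (induction k)
      case (Suc k)
      have "H ^\<^sub>m Suc (Suc k) = (H * H ^\<^sub>m k) * H" by (simp only: pow_mat.simps(2)[of H "Suc k"] Suc)
      also have "\<dots> = H * H ^\<^sub>m Suc k" using assoc_mult_mat[OF H Hp H] by simp
      finally show ?case .
    qed (use H in simp)
    have app: "H ^\<^sub>m Suc k *\<^sub>v v = H *\<^sub>v (H ^\<^sub>m k *\<^sub>v v)" if "v \<in> carrier_vec n" for k v
      unfolding comm by (rule assoc_mult_mat_vec[OF H Hp that])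
    have "mat_kernel (H ^\<^sub>m Suc (Suc k)) = mat_kernel (H ^\<^sub>m Suc k)"
    proof (intro equalityI subsetI)
      fix v assume "v \<in> mat_kernel (H ^\<^sub>m Suc (Suc k))"
      note D = mat_kernelD[OF Hp this]
      define u where "u = H ^\<^sub>m k *\<^sub>v v"
      have u: "u \<in> carrier_vec n" unfolding u_def by (rule mult_mat_vec_carrier[OF Hp D(1)])
      have Hu: "H *\<^sub>v u \<in> carrier_vec n" by (rule mult_mat_vec_carrier[OF H u])
      have "H *\<^sub>v (H *\<^sub>v u) = 0\<^sub>v n"
        using D(2) unfolding app[OF D(1)] u_def .
      then have "(H *\<^sub>v u) \<bullet>c (H *\<^sub>v u) = 0"
        using hermitian_scalar_prod[OF H herm u Hu] u by simp
      then have "H *\<^sub>v u = 0\<^sub>v n"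
        using Hu conjugate_square_eq_0_vec[of "H *\<^sub>v u" n] by simp
      then have "H ^\<^sub>m Suc k *\<^sub>v v = 0\<^sub>v n"
        unfolding app[OF D(1)] u_def .
      then show "v \<in> mat_kernel (H ^\<^sub>m Suc k)" by (rule mat_kernelI[OF Hp D(1)])
    next
      fix v assume "v \<in> mat_kernel (H ^\<^sub>m Suc k)"
      note D = mat_kernelD[OF Hp this]
      have "H ^\<^sub>m Suc (Suc k) *\<^sub>v v = H *\<^sub>v 0\<^sub>v n"
        unfolding app[OF D(1), of "Suc k"] D(2) ..
      also have "H *\<^sub>v 0\<^sub>v n = 0\<^sub>v n" using H by (intro eq_vecI) auto
      finally show "v \<in> mat_kernel (H ^\<^sub>m Suc (Suc k))" by (rule mat_kernelI[OF Hp D(1)])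
    qed
    then show ?case using Suc by simp
  qed
  have "dim_col (H ^\<^sub>m Suc k) = dim_col H" using H by simp
  then show ?thesis unfolding kernel_dim_def ker[of k] by simp
qed

lemma order_prod_list_linear:
  "Polynomial.order x (\<Prod>e\<leftarrow>es. [:- e, 1:]) = count_list es (x :: 'a::idom)"
proof (induction es)
  case (Cons e es)
  have nz: "(\<Prod>e\<leftarrow>es. [:- e, 1:]) \<noteq> 0" by (auto simp: prod_list_zero_iff)
  have "Polynomial.order x ([:- e, 1:] * (\<Prod>e\<leftarrow>es. [:- e, 1:])) = Polynomial.order x [:- e, 1:] + Polynomial.order x (\<Prod>e\<leftarrow>es. [:- e, 1:])"
    by (rule order_mult) (simp only: mult_eq_0_iff nz pCons_eq_0_iff one_neq_zero simp_thms)
  moreover have "Polynomial.order x [:- e, 1:] = (if e = x then 1 else 0)"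
    using order_power_n_n[of x 1] by (auto simp: order_root intro: order_0I)
  ultimately show ?case using Cons by simp
qed simp

lemma kernel_dim_hermitian:
  assumes H: "H \<in> carrier_mat n n" and herm: "\<And>i j. i < n \<Longrightarrow> j < n \<Longrightarrow> H $$ (i, j) = cnj (H $$ (j, i))"
    and c: "char_poly H = (\<Prod>e\<leftarrow>as. [:- e, 1:])" and x: "cnj x = x"
  shows "kernel_dim (H - x \<cdot>\<^sub>m 1\<^sub>m n) = count_list as x"
proof -
  let ?C = "char_matrix H x"
  have eq: "?C = H - x \<cdot>\<^sub>m 1\<^sub>m n"
    using H by (intro eq_matI) (auto simp: char_matrix_def)
  have C: "?C \<in> carrier_mat n n" using H by simp
  have Cherm: "?C $$ (i, j) = cnj (?C $$ (j, i))" if "i < n" "j < n" for i j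
    using that H herm[OF that] x by (auto simp: char_matrix_def)
  obtain n_as where jnf: "jordan_nf H n_as" using jordan_nf_exists[OF H c] by blast
  define l where "l = map fst [(n, e)\<leftarrow>n_as. e = x]"
  \<comment> \<open>The exponent \<open>Suc k\<close> exceeds the size of every Jordan block of
    \<open>x\<close>, so the generalized eigenspace is exhausted and its dimension is the algebraic
    multiplicity.\<close>
  define k where "k = sum_list l"
  have "min (Suc k) b = b" if "b \<in> set l" for b
    using member_le_sum_list[OF that] by (simp add: k_def)
  then have "(\<Sum>b\<leftarrow>l. min (Suc k) b) = sum_list l"
    by (metis map_idI)
  then have "dim_gen_eigenspace H x (Suc k) = sum_list l"
    unfolding dim_gen_eigenspace[OF jnf] l_def by simp
  also have "\<dots> = Polynomial.order x (char_poly H)"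
    unfolding jordan_nf_order[OF jnf] l_def by (simp add: case_prod_unfold)
  finally have "kernel_dim (?C ^\<^sub>m Suc k) = Polynomial.order x (char_poly H)"
    unfolding dim_gen_eigenspace_def .
  then show ?thesis
    using kernel_dim_hermitian_pow[OF C Cherm, of k] by (simp add: eq c order_prod_list_linear)
qed

lemma of_real_sum_list: "of_real (\<Sum>e\<leftarrow>es. f e) = (\<Sum>e\<leftarrow>es. of_real (f e))"
  by (induction es) simp_all

theorem gram_eigenvalues:
  assumes M: "M \<in> carrier_mat n k"
  obtains es where "length es = n" "\<forall>e\<in>set es. 0 \<le> e"
    "char_poly (M * mat_adjoint M) = (\<Prod>e\<leftarrow>es. [:- complex_of_real e, 1:])"
    "\<forall>j. mtrace ((M * mat_adjoint M) ^\<^sub>m j) = complex_of_real (\<Sum>e\<leftarrow>es. e ^ j)"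
    "\<forall>x. kernel_dim (M * mat_adjoint M - complex_of_real x \<cdot>\<^sub>m 1\<^sub>m n) = count_list es x"
    "\<forall>x. eigenvalue (M * mat_adjoint M) (complex_of_real x) \<longleftrightarrow> x \<in> set es"
proof -
  let ?B = "M * mat_adjoint M"
  have B: "?B \<in> carrier_mat n n" using M mat_adjoint_carrier[OF M] by simp
  obtain as where as: "char_poly ?B = (\<Prod>a\<leftarrow>as. [:- a, 1:])" "length as = n"
    using char_poly_factorized[OF B] by blast
  have root: "eigenvalue ?B a \<longleftrightarrow> a \<in> set as" for a
    unfolding eigenvalue_root_char_poly[OF B] as(1) poly_prod_list by (auto simp: prod_list_zero_iff)
  define es where "es = map Re as"
  have as_es: "as = map complex_of_real es"
  proof -
    have "complex_of_real (Re a) = a" if "a \<in> set as" for a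
      using gram_eigenvalue_nonneg[OF M, of a] root[of a] that by auto
    then show ?thesis unfolding es_def by (simp add: map_idI)
  qed
  have inj: "inj complex_of_real" by (simp add: inj_on_def)
  have count: "count_list as (complex_of_real x) = count_list es x" for x
    unfolding as_es by (induction es) auto
  show ?thesis
  proof (rule that[of es])
    show "length es = n" by (simp add: es_def as)
    show "\<forall>e\<in>set es. 0 \<le> e"
    proof
      fix e assume "e \<in> set es"
      then have "complex_of_real e \<in> set as" by (simp add: as_es)
      then show "0 \<le> e" using gram_eigenvalue_nonneg[OF M, of "complex_of_real e"] root by auto
    qed
    show "char_poly ?B = (\<Prod>e\<leftarrow>es. [:- complex_of_real e, 1:])"
      unfolding as(1) as_es by (simp add: o_def)
    show "\<forall>j. mtrace (?B ^\<^sub>m j) = complex_of_real (\<Sum>e\<leftarrow>es. e ^ j)"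
      unfolding mtrace_pow[OF B as(1)] as_es by (simp add: o_def of_real_sum_list)
    show "\<forall>x. kernel_dim (?B - complex_of_real x \<cdot>\<^sub>m 1\<^sub>m n) = count_list es x"
      using kernel_dim_hermitian[OF B gram_hermitian[OF M] as(1)] count by simp
    show "\<forall>x. eigenvalue ?B (complex_of_real x) \<longleftrightarrow> x \<in> set es"
      unfolding root as_es by auto
  qed
qed

text \<open>A polynomial that vanishes at all entries of both lists except \<open>x\<close> sums
  over each list to its value at \<open>x\<close> times the multiplicity of \<open>x\<close>. These
  sums are combinations of power sums.\<close>

lemma power_sums_determine_mset:
  fixes es fs :: "real list"
  assumes eq: "\<And>j. (\<Sum>e\<leftarrow>es. e ^ j) = (\<Sum>e\<leftarrow>fs. e ^ j)"
  shows "mset es = mset fs"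
proof (rule multiset_eqI)
  fix x
  define Y where "Y = (set es \<union> set fs) - {x}"
  define p where "p = (\<Prod>y\<in>Y. [:- y, 1:])"
  have p0: "poly p y = 0" if "y \<in> set es \<union> set fs" "y \<noteq> x" for y
    using that by (auto simp: p_def Y_def poly_prod prod_zero_iff)
  have px: "poly p x \<noteq> 0" by (auto simp: p_def Y_def poly_prod prod_zero_iff)
  have sum: "(\<Sum>e\<leftarrow>gs. poly p e) = (\<Sum>i\<le>Polynomial.degree p. Polynomial.coeff p i * (\<Sum>e\<leftarrow>gs. e ^ i))" for gs
    by (induction gs) (simp_all add: poly_altdef sum.distrib ring_distribs)
  have "(\<Sum>e\<leftarrow>gs. poly p e) = real (count_list gs x) * poly p x" if "set gs \<subseteq> set es \<union> set fs" for gs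
    using that by (induction gs) (auto simp: p0 ring_distribs)
  then have "real (count_list es x) * poly p x = real (count_list fs x) * poly p x"
    using sum[of es] sum[of fs] eq by simp
  then show "count (mset es) x = count (mset fs) x"
    using px by (simp add: count_mset)
qed

definition unit_root :: "nat \<Rightarrow> nat \<Rightarrow> complex" where
  "unit_root m k = cis (2 * pi * real k / real m)"

text \<open>The terms are the powers of \<open>w\<close>, an \<open>m\<close>-th root of unity that
  equals 1 exactly when \<open>m\<close> divides \<open>l\<close>; the rest is a geometric
  sum.\<close>

lemma sum_unit_root_powi:
  assumes m: "0 < m"
  shows "(\<Sum>k<m. unit_root m k powi l) = (if int m dvd l then of_nat m else 0)"
proof -
  define w where "w = unit_root m 1 powi l"
  have r: "unit_root m k = unit_root m 1 ^ k" for k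
    unfolding unit_root_def Complex.DeMoivre by (rule arg_cong[of _ _ cis]) simp
  have w: "unit_root m k powi l = w ^ k" for k
    unfolding w_def r[of k] by (simp add: power_int_power power_int_power' mult.commute)
  have wc: "w = cis (2 * pi * (real_of_int l / real m))"
    by (simp add: w_def unit_root_def cis_power_int mult_ac)
  show ?thesis
  proof (cases "int m dvd l")
    case True
    then obtain c where "l = int m * c" by (auto simp: dvd_def)
    then have "w = 1" using m unfolding wc by (simp add: cis_multiple_2pi)
    then show ?thesis using True by (simp add: w)
  next
    case False
    have "w \<noteq> 1"
    proof
      assume "w = 1"
      then have "cos (2 * pi * (real_of_int l / real m)) = 1" unfolding wc by (simp add: complex_eq_iff)
      then obtain n :: int where "2 * pi * (real_of_int l / real m) = real_of_int n * 2 * pi"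
        using cos_one_2pi_int by blast
      then have "real_of_int l = real_of_int (n * int m)" using m by (simp add: field_simps)
      then have "l = n * int m" by linarith
      with False show False by simp
    qed
    moreover have "w ^ m = 1"
      proof -
      have "w ^ m = cis (2 * pi * real_of_int l)"
        unfolding wc Complex.DeMoivre using m by (intro arg_cong[of _ _ cis]) simp
      then show ?thesis by (simp add: cis_multiple_2pi)
    qed
    ultimately show ?thesis using False geometric_sum[of w m] by (simp add: w)
  qed
qed

section \<open>Group ring matrices and unitary representations\<close>

text \<open>The linear extension of \<phi> to the group ring, evaluated at \<open>a\<close>.
  Convolutions, traces and matrix coefficients of representations are all of this form, so products
  and stars are treated once, in \<open>gsum_conv\<close> and \<open>gsum_gstar\<close>.\<close>

definition gsum :: "('a, 'b) monoid_scheme \<Rightarrow> ('a \<Rightarrow> complex) \<Rightarrow> ('a \<Rightarrow> complex) \<Rightarrow> complex" where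
  "gsum G a \<phi> = (\<Sum>g\<in>{g \<in> carrier G. a g \<noteq> 0}. a g * \<phi> g)"

lemma gsum_superset:
  assumes "finite F" "F \<subseteq> carrier G" "{g \<in> carrier G. a g \<noteq> 0} \<subseteq> F"
  shows "gsum G a \<phi> = (\<Sum>g\<in>F. a g * \<phi> g)"
  unfolding gsum_def by (rule sum.mono_neutral_left) (use assms in auto)

lemma gsum_scale: "gsum G a (\<lambda>g. c * \<phi> g) = c * gsum G a \<phi>"
  by (simp add: gsum_def sum_distrib_left mult_ac)

lemma gsum_add: "gsum G a (\<lambda>g. \<phi> g + \<psi> g) = gsum G a \<phi> + gsum G a \<psi>"
  by (simp add: gsum_def ring_distribs sum.distrib)

lemma gsum_sum: "gsum G a (\<lambda>g. \<Sum>k\<in>J. \<phi> k g) = (\<Sum>k\<in>J. gsum G a (\<phi> k))"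
  unfolding gsum_def sum_distrib_left by (rule sum.swap)

lemma gsum_cong: "(\<And>g. g \<in> carrier G \<Longrightarrow> \<phi> g = \<psi> g) \<Longrightarrow> gsum G a \<phi> = gsum G a \<psi>"
  unfolding gsum_def by (rule sum.cong) auto

lemma conv_gsum:
  "conv G x a g = (if g \<in> carrier G then gsum G a (\<lambda>h. x (g \<otimes>\<^bsub>G\<^esub> inv\<^bsub>G\<^esub> h)) else 0)"
  by (simp add: conv_def gsum_def mult.commute)

abbreviation "GR G \<equiv> group_ring UNIV G"

lemma GR_finite: "a \<in> GR G \<Longrightarrow> finite {g \<in> carrier G. a g \<noteq> 0}"
  by (auto simp: group_ring_def intro: finite_subset[of _ "{g. a g \<noteq> 0}"])

lemma GR_zero_outside: "a \<in> GR G \<Longrightarrow> g \<notin> carrier G \<Longrightarrow> a g = 0"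
  by (auto simp: group_ring_def)

lemma GR_I: "finite F \<Longrightarrow> F \<subseteq> carrier G \<Longrightarrow> (\<And>g. g \<notin> F \<Longrightarrow> a g = 0) \<Longrightarrow> a \<in> GR G"
  by (auto simp: group_ring_def intro: finite_subset[of _ F])

lemma GR_sum:
  assumes "\<And>j. j \<in> J \<Longrightarrow> a j \<in> GR G" "finite J"
  shows "(\<lambda>g. \<Sum>j\<in>J. a j g) \<in> GR G"
proof (rule GR_I[of "\<Union>j\<in>J. {g \<in> carrier G. a j g \<noteq> 0}"])
  show "finite (\<Union>j\<in>J. {g \<in> carrier G. a j g \<noteq> 0})" using assms GR_finite by auto
  show "(\<Sum>j\<in>J. a j g) = 0" if "g \<notin> (\<Union>j\<in>J. {g \<in> carrier G. a j g \<noteq> 0})" for g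
  proof (rule sum.neutral, rule ballI)
    fix j assume "j \<in> J"
    then show "a j g = 0" using that GR_zero_outside[OF assms(1), of j g] by blast
  qed
qed auto

lemma gsum_sum_left:
  assumes a: "\<And>j. j \<in> J \<Longrightarrow> a j \<in> GR G" and J: "finite J"
  shows "gsum G (\<lambda>g. \<Sum>j\<in>J. a j g) \<phi> = (\<Sum>j\<in>J. gsum G (a j) \<phi>)"
proof -
  let ?F = "\<Union>j\<in>J. {g \<in> carrier G. a j g \<noteq> 0}"
  have F: "finite ?F" "?F \<subseteq> carrier G" using a J GR_finite by auto
  have "gsum G (\<lambda>g. \<Sum>j\<in>J. a j g) \<phi> = (\<Sum>g\<in>?F. (\<Sum>j\<in>J. a j g) * \<phi> g)"
  proof (rule gsum_superset[OF F])
    show "{g \<in> carrier G. (\<Sum>j\<in>J. a j g) \<noteq> 0} \<subseteq> ?F"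
    proof
      fix g assume g: "g \<in> {g \<in> carrier G. (\<Sum>j\<in>J. a j g) \<noteq> 0}"
      then have "\<exists>j\<in>J. a j g \<noteq> 0" using sum.neutral[of J "\<lambda>j. a j g"] by blast
      then show "g \<in> ?F" using g by blast
    qed
  qed
  also have "\<dots> = (\<Sum>j\<in>J. \<Sum>g\<in>?F. a j g * \<phi> g)"
    unfolding sum_distrib_right by (rule sum.swap)
  also have "\<dots> = (\<Sum>j\<in>J. gsum G (a j) \<phi>)"
    by (intro sum.cong refl gsum_superset[symmetric] F) auto
  finally show ?thesis .
qed

section \<open>Convolution, involution and translation operators\<close>

context group
begin

lemma mult_inv_cancel: "x \<in> carrier G \<Longrightarrow> h \<in> carrier G \<Longrightarrow> x \<otimes> h \<otimes> inv h = x"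
  and inv_mult_cancel: "x \<in> carrier G \<Longrightarrow> h \<in> carrier G \<Longrightarrow> x \<otimes> inv h \<otimes> h = x"
  by (simp_all add: m_assoc)

lemma conv_GR:
  assumes a: "a \<in> GR G" and b: "b \<in> GR G"
  shows "conv G a b \<in> GR G"
    and gsum_conv: "gsum G (conv G a b) \<phi> = gsum G b (\<lambda>h. gsum G a (\<lambda>g. \<phi> (g \<otimes> h)))"
proof -
  let ?A = "{g \<in> carrier G. a g \<noteq> 0}" and ?B = "{g \<in> carrier G. b g \<noteq> 0}"
  let ?F = "(\<lambda>(g, h). g \<otimes> h) ` (?A \<times> ?B)"
  have fin: "finite ?A" "finite ?B" using a b by (auto intro: GR_finite)
  have F: "finite ?F" "?F \<subseteq> carrier G" using fin by auto
  have zero: "conv G a b g = 0" if "g \<notin> ?F" for g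
  proof (cases "g \<in> carrier G")
    case True
    have "a (g \<otimes> inv h) = 0" if h: "h \<in> ?B" for h
    proof (rule ccontr)
      assume "a (g \<otimes> inv h) \<noteq> 0"
      then have "(g \<otimes> inv h, h) \<in> ?A \<times> ?B" using True h by simp
      then have "g \<otimes> inv h \<otimes> h \<in> ?F" by (metis (mono_tags, lifting) image_eqI case_prod_conv)
      then show False using \<open>g \<notin> ?F\<close> True h by (simp add: inv_mult_cancel)
    qed
    then show ?thesis by (auto simp: conv_def intro!: sum.neutral)
  qed (simp add: conv_def)
  show "conv G a b \<in> GR G" by (rule GR_I[OF F zero])
  have "gsum G (conv G a b) \<phi> = (\<Sum>g\<in>?F. conv G a b g * \<phi> g)"
    by (rule gsum_superset[OF F]) (use zero in blast)
  also have "\<dots> = (\<Sum>g\<in>?F. \<Sum>h\<in>?B. b h * (a (g \<otimes> inv h) * \<phi> g))"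
  proof (rule sum.cong[OF refl])
    fix g assume "g \<in> ?F"
    then have gc: "g \<in> carrier G" using F(2) by blast
    show "conv G a b g * \<phi> g = (\<Sum>h\<in>?B. b h * (a (g \<otimes> inv h) * \<phi> g))"
      by (simp only: conv_def gc if_True sum_distrib_right) (simp add: mult_ac)
  qed
  also have "\<dots> = (\<Sum>h\<in>?B. b h * (\<Sum>g\<in>?F. a (g \<otimes> inv h) * \<phi> g))"
    unfolding sum_distrib_left by (rule sum.swap)
  also have "\<dots> = (\<Sum>h\<in>?B. b h * gsum G a (\<lambda>g. \<phi> (g \<otimes> h)))"
  proof (intro sum.cong refl arg_cong[of _ _ "\<lambda>z. _ * z"])
    fix h assume h: "h \<in> ?B"
    have inj: "inj_on (\<lambda>g. g \<otimes> h) ?A" using h by (auto simp: inj_on_def)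
    have "(\<Sum>g\<in>?F. a (g \<otimes> inv h) * \<phi> g) = (\<Sum>g\<in>(\<lambda>g. g \<otimes> h) ` ?A. a (g \<otimes> inv h) * \<phi> g)"
    proof (rule sum.mono_neutral_right[OF F(1)])
      show "(\<lambda>g. g \<otimes> h) ` ?A \<subseteq> ?F" using h by auto
      show "\<forall>g\<in>?F - (\<lambda>g. g \<otimes> h) ` ?A. a (g \<otimes> inv h) * \<phi> g = 0"
      proof
        fix g assume g: "g \<in> ?F - (\<lambda>g. g \<otimes> h) ` ?A"
        then have gc: "g \<in> carrier G" using F(2) by auto
        have "a (g \<otimes> inv h) = 0"
        proof (rule ccontr)
          assume "a (g \<otimes> inv h) \<noteq> 0"
          then have "g \<otimes> inv h \<in> ?A" using gc h by simp
          then have "g \<otimes> inv h \<otimes> h \<in> (\<lambda>g. g \<otimes> h) ` ?A" by (rule imageI)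
          then show False using g gc h by (simp add: inv_mult_cancel)
        qed
        then show "a (g \<otimes> inv h) * \<phi> g = 0" by simp
      qed
    qed
    also have "\<dots> = (\<Sum>g\<in>?A. a g * \<phi> (g \<otimes> h))"
      unfolding sum.reindex[OF inj] o_def
      by (intro sum.cong refl) (use h in \<open>auto simp: mult_inv_cancel\<close>)
    finally show "(\<Sum>g\<in>?F. a (g \<otimes> inv h) * \<phi> g) = gsum G a (\<lambda>g. \<phi> (g \<otimes> h))"
      by (simp add: gsum_def)
  qed
  finally show "gsum G (conv G a b) \<phi> = gsum G b (\<lambda>h. gsum G a (\<lambda>g. \<phi> (g \<otimes> h)))"
    by (simp add: gsum_def)
qed

text \<open>The left factor is any function on the group, since it will be square summable;
  \<open>a\<close> and \<open>b\<close> are finitely supported, so \<open>gsum_conv\<close> applies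
  to their product.\<close>

lemma conv_assoc:
  assumes a: "a \<in> GR G" and b: "b \<in> GR G"
  shows "conv G (conv G x a) b g = conv G x (conv G a b) g"
proof (cases "g \<in> carrier G")
  case True
  have "conv G x (conv G a b) g = gsum G b (\<lambda>h. gsum G a (\<lambda>k. x (g \<otimes> inv (k \<otimes> h))))"
    using True gsum_conv[OF a b] by (simp add: conv_gsum)
  also have "\<dots> = gsum G b (\<lambda>h. gsum G a (\<lambda>k. x (g \<otimes> inv h \<otimes> inv k)))"
    by (intro gsum_cong) (use True in \<open>simp add: inv_mult_group m_assoc\<close>)
  also have "\<dots> = gsum G b (\<lambda>h. conv G x a (g \<otimes> inv h))"
    by (rule gsum_cong) (use True in \<open>simp add: conv_gsum\<close>)
  finally show ?thesis using True by (simp add: conv_gsum[of G "conv G x a"])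
qed (simp add: conv_gsum)

abbreviation "GM \<equiv> group_ring_mats UNIV G"

lemma GM_entry: "A \<in> GM r s \<Longrightarrow> i < r \<Longrightarrow> j < s \<Longrightarrow> A $$ (i, j) \<in> GR G"
  and GM_dim: "A \<in> GM r s \<Longrightarrow> dim_row A = r" "A \<in> GM r s \<Longrightarrow> dim_col A = s"
  by (auto simp: group_ring_mats_def)

lemma gr_mult_GM: "A \<in> GM r s \<Longrightarrow> B \<in> GM s u \<Longrightarrow> gr_mult G A B \<in> GM r u"
  unfolding group_ring_mats_def gr_mult_def
  by (auto intro!: GR_sum conv_GR)

definition gstar :: "('a \<Rightarrow> complex) \<Rightarrow> 'a \<Rightarrow> complex" where
  "gstar a = (\<lambda>g. if g \<in> carrier G then cnj (a (inv g)) else 0)"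

lemma gstar_GR:
  assumes a: "a \<in> GR G"
  shows "gstar a \<in> GR G"
    and gsum_gstar: "gsum G (gstar a) \<phi> = cnj (gsum G a (\<lambda>g. cnj (\<phi> (inv g))))"
proof -
  let ?A = "{g \<in> carrier G. a g \<noteq> 0}"
  have fin: "finite ?A" using a by (rule GR_finite)
  have eq: "{g \<in> carrier G. gstar a g \<noteq> 0} = m_inv G ` ?A"
  proof
    show "{g \<in> carrier G. gstar a g \<noteq> 0} \<subseteq> m_inv G ` ?A"
    proof
      fix g assume "g \<in> {g \<in> carrier G. gstar a g \<noteq> 0}"
      then have "inv g \<in> ?A" "g = inv (inv g)" by (auto simp: gstar_def)
      then show "g \<in> m_inv G ` ?A" by blast
    qed
  qed (auto simp: gstar_def)
  show "gstar a \<in> GR G"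
    by (rule GR_I[of "m_inv G ` ?A"]) (use fin eq in \<open>auto simp: gstar_def\<close>)
  have "inj_on (m_inv G) ?A" by (rule inj_on_subset[OF inv_inj]) auto
  then have "gsum G (gstar a) \<phi> = (\<Sum>g\<in>?A. gstar a (inv g) * \<phi> (inv g))"
    unfolding gsum_def eq by (simp add: sum.reindex)
  also have "\<dots> = (\<Sum>g\<in>?A. cnj (a g) * \<phi> (inv g))"
    by (intro sum.cong refl) (auto simp: gstar_def)
  finally show "gsum G (gstar a) \<phi> = cnj (gsum G a (\<lambda>g. cnj (\<phi> (inv g))))"
    by (simp add: gsum_def)
qed

lemma gr_star_entry:
  assumes "A \<in> GM r s" "i < r" "j < s"
  shows "gr_star G A $$ (j, i) = gstar (A $$ (i, j))"
  using assms by (simp add: gr_star_def gstar_def GM_dim)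

lemma gr_star_GM: "A \<in> GM r s \<Longrightarrow> gr_star G A \<in> GM s r"
proof -
  assume A: "A \<in> GM r s"
  then have "gr_star G A \<in> carrier_mat s r" by (auto simp: gr_star_def GM_dim)
  then show ?thesis
    using gr_star_entry[OF A] gstar_GR(1)[OF GM_entry[OF A]] by (simp add: group_ring_mats_def)
qed

lemma right_mult_mult:
  assumes A: "A \<in> GM r s" and B: "B \<in> GM s u"
  shows "right_mult G (gr_mult G A B) x = right_mult G B (right_mult G A x)"
proof
  fix p :: "nat \<times> 'a"
  obtain k g where p: "p = (k, g)" by force
  show "right_mult G (gr_mult G A B) x p = right_mult G B (right_mult G A x) p"
  proof (cases "k < u \<and> g \<in> carrier G")
    case True
    then have k: "k < u" and g: "g \<in> carrier G" by auto
    have "right_mult G (gr_mult G A B) x p = (\<Sum>i<r. conv G (\<lambda>h. x (i, h)) (\<lambda>g. \<Sum>j<s. conv G (A $$ (i, j)) (B $$ (j, k)) g) g)"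
      using k A B by (simp add: right_mult_def p gr_mult_def GM_dim)
    also have "\<dots> = (\<Sum>i<r. \<Sum>j<s. conv G (conv G (\<lambda>h. x (i, h)) (A $$ (i, j))) (B $$ (j, k)) g)"
    proof (rule sum.cong[OF refl])
      fix i assume i: "i \<in> {..<r}"
      have "conv G (\<lambda>h. x (i, h)) (\<lambda>g. \<Sum>j<s. conv G (A $$ (i, j)) (B $$ (j, k)) g) g =
          (\<Sum>j<s. conv G (\<lambda>h. x (i, h)) (conv G (A $$ (i, j)) (B $$ (j, k))) g)"
        unfolding conv_gsum[of G "\<lambda>h. x (i, h)"] using g
        by (simp, intro gsum_sum_left conv_GR) (use i k GM_entry[OF A] GM_entry[OF B] in auto)
      also have "\<dots> = (\<Sum>j<s. conv G (conv G (\<lambda>h. x (i, h)) (A $$ (i, j))) (B $$ (j, k)) g)"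
        by (intro sum.cong refl conv_assoc[symmetric]) (use i k GM_entry[OF A] GM_entry[OF B] in auto)
      finally show "conv G (\<lambda>h. x (i, h)) (\<lambda>g. \<Sum>j<s. conv G (A $$ (i, j)) (B $$ (j, k)) g) g =
          (\<Sum>j<s. conv G (conv G (\<lambda>h. x (i, h)) (A $$ (i, j))) (B $$ (j, k)) g)" .
    qed
    also have "\<dots> = (\<Sum>j<s. \<Sum>i<r. conv G (conv G (\<lambda>h. x (i, h)) (A $$ (i, j))) (B $$ (j, k)) g)"
      by (rule sum.swap)
    also have "\<dots> = (\<Sum>j<s. conv G (\<lambda>g. \<Sum>i<r. conv G (\<lambda>h. x (i, h)) (A $$ (i, j)) g) (B $$ (j, k)) g)"
      using g by (intro sum.cong refl) (simp add: conv_gsum[of G _ "B $$ (_, k)"] gsum_sum)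
    also have "\<dots> = right_mult G B (right_mult G A x) p"
      using k A B by (simp add: right_mult_def p GM_dim)
    finally show ?thesis .
  next
    case False
    then show ?thesis using A B by (auto simp: p right_mult_def conv_def gr_mult_def GM_dim)
  qed
qed

text \<open>The elementary operators of which \<open>right_mult\<close> is a finite combination: the
  \<open>i\<close>-th component is translated by \<open>h\<close> and placed in component
  \<open>j\<close>. Boundedness and adjoints are checked on these.\<close>

definition shift :: "nat \<Rightarrow> nat \<Rightarrow> 'a \<Rightarrow> (nat \<times> 'a \<Rightarrow> complex) \<Rightarrow> nat \<times> 'a \<Rightarrow> complex" where
  "shift i j h x = (\<lambda>(j', g). if j' = j \<and> g \<in> carrier G then x (i, g \<otimes> inv h) else 0)"

lemma bij_betw_right_mult: "h \<in> carrier G \<Longrightarrow> bij_betw (\<lambda>g. g \<otimes> h) (carrier G) (carrier G)"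
  by (rule bij_betwI[of _ _ _ "\<lambda>g. g \<otimes> inv h"]) (auto simp: m_assoc)

lemma shift_ell2:
  assumes x: "x \<in> ell2 (index_set G r)" and i: "i < r" and j: "j < s" and h: "h \<in> carrier G"
  shows "shift i j h x \<in> ell2 (index_set G s)"
    and shift_sq: "ell2_sq (index_set G s) (shift i j h x) \<le> ell2_sq (index_set G r) x"
proof -
  let ?f = "\<lambda>p. (cmod (x p))\<^sup>2"
  have bij: "bij_betw (\<lambda>g. (i, g \<otimes> inv h)) (carrier G) ({i} \<times> carrier G)"
  proof -
    have "bij_betw (\<lambda>g. (i, g)) (carrier G) ({i} \<times> carrier G)"
      by (auto simp: bij_betw_def inj_on_def)
    from bij_betw_trans[OF bij_betw_right_mult[of "inv h"] this] h show ?thesis by (simp add: o_def)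
  qed
  have bij': "bij_betw (\<lambda>g. (j, g)) (carrier G) ({j} \<times> carrier G)"
    by (auto simp: bij_betw_def inj_on_def)
  have sx: "?f summable_on index_set G r" using x by (simp add: ell2_def)
  then have s1: "?f summable_on ({i} \<times> carrier G)"
    by (rule summable_on_subset_banach) (use i in auto)
  then have s2: "(\<lambda>g. ?f (i, g \<otimes> inv h)) summable_on carrier G"
    using summable_on_reindex_bij_betw[OF bij, of ?f] by simp
  have "(\<lambda>p. (cmod (shift i j h x p))\<^sup>2) summable_on ({j} \<times> carrier G)"
    using s2 summable_on_reindex_bij_betw[OF bij', of "\<lambda>p. (cmod (shift i j h x p))\<^sup>2"]
    by (simp add: shift_def cong: summable_on_cong)
  then have "(\<lambda>p. (cmod (shift i j h x p))\<^sup>2) summable_on index_set G s"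
    by (rule summable_on_cong_neutral[THEN iffD1, rotated 3]) (use j in \<open>auto simp: shift_def split: if_splits\<close>)
  then show "shift i j h x \<in> ell2 (index_set G s)"
    using j by (auto simp: ell2_def shift_def)
  have "ell2_sq (index_set G s) (shift i j h x) = (\<Sum>\<^sub>\<infinity>p\<in>{j} \<times> carrier G. (cmod (shift i j h x p))\<^sup>2)"
    unfolding ell2_sq_def by (rule infsum_cong_neutral) (use j in \<open>auto simp: shift_def split: if_splits\<close>)
  also have "\<dots> = (\<Sum>\<^sub>\<infinity>g\<in>carrier G. ?f (i, g \<otimes> inv h))"
    unfolding infsum_reindex_bij_betw[OF bij', symmetric] by (rule infsum_cong) (simp add: shift_def)
  also have "\<dots> = (\<Sum>\<^sub>\<infinity>p\<in>{i} \<times> carrier G. ?f p)"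
    by (rule infsum_reindex_bij_betw[OF bij])
  also have "\<dots> \<le> ell2_sq (index_set G r) x"
    unfolding ell2_sq_def by (rule infsum_mono_neutral[OF s1 sx]) (use i in auto)
  finally show "ell2_sq (index_set G s) (shift i j h x) \<le> ell2_sq (index_set G r) x" .
qed

lemma shift_adjoint:
  assumes i: "i < r" and j: "j < s" and h: "h \<in> carrier G"
  shows "ell2_inner (index_set G s) (shift i j h x) y = ell2_inner (index_set G r) x (shift j i (inv h) y)"
proof -
  have bij: "bij_betw (\<lambda>g. (k, g)) (carrier G) ({k} \<times> carrier G)" for k :: nat
    by (auto simp: bij_betw_def inj_on_def)
  have "ell2_inner (index_set G s) (shift i j h x) y = (\<Sum>\<^sub>\<infinity>p\<in>{j} \<times> carrier G. shift i j h x p * cnj (y p))"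
    unfolding ell2_inner_def by (rule infsum_cong_neutral) (use j in \<open>auto simp: shift_def split: if_splits\<close>)
  also have "\<dots> = (\<Sum>\<^sub>\<infinity>g\<in>carrier G. x (i, g \<otimes> inv h) * cnj (y (j, g)))"
    unfolding infsum_reindex_bij_betw[OF bij, symmetric] by (rule infsum_cong) (simp add: shift_def)
  also have "\<dots> = (\<Sum>\<^sub>\<infinity>g\<in>carrier G. x (i, g \<otimes> h \<otimes> inv h) * cnj (y (j, g \<otimes> h)))"
    by (rule infsum_reindex_bij_betw[OF bij_betw_right_mult[OF h], symmetric])
  also have "\<dots> = (\<Sum>\<^sub>\<infinity>g\<in>carrier G. x (i, g) * cnj (shift j i (inv h) y (i, g)))"
    by (rule infsum_cong) (use h in \<open>simp add: shift_def mult_inv_cancel\<close>)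
  also have "\<dots> = (\<Sum>\<^sub>\<infinity>p\<in>{i} \<times> carrier G. x p * cnj (shift j i (inv h) y p))"
    by (rule infsum_reindex_bij_betw[OF bij])
  also have "\<dots> = ell2_inner (index_set G r) x (shift j i (inv h) y)"
    unfolding ell2_inner_def by (rule infsum_cong_neutral) (use i in \<open>auto simp: shift_def split: if_splits\<close>)
  finally show ?thesis .
qed

definition msupp :: "('a \<Rightarrow> complex) mat \<Rightarrow> 'a set" where
  "msupp A = (\<Union>i<dim_row A. \<Union>j<dim_col A. {g \<in> carrier G. (A $$ (i, j)) g \<noteq> 0})"

lemma msupp: "A \<in> GM r s \<Longrightarrow> finite (msupp A)" "msupp A \<subseteq> carrier G"
  using GR_finite[OF GM_entry] by (auto simp: msupp_def GM_dim)

lemma right_mult_shift: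
  assumes A: "A \<in> GM r s"
  shows "right_mult G A x =
    (\<lambda>p. \<Sum>(i, j, h)\<in>{..<r} \<times> {..<s} \<times> msupp A. (A $$ (i, j)) h * shift i j h x p)"
proof
  fix p :: "nat \<times> 'a"
  obtain k g where p: "p = (k, g)" by force
  have "(\<Sum>(i, j, h)\<in>{..<r} \<times> {..<s} \<times> msupp A. (A $$ (i, j)) h * shift i j h x p) =
      (\<Sum>i<r. \<Sum>j<s. \<Sum>h\<in>msupp A. (A $$ (i, j)) h * shift i j h x p)"
    by (simp only: sum.cartesian_product[symmetric])
  also have "\<dots> = (\<Sum>i<r. \<Sum>j<s. if j = k then (\<Sum>h\<in>msupp A. (A $$ (i, k)) h * shift i k h x p) else 0)"
    by (intro sum.cong refl) (auto simp: shift_def p)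
  also have "\<dots> = (if k < s then \<Sum>i<r. \<Sum>h\<in>msupp A. (A $$ (i, k)) h * shift i k h x p else 0)"
    by simp
  also have "\<dots> = right_mult G A x p"
  proof (cases "k < s \<and> g \<in> carrier G")
    case True
    have "(\<Sum>h\<in>msupp A. (A $$ (i, k)) h * shift i k h x p) = conv G (\<lambda>h. x (i, h)) (A $$ (i, k)) g" if "i < r" for i
    proof -
      have "conv G (\<lambda>h. x (i, h)) (A $$ (i, k)) g = gsum G (A $$ (i, k)) (\<lambda>h. x (i, g \<otimes> inv h))"
        using True by (simp add: conv_gsum)
      also have "\<dots> = (\<Sum>h\<in>msupp A. (A $$ (i, k)) h * x (i, g \<otimes> inv h))"
        by (rule gsum_superset[OF msupp(1)[OF A] msupp(2)])
          (use True that A in \<open>auto simp: msupp_def GM_dim\<close>)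
      finally show ?thesis using True by (simp add: shift_def p)
    qed
    then show ?thesis using True A by (simp add: right_mult_def p GM_dim)
  next
    case False
    then show ?thesis using A by (auto simp: right_mult_def p GM_dim shift_def conv_def)
  qed
  finally show "right_mult G A x p =
    (\<Sum>(i, j, h)\<in>{..<r} \<times> {..<s} \<times> msupp A. (A $$ (i, j)) h * shift i j h x p)" by simp
qed

end

lemma ell2_sum:
  assumes "\<And>k. k \<in> J \<Longrightarrow> f k \<in> ell2 I"
  shows "(\<lambda>p. \<Sum>k\<in>J. c k * f k p) \<in> ell2 I"
  using assms
proof (induction J rule: infinite_finite_induct)
  case (insert k F)
  then show ?case
    using ell2_add[OF ell2_scale[of "f k" I "c k"], of "\<lambda>p. \<Sum>k\<in>F. c k * f k p"] by simp
qed (simp_all add: ell2_zero)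

lemma ell2_inner_sum_left:
  assumes "\<And>k. k \<in> J \<Longrightarrow> f k \<in> ell2 I" "y \<in> ell2 I"
  shows "ell2_inner I (\<lambda>p. \<Sum>k\<in>J. c k * f k p) y = (\<Sum>k\<in>J. c k * ell2_inner I (f k) y)"
  using assms
proof (induction J rule: infinite_finite_induct)
  case (insert k F)
  then have "(\<lambda>p. c k * f k p) \<in> ell2 I" "(\<lambda>p. \<Sum>k\<in>F. c k * f k p) \<in> ell2 I"
    by (auto intro: ell2_scale ell2_sum)
  from ell2_inner_add_left[OF this insert.prems(2)] insert show ?case
    by (simp add: ell2_inner_scale_left)
qed (simp_all add: ell2_inner_def)

context group
begin

lemma right_mult_ell2:
  assumes A: "A \<in> GM r s" and x: "x \<in> ell2 (index_set G r)"
  shows "right_mult G A x \<in> ell2 (index_set G s)"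
proof -
  have "(\<lambda>p. \<Sum>k\<in>{..<r} \<times> {..<s} \<times> msupp A. (case k of (i, j, h) \<Rightarrow> (A $$ (i, j)) h) *
      (case k of (i, j, h) \<Rightarrow> shift i j h x) p) \<in> ell2 (index_set G s)"
    by (rule ell2_sum) (use x msupp(2)[of A] in \<open>auto intro!: shift_ell2\<close>)
  then show ?thesis unfolding right_mult_shift[OF A] by (simp add: case_prod_unfold)
qed

lemma right_mult_inner:
  assumes A: "A \<in> GM r s" and x: "x \<in> ell2 (index_set G r)" and y: "y \<in> ell2 (index_set G s)"
  shows "ell2_inner (index_set G s) (right_mult G A x) y =
    (\<Sum>(i, j, h)\<in>{..<r} \<times> {..<s} \<times> msupp A. (A $$ (i, j)) h * ell2_inner (index_set G s) (shift i j h x) y)"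
proof -
  have "ell2_inner (index_set G s) (\<lambda>p. \<Sum>k\<in>{..<r} \<times> {..<s} \<times> msupp A. (case k of (i, j, h) \<Rightarrow> (A $$ (i, j)) h) *
      (case k of (i, j, h) \<Rightarrow> shift i j h x) p) y =
    (\<Sum>k\<in>{..<r} \<times> {..<s} \<times> msupp A. (case k of (i, j, h) \<Rightarrow> (A $$ (i, j)) h) *
      ell2_inner (index_set G s) (case k of (i, j, h) \<Rightarrow> shift i j h x) y)"
    by (rule ell2_inner_sum_left) (use x y msupp(2)[of A] in \<open>auto intro!: shift_ell2\<close>)
  then show ?thesis unfolding right_mult_shift[OF A] by (simp add: case_prod_unfold)
qed

text \<open>The adjoint of \<open>shift i j h\<close> is \<open>shift j i (inv h)\<close>.
  Reindexing the triple sum by this exchange turns the coefficients of \<open>A\<close> into those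
  of \<open>gr_star G A\<close>.\<close>

lemma right_mult_adjoint:
  assumes A: "A \<in> GM r s" and x: "x \<in> ell2 (index_set G r)" and y: "y \<in> ell2 (index_set G s)"
  shows "ell2_inner (index_set G s) (right_mult G A x) y =
    ell2_inner (index_set G r) x (right_mult G (gr_star G A) y)"
proof -
  note A' = gr_star_GM[OF A]
  have entry: "(gr_star G A $$ (j, i)) h = cnj ((A $$ (i, j)) (inv h))" if "i < r" "j < s" "h \<in> carrier G" for i j h
    using gr_star_entry[OF A that(1,2)] that by (simp add: gstar_def)
  have supp: "msupp (gr_star G A) = m_inv G ` msupp A"
  proof
    show "msupp (gr_star G A) \<subseteq> m_inv G ` msupp A"
    proof
      fix h assume "h \<in> msupp (gr_star G A)"
      then obtain i j where ij: "i < r" "j < s" "h \<in> carrier G" "(gr_star G A $$ (j, i)) h \<noteq> 0"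
        using A' by (auto simp: msupp_def GM_dim)
      then have "(A $$ (i, j)) (inv h) \<noteq> 0" using entry[of i j h] by simp
      then have "inv h \<in> msupp A" using ij A by (auto simp: msupp_def GM_dim)
      moreover have "h = inv (inv h)" using ij by simp
      ultimately show "h \<in> m_inv G ` msupp A" by blast
    qed
    show "m_inv G ` msupp A \<subseteq> msupp (gr_star G A)"
    proof
      fix h assume "h \<in> m_inv G ` msupp A"
      then obtain i j g where ij: "i < r" "j < s" "g \<in> carrier G" "(A $$ (i, j)) g \<noteq> 0" "h = inv g"
        using A by (auto simp: msupp_def GM_dim)
      then have "(gr_star G A $$ (j, i)) h \<noteq> 0" using entry[of i j h] by simp
      then show "h \<in> msupp (gr_star G A)" using ij A' by (auto simp: msupp_def GM_dim)
    qed
  qed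
  have "ell2_inner (index_set G r) x (right_mult G (gr_star G A) y) =
      cnj (ell2_inner (index_set G r) (right_mult G (gr_star G A) y) x)"
    by (rule ell2_inner_commute)
  also have "\<dots> = (\<Sum>(j, i, h)\<in>{..<s} \<times> {..<r} \<times> msupp (gr_star G A).
      cnj ((gr_star G A $$ (j, i)) h) * cnj (ell2_inner (index_set G r) (shift j i h y) x))"
    unfolding right_mult_inner[OF A' y x] by (simp add: case_prod_unfold)
  also have "\<dots> = (\<Sum>(i, j, h)\<in>{..<r} \<times> {..<s} \<times> msupp A.
      (A $$ (i, j)) h * ell2_inner (index_set G s) (shift i j h x) y)"
  proof (rule sum.reindex_bij_witness[of _ "\<lambda>(i, j, h). (j, i, inv h)" "\<lambda>(j, i, h). (i, j, inv h)"])
    fix b assume b: "b \<in> {..<s} \<times> {..<r} \<times> msupp (gr_star G A)"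
    obtain j i h where b_eq: "b = (j, i, h)" by (cases b) auto
    then have ij: "j < s" "i < r" and h: "h \<in> msupp (gr_star G A)" "h \<in> carrier G"
      using b msupp(2)[of "gr_star G A"] by auto
    have "cnj (ell2_inner (index_set G r) (shift j i h y) x) = ell2_inner (index_set G s) (shift i j (inv h) x) y"
      using shift_adjoint[OF ij(2,1), of "inv h" x y] h ell2_inner_commute[of "index_set G r" x "shift j i h y"] by simp
    then show "(case (case b of (j, i, h) \<Rightarrow> (i, j, inv h)) of (i, j, h) \<Rightarrow>
        (A $$ (i, j)) h * ell2_inner (index_set G s) (shift i j h x) y) =
      (case b of (j, i, h) \<Rightarrow> cnj ((gr_star G A $$ (j, i)) h) * cnj (ell2_inner (index_set G r) (shift j i h y) x))"
      using entry[OF ij(2,1) h(2)] by (simp add: b_eq)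
  qed (use msupp(2)[of A] in \<open>auto simp: supp\<close>)
  finally show ?thesis unfolding right_mult_inner[OF A x y] by simp
qed

theorem right_mult_positive:
  assumes A: "A \<in> GM r s"
  obtains R where "positive_operator (index_set G r) (right_mult G (gr_mult G A (gr_star G A))) R"
proof -
  let ?I = "index_set G r" and ?C = "gr_mult G A (gr_star G A)"
  note A' = gr_star_GM[OF A]
  note C = gr_mult_GM[OF A A']
  have split: "right_mult G ?C x = right_mult G (gr_star G A) (right_mult G A x)" for x
    by (rule right_mult_mult[OF A A'])
  have inner: "ell2_inner ?I (right_mult G ?C x) y =
      ell2_inner (index_set G s) (right_mult G A x) (right_mult G A y)"
    if x: "x \<in> ell2 ?I" and y: "y \<in> ell2 ?I" for x y
  proof -
    note Ax = right_mult_ell2[OF A x] and Ay = right_mult_ell2[OF A y]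
    have "ell2_inner ?I (right_mult G ?C x) y = cnj (ell2_inner ?I y (right_mult G ?C x))"
      by (rule ell2_inner_commute)
    also have "\<dots> = cnj (ell2_inner (index_set G s) (right_mult G A y) (right_mult G A x))"
      unfolding split right_mult_adjoint[OF A y Ax] ..
    finally show ?thesis by (simp only: ell2_inner_commute[symmetric])
  qed
  \<comment> \<open>Each shift is a contraction, so the sum of the moduli of all coefficients bounds
    the form; adding 1 makes the bound positive even for the zero matrix.\<close>
  define R where "R = 1 + (\<Sum>(i, j, h)\<in>{..<r} \<times> {..<r} \<times> msupp ?C. cmod ((?C $$ (i, j)) h))"
  have "positive_operator ?I (right_mult G ?C) R"
  proof
    fix x assume x: "x \<in> ell2 ?I"
    show "right_mult G ?C x \<in> ell2 ?I" by (rule right_mult_ell2[OF C x])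
    show "0 \<le> Re (ell2_inner ?I (right_mult G ?C x) x)"
      unfolding inner[OF x x] by (simp add: ell2_inner_same ell2_sq_nonneg)
    show "right_mult G ?C (\<lambda>i. c * x i) = (\<lambda>i. c * right_mult G ?C x i)" for c
      unfolding right_mult_def by (auto simp: conv_gsum gsum_scale sum_distrib_left fun_eq_iff intro!: sum.cong)
    have bound: "cmod (ell2_inner ?I (shift i j h x) x) \<le> ell2_sq ?I x"
      if "i < r" "j < r" "h \<in> carrier G" for i j h
    proof -
      have "(cmod (ell2_inner ?I (shift i j h x) x))\<^sup>2 \<le> ell2_sq ?I (shift i j h x) * ell2_sq ?I x"
        by (rule ell2_Cauchy_Schwarz[OF shift_ell2(1)[OF x that] x])
      also have "\<dots> \<le> ell2_sq ?I x * ell2_sq ?I x"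
        by (intro mult_right_mono shift_sq[OF x that] ell2_sq_nonneg)
      finally show ?thesis
        using power2_le_imp_le[OF _ ell2_sq_nonneg] by (simp add: power2_eq_square)
    qed
    have "Re (ell2_inner ?I (right_mult G ?C x) x) \<le> cmod (ell2_inner ?I (right_mult G ?C x) x)"
      by (rule complex_Re_le_cmod)
    also have "\<dots> \<le> (\<Sum>(i, j, h)\<in>{..<r} \<times> {..<r} \<times> msupp ?C. cmod ((?C $$ (i, j)) h) * ell2_sq ?I x)"
      unfolding right_mult_inner[OF C x x]
      by (rule sum_norm_le)
        (use msupp(2)[of ?C] in \<open>auto simp: norm_mult intro!: mult_left_mono bound\<close>)
    also have "\<dots> = (\<Sum>(i, j, h)\<in>{..<r} \<times> {..<r} \<times> msupp ?C. cmod ((?C $$ (i, j)) h)) * ell2_sq ?I x"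
      by (simp add: sum_distrib_right case_prod_unfold)
    also have "\<dots> \<le> R * ell2_sq ?I x"
      by (intro mult_right_mono ell2_sq_nonneg) (simp add: R_def)
    finally show "Re (ell2_inner ?I (right_mult G ?C x) x) \<le> R * ell2_sq ?I x" .
    fix y assume y: "y \<in> ell2 ?I"
    show "right_mult G ?C (\<lambda>i. x i + y i) = (\<lambda>i. right_mult G ?C x i + right_mult G ?C y i)"
    proof
      fix p :: "nat \<times> 'a"
      obtain k g where p: "p = (k, g)" by force
      show "right_mult G ?C (\<lambda>i. x i + y i) p = right_mult G ?C x p + right_mult G ?C y p"
        by (cases "g \<in> carrier G") (simp_all add: p right_mult_def conv_gsum gsum_add sum.distrib)
    qed
    show "ell2_inner ?I (right_mult G ?C x) y = ell2_inner ?I x (right_mult G ?C y)"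
      using inner[OF x y] right_mult_adjoint[OF A x right_mult_ell2[OF A y]]
      by (simp only: split[of y])
  next
    show "0 < R" unfolding R_def by (intro add_pos_nonneg sum_nonneg) auto
  qed
  then show ?thesis by (rule that)
qed

primrec gr_pow :: "('a \<Rightarrow> complex) mat \<Rightarrow> nat \<Rightarrow> ('a \<Rightarrow> complex) mat" where
  "gr_pow C 0 = Matrix.mat (dim_row C) (dim_row C) (\<lambda>(i, j). if i = j then unit_fun \<one> else (\<lambda>_. 0))"
| "gr_pow C (Suc j) = gr_mult G (gr_pow C j) C"

lemma unit_fun_GR: "unit_fun \<one> \<in> GR G"
  by (rule GR_I[of "{\<one>}"]) (auto simp: unit_fun_def)

lemma gr_pow_GM: "C \<in> GM r r \<Longrightarrow> gr_pow C j \<in> GM r r"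
proof (induction j)
  case 0
  have "(\<lambda>_. 0) \<in> GR G" by (auto simp: group_ring_def)
  then show ?case using 0 unit_fun_GR by (auto simp: group_ring_mats_def)
qed (auto intro: gr_mult_GM)

text \<open>Through this the moments of the scalar measures at unit vectors can be read off as
  coefficients, at the neutral element, of powers in the group ring.\<close>

lemma right_mult_pow_unit:
  assumes C: "C \<in> GM r r" and k: "k < r"
  shows "(right_mult G C ^^ j) (unit_fun (k, \<one>)) =
    (\<lambda>(i, g). if i < r then (gr_pow C j $$ (k, i)) g else 0)"
proof (induction j)
  case 0
  show ?case using k GM_dim(1)[OF C] by (auto simp: fun_eq_iff unit_fun_def)
next
  case (Suc j)
  have "(right_mult G C ^^ Suc j) (unit_fun (k, \<one>)) =
      right_mult G C (\<lambda>(i, g). if i < r then (gr_pow C j $$ (k, i)) g else 0)"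
    by (simp add: Suc)
  also have "\<dots> = (\<lambda>(i, g). if i < r then (gr_pow C (Suc j) $$ (k, i)) g else 0)"
    using GM_dim[OF C] GM_dim[OF gr_pow_GM[OF C, of j]] k
    by (auto simp: fun_eq_iff right_mult_def gr_mult_def intro!: sum.cong)
  finally show ?case .
qed

end

section \<open>Block matrices of finite-dimensional unitary representations\<close>

lemma sum_div_mod:
  fixes f :: "nat \<Rightarrow> nat \<Rightarrow> 'c::comm_monoid_add"
  shows "(\<Sum>l<s * n. f (l div n) (l mod n)) = (\<Sum>j<s. \<Sum>b<n. f j b)"
proof -
  have less: "j * n + b < s * n" if "j < s" "b < n" for j b
  proof -
    have "j * n + b < Suc j * n" using that by simp
    also have "\<dots> \<le> s * n" using that by (intro mult_le_mono1) auto
    finally show ?thesis .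
  qed
  have "(\<Sum>j<s. \<Sum>b<n. f j b) = (\<Sum>(j, b)\<in>{..<s} \<times> {..<n}. f j b)"
    by (simp add: sum.cartesian_product)
  also have "\<dots> = (\<Sum>l<s * n. f (l div n) (l mod n))"
    by (rule sum.reindex_bij_witness[of _ "\<lambda>l. (l div n, l mod n)" "\<lambda>(j, b). j * n + b"])
      (auto simp: less_mult_imp_div_less intro: less intro!: mod_less_divisor gr0I)
  finally show ?thesis by simp
qed

locale unitary_rep = group G for G (structure) +
  fixes n :: nat and \<rho> :: "'a \<Rightarrow> nat \<Rightarrow> nat \<Rightarrow> complex"
  assumes rep_mult: "g \<in> carrier G \<Longrightarrow> h \<in> carrier G \<Longrightarrow> i < n \<Longrightarrow> k < n \<Longrightarrow>
      \<rho> (g \<otimes> h) i k = (\<Sum>j<n. \<rho> g i j * \<rho> h j k)"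
    and rep_inv: "g \<in> carrier G \<Longrightarrow> i < n \<Longrightarrow> j < n \<Longrightarrow> \<rho> (inv g) i j = cnj (\<rho> g j i)"
    and rep_one: "i < n \<Longrightarrow> j < n \<Longrightarrow> \<rho> \<one> i j = (if i = j then 1 else 0)"
begin

definition lin :: "('a \<Rightarrow> complex) \<Rightarrow> nat \<Rightarrow> nat \<Rightarrow> complex" where
  "lin a i j = gsum G a (\<lambda>g. \<rho> g i j)"

text \<open>Quotients modulo \<open>n\<close> number the blocks and remainders the entries of a
  block. This is the convention of \<open>basis_index\<close>, so that \<open>regular_matrix\<close>
  becomes an instance.\<close>

definition rep_mat :: "('a \<Rightarrow> complex) mat \<Rightarrow> complex mat" where
  "rep_mat A = Matrix.mat (dim_row A * n) (dim_col A * n)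
     (\<lambda>(k, l). lin (A $$ (k div n, l div n)) (k mod n) (l mod n))"

definition charac :: "'a \<Rightarrow> complex" where "charac g = (\<Sum>a<n. \<rho> g a a)"

lemma rep_mat_carrier: "A \<in> GM r s \<Longrightarrow> rep_mat A \<in> carrier_mat (r * n) (s * n)"
  by (simp add: rep_mat_def GM_dim)

lemma lin_conv:
  assumes a: "a \<in> GR G" and b: "b \<in> GR G" and i: "i < n" and k: "k < n"
  shows "lin (conv G a b) i k = (\<Sum>j<n. lin a i j * lin b j k)"
proof -
  have "lin (conv G a b) i k = gsum G b (\<lambda>h. gsum G a (\<lambda>g. \<Sum>j<n. \<rho> h j k * \<rho> g i j))"
    unfolding lin_def gsum_conv[OF a b] by (intro gsum_cong) (simp add: rep_mult i k mult.commute)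
  also have "\<dots> = (\<Sum>j<n. gsum G b (\<lambda>h. gsum G a (\<lambda>g. \<rho> g i j) * \<rho> h j k))"
    by (simp add: gsum_sum gsum_scale mult.commute)
  also have "\<dots> = (\<Sum>j<n. lin a i j * lin b j k)"
    by (simp add: gsum_scale lin_def)
  finally show ?thesis .
qed

lemma rep_mat_mult:
  assumes A: "A \<in> GM r s" and B: "B \<in> GM s u"
  shows "rep_mat (gr_mult G A B) = rep_mat A * rep_mat B"
proof (rule eq_matI)
  show "dim_row (rep_mat (gr_mult G A B)) = dim_row (rep_mat A * rep_mat B)"
    "dim_col (rep_mat (gr_mult G A B)) = dim_col (rep_mat A * rep_mat B)"
    by (simp_all add: rep_mat_def gr_mult_def)
  fix i k assume "i < dim_row (rep_mat A * rep_mat B)" "k < dim_col (rep_mat A * rep_mat B)"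
  then have ik: "i < r * n" "k < u * n" using A B by (simp_all add: rep_mat_def GM_dim)
  then have "n > 0" by (cases n) auto
  then have m: "i mod n < n" "k mod n < n" "i div n < r" "k div n < u"
    using ik by (auto simp: less_mult_imp_div_less)
  have "rep_mat (gr_mult G A B) $$ (i, k) =
      lin (\<lambda>g. \<Sum>j<s. conv G (A $$ (i div n, j)) (B $$ (j, k div n)) g) (i mod n) (k mod n)"
    using ik m A B by (simp add: rep_mat_def gr_mult_def GM_dim)
  also have "\<dots> = (\<Sum>j<s. lin (conv G (A $$ (i div n, j)) (B $$ (j, k div n))) (i mod n) (k mod n))"
    unfolding lin_def by (rule gsum_sum_left) (use m GM_entry[OF A] GM_entry[OF B] in \<open>auto intro!: conv_GR\<close>)
  also have "\<dots> = (\<Sum>j<s. \<Sum>b<n. lin (A $$ (i div n, j)) (i mod n) b * lin (B $$ (j, k div n)) b (k mod n))"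
    by (intro sum.cong refl lin_conv) (use m GM_entry[OF A] GM_entry[OF B] in auto)
  also have "\<dots> = (\<Sum>l<s * n. lin (A $$ (i div n, l div n)) (i mod n) (l mod n) * lin (B $$ (l div n, k div n)) (l mod n) (k mod n))"
    by (rule sum_div_mod[symmetric])
  also have "\<dots> = (\<Sum>l<s * n. rep_mat A $$ (i, l) * rep_mat B $$ (l, k))"
    using ik A B by (intro sum.cong refl) (simp add: rep_mat_def GM_dim)
  also have "\<dots> = (rep_mat A * rep_mat B) $$ (i, k)"
    by (rule mat_mult_entry[OF rep_mat_carrier[OF A] rep_mat_carrier[OF B] ik, symmetric])
  finally show "rep_mat (gr_mult G A B) $$ (i, k) = (rep_mat A * rep_mat B) $$ (i, k)" .
qed

lemma rep_mat_star:
  assumes A: "A \<in> GM r s"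
  shows "rep_mat (gr_star G A) = mat_adjoint (rep_mat A)"
proof (rule eq_matI)
  note cA = rep_mat_carrier[OF A] and cA' = rep_mat_carrier[OF gr_star_GM[OF A]]
  show "dim_row (rep_mat (gr_star G A)) = dim_row (mat_adjoint (rep_mat A))"
    "dim_col (rep_mat (gr_star G A)) = dim_col (mat_adjoint (rep_mat A))"
    using mat_adjoint_carrier[OF cA] cA' by auto
  fix i k assume "i < dim_row (mat_adjoint (rep_mat A))" "k < dim_col (mat_adjoint (rep_mat A))"
  then have ik: "i < s * n" "k < r * n" using mat_adjoint_carrier[OF cA] by auto
  then have "n > 0" by (cases n) auto
  then have m: "i mod n < n" "k mod n < n" "i div n < s" "k div n < r"
    using ik by (auto simp: less_mult_imp_div_less)
  have "rep_mat (gr_star G A) $$ (i, k) = lin (gstar (A $$ (k div n, i div n))) (i mod n) (k mod n)"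
    using ik m A gr_star_GM[OF A] gr_star_entry[OF A m(4,3)] by (simp add: rep_mat_def GM_dim)
  also have "\<dots> = cnj (lin (A $$ (k div n, i div n)) (k mod n) (i mod n))"
    unfolding lin_def gsum_gstar[OF GM_entry[OF A m(4,3)]]
    by (intro arg_cong[of _ _ cnj] gsum_cong) (simp add: rep_inv m)
  also have "\<dots> = mat_adjoint (rep_mat A) $$ (i, k)"
    unfolding mat_adjoint_entry[OF cA ik] using ik A by (simp add: rep_mat_def GM_dim)
  finally show "rep_mat (gr_star G A) $$ (i, k) = mat_adjoint (rep_mat A) $$ (i, k)" .
qed

lemma rep_mat_pow:
  assumes C: "C \<in> GM r r"
  shows "rep_mat (gr_pow C j) = rep_mat C ^\<^sub>m j"
proof (induction j)
  case 0
  have zero: "lin (\<lambda>_. 0) a b = 0" for a b by (simp add: lin_def gsum_def)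
  have one: "lin (unit_fun \<one>) a b = (if a = b then 1 else 0)" if "a < n" "b < n" for a b
    unfolding lin_def by (subst gsum_superset[of "{\<one>}"]) (use that in \<open>auto simp: unit_fun_def rep_one\<close>)
  show ?case
  proof (rule eq_matI)
    fix i k assume "i < dim_row (rep_mat C ^\<^sub>m 0)" "k < dim_col (rep_mat C ^\<^sub>m 0)"
    then have ik: "i < r * n" "k < r * n" using C by (simp_all add: rep_mat_def GM_dim)
    then have "n > 0" by (cases n) auto
    then have m: "i mod n < n" "k mod n < n" "i div n < r" "k div n < r"
      using ik by (auto simp: less_mult_imp_div_less)
    have "i = k \<longleftrightarrow> i div n = k div n \<and> i mod n = k mod n"
      by (metis div_mod_decomp)
    then show "rep_mat (gr_pow C 0) $$ (i, k) = (rep_mat C ^\<^sub>m 0) $$ (i, k)"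
      using ik m C by (auto simp: rep_mat_def GM_dim zero one)
  qed (use C in \<open>simp_all add: rep_mat_def GM_dim\<close>)
next
  case (Suc j)
  then show ?case using rep_mat_mult[OF gr_pow_GM[OF C] C] by simp
qed

text \<open>Since \<open>rep_mat\<close> respects products and adjoints, the power is the image of a
  power in the group ring, and its trace is linear in the character. Representations with the same
  character thus give Gram matrices with the same power sums of eigenvalues.\<close>

theorem mtrace_gram_pow:
  assumes A: "A \<in> GM r s"
  shows "mtrace ((rep_mat A * mat_adjoint (rep_mat A)) ^\<^sub>m j) =
    (\<Sum>k<r. gsum G (gr_pow (gr_mult G A (gr_star G A)) j $$ (k, k)) charac)"
proof -
  let ?C = "gr_mult G A (gr_star G A)"
  note C = gr_mult_GM[OF A gr_star_GM[OF A]]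
  note D = gr_pow_GM[OF C, of j]
  have "(rep_mat A * mat_adjoint (rep_mat A)) ^\<^sub>m j = rep_mat (gr_pow ?C j)"
    unfolding rep_mat_pow[OF C] rep_mat_mult[OF A gr_star_GM[OF A]] rep_mat_star[OF A] ..
  then have "mtrace ((rep_mat A * mat_adjoint (rep_mat A)) ^\<^sub>m j) =
      (\<Sum>k<r * n. lin (gr_pow ?C j $$ (k div n, k div n)) (k mod n) (k mod n))"
    using GM_dim[OF D] by (simp add: mtrace_def rep_mat_def)
  also have "\<dots> = (\<Sum>k<r. \<Sum>a<n. lin (gr_pow ?C j $$ (k, k)) a a)"
    by (rule sum_div_mod)
  also have "\<dots> = (\<Sum>k<r. gsum G (gr_pow ?C j $$ (k, k)) charac)"
    by (simp add: lin_def charac_def[abs_def] gsum_sum)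
  finally show ?thesis .
qed

end

section \<open>Finite quotients and infinite cyclic normal subgroups\<close>

locale enumerated_quotient = group_hom G H p for G (structure) and H (structure) and p +
  fixes q :: nat and c :: "nat \<Rightarrow> 'c"
  assumes bij: "bij_betw c {..<q} (carrier H)"
begin

text \<open>The permutation matrix of right translation by the image of \<open>g\<close>: the
  regular representation of \<open>H\<close>, pulled back to \<open>G\<close>.\<close>

definition quotient_rep :: "'a \<Rightarrow> nat \<Rightarrow> nat \<Rightarrow> complex" where
  "quotient_rep g a b = (if c a \<otimes>\<^bsub>H\<^esub> p g = c b then 1 else 0)"

lemma cc: "a < q \<Longrightarrow> c a \<in> carrier H"
  using bij by (auto simp: bij_betw_def)

lemma c_inj: "a < q \<Longrightarrow> b < q \<Longrightarrow> c a = c b \<longleftrightarrow> a = b"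
  using bij by (auto simp: bij_betw_def inj_on_def)

lemma c_surj: "x \<in> carrier H \<Longrightarrow> \<exists>a<q. c a = x"
proof -
  assume "x \<in> carrier H"
  then have "x \<in> c ` {..<q}" using bij by (simp add: bij_betw_def)
  then show ?thesis by blast
qed

lemma quotient_rep_unitary: "unitary_rep G q quotient_rep"
proof
  fix g h i k assume g: "g \<in> carrier G" and h: "h \<in> carrier G" and i: "i < q" and k: "k < q"
  have "c i \<otimes>\<^bsub>H\<^esub> p g \<in> carrier H" using cc[OF i] g by simp
  then obtain j where j: "j < q" "c j = c i \<otimes>\<^bsub>H\<^esub> p g" using c_surj by blast
  have "quotient_rep g i j' = (if j' = j then 1 else 0)" if "j' < q" for j'
    using c_inj[OF j(1) that] by (auto simp: quotient_rep_def j(2)[symmetric])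
  then have "(\<Sum>j'<q. quotient_rep g i j' * quotient_rep h j' k) = (\<Sum>j'<q. if j' = j then quotient_rep h j k else 0)"
    by (intro sum.cong refl) simp
  also have "\<dots> = quotient_rep h j k" using j(1) by simp
  also have "\<dots> = quotient_rep (g \<otimes> h) i k"
    using cc[OF i] g h by (simp add: quotient_rep_def j(2) H.m_assoc)
  finally show "quotient_rep (g \<otimes> h) i k = (\<Sum>j'<q. quotient_rep g i j' * quotient_rep h j' k)" ..
next
  fix g i j assume g: "g \<in> carrier G" and i: "i < q" and j: "j < q"
  have "c i \<otimes>\<^bsub>H\<^esub> inv\<^bsub>H\<^esub> (p g) = c j \<longleftrightarrow> c j \<otimes>\<^bsub>H\<^esub> p g = c i"
    using cc[OF i] cc[OF j] g H.inv_solve_right'[of "c j" "c i" "p g"] by auto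
  then show "quotient_rep (inv g) i j = cnj (quotient_rep g j i)"
    using g by (simp add: quotient_rep_def)
next
  fix i j assume i: "i < q" and j: "j < q"
  then show "quotient_rep \<one> i j = (if i = j then 1 else 0)"
    using cc[OF i] c_inj[OF i j] by (simp add: quotient_rep_def)
qed

sublocale unitary_rep G q quotient_rep
  by (rule quotient_rep_unitary)

lemma quotient_rep_charac:
  assumes g: "g \<in> carrier G"
  shows "charac g = (if p g = \<one>\<^bsub>H\<^esub> then of_nat q else 0)"
proof -
  have "quotient_rep g a a = (if p g = \<one>\<^bsub>H\<^esub> then 1 else 0)" if "a < q" for a
    using cc[OF that] g H.l_cancel_one[of "c a" "p g"] by (simp add: quotient_rep_def)
  then show ?thesis by (simp add: charac_def)
qed

lemma regular_matrix_entry: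
  assumes q: "order H = q" and c_def: "\<And>k. c k = from_nat_into (carrier H) k"
    and kl: "k < dim_row B * q" "l < dim_col B * q"
  shows "regular_matrix H B $$ (k, l) =
    (B $$ (k div q, l div q)) (inv\<^bsub>H\<^esub> c (k mod q) \<otimes>\<^bsub>H\<^esub> c (l mod q))"
proof -
  have "q > 0" using kl by (cases q) auto
  then have m: "k mod q < q" "l mod q < q" "k div q < dim_row B" "l div q < dim_col B"
    using kl by (auto simp: less_mult_imp_div_less)
  define x where "x = c (k mod q)"
  define y where "y = c (l mod q)"
  have x: "x \<in> carrier H" and y: "y \<in> carrier H" using cc m by (auto simp: x_def y_def)
  have fin: "finite (carrier H)" using bij bij_betw_finite by blast
  \<comment> \<open>Convolution with a unit vector leaves the single \<open>h\<close> that carries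
    \<open>x\<close> to \<open>y\<close>.\<close>
  have solve: "x = y \<otimes>\<^bsub>H\<^esub> inv\<^bsub>H\<^esub> h \<longleftrightarrow> h = inv\<^bsub>H\<^esub> x \<otimes>\<^bsub>H\<^esub> y" if "h \<in> carrier H" for h
    using H.inv_solve_right[of x y h] H.inv_solve_left[of h x y] x y that by auto
  let ?D = "inv\<^bsub>H\<^esub> x \<otimes>\<^bsub>H\<^esub> y" and ?a = "B $$ (k div q, l div q)"
  have D: "?D \<in> carrier H" using x y by simp
  have "regular_matrix H B $$ (k, l) =
      (\<Sum>i<dim_row B. conv H (\<lambda>h. unit_fun (k div q, x) (i, h)) (B $$ (i, l div q)) y)"
    using kl m by (simp add: regular_matrix_def q basis_index_def right_mult_def x_def y_def c_def)
  also have "\<dots> = (\<Sum>i<dim_row B. if i = k div q then ?a ?D else 0)"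
  proof (rule sum.cong[OF refl])
    fix i assume "i \<in> {..<dim_row B}"
    show "conv H (\<lambda>h. unit_fun (k div q, x) (i, h)) (B $$ (i, l div q)) y =
        (if i = k div q then ?a ?D else 0)"
    proof (cases "i = k div q")
      case True
      have "conv H (\<lambda>h. unit_fun (k div q, x) (i, h)) (B $$ (i, l div q)) y =
          (\<Sum>h\<in>{h \<in> carrier H. ?a h \<noteq> 0}. if h = ?D then ?a ?D else 0)"
      proof -
        have "unit_fun (k div q, x) (i, y \<otimes>\<^bsub>H\<^esub> inv\<^bsub>H\<^esub> h) = (if h = ?D then 1 else 0)" if "h \<in> carrier H" for h
          using solve[OF that] True by (auto simp: unit_fun_def)
        then show ?thesis using y True unfolding conv_def by (simp add: cong: sum.cong) (rule sum.cong, auto)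
      qed
      also have "\<dots> = ?a ?D"
        using fin D by (subst sum.delta) auto
      finally show ?thesis using True by simp
    qed (auto simp: conv_def unit_fun_def intro!: sum.neutral)
  qed
  also have "\<dots> = ?a ?D" using m by simp
  finally show ?thesis by (simp add: x_def y_def)
qed

end

section \<open>Regular representations of the quotients by finite index normal subgroups\<close>

context group
begin

definition coset_enum :: "'a set \<Rightarrow> nat \<Rightarrow> 'a set" where
  "coset_enum N k = from_nat_into (carrier (G Mod N)) k"

lemma finite_index_normalD:
  assumes "N \<in> finite_index_normal G"
  shows "N \<lhd> G" "finite (carrier (G Mod N))" "order (G Mod N) = group_index G N"
    "carrier (G Mod N) = rcosets N"
proof -
  show N: "N \<lhd> G" using assms by (simp add: finite_index_normal_def)
  show c: "carrier (G Mod N) = rcosets N" by (simp add: FactGroup_def)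
  show fin: "finite (carrier (G Mod N))" unfolding c using assms by (simp add: finite_index_normal_def)
  show "order (G Mod N) = group_index G N" by (simp add: order_def c group_index_def)
qed

lemma enumerated_quotient_coset:
  assumes N: "N \<in> finite_index_normal G"
  shows "enumerated_quotient G (G Mod N) (\<lambda>g. N #> g) (group_index G N) (coset_enum N)"
proof -
  note F = finite_index_normalD[OF N]
  have "group (G Mod N)" by (rule normal.factorgroup_is_group[OF F(1)])
  moreover have "(\<lambda>g. N #> g) \<in> hom G (G Mod N)" by (rule normal.r_coset_hom_Mod[OF F(1)])
  moreover have "bij_betw (coset_enum N) {..<group_index G N} (carrier (G Mod N))"
    using bij_betw_from_nat_into_finite[OF F(2)] F(4) unfolding coset_enum_def[abs_def] group_index_def by simp
  ultimately show ?thesis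
    by (simp add: enumerated_quotient_def enumerated_quotient_axioms_def group_hom_def group_hom_axioms_def
        is_group)
qed

lemma mem_coset_iff:
  assumes N: "N \<lhd> G" and D: "D \<in> rcosets N" and g: "g \<in> carrier G"
  shows "N #> g = D \<longleftrightarrow> g \<in> D"
proof -
  have sub: "subgroup N G" using N by (rule normal_imp_subgroup)
  obtain x where x: "x \<in> carrier G" "D = N #> x" using D by (auto simp: RCOSETS_def)
  show ?thesis
    using rcos_self[OF g sub] repr_independence[OF _ x(1) sub, of g] x(2) by metis
qed

lemma regular_matrix_rep_mat:
  assumes N: "N \<in> finite_index_normal G" and A: "A \<in> GM r s"
  shows "regular_matrix (G Mod N) (quotient_mat G N A) =
    unitary_rep.rep_mat G (group_index G N)
      (enumerated_quotient.quotient_rep (G Mod N) (\<lambda>g. N #> g) (coset_enum N)) A"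
proof -
  note F = finite_index_normalD[OF N]
  interpret Q: enumerated_quotient G "G Mod N" "\<lambda>g. N #> g" "group_index G N" "coset_enum N"
    by (rule enumerated_quotient_coset[OF N])
  let ?q = "group_index G N" and ?A = "quotient_mat G N A"
  have dims: "dim_row ?A = r" "dim_col ?A = s" using A by (simp_all add: quotient_mat_def GM_dim)
  show ?thesis
  proof (rule eq_matI)
    fix k l assume "k < dim_row (Q.rep_mat A)" "l < dim_col (Q.rep_mat A)"
    then have kl: "k < r * ?q" "l < s * ?q" using A by (simp_all add: Q.rep_mat_def GM_dim)
    then have "?q > 0" by (cases ?q) auto
    then have m: "k mod ?q < ?q" "l mod ?q < ?q" "k div ?q < r" "l div ?q < s"
      using kl by (auto simp: less_mult_imp_div_less)
    define x where "x = coset_enum N (k mod ?q)"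
    define y where "y = coset_enum N (l mod ?q)"
    have x: "x \<in> carrier (G Mod N)" and y: "y \<in> carrier (G Mod N)"
      using Q.cc m unfolding x_def y_def by blast+
    define D where "D = inv\<^bsub>G Mod N\<^esub> x \<otimes>\<^bsub>G Mod N\<^esub> y"
    have D: "D \<in> carrier (G Mod N)" unfolding D_def by (rule Q.H.m_closed[OF Q.H.inv_closed[OF x] y])
    let ?a = "A $$ (k div ?q, l div ?q)"
    have "regular_matrix (G Mod N) ?A $$ (k, l) = (?A $$ (k div ?q, l div ?q)) D"
      unfolding D_def x_def y_def
      by (rule Q.regular_matrix_entry[OF F(3)]) (use kl in \<open>simp_all add: dims coset_enum_def\<close>)
    also have "\<dots> = (\<Sum>g\<in>{g \<in> D. ?a g \<noteq> 0}. ?a g)"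
      using m A D by (simp add: quotient_mat_def GM_dim)
    also have "\<dots> = (\<Sum>g\<in>{g \<in> carrier G. ?a g \<noteq> 0}. ?a g * Q.quotient_rep g (k mod ?q) (l mod ?q))"
    proof -
      have rep: "Q.quotient_rep g (k mod ?q) (l mod ?q) = (if g \<in> D then 1 else 0)" if g: "g \<in> carrier G" for g
      proof -
        have pg: "N #> g \<in> carrier (G Mod N)" using g by (rule Q.hom_closed)
        have "x \<otimes>\<^bsub>G Mod N\<^esub> (N #> g) = y \<longleftrightarrow> N #> g = D"
          unfolding D_def using Q.H.inv_solve_left[OF pg x y] by metis
        then show ?thesis
          using mem_coset_iff[OF F(1) _ g, of D] D F(4) unfolding Q.quotient_rep_def x_def y_def by simp
      qed
      have fin: "finite {g \<in> carrier G. ?a g \<noteq> 0}" by (rule GR_finite[OF GM_entry[OF A m(3,4)]])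
      have "D \<subseteq> carrier G"
        using D F(4) rcosets_part_G[OF normal_imp_subgroup[OF F(1)]] by blast
      then have "(\<Sum>g\<in>{g \<in> D. ?a g \<noteq> 0}. ?a g) = (\<Sum>g\<in>{g \<in> carrier G. ?a g \<noteq> 0}. if g \<in> D then ?a g else 0)"
        by (intro sum.mono_neutral_cong_left fin) auto
      also have "\<dots> = (\<Sum>g\<in>{g \<in> carrier G. ?a g \<noteq> 0}. ?a g * Q.quotient_rep g (k mod ?q) (l mod ?q))"
        by (rule sum.cong[OF refl]) (simp add: rep)
      finally show ?thesis .
    qed
    also have "\<dots> = Q.rep_mat A $$ (k, l)"
      using kl A by (simp add: Q.rep_mat_def GM_dim Q.lin_def gsum_def)
    finally show "regular_matrix (G Mod N) ?A $$ (k, l) = Q.rep_mat A $$ (k, l)" .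
  qed (use A in \<open>simp_all add: regular_matrix_def dims Q.rep_mat_def F(3) GM_dim\<close>)
qed

theorem mtrace_regular_matrix:
  assumes N: "N \<in> finite_index_normal G" and A: "A \<in> GM r s"
  defines "M \<equiv> regular_matrix (G Mod N) (quotient_mat G N A)"
  shows "M \<in> carrier_mat (r * group_index G N) (s * group_index G N)"
    and "mtrace ((M * mat_adjoint M) ^\<^sub>m j) =
      (\<Sum>k<r. gsum G (gr_pow (gr_mult G A (gr_star G A)) j $$ (k, k))
        (\<lambda>g. if g \<in> N then of_nat (group_index G N) else 0))"
proof -
  note F = finite_index_normalD[OF N]
  interpret Q: enumerated_quotient G "G Mod N" "\<lambda>g. N #> g" "group_index G N" "coset_enum N"
    by (rule enumerated_quotient_coset[OF N])
  note M = regular_matrix_rep_mat[OF N A, folded M_def]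
  show "M \<in> carrier_mat (r * group_index G N) (s * group_index G N)"
    unfolding M by (rule Q.rep_mat_carrier[OF A])
  have sub: "subgroup N G" using F(1) by (rule normal_imp_subgroup)
  have ch: "Q.charac g = (if g \<in> N then of_nat (group_index G N) else 0)" if g: "g \<in> carrier G" for g
  proof -
    have "N #> g = \<one>\<^bsub>G Mod N\<^esub> \<longleftrightarrow> g \<in> N"
      using coset_join1[OF _ g sub] coset_join2[OF g sub] by (auto simp: FactGroup_def)
    then show ?thesis using Q.quotient_rep_charac[OF g] by simp
  qed
  show "mtrace ((M * mat_adjoint M) ^\<^sub>m j) =
      (\<Sum>k<r. gsum G (gr_pow (gr_mult G A (gr_star G A)) j $$ (k, k))
        (\<lambda>g. if g \<in> N then of_nat (group_index G N) else 0))"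
    unfolding M Q.mtrace_gram_pow[OF A] by (intro sum.cong refl gsum_cong ch)
qed

end

section \<open>Groups with a normal infinite cyclic subgroup of finite index\<close>

lemma int_subgroup_generator:
  fixes S :: "int set"
  assumes "D \<in> S" "0 < D" and diff: "\<And>a b. a \<in> S \<Longrightarrow> b \<in> S \<Longrightarrow> a - b \<in> S"
  obtains e where "0 < e" "S = {e * l | l. True}"
proof -
  define e where "e = int (LEAST n. 0 < n \<and> int n \<in> S)"
  have "0 < nat D \<and> int (nat D) \<in> S" using assms by simp
  from LeastI[of "\<lambda>n. 0 < n \<and> int n \<in> S", OF this] have e: "0 < e" "e \<in> S" by (auto simp: e_def)
  have least: "e \<le> a" if "0 < a" "a \<in> S" for a
    using Least_le[of "\<lambda>n. 0 < n \<and> int n \<in> S" "nat a"] that by (simp add: e_def)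
  have zero: "0 \<in> S" using diff[OF e(2) e(2)] by simp
  have neg: "- a \<in> S" if "a \<in> S" for a using diff[OF zero that] by simp
  have add: "a + b \<in> S" if "a \<in> S" "b \<in> S" for a b using diff[OF that(1) neg[OF that(2)]] by simp
  have mulnat: "e * int n \<in> S" for n by (induction n) (auto simp: zero ring_distribs intro: add e)
  have mult: "e * l \<in> S" for l
    using mulnat[of "nat l"] neg[OF mulnat[of "nat (- l)"]] by (cases "0 \<le> l") auto
  have "a \<in> {e * l | l. True}" if a: "a \<in> S" for a
  proof -
    have "a - e * (a div e) \<in> S" by (rule diff[OF a mult])
    then have "a mod e \<in> S" by (simp add: minus_mult_div_eq_mod)
    then have "a mod e = 0"
      using least[of "a mod e"] pos_mod_bound[OF e(1), of a] pos_mod_sign[OF e(1), of a] by linarith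
    then have "a = e * (a div e)" by auto
    then show ?thesis by blast
  qed
  with mult have "S = {e * l | l. True}" by blast
  with e(1) show ?thesis by (rule that)
qed

text \<open>The \<open>rp a\<close> represent the right cosets of the infinite cyclic group
  generated by \<open>t\<close>. The element \<open>t\<close> need not be central: in the infinite
  dihedral group, for instance, a reflection inverts it. Normality of the cyclic group is what
  \<open>conj\<close> expresses.\<close>

locale virtually_Z = group G for G (structure) +
  fixes t :: 'a and d :: nat and rp :: "nat \<Rightarrow> 'a"
  assumes t: "t \<in> carrier G" and d: "0 < d" and rp: "a < d \<Longrightarrow> rp a \<in> carrier G"
    and coord_ex: "g \<in> carrier G \<Longrightarrow> \<exists>l a. a < d \<and> g = t [^] (l::int) \<otimes> rp a"
    and coord_unique: "a < d \<Longrightarrow> b < d \<Longrightarrow> t [^] (l::int) \<otimes> rp a = t [^] (k::int) \<otimes> rp b \<Longrightarrow> l = k \<and> a = b"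
    and conj: "g \<in> carrier G \<Longrightarrow> \<exists>k. g \<otimes> t [^] (l::int) \<otimes> inv g = t [^] (k::int)"
begin

lemma tpow: "t [^] (l::int) \<in> carrier G"
  using t by simp

lemma tpow_inj: "t [^] (l::int) = t [^] (k::int) \<Longrightarrow> l = k"
  using coord_unique[OF d d, of l k] by simp

definition co :: "'a \<Rightarrow> nat" where
  "co g = (SOME a. a < d \<and> (\<exists>l. g = t [^] (l::int) \<otimes> rp a))"

definition ex :: "'a \<Rightarrow> int" where
  "ex g = (SOME l. g = t [^] (l::int) \<otimes> rp (co g))"

lemma coord: "g \<in> carrier G \<Longrightarrow> co g < d" "g \<in> carrier G \<Longrightarrow> g = t [^] ex g \<otimes> rp (co g)"
proof -
  assume g: "g \<in> carrier G"
  have "\<exists>a. a < d \<and> (\<exists>l. g = t [^] (l::int) \<otimes> rp a)" using coord_ex[OF g] by blast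
  from someI_ex[OF this] have *: "co g < d \<and> (\<exists>l. g = t [^] (l::int) \<otimes> rp (co g))"
    unfolding co_def .
  then show "co g < d" by blast
  from * have "\<exists>l. g = t [^] (l::int) \<otimes> rp (co g)" by blast
  from someI_ex[OF this] show "g = t [^] ex g \<otimes> rp (co g)" unfolding ex_def .
qed

lemma coord_eq:
  assumes a: "a < d"
  shows "co (t [^] (l::int) \<otimes> rp a) = a" "ex (t [^] l \<otimes> rp a) = l"
proof -
  have g: "t [^] l \<otimes> rp a \<in> carrier G" using tpow rp[OF a] by simp
  from coord_unique[OF a coord(1)[OF g] coord(2)[OF g]]
  show "co (t [^] (l::int) \<otimes> rp a) = a" "ex (t [^] l \<otimes> rp a) = l" by simp_all
qed

lemma coord_tpow_mult:
  assumes g: "g \<in> carrier G"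
  shows "co (t [^] (l::int) \<otimes> g) = co g" "ex (t [^] l \<otimes> g) = l + ex g"
proof -
  have "t [^] l \<otimes> g = t [^] l \<otimes> (t [^] ex g \<otimes> rp (co g))" using coord(2)[OF g] by simp
  also have "\<dots> = t [^] (l + ex g) \<otimes> rp (co g)"
    using t rp[OF coord(1)[OF g]] by (simp add: int_pow_mult m_assoc)
  finally have "t [^] l \<otimes> g = t [^] (l + ex g) \<otimes> rp (co g)" .
  then show "co (t [^] (l::int) \<otimes> g) = co g" "ex (t [^] l \<otimes> g) = l + ex g"
    using coord_eq[OF coord(1)[OF g], of "l + ex g"] by simp_all
qed

text \<open>The representation induced from the character \<open>t \<mapsto> z\<close> of the cyclic
  subgroup. In the basis of coset representatives,
  \<open>rp a \<otimes> g = t [^] l \<otimes> rp b\<close> puts \<open>z powi l\<close> at position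
  \<open>(a, b)\<close>.\<close>

definition zrep :: "complex \<Rightarrow> 'a \<Rightarrow> nat \<Rightarrow> nat \<Rightarrow> complex" where
  "zrep z g a b = (if co (rp a \<otimes> g) = b then z powi ex (rp a \<otimes> g) else 0)"

lemma zrep_unitary:
  assumes z: "cmod z = 1"
  shows "unitary_rep G d (zrep z)"
proof
  have z0: "z \<noteq> 0" using z by auto
  fix g h i k assume g: "g \<in> carrier G" and h: "h \<in> carrier G" and i: "i < d" and k: "k < d"
  let ?x = "rp i \<otimes> g" and ?j = "co (rp i \<otimes> g)"
  have x: "?x \<in> carrier G" using rp[OF i] g by simp
  note j = coord(1)[OF x]
  have y: "rp ?j \<otimes> h \<in> carrier G" using rp[OF j] h by simp
  have eq: "rp i \<otimes> (g \<otimes> h) = t [^] ex ?x \<otimes> (rp ?j \<otimes> h)"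
  proof -
    have "rp i \<otimes> (g \<otimes> h) = ?x \<otimes> h" using rp[OF i] g h by (simp add: m_assoc)
    also have "\<dots> = t [^] ex ?x \<otimes> rp ?j \<otimes> h" using coord(2)[OF x] by simp
    finally show ?thesis using tpow rp[OF j] h by (simp add: m_assoc)
  qed
  have "(\<Sum>j'<d. zrep z g i j' * zrep z h j' k) = (\<Sum>j'<d. if j' = ?j then z powi ex ?x * zrep z h ?j k else 0)"
    by (intro sum.cong refl) (auto simp: zrep_def)
  also have "\<dots> = z powi ex ?x * zrep z h ?j k" using j by simp
  also have "\<dots> = zrep z (g \<otimes> h) i k"
    unfolding zrep_def eq coord_tpow_mult[OF y] using z0 by (simp add: power_int_add)
  finally show "zrep z (g \<otimes> h) i k = (\<Sum>j'<d. zrep z g i j' * zrep z h j' k)" ..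
next
  fix g i j assume g: "g \<in> carrier G" and i: "i < d" and j: "j < d"
  have z0: "z \<noteq> 0" using z by auto
  have cz: "cnj z = inverse z"
    using z by (metis complex_norm_square inverse_unique mult.commute of_real_1 power_one)
  \<comment> \<open>Solving \<open>rp b \<otimes> h = t [^] l \<otimes> rp a\<close> for
    \<open>rp a \<otimes> inv h\<close> exchanges the cosets and negates the exponent. This is
    unitarity, because the conjugate of \<open>z\<close> is its inverse.\<close>
  have *: "co (rp a \<otimes> inv h) = b \<and> ex (rp a \<otimes> inv h) = - ex (rp b \<otimes> h)"
    if h: "h \<in> carrier G" and a: "a < d" and b: "b < d" and co: "co (rp b \<otimes> h) = a" for h a b
  proof -
    let ?l = "ex (rp b \<otimes> h)"
    have "rp b \<otimes> h = t [^] ?l \<otimes> rp a" using coord(2)[of "rp b \<otimes> h"] rp[OF b] h co by simp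
    then have "t [^] (- ?l) \<otimes> (rp b \<otimes> h) \<otimes> inv h = t [^] (- ?l) \<otimes> (t [^] ?l \<otimes> rp a) \<otimes> inv h" by simp
    moreover have "t [^] (- ?l) \<otimes> (rp b \<otimes> h) \<otimes> inv h = t [^] (- ?l) \<otimes> rp b"
      using tpow rp[OF b] h by (simp add: m_assoc)
    moreover have "t [^] (- ?l) \<otimes> (t [^] ?l \<otimes> rp a) = rp a"
    proof -
      have "t [^] (- ?l) \<otimes> (t [^] ?l \<otimes> rp a) = t [^] (- ?l + ?l) \<otimes> rp a"
        using t rp[OF a] by (simp only: int_pow_mult m_assoc[symmetric] tpow)
      then show ?thesis using rp[OF a] by simp
    qed
    ultimately have "rp a \<otimes> inv h = t [^] (- ?l) \<otimes> rp b" by simp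
    then show ?thesis using coord_eq[OF b, of "- ?l"] by simp
  qed
  show "zrep z (inv g) i j = cnj (zrep z g j i)"
  proof (cases "co (rp j \<otimes> g) = i")
    case True
    then show ?thesis using *[OF g i j True] z0
      by (simp add: zrep_def complex_cnj_power_int cz power_int_inverse power_int_minus)
  next
    case False
    have "co (rp i \<otimes> inv g) \<noteq> j"
    proof
      assume "co (rp i \<otimes> inv g) = j"
      then have "co (rp j \<otimes> inv (inv g)) = i" using *[of "inv g" j i] g i j by simp
      with False g show False by simp
    qed
    then show ?thesis using False by (simp add: zrep_def)
  qed
next
  fix i j assume i: "i < d" and j: "j < d"
  have "rp i \<otimes> \<one> = t [^] (0::int) \<otimes> rp i" using rp[OF i] by simp
  then have "co (rp i \<otimes> \<one>) = i" "ex (rp i \<otimes> \<one>) = 0" using coord_eq[OF i, of 0] by simp_all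
  then show "zrep z \<one> i j = (if i = j then 1 else 0)" by (auto simp: zrep_def)
qed

section \<open>The subgroups \<open>Z m\<close> and their cofinality\<close>

definition Z :: "nat \<Rightarrow> 'a set" where
  "Z m = {t [^] (int m * l) | l. True}"

text \<open>Conjugation sends \<open>t [^] l\<close> to a power of \<open>t\<close> and, being a
  homomorphism, sends \<open>m\<close>-th powers to \<open>m\<close>-th powers.\<close>

lemma Z_conj: "g \<in> carrier G \<Longrightarrow> x \<in> Z m \<Longrightarrow> g \<otimes> x \<otimes> inv g \<in> Z m"
proof -
  assume g: "g \<in> carrier G" and "x \<in> Z m"
  then obtain l where x: "x = t [^] (int m * l)" by (auto simp: Z_def)
  obtain k where k: "g \<otimes> t [^] l \<otimes> inv g = t [^] (k::int)" using conj[OF g] by blast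
  have pow: "g \<otimes> y [^] n \<otimes> inv g = (g \<otimes> y \<otimes> inv g) [^] n" if y: "y \<in> carrier G" for y and n :: nat
  proof (induction n)
    case (Suc n)
    have "g \<otimes> y [^] Suc n \<otimes> inv g = g \<otimes> y [^] n \<otimes> inv g \<otimes> (g \<otimes> y \<otimes> inv g)"
      using g y by (simp add: m_assoc) (metis g y inv_closed l_inv m_assoc m_closed nat_pow_closed r_one l_one)
    then show ?case by (simp add: Suc)
  qed (use g in simp)
  have "x = (t [^] l) [^] m"
    using t by (simp add: x int_pow_pow int_pow_int[symmetric] mult.commute)
  then have "g \<otimes> x \<otimes> inv g = (t [^] k) [^] m" using pow[OF tpow, of l m] k by simp
  also have "\<dots> = t [^] (int m * k)"
    using t by (simp add: int_pow_pow int_pow_int[symmetric] mult.commute)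
  finally show ?thesis unfolding Z_def by blast
qed

lemma Z_subgroup: "subgroup (Z m) G"
proof
  show "Z m \<subseteq> carrier G" using tpow by (auto simp: Z_def)
  show "\<one> \<in> Z m" unfolding Z_def by (auto intro!: exI[of _ 0])
  fix x y assume "x \<in> Z m" "y \<in> Z m"
  then obtain k l where xy: "x = t [^] (int m * k)" "y = t [^] (int m * l)" by (auto simp: Z_def)
  have "x \<otimes> y = t [^] (int m * (k + l))" using t by (simp add: xy int_pow_mult ring_distribs)
  then show "x \<otimes> y \<in> Z m" unfolding Z_def by blast
next
  fix x assume "x \<in> Z m"
  then obtain k where x: "x = t [^] (int m * k)" by (auto simp: Z_def)
  have "inv x = t [^] (int m * (- k))" using t by (simp add: x int_pow_neg)
  then show "inv x \<in> Z m" unfolding Z_def by blast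
qed

lemma Z_normal: "Z m \<lhd> G"
  unfolding normal_inv_iff using Z_subgroup Z_conj by blast

lemma tpow_mem_Z: "t [^] (k::int) \<in> Z m \<longleftrightarrow> int m dvd k"
  by (auto simp: Z_def dvd_def dest: tpow_inj)

lemma Z_index:
  assumes m: "0 < m"
  shows "Z m \<in> finite_index_normal G" "group_index G (Z m) = d * m"
proof -
  let ?f = "\<lambda>(i, a). Z m #> (t [^] int i \<otimes> rp a)"
  have f: "t [^] int i \<otimes> rp a \<in> carrier G" if "a < d" for i a using tpow rp[OF that] by blast
  have "bij_betw ?f ({..<m} \<times> {..<d}) (rcosets Z m)"
    unfolding bij_betw_def
  proof
    show "inj_on ?f ({..<m} \<times> {..<d})"
    proof (rule inj_onI, clarsimp)
      fix i a i' a' assume i: "i < m" "i' < m" and a: "a < d" "a' < d"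
        and eq: "Z m #> (t [^] int i \<otimes> rp a) = Z m #> (t [^] int i' \<otimes> rp a')"
      have "t [^] int i \<otimes> rp a \<in> Z m #> (t [^] int i' \<otimes> rp a')"
        using rcos_self[OF f[OF a(1)] Z_subgroup] eq by metis
      then obtain l where "t [^] int i \<otimes> rp a = t [^] (int m * l) \<otimes> (t [^] int i' \<otimes> rp a')"
        by (auto simp: r_coset_def Z_def)
      also have "\<dots> = t [^] (int m * l + int i') \<otimes> rp a'"
        using t rp[OF a(2)] by (simp only: int_pow_mult m_assoc tpow)
      finally have *: "int i = int m * l + int i'" "a = a'"
        using coord_unique[OF a] by blast+
      have "int i mod int m = (int m * l + int i') mod int m" using *(1) by simp
      then have "int i = int i'" using i by simp
      then show "i = i' \<and> a = a'" using *(2) by (simp only: of_nat_eq_iff)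
    qed
    show "?f ` ({..<m} \<times> {..<d}) = rcosets Z m"
    proof
      show "?f ` ({..<m} \<times> {..<d}) \<subseteq> rcosets Z m"
        using f by (auto simp: RCOSETS_def)
      show "rcosets Z m \<subseteq> ?f ` ({..<m} \<times> {..<d})"
      proof
        fix D assume "D \<in> rcosets Z m"
        then obtain g where g: "g \<in> carrier G" "D = Z m #> g" by (auto simp: RCOSETS_def)
        let ?a = "co g" and ?l = "ex g"
        define i where "i = nat (?l mod int m)"
        have i: "i < m" "int i = ?l mod int m" using m by (auto simp: i_def nat_less_iff)
        have a: "?a < d" by (rule coord[OF g(1)])
        have "?l = int m * (?l div int m) + int i" using i by simp
        then have "t [^] ?l = t [^] (int m * (?l div int m)) \<otimes> t [^] int i"
          using t by (metis int_pow_mult)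
        then have "g = t [^] (int m * (?l div int m)) \<otimes> (t [^] int i \<otimes> rp ?a)"
          using coord(2)[OF g(1)] tpow rp[OF a] by (metis m_assoc)
        then have "g \<in> Z m #> (t [^] int i \<otimes> rp ?a)" by (auto simp: r_coset_def Z_def)
        then have "D = Z m #> (t [^] int i \<otimes> rp ?a)"
          using repr_independence[OF _ f[OF a] Z_subgroup] g by metis
        then show "D \<in> ?f ` ({..<m} \<times> {..<d})" using i a by force
      qed
    qed
  qed
  from bij_betw_same_card[OF this] bij_betw_finite[OF this]
  show "Z m \<in> finite_index_normal G" "group_index G (Z m) = d * m"
    using Z_normal by (simp_all add: finite_index_normal_def group_index_def card_cartesian_product mult.commute)
qed

text \<open>By finiteness two powers of \<open>t\<close> lie in the same coset of \<open>N\<close>,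
  so the exponents that lead into \<open>N\<close> form a nonzero subgroup of the integers.\<close>

lemma finite_index_tpow:
  assumes N: "N \<in> finite_index_normal G"
  obtains m where "0 < m" "{k::int. t [^] k \<in> N} = {int m * l | l. True}"
proof -
  note F = finite_index_normalD[OF N]
  have sub: "subgroup N G" using F(1) by (rule normal_imp_subgroup)
  have "\<not> inj_on (\<lambda>i::nat. N #> t [^] int i) UNIV"
  proof
    assume "inj_on (\<lambda>i::nat. N #> t [^] int i) UNIV"
    moreover have "range (\<lambda>i::nat. N #> t [^] int i) \<subseteq> rcosets N" using tpow by (auto simp: RCOSETS_def)
    ultimately show False
      using F(2,4) by (metis finite_imageD finite_subset infinite_UNIV_nat)
  qed
  then obtain i j where ij: "i < j" "N #> t [^] int i = N #> t [^] int j"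
    unfolding inj_on_def by (metis linorder_neqE_nat)
  then have "t [^] int j \<in> N #> t [^] int i" using rcos_self[OF tpow sub] by metis
  then obtain x where x: "x \<in> N" "t [^] int j = x \<otimes> t [^] int i" by (auto simp: r_coset_def)
  have "t [^] (int j - int i) = x"
    using x subgroup.mem_carrier[OF sub x(1)] t tpow[of "int i"]
    by (metis int_pow_diff inv_solve_right' tpow)
  then have D: "int j - int i \<in> {k. t [^] k \<in> N}" "0 < int j - int i" using x ij by simp_all
  have "a - b \<in> {k. t [^] k \<in> N}" if "a \<in> {k. t [^] k \<in> N}" "b \<in> {k. t [^] k \<in> N}" for a b :: int
    using that t sub by (simp add: int_pow_diff subgroup.m_closed subgroup.m_inv_closed)
  from int_subgroup_generator[OF D this] obtain e where "0 < e" "{k::int. t [^] k \<in> N} = {e * l | l. True}"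
    by blast
  then show ?thesis using that[of "nat e"] by simp
qed

lemma Z_subset_finite_index: "N \<in> finite_index_normal G \<Longrightarrow> \<exists>k>0. Z k \<subseteq> N"
proof -
  assume "N \<in> finite_index_normal G"
  from finite_index_tpow[OF this] obtain m where "0 < m" "{k::int. t [^] k \<in> N} = {int m * l | l. True}" by blast
  then show ?thesis unfolding Z_def by (intro exI[of _ m]) blast
qed

text \<open>Together with \<open>Z_subset_finite_index\<close> this turns limits along the net into
  limits over multiples: below \<open>Z k\<close> the net consists of the \<open>Z m\<close> with
  \<open>k dvd m\<close>.\<close>

lemma finite_index_subset_Z:
  assumes M: "M \<in> finite_index_normal G" "M \<subseteq> Z k"
  shows "\<exists>m>0. k dvd m \<and> M = Z m"
proof -
  from finite_index_tpow[OF M(1)] obtain m where m: "0 < m" "{k::int. t [^] k \<in> M} = {int m * l | l. True}" by blast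
  have "M = Z m"
  proof (intro equalityI subsetI)
    fix x assume x: "x \<in> M"
    then obtain l where l: "x = t [^] (int k * l)" using M(2) unfolding Z_def by blast
    then have "int k * l \<in> {k. t [^] k \<in> M}" using x by simp
    then obtain l' where "int k * l = int m * l'" using m(2) by blast
    then show "x \<in> Z m" unfolding l Z_def by auto
  next
    fix x assume "x \<in> Z m"
    then obtain l where x: "x = t [^] (int m * l)" unfolding Z_def by blast
    have "int m * l \<in> {k. t [^] k \<in> M}" using m(2) by blast
    then show "x \<in> M" by (simp add: x)
  qed
  moreover have "t [^] int m \<in> Z m" by (simp add: tpow_mem_Z)
  ultimately have "int k dvd int m" using M(2) tpow_mem_Z[of "int m" k] by blast
  then show ?thesis using m(1) \<open>M = Z m\<close> by auto
qed

lemma Z_antimono: "k dvd m \<Longrightarrow> Z m \<subseteq> Z k"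
proof
  fix x assume "k dvd m" "x \<in> Z m"
  then obtain c l where "m = k * c" "x = t [^] (int m * l)" unfolding Z_def dvd_def by blast
  then have "x = t [^] (int k * (int c * l))" by (simp add: mult.assoc)
  then show "x \<in> Z k" unfolding Z_def by blast
qed

text \<open>The \<open>m\<close> induced representations together have the character of the regular
  representation of the quotient by \<open>Z m\<close>. A diagonal entry at \<open>a\<close> is
  nonzero only if \<open>rp a\<close> conjugates \<open>g\<close> into the cyclic group, and
  summation over the roots of unity then selects the exponents divisible by
  \<open>m\<close>.\<close>

lemma sum_charac:
  assumes m: "0 < m" and g: "g \<in> carrier G"
  shows "(\<Sum>k<m. unitary_rep.charac d (zrep (unit_root m k)) g) = (if g \<in> Z m then of_nat (d * m) else 0)"
proof -
  have [simp]: "cmod (unit_root m k) = 1" for k by (simp add: unit_root_def)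
  have ch: "unitary_rep.charac d (zrep (unit_root m k)) g = (\<Sum>a<d. zrep (unit_root m k) g a a)" for k
    by (rule unitary_rep.charac_def[OF zrep_unitary]) simp
  have inner: "(\<Sum>k<m. zrep (unit_root m k) g a a) = (if g \<in> Z m then of_nat m else 0)" if a: "a < d" for a
  proof -
    let ?x = "rp a \<otimes> g"
    have x: "?x \<in> carrier G" using rp[OF a] g by simp
    have iff: "co ?x = a \<and> int m dvd ex ?x \<longleftrightarrow> g \<in> Z m"
    proof
      assume *: "co ?x = a \<and> int m dvd ex ?x"
      then have "?x = t [^] ex ?x \<otimes> rp a" using coord(2)[OF x] by simp
      then have "g = inv (rp a) \<otimes> t [^] ex ?x \<otimes> inv (inv (rp a))"
        using rp[OF a] g tpow by (metis inv_closed inv_inv inv_solve_left m_assoc m_closed)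
      moreover have "t [^] ex ?x \<in> Z m" using * by (simp add: tpow_mem_Z)
      ultimately show "g \<in> Z m" using Z_conj[of "inv (rp a)" "t [^] ex ?x" m] rp[OF a] by simp
    next
      assume "g \<in> Z m"
      then have "rp a \<otimes> g \<otimes> inv (rp a) \<in> Z m" by (rule Z_conj[OF rp[OF a]])
      then obtain l where "rp a \<otimes> g \<otimes> inv (rp a) = t [^] (int m * l)" by (auto simp: Z_def)
      then have "?x = t [^] (int m * l) \<otimes> rp a" using rp[OF a] g by (metis inv_mult_cancel m_closed)
      then show "co ?x = a \<and> int m dvd ex ?x" using coord_eq[OF a, of "int m * l"] by simp
    qed
    have "(\<Sum>k<m. zrep (unit_root m k) g a a) = (if co ?x = a then \<Sum>k<m. unit_root m k powi ex ?x else 0)"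
      by (simp add: zrep_def)
    also have "\<dots> = (if g \<in> Z m then of_nat m else 0)"
      using iff by (auto simp: sum_unit_root_powi[OF m])
    finally show ?thesis .
  qed
  have "(\<Sum>k<m. unitary_rep.charac d (zrep (unit_root m k)) g) = (\<Sum>a<d. \<Sum>k<m. zrep (unit_root m k) g a a)"
    unfolding ch by (rule sum.swap)
  also have "\<dots> = (\<Sum>a<d. if g \<in> Z m then of_nat m else 0)"
    by (intro sum.cong refl inner) simp
  finally show ?thesis by simp
qed

end

section \<open>Infinite virtually cyclic groups\<close>

context group
begin

lemma infinite_order_inj:
  assumes h: "h \<in> carrier G" and inf: "infinite (range (\<lambda>k::int. h [^] k))"
  shows "inj (\<lambda>k::int. h [^] k)"
proof (rule ccontr)
  assume "\<not> inj (\<lambda>k::int. h [^] k)"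
  then obtain a' b' :: int where "h [^] a' = h [^] b'" "a' \<noteq> b'"
    unfolding inj_def by blast
  then have "h [^] min a' b' = h [^] max a' b'" "min a' b' < max a' b'"
    by (auto simp: min_def max_def)
  then obtain a b :: int where ab: "h [^] a = h [^] b" "a < b" by blast
  define e where "e = b - a"
  have e: "0 < e" using ab by (simp add: e_def)
  have one: "h [^] e = \<one>"
    using h ab by (simp add: e_def int_pow_diff)
  have "h [^] k = h [^] (k mod e)" for k :: int
  proof -
    have "h [^] k = h [^] (e * (k div e) + k mod e)" by simp
    also have "\<dots> = (h [^] e) [^] (k div e) \<otimes> h [^] (k mod e)"
      using h by (simp only: int_pow_mult int_pow_pow)
    finally show ?thesis using h by (simp add: one)
  qed
  then have "range (\<lambda>k::int. h [^] k) \<subseteq> (\<lambda>k::int. h [^] k) ` {0..<e}"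
    using e by (metis (no_types, lifting) atLeastLessThan_iff image_eqI image_subsetI pos_mod_bound pos_mod_sign)
  then show False using inf finite_subset by blast
qed

lemma conj_int_pow_diff:
  assumes "g \<in> carrier G" "h \<in> carrier G"
  shows "g \<otimes> h [^] (a - b :: int) \<otimes> inv g = (g \<otimes> h [^] a \<otimes> inv g) \<otimes> inv (g \<otimes> h [^] b \<otimes> inv g)"
proof -
  have "inv g \<otimes> (g \<otimes> x) = x" if "x \<in> carrier G" for x
    using that assms(1) by (simp flip: m_assoc)
  then show ?thesis using assms by (simp add: int_pow_diff inv_mult_group m_assoc)
qed

text \<open>The cyclic subgroup \<open>H\<close> of finite index need not be normal. Its generator
  is replaced by a power \<open>t = h [^] e\<close> whose conjugates all stay in \<open>H\<close>.
  The exponents with this property form the subgroup \<open>KK\<close> of the integers, so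
  \<open>t\<close> generates the normal core of \<open>H\<close>.\<close>

theorem virtually_Z_exists:
  assumes vc: "virtually_cyclic G" and inf: "infinite (carrier G)"
  shows "\<exists>t d rp. virtually_Z G t d rp"
proof -
  obtain H where H: "subgroup H G" "cyclic_group (G\<lparr>carrier := H\<rparr>)" "finite (rcosets H)"
    using vc by (auto simp: virtually_cyclic_def)
  have HG: "H \<subseteq> carrier G" using H(1) by (rule subgroup.subset)
  interpret HH: group "G\<lparr>carrier := H\<rparr>" using H(1) is_group by (rule subgroup.subgroup_is_group)
  obtain h where h: "h \<in> H" "H = range (\<lambda>n::int. h [^]\<^bsub>G\<lparr>carrier := H\<rparr>\<^esub> n)"
    using H(2) unfolding HH.cyclic_group by auto
  have hG: "h \<in> carrier G" using h HG by blast
  have H_eq: "H = range (\<lambda>n::int. h [^] n)"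
    using h(2) int_pow_consistent[OF H(1) h(1)] by simp
  have hpow: "h [^] (k::int) \<in> H" for k using H_eq by blast
  have hpowG: "h [^] (k::int) \<in> carrier G" for k using hG by simp
  have "infinite H"
  proof
    assume "finite H"
    then have "finite D" if "D \<in> rcosets H" for D using that by (auto simp: RCOSETS_def r_coset_def)
    then have "finite (\<Union> (rcosets H))" using H(3) by blast
    then show False using inf rcosets_part_G[OF H(1)] by simp
  qed
  then have inj: "inj (\<lambda>k::int. h [^] k)" using infinite_order_inj[OF hG] H_eq by simp
  define K where "K g = {k::int. g \<otimes> h [^] k \<otimes> inv g \<in> H}" for g
  have K_diff: "a - b \<in> K g" if g: "g \<in> carrier G" and "a \<in> K g" "b \<in> K g" for g a b
    using that(2,3) unfolding K_def mem_Collect_eq conj_int_pow_diff[OF g hG]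
    by (rule subgroup.m_closed[OF H(1) _ subgroup.m_inv_closed[OF H(1)]])
  define q where "q = card (rcosets H)"
  \<comment> \<open>Of the \<open>q + 1\<close> conjugated powers with exponents 0 to
    \<open>q\<close> two lie in the same coset, so a positive difference of at most \<open>q\<close>
    belongs to \<open>K g\<close>. It depends on \<open>g\<close> but always divides
    \<open>fact q\<close>, which is thus a common exponent for all \<open>g\<close>.\<close>
  have fact_K: "int (fact q) \<in> K g" if g: "g \<in> carrier G" for g
  proof -
    let ?f = "\<lambda>i::nat. H #> (g \<otimes> h [^] int i \<otimes> inv g)"
    have y: "g \<otimes> h [^] int i \<otimes> inv g \<in> carrier G" for i using g hG by simp
    have "?f ` {0..q} \<subseteq> rcosets H" using y by (auto simp: RCOSETS_def)
    then have "card (?f ` {0..q}) \<le> q" unfolding q_def by (rule card_mono[OF H(3)])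
    have "\<not> inj_on ?f {0..q}"
    proof
      assume "inj_on ?f {0..q}"
      then have "card (?f ` {0..q}) = Suc q" by (simp add: card_image)
      with \<open>card (?f ` {0..q}) \<le> q\<close> show False by simp
    qed
    then obtain i j where ij: "i \<le> q" "j \<le> q" "i < j" "?f i = ?f j"
      unfolding inj_on_def by (metis atLeastAtMost_iff linorder_neqE_nat)
    have "g \<otimes> h [^] int j \<otimes> inv g \<in> ?f i" using rcos_self[OF y H(1), of j] ij by simp
    then obtain x where x: "x \<in> H" "g \<otimes> h [^] int j \<otimes> inv g = x \<otimes> (g \<otimes> h [^] int i \<otimes> inv g)"
      by (auto simp: r_coset_def)
    have "x = (g \<otimes> h [^] int j \<otimes> inv g) \<otimes> inv (g \<otimes> h [^] int i \<otimes> inv g)"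
      unfolding x(2) using mult_inv_cancel[OF _ y[of i], of x] x(1) HG by auto
    then have e: "int j - int i \<in> K g" using x(1) by (simp add: K_def conj_int_pow_diff[OF g hG])
    have e0: "0 < int j - int i" using ij by simp
    obtain e' where e': "0 < e'" "K g = {e' * l | l. True}"
      using int_subgroup_generator[OF e e0 K_diff[OF g]] by blast
    have "e' dvd int j - int i" using e e' by auto
    moreover have "int j - int i dvd int (fact q)"
    proof -
      have "(j - i) dvd fact q" using ij by (intro dvd_fact) auto
      then have "int (j - i) dvd int (fact q)" by (simp only: of_nat_dvd_iff)
      then show ?thesis using ij by (simp add: of_nat_diff)
    qed
    ultimately have "e' dvd int (fact q)" by (rule dvd_trans)
    then show ?thesis unfolding e'(2) dvd_def by blast
  qed
  define KK where "KK = (\<Inter>g\<in>carrier G. K g)"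
  have "int (fact q) \<in> KK" using fact_K by (simp add: KK_def)
  moreover have "0 < int (fact q)" by simp
  moreover have "a - b \<in> KK" if "a \<in> KK" "b \<in> KK" for a b using that K_diff by (simp add: KK_def)
  ultimately obtain e where e: "0 < e" "KK = {e * l | l. True}" using int_subgroup_generator by blast
  define t where "t = h [^] e"
  have t: "t \<in> carrier G" by (simp add: t_def hpowG)
  have tpow: "t [^] l = h [^] (e * l)" for l :: int using hG by (simp add: t_def int_pow_pow)
  have tpowG: "t [^] (l::int) \<in> carrier G" for l using t by simp
  have t_inj: "l = k" if "t [^] l = t [^] (k::int)" for l k
    using that inj e(1) unfolding tpow inj_def by (metis mult_left_cancel less_irrefl)
  have conj: "\<exists>k. g \<otimes> t [^] l \<otimes> inv g = t [^] (k::int)" if g: "g \<in> carrier G" for g and l :: int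
  proof -
    have "e * l \<in> KK" using e(2) by blast
    then have el: "g' \<otimes> h [^] (e * l) \<otimes> inv g' \<in> H" if "g' \<in> carrier G" for g'
      using that by (simp add: KK_def K_def)
    then obtain k' :: int where k': "g \<otimes> h [^] (e * l) \<otimes> inv g = h [^] k'" using g H_eq by blast
    \<comment> \<open>Conjugating \<open>h [^] k'\<close> by \<open>g'\<close> amounts to
      conjugating \<open>h [^] (e * l)\<close> by \<open>g' \<otimes> g\<close>, which stays in
      \<open>H\<close>.\<close>
    have "k' \<in> KK"
      unfolding KK_def K_def
    proof clarify
      fix g' assume g': "g' \<in> carrier G"
      have "g' \<otimes> h [^] k' \<otimes> inv g' = (g' \<otimes> g) \<otimes> h [^] (e * l) \<otimes> inv (g' \<otimes> g)"
        unfolding k'[symmetric] using g g' hpowG by (simp add: inv_mult_group m_assoc)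
      then show "g' \<otimes> h [^] k' \<otimes> inv g' \<in> H" using el[of "g' \<otimes> g"] g g' by simp
    qed
    then obtain k where "k' = e * k" using e(2) by blast
    then show ?thesis using k' unfolding tpow by auto
  qed
  define Z where "Z = range (\<lambda>l::int. t [^] l)"
  have Z: "subgroup Z G"
  proof
    show "Z \<subseteq> carrier G" using tpowG by (auto simp: Z_def)
    show "\<one> \<in> Z" unfolding Z_def by (rule range_eqI[of _ _ 0]) simp
    fix x y assume "x \<in> Z" "y \<in> Z"
    then obtain k l :: int where "x = t [^] k" "y = t [^] l" by (auto simp: Z_def)
    then show "x \<otimes> y \<in> Z" unfolding Z_def using t by (intro range_eqI[of _ _ "k + l"]) (simp add: int_pow_mult)
  next
    fix x assume "x \<in> Z"
    then obtain k :: int where "x = t [^] k" by (auto simp: Z_def)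
    then show "inv x \<in> Z" unfolding Z_def using t by (intro range_eqI[of _ _ "- k"]) (simp add: int_pow_neg)
  qed
  define r where "r D = (SOME g. g \<in> D)" for D :: "'a set"
  have r: "r D \<in> D" if "g \<in> D" for g D unfolding r_def using that by (rule someI)
  have fin: "finite (rcosets Z)"
  proof (rule finite_subset)
    \<comment> \<open>Each coset of \<open>Z\<close> contains some
      \<open>h [^] i \<otimes> r D\<close> with \<open>0 \<le> i < e\<close>, so passing from
      \<open>H\<close> to \<open>Z\<close> multiplies the index by at most \<open>e\<close>.\<close>
    let ?g = "\<lambda>(i::int, D). Z #> (h [^] i \<otimes> r D)"
    show "finite (?g ` ({0..<e} \<times> rcosets H))" using H(3) by simp
    show "rcosets Z \<subseteq> ?g ` ({0..<e} \<times> rcosets H)"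
    proof
      fix C assume "C \<in> rcosets Z"
      then obtain g where g: "g \<in> carrier G" "C = Z #> g" by (auto simp: RCOSETS_def)
      define D where "D = H #> g"
      have D: "D \<in> rcosets H" using g by (auto simp: RCOSETS_def D_def)
      have gD: "g \<in> D" unfolding D_def by (rule rcos_self[OF g(1) H(1)])
      have rD: "r D \<in> D" by (rule r[OF gD])
      then have rG: "r D \<in> carrier G" using D rcosets_part_G[OF H(1)] by blast
      have "D = H #> r D" using repr_independence[OF _ g(1) H(1)] rD unfolding D_def by blast
      then obtain k :: int where k: "g = h [^] k \<otimes> r D" using gD H_eq by (auto simp: r_coset_def)
      define i where "i = k mod e"
      have i: "i \<in> {0..<e}" using e(1) by (simp add: i_def)
      have "h [^] k = h [^] (e * (k div e) + i)" by (simp add: i_def)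
      also have "\<dots> = t [^] (k div e) \<otimes> h [^] i" unfolding tpow using hG by (rule int_pow_mult)
      finally have "g = t [^] (k div e) \<otimes> (h [^] i \<otimes> r D)" using k tpowG hpowG rG by (simp add: m_assoc)
      then have "g \<in> Z #> (h [^] i \<otimes> r D)" by (auto simp: r_coset_def Z_def)
      then have "C = Z #> (h [^] i \<otimes> r D)"
        unfolding g(2) using repr_independence[OF _ _ Z] hpowG rG by blast
      then show "C \<in> ?g ` ({0..<e} \<times> rcosets H)" using i D by force
    qed
  qed
  define d where "d = card (rcosets Z)"
  define C where "C a = from_nat_into (rcosets Z) a" for a
  have bij: "bij_betw C {..<d} (rcosets Z)"
    using bij_betw_from_nat_into_finite[OF fin] unfolding C_def[abs_def] d_def .
  have Z_mem: "Z \<in> rcosets Z" by (rule subgroup.subgroup_in_rcosets[OF Z is_group])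
  define rp where "rp a = r (C a)" for a
  have Ca: "\<exists>g\<in>carrier G. C a = Z #> g" if "a < d" for a
  proof -
    have "C a \<in> rcosets Z" using bij that by (auto simp: bij_betw_def)
    then show ?thesis by (auto simp: RCOSETS_def)
  qed
  have rp_mem: "rp a \<in> C a" and rp: "rp a \<in> carrier G" and C_rp: "C a = Z #> rp a" if a: "a < d" for a
  proof -
    obtain g where g: "g \<in> carrier G" "C a = Z #> g" using Ca[OF a] by blast
    show mem: "rp a \<in> C a" unfolding rp_def by (rule r[of g]) (simp add: g rcos_self[OF g(1) Z])
    then show "rp a \<in> carrier G" using g r_coset_subset_G[OF subgroup.subset[OF Z] g(1)] by blast
    show "C a = Z #> rp a" using repr_independence[OF _ g(1) Z] mem unfolding g(2) by blast
  qed
  have "virtually_Z G t d rp"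
  proof
    show "t \<in> carrier G" by (rule t)
    show "0 < d" unfolding d_def using fin Z_mem by (auto simp: card_gt_0_iff)
    show "rp a \<in> carrier G" if "a < d" for a by (rule rp[OF that])
    show "\<exists>l a. a < d \<and> g = t [^] (l::int) \<otimes> rp a" if g: "g \<in> carrier G" for g
    proof -
      have "Z #> g \<in> C ` {..<d}" using bij g by (auto simp: bij_betw_def RCOSETS_def)
      then obtain a where a: "a < d" "Z #> g = C a" by auto
      have "g \<in> Z #> rp a" using rcos_self[OF g Z] a C_rp[OF a(1)] by simp
      then show ?thesis using a by (auto simp: r_coset_def Z_def)
    qed
    show "l = k \<and> a = b" if a: "a < d" and b: "b < d" and eq: "t [^] l \<otimes> rp a = t [^] k \<otimes> rp b" for a b and l k :: int
    proof -
      have "t [^] l \<otimes> rp a \<in> Z #> rp a" "t [^] k \<otimes> rp b \<in> Z #> rp b" by (auto simp: r_coset_def Z_def)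
      then have "Z #> rp a = Z #> rp b"
        using repr_independence[OF _ rp[OF a] Z] repr_independence[OF _ rp[OF b] Z] eq by metis
      then have "C a = C b" using C_rp a b by simp
      then have ab: "a = b" using bij a b by (auto simp: bij_betw_def inj_on_def)
      then have "t [^] l = t [^] k" using eq rp[OF b] tpowG by simp
      then show ?thesis using ab t_inj by blast
    qed
    show "\<exists>k. g \<otimes> t [^] l \<otimes> inv g = t [^] (k::int)" if "g \<in> carrier G" for g and l :: int
      by (rule conj[OF that])
  qed
  then show ?thesis by blast
qed

end

section \<open>Eigenvalues of Laurent polynomial matrices\<close>

text \<open>Laurent polynomials are represented through their values on the circle: a power of
  \<open>z\<close> clears the denominators. On the circle this power has modulus 1, so the moduli of
  such functions are moduli of polynomials.\<close>

definition laurent :: "(complex \<Rightarrow> complex) \<Rightarrow> bool" where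
  "laurent f \<longleftrightarrow> (\<exists>D p. \<forall>z. cmod z = 1 \<longrightarrow> z ^ D * f z = poly p z)"

lemma laurent_const: "laurent (\<lambda>z. c)"
  unfolding laurent_def by (rule exI[of _ 0], rule exI[of _ "[:c:]"]) simp

lemma laurent_add:
  assumes "laurent f" "laurent g"
  shows "laurent (\<lambda>z. f z + g z)"
proof -
  obtain D p E q where p: "\<And>z. cmod z = 1 \<Longrightarrow> z ^ D * f z = poly p z"
    and q: "\<And>z. cmod z = 1 \<Longrightarrow> z ^ E * g z = poly q z"
    using assms unfolding laurent_def by blast
  have "z ^ (D + E) * (f z + g z) = poly (Polynomial.monom 1 E * p + Polynomial.monom 1 D * q) z" if "cmod z = 1" for z
  proof -
    have "z ^ (D + E) * (f z + g z) = z ^ E * (z ^ D * f z) + z ^ D * (z ^ E * g z)"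
      by (simp add: power_add algebra_simps)
    then show ?thesis using p[OF that] q[OF that] by (simp add: poly_monom)
  qed
  then show ?thesis unfolding laurent_def by blast
qed

lemma laurent_mult:
  assumes "laurent f" "laurent g"
  shows "laurent (\<lambda>z. f z * g z)"
proof -
  obtain D p E q where p: "\<And>z. cmod z = 1 \<Longrightarrow> z ^ D * f z = poly p z"
    and q: "\<And>z. cmod z = 1 \<Longrightarrow> z ^ E * g z = poly q z"
    using assms unfolding laurent_def by blast
  have "z ^ (D + E) * (f z * g z) = poly (p * q) z" if "cmod z = 1" for z
  proof -
    have "z ^ (D + E) * (f z * g z) = (z ^ D * f z) * (z ^ E * g z)"
      by (simp add: power_add algebra_simps)
    then show ?thesis using p[OF that] q[OF that] by simp
  qed
  then show ?thesis unfolding laurent_def by blast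
qed

lemma laurent_sum: "(\<And>k. k \<in> J \<Longrightarrow> laurent (f k)) \<Longrightarrow> laurent (\<lambda>z. \<Sum>k\<in>J. f k z)"
  by (induction J rule: infinite_finite_induct) (simp_all add: laurent_const laurent_add)

lemma laurent_powi: "laurent (\<lambda>z. z powi l)"
proof (cases "0 \<le> l")
  case True
  have "z ^ 0 * z powi l = poly (Polynomial.monom 1 (nat l)) z" for z :: complex
    using True by (simp add: poly_monom power_int_def)
  then show ?thesis unfolding laurent_def by blast
next
  case False
  have "z ^ nat (- l) * z powi l = poly 1 z" if "cmod z = 1" for z :: complex
  proof -
    have "z \<noteq> 0" using that by auto
    then show ?thesis using False by (simp add: power_int_def power_inverse)
  qed
  then show ?thesis unfolding laurent_def by blast
qed

lemma laurent_cong: "laurent f \<Longrightarrow> (\<And>z. cmod z = 1 \<Longrightarrow> f z = g z) \<Longrightarrow> laurent g"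
  unfolding laurent_def by metis

definition laurent_poly :: "(complex \<Rightarrow> complex poly) \<Rightarrow> bool" where
  "laurent_poly F \<longleftrightarrow> (\<forall>k. laurent (\<lambda>z. Polynomial.coeff (F z) k))"

lemma laurent_poly_const: "laurent_poly (\<lambda>z. q)"
  by (simp add: laurent_poly_def laurent_const)

lemma laurent_poly_add: "laurent_poly F \<Longrightarrow> laurent_poly H \<Longrightarrow> laurent_poly (\<lambda>z. F z + H z)"
  by (simp add: laurent_poly_def laurent_add)

lemma laurent_poly_mult: "laurent_poly F \<Longrightarrow> laurent_poly H \<Longrightarrow> laurent_poly (\<lambda>z. F z * H z)"
  by (simp add: laurent_poly_def coeff_mult laurent_sum laurent_mult)

lemma laurent_poly_sum: "(\<And>k. k \<in> J \<Longrightarrow> laurent_poly (F k)) \<Longrightarrow> laurent_poly (\<lambda>z. \<Sum>k\<in>J. F k z)"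
  by (induction J rule: infinite_finite_induct) (simp_all add: laurent_poly_const laurent_poly_add)

lemma laurent_poly_prod: "(\<And>k. k \<in> J \<Longrightarrow> laurent_poly (F k)) \<Longrightarrow> laurent_poly (\<lambda>z. \<Prod>k\<in>J. F k z)"
  by (induction J rule: infinite_finite_induct) (simp_all add: laurent_poly_const laurent_poly_mult)

lemma laurent_char_poly:
  assumes B: "\<And>z. B z \<in> carrier_mat n n" and ent: "\<And>i j. i < n \<Longrightarrow> j < n \<Longrightarrow> laurent (\<lambda>z. B z $$ (i, j))"
  shows "laurent_poly (\<lambda>z. char_poly (B z))"
proof -
  have "char_poly (B z) = (\<Sum>p\<in>{p. p permutes {0..<n}}. signof p * (\<Prod>i = 0..<n. char_poly_matrix (B z) $$ (i, p i)))" for z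
    unfolding char_poly_def by (rule det_def') (use B in simp)
  moreover have "laurent_poly (\<lambda>z. char_poly_matrix (B z) $$ (i, j))" if ij: "i < n" "j < n" for i j
  proof -
    have eq: "char_poly_matrix (B z) $$ (i, j) = (if i = j then [:0, 1:] else 0) + [:- (B z $$ (i, j)):]" for z
      using ij B[of z] by (auto simp: char_poly_matrix_def)
    have "laurent_poly (\<lambda>z. [:- (B z $$ (i, j)):])"
      unfolding laurent_poly_def
    proof
      fix k
      have "laurent (\<lambda>z. - 1 * (B z $$ (i, j)))" by (rule laurent_mult[OF laurent_const ent[OF ij]])
      then show "laurent (\<lambda>z. Polynomial.coeff [:- (B z $$ (i, j)):] k)"
        by (cases k) (simp_all add: laurent_const)
    qed
    then show ?thesis unfolding eq by (intro laurent_poly_add laurent_poly_const)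
  qed
  moreover have "p i < n" if "p permutes {0..<n}" "i < n" for p i
    using that permutes_in_image[of p "{0..<n}" i] by simp
  ultimately show ?thesis
    by (simp only:) (intro laurent_poly_sum laurent_poly_mult laurent_poly_const laurent_poly_prod, auto)
qed

text \<open>For positive roots the sum of the reciprocals determines the smallest root up to a
  factor of at most the number of roots, and here it appears as a quotient of coefficients.\<close>

lemma prod_list_linear_coeffs:
  fixes es :: "complex list"
  assumes "0 \<notin> set es"
  shows "Polynomial.coeff (\<Prod>e\<leftarrow>es. [:- e, 1:]) 0 \<noteq> 0"
    and "Polynomial.coeff (\<Prod>e\<leftarrow>es. [:- e, 1:]) 1 =
      - Polynomial.coeff (\<Prod>e\<leftarrow>es. [:- e, 1:]) 0 * (\<Sum>e\<leftarrow>es. 1 / e)"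
proof -
  have "Polynomial.coeff (\<Prod>e\<leftarrow>es. [:- e, 1:]) 0 \<noteq> 0 \<and>
    Polynomial.coeff (\<Prod>e\<leftarrow>es. [:- e, 1:]) 1 =
      - Polynomial.coeff (\<Prod>e\<leftarrow>es. [:- e, 1:]) 0 * (\<Sum>e\<leftarrow>es. 1 / e)"
    using assms
  proof (induction es)
    case (Cons e es)
    let ?q = "\<Prod>e\<leftarrow>es. [:- e, 1:]"
    have "Polynomial.coeff ([:- e, 1:] * ?q) 0 = - e * Polynomial.coeff ?q 0"
      "Polynomial.coeff ([:- e, 1:] * ?q) 1 = - e * Polynomial.coeff ?q 1 + Polynomial.coeff ?q 0"
      by (simp_all add: coeff_pCons)
    then show ?case using Cons by (simp add: field_simps)
  qed simp
  then show "Polynomial.coeff (\<Prod>e\<leftarrow>es. [:- e, 1:]) 0 \<noteq> 0"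
    "Polynomial.coeff (\<Prod>e\<leftarrow>es. [:- e, 1:]) 1 =
      - Polynomial.coeff (\<Prod>e\<leftarrow>es. [:- e, 1:]) 0 * (\<Sum>e\<leftarrow>es. 1 / e)" by blast+
qed

lemma prod_list_filter_zero:
  fixes es :: "real list"
  shows "(\<Prod>e\<leftarrow>es. [:- complex_of_real e, 1:]) =
    Polynomial.monom 1 (count_list es 0) * (\<Prod>e\<leftarrow>filter (\<lambda>e. e \<noteq> 0) es. [:- complex_of_real e, 1:])"
  by (induction es) (auto simp: monom_Suc mult_ac monom_0)

section \<open>Polynomials on the unit circle\<close>

lemma sphere_limpt: "cmod z = 1 \<Longrightarrow> finite X \<Longrightarrow> z islimpt (sphere 0 1 - X)"
proof -
  assume z: "cmod z = 1" and X: "finite X"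
  have "connected (sphere (0::complex) 1)" by (rule connected_sphere) simp
  moreover have "\<not> (\<exists>x. sphere (0::complex) 1 = {x})"
  proof
    assume "\<exists>x. sphere (0::complex) 1 = {x}"
    moreover have "1 \<in> sphere (0::complex) 1" "-1 \<in> sphere (0::complex) 1" by simp_all
    ultimately show False by (metis one_neq_neg_one singletonD)
  qed
  ultimately have "z islimpt sphere 0 1" using z by (intro connected_imp_perfect) auto
  then have "z islimpt (X \<union> (sphere 0 1 - X))" by (rule islimpt_subset) auto
  then show ?thesis using islimpt_Un_finite[OF X] by blast
qed

lemma poly_bounded_on_sphere:
  fixes p :: "complex poly"
  obtains C where "0 < C" "\<And>z. cmod z = 1 \<Longrightarrow> cmod (poly p z) \<le> C"
proof -
  have "compact ((\<lambda>z. poly p z) ` sphere 0 1)"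
    by (intro compact_continuous_image continuous_intros) auto
  then have "bounded ((\<lambda>z. poly p z) ` sphere 0 1)" by (rule compact_imp_bounded)
  then obtain C where "\<forall>x\<in>(\<lambda>z. poly p z) ` sphere 0 1. norm x \<le> C" unfolding bounded_iff by blast
  then have "\<And>z. cmod z = 1 \<Longrightarrow> cmod (poly p z) \<le> C" by simp
  then show ?thesis by (intro that[of "\<bar>C\<bar> + 1"]) (auto intro: order_trans[of _ C])
qed

lemma poly_bounded_below_on_sphere:
  fixes p :: "complex poly"
  assumes "\<And>z. cmod z = 1 \<Longrightarrow> poly p z \<noteq> 0"
  obtains c where "0 < c" "\<And>z. cmod z = 1 \<Longrightarrow> c \<le> cmod (poly p z)"
proof -
  have "\<exists>x\<in>sphere 0 1. \<forall>y\<in>sphere 0 1. cmod (poly p x) \<le> cmod (poly p y)"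
    by (rule continuous_attains_inf) (auto intro!: continuous_intros)
  then obtain x where x: "cmod x = 1" "\<And>y. cmod y = 1 \<Longrightarrow> cmod (poly p x) \<le> cmod (poly p y)" by auto
  then show ?thesis using assms[of x] by (intro that[of "cmod (poly p x)"]) auto
qed

lemma laurent_bounded:
  assumes "laurent f"
  obtains C where "0 < C" "\<And>z. cmod z = 1 \<Longrightarrow> cmod (f z) \<le> C"
proof -
  obtain D p where p: "\<And>z. cmod z = 1 \<Longrightarrow> z ^ D * f z = poly p z"
    using assms unfolding laurent_def by blast
  have eq: "cmod (f z) = cmod (poly p z)" if "cmod z = 1" for z
    using that by (simp add: p[OF that, symmetric] norm_mult norm_power)
  show ?thesis
  proof (rule poly_bounded_on_sphere[of p])
    fix C assume C: "0 < C" "\<And>z. cmod z = 1 \<Longrightarrow> cmod (poly p z) \<le> C"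
    show thesis by (rule that[OF C(1)]) (simp add: eq C(2))
  qed
qed

lemma member_le_sum_list_nonneg:
  fixes xs :: "real list"
  assumes "x \<in> set xs" "\<forall>y\<in>set xs. 0 \<le> y"
  shows "x \<le> sum_list xs"
  using assms
proof (induction xs)
  case (Cons y ys)
  have "0 \<le> sum_list ys" using Cons.prems(2) by (intro sum_list_nonneg) simp
  moreover have "x = y \<or> x \<le> sum_list ys" using Cons by auto
  ultimately show ?case using Cons.prems(2) by auto
qed simp

lemma poly_split_common_roots:
  fixes P Q :: "complex poly"
  assumes "P \<noteq> 0"
  shows "\<exists>g p q. P = g * p \<and> Q = g * q \<and> (\<forall>z. \<not> (poly p z = 0 \<and> poly q z = 0))"
  using assms
proof (induction "Polynomial.degree P" arbitrary: P Q rule: less_induct)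
  case less
  show ?case
  proof (cases "\<exists>z. poly P z = 0 \<and> poly Q z = 0")
    case False
    then show ?thesis by (intro exI[of _ 1] exI[of _ P] exI[of _ Q]) simp
  next
    case True
    then obtain a where "[:- a, 1:] dvd P" "[:- a, 1:] dvd Q" by (auto simp: poly_eq_0_iff_dvd)
    then obtain P' Q' where PQ: "P = [:- a, 1:] * P'" "Q = [:- a, 1:] * Q'" by (auto simp: dvd_def)
    have P': "P' \<noteq> 0" using PQ(1) less.prems by auto
    have "Polynomial.degree P = Polynomial.degree [:- a, 1:] + Polynomial.degree P'"
      unfolding PQ(1) by (rule degree_mult_eq) (use P' in auto)
    then have "Polynomial.degree P' < Polynomial.degree P" by simp
    from less.hyps[OF this P', of Q'] obtain g p q where g: "P' = g * p" "Q' = g * q"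
      "\<forall>z. \<not> (poly p z = 0 \<and> poly q z = 0)" by blast
    have "P = ([:- a, 1:] * g) * p" "Q = ([:- a, 1:] * g) * q"
      unfolding PQ g(1,2) by (simp_all only: mult.assoc)
    then show ?thesis using g(3) by blast
  qed
qed

lemma count_list_all_eq: "\<forall>e\<in>set xs. e = a \<Longrightarrow> count_list xs a = length xs"
  by (induction xs) auto

text \<open>The two lowest nonzero coefficients of the characteristic polynomial have the sum of the
  reciprocals of the positive eigenvalues as quotient, up to sign. It is bounded below, so after
  cancelling common zeros its numerator has no zeros on the circle, and its denominator is \<open>p\<close>.\<close>

theorem smallest_eigenvalue_comparable:
  fixes es :: "complex \<Rightarrow> real list" and B :: "complex \<Rightarrow> complex mat"
  assumes len: "\<And>z. cmod z = 1 \<Longrightarrow> length (es z) = n"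
    and nonneg: "\<And>z e. cmod z = 1 \<Longrightarrow> e \<in> set (es z) \<Longrightarrow> 0 \<le> e"
    and cp: "\<And>z. cmod z = 1 \<Longrightarrow> char_poly (B z) = (\<Prod>e\<leftarrow>es z. [:- complex_of_real e, 1:])"
    and lau: "laurent_poly (\<lambda>z. char_poly (B z))"
    and tr: "laurent (\<lambda>z. complex_of_real (\<Sum>e\<leftarrow>es z. e))"
  shows "\<exists>k0 X p c1 c2. finite X \<and> p \<noteq> 0 \<and> 0 < c1 \<and> 0 < c2 \<and> k0 \<le> n \<and>
    (\<forall>z. cmod z = 1 \<longrightarrow> z \<notin> X \<longrightarrow> count_list (es z) 0 = k0 \<and>
      (k0 < n \<longrightarrow> (\<forall>e\<in>set (es z). 0 < e \<longrightarrow> c1 * cmod (poly p z) \<le> e) \<and>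
        (\<exists>e\<in>set (es z). 0 < e \<and> e \<le> c2 * cmod (poly p z))))"
proof -
  define c where "c k z = Polynomial.coeff (char_poly (B z)) k" for k z
  have "\<forall>k. \<exists>P. \<forall>z. cmod z = 1 \<longrightarrow> cmod (c k z) = cmod (poly P z)"
  proof
    fix k
    obtain D P where P: "\<And>z. cmod z = 1 \<Longrightarrow> z ^ D * c k z = poly P z"
      using lau unfolding laurent_poly_def laurent_def c_def by blast
    have "cmod (c k z) = cmod (poly P z)" if "cmod z = 1" for z
      using that by (simp add: P[OF that, symmetric] norm_mult norm_power)
    then show "\<exists>P. \<forall>z. cmod z = 1 \<longrightarrow> cmod (c k z) = cmod (poly P z)" by blast
  qed
  then obtain P where P: "\<And>k z. cmod z = 1 \<Longrightarrow> cmod (c k z) = cmod (poly (P k) z)" by metis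
  define pos where "pos z = filter (\<lambda>e. e \<noteq> 0) (es z)" for z
  define Q where "Q z = (\<Prod>e\<leftarrow>map complex_of_real (pos z). [:- e, 1:])" for z
  have cQ: "c (count_list (es z) 0 + j) z = Polynomial.coeff (Q z) j"
    "i < count_list (es z) 0 \<Longrightarrow> c i z = 0" if "cmod z = 1" for z i j
    unfolding c_def cp[OF that] prod_list_filter_zero[of "es z"] Q_def pos_def
    by (simp_all add: coeff_monom_mult o_def)
  have pos0: "0 \<notin> set (map complex_of_real (pos z))" for z by (auto simp: pos_def)
  have Q0: "Polynomial.coeff (Q z) 0 \<noteq> 0"
    and Q1: "Polynomial.coeff (Q z) 1 = - Polynomial.coeff (Q z) 0 * (\<Sum>e\<leftarrow>map complex_of_real (pos z). 1 / e)" for z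
    unfolding Q_def by (rule prod_list_linear_coeffs[OF pos0])+
  \<comment> \<open>The lowest index of a coefficient that does not vanish identically on the
    circle. Off the zeros of this coefficient it is the multiplicity of the eigenvalue 0.\<close>
  define k0 where "k0 = (LEAST k. \<exists>z. cmod z = 1 \<and> c k z \<noteq> 0)"
  have ex: "\<exists>z. cmod z = 1 \<and> c (count_list (es 1) 0) z \<noteq> 0"
    using cQ(1)[of 1 0] Q0[of 1] by (intro exI[of _ 1]) simp
  obtain w where w: "cmod w = 1" "c k0 w \<noteq> 0" using LeastI[of "\<lambda>k. \<exists>z. cmod z = 1 \<and> c k z \<noteq> 0", OF ex] unfolding k0_def by blast
  have below: "c k z = 0" if "k < k0" "cmod z = 1" for k z
    using not_less_Least[of k "\<lambda>k. \<exists>z. cmod z = 1 \<and> c k z \<noteq> 0"] that unfolding k0_def by blast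
  have Pk0: "P k0 \<noteq> 0" using P[OF w(1), of k0] w by auto
  define X where "X = {z. poly (P k0) z = 0}"
  have X: "finite X" unfolding X_def by (rule poly_roots_finite[OF Pk0])
  have cX: "c k0 z \<noteq> 0" if "cmod z = 1" "z \<notin> X" for z using P[OF that(1), of k0] that by (auto simp: X_def)
  have count: "count_list (es z) 0 = k0" if z: "cmod z = 1" "z \<notin> X" for z
  proof (rule antisym)
    show "count_list (es z) 0 \<le> k0" using cQ(2)[OF z(1), of k0] cX[OF z] by force
    have "c (count_list (es z) 0) z \<noteq> 0" using cQ(1)[OF z(1), of 0] Q0 by simp
    then show "k0 \<le> count_list (es z) 0" using below[OF _ z(1), of "count_list (es z) 0"] by force
  qed
  have good: "\<exists>z. cmod z = 1 \<and> z \<notin> X"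
  proof -
    have "(1::complex) islimpt (sphere 0 1 - X)" by (rule sphere_limpt[OF _ X]) simp
    then have "sphere (0::complex) 1 - X \<noteq> {}" by (metis islimpt_EMPTY)
    then show ?thesis by auto
  qed
  have k0n: "k0 \<le> n"
  proof -
    obtain z where "cmod z = 1" "z \<notin> X" using good by blast
    then show ?thesis using count[of z] len[of z] count_le_length[of "es z" 0] by simp
  qed
  show ?thesis
  proof (cases "k0 < n")
    case False
    \<comment> \<open>All eigenvalues off \<open>X\<close> vanish in this case and the conditions on
      \<open>p\<close> are vacuous, so a constant polynomial serves.\<close>
    then show ?thesis using X k0n count
      by (intro exI[of _ k0] exI[of _ X] exI[of _ 1]) auto
  next
    case True
    have pos_ne: "pos z \<noteq> []" if z: "cmod z = 1" "z \<notin> X" for z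
    proof
      assume "pos z = []"
      then have "\<forall>e\<in>set (es z). e = 0" unfolding pos_def filter_empty_conv by blast
      then have "count_list (es z) 0 = length (es z)" by (rule count_list_all_eq)
      then show False using count[OF z] len[OF z(1)] True by simp
    qed
    have pos_set: "set (pos z) = {e \<in> set (es z). 0 < e}" if "cmod z = 1" for z
      using nonneg[OF that] by (auto simp: pos_def less_le)
    define s where "s z = (\<Sum>e\<leftarrow>pos z. 1 / e)" for z
    have s_eq: "cmod (poly (P (Suc k0)) z) = cmod (poly (P k0) z) * s z" if z: "cmod z = 1" "z \<notin> X" for z
    proof -
      have s0: "0 \<le> s z"
        unfolding s_def
      proof (rule sum_list_nonneg)
        fix x assume "x \<in> set (map (\<lambda>e. 1 / e) (pos z))"
        then obtain e where "e \<in> set (pos z)" "x = 1 / e" by auto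
        moreover from this have "0 < e" unfolding pos_set[OF z(1)] by blast
        ultimately show "0 \<le> x" by simp
      qed
      have "c (Suc k0) z = - c k0 z * complex_of_real (s z)"
        using cQ(1)[OF z(1), of 1] cQ(1)[OF z(1), of 0] Q1[of z] count[OF z]
        by (simp add: s_def of_real_sum_list o_def)
      then have "cmod (c (Suc k0) z) = cmod (c k0 z) * s z" using s0 by (simp add: norm_mult)
      then show ?thesis by (simp add: P[OF z(1)])
    qed
    have e_le_s: "1 / e \<le> s z" if z: "cmod z = 1" and e: "e \<in> set (pos z)" for z e
    proof -
      have "1 / e \<in> set (map (\<lambda>e. 1 / e) (pos z))" using e by auto
      moreover have "\<forall>y\<in>set (map (\<lambda>e. 1 / e) (pos z)). 0 \<le> y"
      proof
        fix x assume "x \<in> set (map (\<lambda>e. 1 / e) (pos z))"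
        then obtain e where "e \<in> set (pos z)" "x = 1 / e" by auto
        moreover from this have "0 < e" unfolding pos_set[OF z] by blast
        ultimately show "0 \<le> x" by simp
      qed
      ultimately show ?thesis unfolding s_def by (rule member_le_sum_list_nonneg)
    qed
    have s_pos: "0 < s z" if z: "cmod z = 1" "z \<notin> X" for z
    proof -
      obtain e where e: "e \<in> set (pos z)" using pos_ne[OF z] by (cases "pos z") auto
      then have "0 < 1 / e" using pos_set[OF z(1)] by auto
      then show ?thesis using e_le_s[OF z(1) e] by linarith
    qed
    \<comment> \<open>At most \<open>n\<close> reciprocals add up to \<open>s z\<close>, so one of
      them is at least \<open>s z / n\<close>; it belongs to an eigenvalue that is as small as
      required.\<close>
    have s_le: "\<exists>e\<in>set (pos z). s z \<le> real n / e" if z: "cmod z = 1" "z \<notin> X" for z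
    proof (rule ccontr)
      assume no: "\<not> (\<exists>e\<in>set (pos z). s z \<le> real n / e)"
      have lenp: "length (pos z) \<le> n" unfolding pos_def using len[OF z(1)] by (metis length_filter_le)
      have lt: "1 / e < s z / real n" if "e \<in> set (pos z)" for e
        using no that True by (auto simp: field_simps not_le)
      have "s z < (\<Sum>e\<leftarrow>pos z. s z / real n)"
        unfolding s_def[of z] using pos_ne[OF z] lt unfolding s_def[of z] by (rule sum_list_strict_mono)
      also have "\<dots> = real (length (pos z)) * (s z / real n)" by (simp add: sum_list_triv)
      also have "\<dots> \<le> real n * (s z / real n)" using lenp s_pos[OF z] by (intro mult_right_mono) auto
      also have "\<dots> = s z" using True by simp
      finally show False by simp
    qed
    \<comment> \<open>The trace dominates every eigenvalue and is bounded on the circle, which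
      bounds \<open>s\<close> below by \<open>1 / K\<close> off \<open>X\<close>.\<close>
    obtain K where K: "0 < K" "\<And>z. cmod z = 1 \<Longrightarrow> cmod (complex_of_real (\<Sum>e\<leftarrow>es z. e)) \<le> K"
      using laurent_bounded[OF tr] by blast
    have e_le_K: "e \<le> K" if z: "cmod z = 1" and e: "e \<in> set (es z)" for z e
    proof -
      have "e \<le> (\<Sum>e\<leftarrow>es z. e)" using member_le_sum_list_nonneg[OF e] nonneg[OF z] by simp
      also have "\<dots> \<le> K" using K(2)[OF z] by simp
      finally show ?thesis .
    qed
    have "P (Suc k0) \<noteq> 0"
    proof
      assume 0: "P (Suc k0) = 0"
      obtain z where z: "cmod z = 1" "z \<notin> X" using good by blast
      then show False using s_eq[OF z] s_pos[OF z] 0 by (auto simp: X_def)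
    qed
    obtain g p q where Pp: "P k0 = g * p" and Pq: "P (Suc k0) = g * q"
      and cop: "\<And>z. \<not> (poly p z = 0 \<and> poly q z = 0)"
      using poly_split_common_roots[OF Pk0, of "P (Suc k0)"] by blast
    have p0: "p \<noteq> 0" using Pp Pk0 by auto
    have pq: "cmod (poly q z) = cmod (poly p z) * s z" and pz: "poly p z \<noteq> 0" if z: "cmod z = 1" "z \<notin> X" for z
    proof -
      have "poly g z \<noteq> 0" and "poly p z \<noteq> 0" using z Pp by (auto simp: X_def)
      then show "cmod (poly q z) = cmod (poly p z) * s z" "poly p z \<noteq> 0"
        using s_eq[OF z] by (auto simp: Pp Pq norm_mult)
    qed
    \<comment> \<open>Off \<open>X\<close> this is the lower bound for \<open>s\<close>. The
      inequality is a closed condition and the circle without finitely many points is dense in the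
      circle, so it persists on \<open>X\<close>, where a zero of \<open>q\<close> would now be a
      common zero of \<open>p\<close> and \<open>q\<close>.\<close>
    have closed: "cmod (poly p z) \<le> K * cmod (poly q z)" if z: "cmod z = 1" for z
    proof -
      let ?S = "{z. cmod (poly p z) \<le> K * cmod (poly q z)}"
      have "closed ?S" by (intro closed_Collect_le continuous_intros)
      moreover have "sphere 0 1 - X \<subseteq> ?S"
      proof
        fix y assume "y \<in> sphere 0 1 - X"
        then have y: "cmod y = 1" "y \<notin> X" by auto
        obtain e where e: "e \<in> set (pos y)" using pos_ne[OF y] by (cases "pos y") auto
        then have "0 < e" "e \<le> K" using pos_set[OF y(1)] e_le_K[OF y(1)] by auto
        then have "1 / K \<le> 1 / e" by (intro divide_left_mono) auto
        also have "\<dots> \<le> s y" by (rule e_le_s[OF y(1) e])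
        finally have "1 \<le> K * s y" using K(1) by (simp add: field_simps)
        then have "cmod (poly p y) * 1 \<le> cmod (poly p y) * (K * s y)" by (intro mult_left_mono) auto
        then show "y \<in> ?S" using pq[OF y] by (simp add: mult_ac)
      qed
      ultimately show ?thesis
        using sphere_limpt[OF z X] islimpt_subset closed_limpt by blast
    qed
    have q_nz: "poly q z \<noteq> 0" if z: "cmod z = 1" for z
    proof
      assume qz: "poly q z = 0"
      then have "poly p z = 0" using closed[OF z] by simp
      then show False using qz cop by blast
    qed
    obtain cq where cq: "0 < cq" "\<And>z. cmod z = 1 \<Longrightarrow> cq \<le> cmod (poly q z)"
      using poly_bounded_below_on_sphere[of q] q_nz by blast
    obtain Cq where Cq: "0 < Cq" "\<And>z. cmod z = 1 \<Longrightarrow> cmod (poly q z) \<le> Cq"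
      using poly_bounded_on_sphere[of q] by blast
    have main: "(\<forall>e\<in>set (es z). 0 < e \<longrightarrow> 1 / Cq * cmod (poly p z) \<le> e) \<and>
        (\<exists>e\<in>set (es z). 0 < e \<and> e \<le> real n / cq * cmod (poly p z))" if z: "cmod z = 1" "z \<notin> X" for z
    proof (intro conjI ballI impI)
      fix e assume e: "e \<in> set (es z)" "0 < e"
      then have "1 / e \<le> s z" using pos_set[OF z(1)] by (intro e_le_s[OF z(1)]) simp
      then have "1 \<le> e * s z" using e by (simp add: field_simps)
      then have "cmod (poly p z) * 1 \<le> cmod (poly p z) * (e * s z)" by (intro mult_left_mono) auto
      also have "\<dots> = e * cmod (poly q z)" using pq[OF z] by simp
      also have "\<dots> \<le> e * Cq" using e Cq(2)[OF z(1)] by (intro mult_left_mono) auto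
      finally show "1 / Cq * cmod (poly p z) \<le> e" using Cq(1) by (simp add: field_simps)
    next
      obtain e where e: "e \<in> set (pos z)" "s z \<le> real n / e" using s_le[OF z] by blast
      then have e': "e \<in> set (es z)" "0 < e" using pos_set[OF z(1)] by auto
      have "e * s z \<le> real n" using e(2) e'(2) by (simp add: field_simps)
      then have "cmod (poly p z) * (e * s z) \<le> cmod (poly p z) * real n" by (intro mult_left_mono) auto
      then have "e * cmod (poly q z) \<le> cmod (poly p z) * real n" using pq[OF z] by (simp add: mult_ac)
      moreover have "e * cq \<le> e * cmod (poly q z)" using e' cq(2)[OF z(1)] by (intro mult_left_mono) auto
      ultimately have "e * cq \<le> cmod (poly p z) * real n" by linarith
      then have "e \<le> real n / cq * cmod (poly p z)" using cq(1) by (simp add: field_simps)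
      then show "\<exists>e\<in>set (es z). 0 < e \<and> e \<le> real n / cq * cmod (poly p z)" using e' by blast
    qed
    have "0 < 1 / Cq" "0 < real n / cq" using Cq(1) cq(1) True by auto
    note pos = this
    have "\<forall>z. cmod z = 1 \<longrightarrow> z \<notin> X \<longrightarrow> count_list (es z) 0 = k0 \<and>
      (k0 < n \<longrightarrow> (\<forall>e\<in>set (es z). 0 < e \<longrightarrow> 1 / Cq * cmod (poly p z) \<le> e) \<and>
        (\<exists>e\<in>set (es z). 0 < e \<and> e \<le> real n / cq * cmod (poly p z)))"
      using main count by simp
    with X p0 pos k0n show ?thesis
      by (intro exI[of _ k0] exI[of _ X] exI[of _ p] exI[of _ "1 / Cq"] exI[of _ "real n / cq"] conjI) assumption+
  qed
qed

section \<open>Roots of unity near a point of the circle\<close>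

text \<open>The assumption keeps the bound nonnegative when the interval contains no
  integer.\<close>

lemma card_nat_interval_le:
  assumes "\<alpha> \<le> \<beta> + 1"
  shows "finite {k::nat. \<alpha> \<le> real k \<and> real k \<le> \<beta>}" "real (card {k::nat. \<alpha> \<le> real k \<and> real k \<le> \<beta>}) \<le> \<beta> - \<alpha> + 1"
proof -
  let ?K = "{k::nat. \<alpha> \<le> real k \<and> real k \<le> \<beta>}"
  have "int ` ?K \<subseteq> {\<lceil>\<alpha>\<rceil>..\<lfloor>\<beta>\<rfloor>}" by (auto simp: ceiling_le_iff le_floor_iff)
  note sub = this
  have fin: "finite (int ` ?K)" by (rule finite_subset[OF sub]) simp
  have "card (int ` ?K) \<le> card {\<lceil>\<alpha>\<rceil>..\<lfloor>\<beta>\<rfloor>}" by (rule card_mono[OF _ sub]) simp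
  then have "card ?K \<le> nat (\<lfloor>\<beta>\<rfloor> - \<lceil>\<alpha>\<rceil> + 1)" by (simp add: card_image)
  moreover have "real (nat (\<lfloor>\<beta>\<rfloor> - \<lceil>\<alpha>\<rceil> + 1)) \<le> \<beta> - \<alpha> + 1"
  proof (cases "0 \<le> \<lfloor>\<beta>\<rfloor> - \<lceil>\<alpha>\<rceil> + 1")
    case True
    then have "real (nat (\<lfloor>\<beta>\<rfloor> - \<lceil>\<alpha>\<rceil> + 1)) = of_int \<lfloor>\<beta>\<rfloor> - of_int \<lceil>\<alpha>\<rceil> + 1" by simp
    also have "\<dots> \<le> \<beta> - \<alpha> + 1" using of_int_floor_le[of \<beta>] le_of_int_ceiling[of \<alpha>] by linarith
    finally show ?thesis .
  qed (use assms in simp)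
  ultimately show "real (card ?K) \<le> \<beta> - \<alpha> + 1" by (meson of_nat_mono order_trans)
  show "finite ?K" using fin by (rule finite_imageD) simp
qed

lemma card_nat_interval_ge:
  assumes "0 \<le> \<alpha>" and A: "finite A" "{k::nat. \<alpha> \<le> real k \<and> real k \<le> \<beta>} \<subseteq> A"
  shows "\<beta> - \<alpha> - 1 \<le> real (card A)"
proof (cases "\<alpha> \<le> \<beta>")
  case True
  have a0: "0 \<le> \<lceil>\<alpha>\<rceil>" using assms(1) by simp
  have "{nat \<lceil>\<alpha>\<rceil>..<nat (\<lfloor>\<beta>\<rfloor> + 1)} \<subseteq> A"
  proof
    fix k assume k: "k \<in> {nat \<lceil>\<alpha>\<rceil>..<nat (\<lfloor>\<beta>\<rfloor> + 1)}"
    then have "\<lceil>\<alpha>\<rceil> \<le> int k" "int k \<le> \<lfloor>\<beta>\<rfloor>" unfolding atLeastLessThan_iff by linarith+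
    then have "\<alpha> \<le> real k" "real k \<le> \<beta>" by (auto simp: ceiling_le_iff le_floor_iff)
    then show "k \<in> A" using A(2) by blast
  qed
  then have "card {nat \<lceil>\<alpha>\<rceil>..<nat (\<lfloor>\<beta>\<rfloor> + 1)} \<le> card A" by (rule card_mono[OF A(1)])
  moreover have "\<beta> - \<alpha> - 1 \<le> real (nat (\<lfloor>\<beta>\<rfloor> + 1) - nat \<lceil>\<alpha>\<rceil>)"
    using a0 by linarith
  ultimately show ?thesis by simp
qed simp

lemma cmod_cis_diff: "cmod (cis a - cis b) = 2 * \<bar>sin ((a - b) / 2)\<bar>"
proof -
  have "(cmod (cis a - cis b))\<^sup>2 = (cos a - cos b)\<^sup>2 + (sin a - sin b)\<^sup>2"
    by (simp add: cmod_power2)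
  also have "\<dots> = ((cos a)\<^sup>2 + (sin a)\<^sup>2) + ((cos b)\<^sup>2 + (sin b)\<^sup>2) - 2 * (cos a * cos b + sin a * sin b)"
    by (simp add: power2_eq_square algebra_simps)
  also have "\<dots> = 2 - 2 * cos (a - b)"
    by (simp add: cos_diff)
  also have "cos (a - b) = 1 - 2 * (sin ((a - b) / 2))\<^sup>2"
  proof -
    have "2 * ((a - b) / 2) = a - b" by simp
    then show ?thesis using cos_double_sin[of "(a - b) / 2"] by metis
  qed
  finally have "(cmod (cis a - cis b))\<^sup>2 = (2 * \<bar>sin ((a - b) / 2)\<bar>)\<^sup>2"
    by (simp add: power_mult_distrib)
  then show ?thesis by (rule power2_eq_imp_eq) auto
qed

text \<open>By Maclaurin's bound the error of the linear approximation is at most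
  \<open>x ^ 3 / 6\<close>, which for \<open>x \<le> 2\<close> is at most two thirds of
  \<open>x\<close>.\<close>

lemma sin_ge_third:
  assumes "0 \<le> x" "x \<le> pi / 2"
  shows "x / 3 \<le> sin x"
proof -
  have "\<bar>sin x - (\<Sum>m<3. sin_coeff m * x ^ m)\<bar> \<le> inverse (fact 3) * \<bar>x\<bar> ^ 3"
    by (rule Maclaurin_sin_bound)
  moreover have "(\<Sum>m<3. sin_coeff m * x ^ m) = x"
    by (simp add: numeral_eq_Suc sin_coeff_def)
  moreover have "inverse (fact 3) * \<bar>x\<bar> ^ 3 \<le> 2 / 3 * x"
  proof -
    have "x \<le> 2" using assms pi_less_4 by linarith
    then have "x * x \<le> 2 * 2" using assms by (intro mult_mono) auto
    then have "x * (x * x) \<le> x * 4" using assms by (intro mult_left_mono) auto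
    then show ?thesis using assms by (simp add: power3_eq_cube fact_numeral field_simps)
  qed
  ultimately show ?thesis by linarith
qed

lemma norm_unit_root [simp]: "cmod (unit_root m k) = 1"
  by (simp add: unit_root_def)

lemma unit_root_pow: "0 < m \<Longrightarrow> unit_root m k ^ m = 1"
proof -
  assume m: "0 < m"
  have "unit_root m k ^ m = cis (2 * pi * real_of_int (int k))"
    unfolding unit_root_def Complex.DeMoivre using m by (intro arg_cong[of _ _ cis]) simp
  then show ?thesis by (simp only: cis_multiple_2pi Ints_of_int)
qed

lemma unit_root_inj: "inj_on (unit_root m) {..<m}"
proof (rule inj_onI)
  fix i j assume ij: "i \<in> {..<m}" "j \<in> {..<m}" and eq: "unit_root m i = unit_root m j"
  let ?x = "(2 * pi * real i / real m - 2 * pi * real j / real m) / 2"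
  have m: "0 < real m" using ij by auto
  have "sin ?x = 0" using eq cmod_cis_diff[of "2 * pi * real i / real m" "2 * pi * real j / real m"]
    by (simp add: unit_root_def)
  then obtain n :: int where n: "?x = of_int n * pi" by (auto simp: sin_zero_iff_int2)
  have "?x = pi * ((real i - real j) / real m)" by (simp add: diff_divide_distrib right_diff_distrib)
  then have "pi * ((real i - real j) / real m) = pi * of_int n" using n by (simp only: mult.commute)
  then have "(real i - real j) / real m = of_int n" by (simp only: mult_cancel_left) simp
  then have "real i - real j = of_int n * real m" using m by (simp add: divide_eq_eq)
  then have eqn: "int i - int j = n * int m" by (metis of_int_diff of_int_eq_iff of_int_mult of_int_of_nat_eq)
  moreover have "\<bar>int i - int j\<bar> < int m" using ij by auto
  ultimately have "int m dvd int i - int j" "\<bar>int i - int j\<bar> < int m" by simp_all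
  then have "int i - int j = 0" by (metis dvd_imp_le_int not_le abs_of_nat)
  then show "i = j" by simp
qed

text \<open>The angles of nearby points lie in an interval around the angle of \<open>z\<close> or,
  because angles are cut at 0, in a piece at either end of the range from 0 to
  \<open>2 * pi\<close>. Each of the three intervals may contain one integer more than its scaled
  length, whence the summand 3.\<close>

lemma unit_root_near_card_le:
  assumes z: "cmod z = 1" and \<rho>: "0 \<le> \<rho>" and m: "0 < m"
  shows "real (card {k. k < m \<and> cmod (unit_root m k - z) \<le> \<rho>}) \<le> 2 * \<rho> * real m + 3"
proof -
  obtain \<theta> where \<theta>: "0 \<le> \<theta>" "\<theta> < 2 * pi" "z = cis \<theta>"
  proof -
    have "z = rcis (cmod z) (Arg2pi z)" using Arg2pi_eq[of z] by (simp add: rcis_def cis_conv_exp)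
    then show ?thesis using that[of "Arg2pi z"] z Arg2pi_ge_0[of z] Arg2pi_lt_2pi[of z] by (simp add: rcis_def)
  qed
  \<comment> \<open>With \<open>2 * \<bar>sin x\<bar> \<le> \<rho>\<close> for half the angle
    difference \<open>x\<close>, \<open>sin_ge_third\<close> shows that \<open>\<bar>x\<bar>\<close>
    or \<open>pi - \<bar>x\<bar>\<close> is at most \<open>w\<close>.\<close>
  define w where "w = 3 * \<rho> / 2"
  have w: "0 \<le> w" using \<rho> by (simp add: w_def)
  define I where "I \<alpha> \<beta> = {k::nat. \<alpha> \<le> real k \<and> real k \<le> \<beta>}" for \<alpha> \<beta>
  define f where "f y = y * real m / (2 * pi)" for y
  have mp: "0 < real m / (2 * pi)" using m by simp
  have f_mono: "f x \<le> f y \<longleftrightarrow> x \<le> y" for x y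
    using mult_le_cancel_right_pos[OF mp, of x y] by (simp add: f_def)
  have f_root: "f (2 * pi * real k / real m) = real k" for k using m by (simp add: f_def)
  have sub: "{k. k < m \<and> cmod (unit_root m k - z) \<le> \<rho>} \<subseteq>
     I (f (\<theta> - 2 * w)) (f (\<theta> + 2 * w)) \<union> (I (f (\<theta> + 2 * pi - 2 * w)) (f (2 * pi)) \<union> I 0 (f (\<theta> - 2 * pi + 2 * w)))"
  proof
    fix k assume "k \<in> {k. k < m \<and> cmod (unit_root m k - z) \<le> \<rho>}"
    then have k: "k < m" "cmod (unit_root m k - z) \<le> \<rho>" by auto
    define a where "a = 2 * pi * real k / real m"
    have a: "0 \<le> a" "a < 2 * pi" using k(1) m by (auto simp: a_def field_simps)
    have fa: "f a = real k" unfolding a_def by (rule f_root)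
    define x where "x = (a - \<theta>) / 2"
    have x: "- pi < x" "x < pi" using a \<theta> by (auto simp: x_def)
    have s: "2 * \<bar>sin x\<bar> \<le> \<rho>" using k(2) cmod_cis_diff[of a \<theta>] by (simp add: unit_root_def \<theta>(3) a_def x_def)
    have "\<bar>x\<bar> \<le> w \<or> pi - \<bar>x\<bar> \<le> w"
    proof (cases "\<bar>x\<bar> \<le> pi / 2")
      case True
      then have "\<bar>x\<bar> / 3 \<le> sin \<bar>x\<bar>" by (intro sin_ge_third) auto
      also have "sin \<bar>x\<bar> \<le> \<bar>sin x\<bar>" by (cases "0 \<le> x") auto
      finally show ?thesis using s by (simp add: w_def)
    next
      case False
      then have "(pi - \<bar>x\<bar>) / 3 \<le> sin (pi - \<bar>x\<bar>)" using x by (intro sin_ge_third) auto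
      also have "sin (pi - \<bar>x\<bar>) \<le> \<bar>sin x\<bar>" by (cases "0 \<le> x") auto
      finally show ?thesis using s by (simp add: w_def)
    qed
    moreover have "a = \<theta> + 2 * x" by (simp add: x_def field_simps)
    ultimately have "(\<theta> - 2 * w \<le> a \<and> a \<le> \<theta> + 2 * w) \<or> \<theta> + 2 * pi - 2 * w \<le> a \<or> a \<le> \<theta> - 2 * pi + 2 * w"
      by arith
    then consider "\<theta> - 2 * w \<le> a \<and> a \<le> \<theta> + 2 * w" | "\<theta> + 2 * pi - 2 * w \<le> a" | "a \<le> \<theta> - 2 * pi + 2 * w"
      by blast
    then show "k \<in> I (f (\<theta> - 2 * w)) (f (\<theta> + 2 * w)) \<union> (I (f (\<theta> + 2 * pi - 2 * w)) (f (2 * pi)) \<union> I 0 (f (\<theta> - 2 * pi + 2 * w)))"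
      using a by cases (auto simp: I_def f_mono simp flip: fa)
  qed
  have cI: "finite (I \<alpha> \<beta>) \<and> real (card (I \<alpha> \<beta>)) \<le> \<gamma> + 1" if "\<beta> - \<alpha> \<le> \<gamma>" "0 \<le> \<gamma>" for \<alpha> \<beta> \<gamma>
  proof (cases "\<alpha> \<le> \<beta> + 1")
    case True
    from card_nat_interval_le[OF this] that show ?thesis unfolding I_def by auto
  next
    case False
    then have "I \<alpha> \<beta> = {}" by (auto simp: I_def)
    then show ?thesis using that by simp
  qed
  define \<gamma> where "\<gamma> = f (2 * w)"
  have \<gamma>0: "0 \<le> \<gamma>" using w m by (simp add: \<gamma>_def f_def)
  have f_lin: "f (x + y) = f x + f y" "f (x - y) = f x - f y" for x y
    by (simp_all add: f_def ring_distribs add_divide_distrib diff_divide_distrib)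
  have f2: "f (2 * w) = \<gamma>" by (simp add: \<gamma>_def)
  have f\<theta>: "0 \<le> f \<theta>" "f \<theta> \<le> f (2 * pi)" using \<theta> m f_mono[of \<theta> "2 * pi"] by (auto simp: f_def)
  have c1: "finite (I (f (\<theta> - 2 * w)) (f (\<theta> + 2 * w))) \<and> real (card (I (f (\<theta> - 2 * w)) (f (\<theta> + 2 * w)))) \<le> 2 * \<gamma> + 1"
    by (rule cI) (use \<gamma>0 in \<open>simp_all add: f_lin f2\<close>)
  have c2: "finite (I (f (\<theta> + 2 * pi - 2 * w)) (f (2 * pi))) \<and> real (card (I (f (\<theta> + 2 * pi - 2 * w)) (f (2 * pi)))) \<le> \<gamma> + 1"
    by (rule cI) (use \<gamma>0 f\<theta> in \<open>simp_all add: f_lin f2\<close>)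
  have c3: "finite (I 0 (f (\<theta> - 2 * pi + 2 * w))) \<and> real (card (I 0 (f (\<theta> - 2 * pi + 2 * w)))) \<le> \<gamma> + 1"
    by (rule cI) (use \<gamma>0 f\<theta> in \<open>simp_all add: f_lin f2\<close>)
  have "card {k. k < m \<and> cmod (unit_root m k - z) \<le> \<rho>} \<le>
     card (I (f (\<theta> - 2 * w)) (f (\<theta> + 2 * w)) \<union> (I (f (\<theta> + 2 * pi - 2 * w)) (f (2 * pi)) \<union> I 0 (f (\<theta> - 2 * pi + 2 * w))))"
    by (rule card_mono[OF _ sub]) (use c1 c2 c3 in simp)
  also have "\<dots> \<le> card (I (f (\<theta> - 2 * w)) (f (\<theta> + 2 * w))) + (card (I (f (\<theta> + 2 * pi - 2 * w)) (f (2 * pi))) + card (I 0 (f (\<theta> - 2 * pi + 2 * w))))"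
    by (meson add_left_mono card_Un_le order_trans)
  finally have "real (card {k. k < m \<and> cmod (unit_root m k - z) \<le> \<rho>}) \<le> 4 * \<gamma> + 3"
    using c1 c2 c3 by linarith
  also have "4 * \<gamma> \<le> 2 * \<rho> * real m"
  proof -
    have "4 * \<gamma> = 6 * \<rho> * real m / pi" by (simp add: \<gamma>_def f_def w_def field_simps)
    also have "\<dots> \<le> 6 * \<rho> * real m / 3" using \<rho> pi_gt3 by (intro divide_left_mono) auto
    finally show ?thesis by simp
  qed
  finally show ?thesis by simp
qed

text \<open>Chords are at most as long as arcs, so angles within \<rho> suffice. Only one side of
  the angle of \<open>z\<close> is used, namely the side on which the cut at 0 is not crossed; 7 is
  an upper bound for \<open>2 * pi\<close>.\<close>

lemma unit_root_near_card_ge: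
  assumes z: "cmod z = 1" and \<rho>: "0 \<le> \<rho>" "\<rho> \<le> 1"
  shows "\<rho> * real m / 7 - 1 \<le> real (card {k. k < m \<and> cmod (unit_root m k - z) \<le> \<rho>})"
proof (cases "m = 0")
  case False
  then have m: "0 < real m" by simp
  obtain \<theta> where \<theta>: "0 \<le> \<theta>" "\<theta> < 2 * pi" "z = cis \<theta>"
  proof -
    have "z = rcis (cmod z) (Arg2pi z)" using Arg2pi_eq[of z] by (simp add: rcis_def cis_conv_exp)
    then show ?thesis using that[of "Arg2pi z"] z Arg2pi_ge_0[of z] Arg2pi_lt_2pi[of z] by (simp add: rcis_def)
  qed
  let ?A = "{k. k < m \<and> cmod (unit_root m k - z) \<le> \<rho>}"
  have fin: "finite ?A" by simp
  have near: "cmod (unit_root m k - z) \<le> \<bar>2 * pi * real k / real m - \<theta>\<bar>" for k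
    unfolding unit_root_def \<theta>(3) cmod_cis_diff
    using abs_sin_x_le_abs_x[of "(2 * pi * real k / real m - \<theta>) / 2"] by simp
  have main: "(b - a) * real m / (2 * pi) - 1 \<le> real (card ?A)"
    if ab: "0 \<le> a" "b < 2 * pi" "\<theta> - \<rho> \<le> a" "b \<le> \<theta> + \<rho>" for a b
  proof -
    have "{k::nat. a * real m / (2 * pi) \<le> real k \<and> real k \<le> b * real m / (2 * pi)} \<subseteq> ?A"
    proof
      fix k :: nat assume "k \<in> {k. a * real m / (2 * pi) \<le> real k \<and> real k \<le> b * real m / (2 * pi)}"
      then have "a \<le> 2 * pi * real k / real m" "2 * pi * real k / real m \<le> b"
        using m by (auto simp: field_simps)
      moreover from this have "2 * pi * real k / real m < 2 * pi * 1" using ab by linarith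
      then have "real k < real m" using m by (simp add: field_simps)
      ultimately show "k \<in> ?A" using near[of k] ab by auto
    qed
    from card_nat_interval_ge[OF _ fin this] ab show ?thesis
      by (simp add: left_diff_distrib diff_divide_distrib)
  qed
  have le: "\<rho> * real m / 7 \<le> \<rho> * real m / (2 * pi)"
    using \<rho> m pi_less_4 pi_approx by (intro divide_left_mono) (auto simp: algebra_simps)
  show ?thesis
  proof (cases "\<theta> \<le> pi")
    case True
    have "(\<theta> + \<rho> - \<theta>) * real m / (2 * pi) - 1 \<le> real (card ?A)"
      by (rule main) (use True \<theta> \<rho> pi_gt3 in auto)
    then show ?thesis using le by simp
  next
    case False
    have "(\<theta> - (\<theta> - \<rho>)) * real m / (2 * pi) - 1 \<le> real (card ?A)"
      by (rule main) (use False \<theta> \<rho> pi_gt3 in auto)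
    then show ?thesis using le by simp
  qed
qed simp

section \<open>Separation of roots of unity\<close>

lemma norm_root_of_unity:
  assumes "(y::complex) ^ m = 1" "0 < m"
  shows "cmod y = 1"
proof (rule power_eq_imp_eq_base)
  show "cmod y ^ m = 1 ^ m" using assms by (simp flip: norm_power)
qed (use assms in auto)

text \<open>For \<open>y = \<omega> / z \<noteq> 1\<close> the powers of \<open>y\<close> sum to 0,
  so the \<open>m\<close> numbers \<open>1 - y ^ k\<close> sum to \<open>m\<close>, while each of
  them has modulus at most \<open>m * cmod (1 - y)\<close>.\<close>

lemma root_of_unity_separation:
  fixes \<omega> z :: complex
  assumes m: "0 < m" and \<omega>: "\<omega> ^ m = 1" and z: "z ^ m = 1" and ne: "\<omega> \<noteq> z"
  shows "1 / real m \<le> cmod (\<omega> - z)"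
proof -
  note norm1 = norm_root_of_unity[OF _ m]
  have z0: "z \<noteq> 0" using z m by (auto simp: power_0_left)
  define y where "y = \<omega> / z"
  have y: "y ^ m = 1" "y \<noteq> 1" using \<omega> z ne z0 by (simp_all add: y_def power_divide)
  have "(\<Sum>k<m. y ^ k) = 0" using geometric_sum[OF y(2), of m] y(1) by simp
  then have "(\<Sum>k<m. 1 - y ^ k) = of_nat m" by (simp add: sum_subtractf)
  then have "real m = cmod (\<Sum>k<m. 1 - y ^ k)" by simp
  also have "\<dots> \<le> (\<Sum>k<m. real m * cmod (1 - y))"
  proof (rule sum_norm_le)
    fix k assume k: "k \<in> {..<m}"
    have "cmod (1 ^ k - y ^ k) \<le> real k * cmod (1 - y)"
      by (rule norm_power_diff) (use norm1[OF y(1)] in auto)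
    also have "\<dots> \<le> real m * cmod (1 - y)" using k by (intro mult_right_mono) auto
    finally show "cmod (1 - y ^ k) \<le> real m * cmod (1 - y)" by simp
  qed
  also have "\<dots> = real m * (real m * cmod (1 - y))" by simp
  finally have "1 \<le> real m * cmod (1 - y)" using m by simp
  moreover have "cmod (1 - y) = cmod (\<omega> - z)"
  proof -
    have "\<omega> - z = - z * (1 - y)" using z0 by (simp add: y_def field_simps)
    then show ?thesis using norm1[OF z] by (simp add: norm_mult)
  qed
  ultimately show ?thesis using m by (simp add: field_simps)
qed

text \<open>Let \<open>k'\<close> kill the roots of unity in \<open>S\<close>. If \<open>z ^ (k' * j)\<close> is close to \<open>1\<close> for some other
  \<open>z \<in> S\<close>, for each of \<open>card S + 1\<close> consecutive \<open>j\<close>, then the same \<open>z\<close> serves for two of them, and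
  \<open>z ^ (k' * h)\<close> is close to \<open>1\<close> for their difference \<open>h \<le> card S\<close>.\<close>

lemma roots_of_unity_avoid:
  fixes S :: "complex set"
  assumes fin: "finite S" and z1: "\<And>z. z \<in> S \<Longrightarrow> cmod z = 1" and k: "0 < k"
  obtains k' \<delta> where "0 < k'" "k dvd k'" "0 < \<delta>"
    "\<And>M. \<exists>j>M. \<forall>z\<in>S. \<forall>\<omega>. \<omega> ^ (k' * j) = 1 \<longrightarrow> \<omega> \<noteq> z \<longrightarrow> \<delta> / real (k' * j) \<le> cmod (\<omega> - z)"
proof -
  define S1 where "S1 = {z \<in> S. \<exists>q>0. z ^ q = 1}"
  define S2 where "S2 = S - S1"
  have fin': "finite S1" "finite S2" using fin by (auto simp: S1_def S2_def)
  define od where "od z = (SOME q. 0 < q \<and> z ^ q = 1)" for z :: complex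
  have od: "0 < od z" "z ^ od z = 1" if "z \<in> S1" for z
  proof -
    have "\<exists>q. 0 < q \<and> z ^ q = 1" using that by (auto simp: S1_def)
    from someI_ex[OF this] show "0 < od z" "z ^ od z = 1" unfolding od_def by auto
  qed
  \<comment> \<open>Every root of unity in \<open>S\<close> is then an \<open>m\<close>-th root of
    unity for \<open>m = k' * j\<close>, so \<open>root_of_unity_separation\<close> applies to
    it.\<close>
  define k' where "k' = k * (\<Prod>z\<in>S1. od z)"
  have k': "0 < k'" using k od fin' by (simp add: k'_def prod_pos)
  have k'1: "z ^ (k' * j) = 1" if "z \<in> S1" for z j
  proof -
    have "od z dvd k' * j" unfolding k'_def using fin' that by (intro dvd_mult2 dvd_mult) (auto intro: dvd_prodI)
    then obtain c where "k' * j = od z * c" by (auto simp: dvd_def)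
    then show ?thesis using od[OF that] by (simp add: power_mult)
  qed
  define s where "s = card S2"
  \<comment> \<open>The distances of \<open>z ^ (k' * h)\<close> from 1 for the differences
    \<open>h\<close> that the pigeonhole argument can produce. They are positive because
    \<open>S2\<close> contains no roots of unity. The element 1 keeps the set nonempty and \<delta>
    at most 1.\<close>
  define D where "D = insert 1 ((\<lambda>(z, h). cmod (z ^ (k' * h) - 1)) ` (S2 \<times> {1..s}))"
  have finD: "finite D" "D \<noteq> {}" using fin' by (auto simp: D_def)
  have D_pos: "0 < x" if "x \<in> D" for x
  proof -
    have "cmod (z ^ (k' * h) - 1) \<noteq> 0" if "z \<in> S2" "1 \<le> h" for z h
    proof
      assume "cmod (z ^ (k' * h) - 1) = 0"
      moreover have "0 < k' * h" using k' that by simp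
      ultimately have "z ^ (k' * h) = 1" "0 < k' * h" by simp_all
      then have "\<exists>q>0. z ^ q = 1" by blast
      then show False using that(1) unfolding S2_def S1_def by blast
    qed
    then show ?thesis using that by (auto simp: D_def)
  qed
  define \<delta> where "\<delta> = Min D / 2"
  have \<delta>: "0 < \<delta>" using D_pos Min_in[OF finD] by (simp add: \<delta>_def)
  have \<delta>1: "\<delta> \<le> 1" using Min_le[OF finD(1), of 1] \<delta> by (simp add: \<delta>_def D_def)
  have \<delta>h: "2 * \<delta> \<le> cmod (z ^ (k' * h) - 1)" if "z \<in> S2" "1 \<le> h" "h \<le> s" for z h
    using Min_le[OF finD(1), of "cmod (z ^ (k' * h) - 1)"] that by (force simp: \<delta>_def D_def)
  have good: "\<exists>j>M. \<forall>z\<in>S2. \<delta> \<le> cmod (z ^ (k' * j) - 1)" for M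
  proof (rule ccontr)
    assume "\<not> ?thesis"
    then have "\<forall>j\<in>{M<..M + s + 1}. \<exists>z\<in>S2. cmod (z ^ (k' * j) - 1) < \<delta>" by (auto simp: not_le)
    then obtain f where f: "\<And>j. j \<in> {M<..M + s + 1} \<Longrightarrow> f j \<in> S2 \<and> cmod (f j ^ (k' * j) - 1) < \<delta>"
      by metis
    have lt: False if ij: "i \<in> {M<..M + s + 1}" "j \<in> {M<..M + s + 1}" "f i = f j" "i < j" for i j
    proof -
      let ?z = "f i"
      have z: "?z \<in> S2" using f[OF ij(1)] by simp
      have n1: "cmod ?z = 1" using z z1 by (simp add: S2_def)
      have "?z ^ (k' * j) = ?z ^ (k' * i) * ?z ^ (k' * (j - i))"
        using ij(4) by (simp flip: power_add add: add_mult_distrib2[symmetric])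
      then have "?z ^ (k' * i) * (?z ^ (k' * (j - i)) - 1) = ?z ^ (k' * j) - ?z ^ (k' * i)"
        by (simp add: algebra_simps)
      then have "cmod (?z ^ (k' * i) * (?z ^ (k' * (j - i)) - 1)) = cmod ((?z ^ (k' * j) - 1) - (?z ^ (k' * i) - 1))"
        by simp
      then have "cmod (?z ^ (k' * (j - i)) - 1) = cmod ((?z ^ (k' * j) - 1) - (?z ^ (k' * i) - 1))"
        by (simp add: norm_mult norm_power n1)
      also have "\<dots> \<le> cmod (?z ^ (k' * j) - 1) + cmod (?z ^ (k' * i) - 1)" by (rule norm_triangle_ineq4)
      also have "\<dots> < 2 * \<delta>" using f[OF ij(1)] f[OF ij(2)] ij(3) by simp
      finally have "cmod (?z ^ (k' * (j - i)) - 1) < 2 * \<delta>" .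
      moreover have "1 \<le> j - i" "j - i \<le> s" using ij by auto
      ultimately show False using \<delta>h[OF z, of "j - i"] by linarith
    qed
    have "inj_on f {M<..M + s + 1}"
    proof (rule inj_onI)
      fix i j assume "i \<in> {M<..M + s + 1}" "j \<in> {M<..M + s + 1}" "f i = f j"
      then show "i = j" using lt[of i j] lt[of j i] by (cases i j rule: linorder_cases) auto
    qed
    then have "card (f ` {M<..M + s + 1}) = s + 1" by (simp add: card_image)
    moreover have "f ` {M<..M + s + 1} \<subseteq> S2" using f by blast
    ultimately have "s + 1 \<le> s" unfolding s_def using card_mono[OF fin'(2)] by metis
    then show False by simp
  qed
  show ?thesis
  proof (rule that[of k' \<delta>])
    show "k dvd k'" by (simp add: k'_def)
    fix M
    obtain j where j: "j > M" "\<And>z. z \<in> S2 \<Longrightarrow> \<delta> \<le> cmod (z ^ (k' * j) - 1)" using good by blast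
    have m: "0 < k' * j" using k' j(1) by simp
    have "\<delta> / real (k' * j) \<le> cmod (\<omega> - z)" if z: "z \<in> S" and \<omega>: "\<omega> ^ (k' * j) = 1" and ne: "\<omega> \<noteq> z" for z \<omega>
    proof (cases "z \<in> S1")
      case True
      have "\<delta> / real (k' * j) \<le> 1 / real (k' * j)" using \<delta>1 by (intro divide_right_mono) auto
      also have "\<dots> \<le> cmod (\<omega> - z)" by (rule root_of_unity_separation[OF m \<omega> k'1[OF True] ne])
      finally show ?thesis .
    next
      case False
      have "cmod \<omega> = 1" by (rule norm_root_of_unity[OF \<omega> m])
      \<comment> \<open>An \<open>m\<close>-th root of unity close to \<open>z\<close> would make
        \<open>z ^ m\<close> close to 1, with a loss of a factor \<open>m\<close>.\<close>
      then have "cmod (z ^ (k' * j) - \<omega> ^ (k' * j)) \<le> real (k' * j) * cmod (z - \<omega>)"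
        by (intro norm_power_diff) (use z1[OF z] in auto)
      moreover have "\<delta> \<le> cmod (z ^ (k' * j) - 1)" using j(2) z False by (simp add: S2_def)
      ultimately have "\<delta> \<le> real (k' * j) * cmod (\<omega> - z)" by (simp add: \<omega> norm_minus_commute)
      then show ?thesis using m by (simp add: field_simps)
    qed
    then show "\<exists>j>M. \<forall>z\<in>S. \<forall>\<omega>. \<omega> ^ (k' * j) = 1 \<longrightarrow> \<omega> \<noteq> z \<longrightarrow> \<delta> / real (k' * j) \<le> cmod (\<omega> - z)"
      using j(1) by blast
  qed (use k' \<delta> in auto)
qed

section \<open>Counting eigenvalues at roots of unity\<close>

lemma powr_inverse_pow: "0 \<le> y \<Longrightarrow> 0 < b \<Longrightarrow> (y powr (1 / real b)) ^ b = y"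
  by (cases "y = 0") (simp_all add: powr_powr flip: powr_realpow)

lemma le_powr_inverse:
  assumes "0 \<le> x" "0 < b" "x ^ b \<le> y"
  shows "x \<le> y powr (1 / real b)"
proof -
  have "0 \<le> y" using assms(1,3) by (meson order_trans zero_le_power)
  then have "x ^ b \<le> (y powr (1 / real b)) ^ b" using assms powr_inverse_pow by simp
  then show ?thesis using assms by (simp add: power_mono_iff)
qed

text \<open>Otherwise there are points at which \<open>p\<close> is smaller than
  \<open>1 / (i + 1)\<close> times the \<open>b\<close>-th power of the distance to each zero. A
  limit point \<open>w\<close> of them is a zero, and after division by the full power of
  \<open>[:- w, 1:]\<close>, whose exponent is at most \<open>b\<close>, the cofactor would vanish
  at \<open>w\<close> as well.\<close>

lemma poly_lower_bound_on_circle: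
  fixes p :: "complex poly"
  defines "S \<equiv> {z. cmod z = 1 \<and> poly p z = 0}"
  assumes p: "p \<noteq> 0" and ne: "S \<noteq> {}" and b: "\<And>z. z \<in> S \<Longrightarrow> Polynomial.order z p \<le> b"
  shows "\<exists>c>0. \<forall>z. cmod z = 1 \<longrightarrow> (\<exists>z0\<in>S. c * cmod (z - z0) ^ b \<le> cmod (poly p z))"
proof (rule ccontr)
  assume no: "\<not> ?thesis"
  have "\<forall>i. \<exists>z. cmod z = 1 \<and> (\<forall>z0\<in>S. cmod (poly p z) < 1 / real (Suc i) * cmod (z - z0) ^ b)"
  proof
    fix i
    have "0 < 1 / real (Suc i)" by simp
    then show "\<exists>z. cmod z = 1 \<and> (\<forall>z0\<in>S. cmod (poly p z) < 1 / real (Suc i) * cmod (z - z0) ^ b)"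
      using no by (meson not_le)
  qed
  then obtain f where f1: "\<And>i. cmod (f i) = 1"
    and f2: "\<And>i z0. z0 \<in> S \<Longrightarrow> cmod (poly p (f i)) < 1 / real (Suc i) * cmod (f i - z0) ^ b"
    by metis
  have "compact (sphere (0::complex) 1)" by simp
  then obtain w r where w: "w \<in> sphere 0 1" and r: "strict_mono r" and lim: "(f \<circ> r) \<longlonglongrightarrow> w"
    unfolding compact_def using f1 by (metis dist_0_norm mem_sphere)
  have rinv: "(\<lambda>i. 2 ^ b / real (Suc (r i))) \<longlonglongrightarrow> 0"
  proof -
    have "(\<lambda>i. 2 ^ b / real (Suc i)) \<longlonglongrightarrow> 0" by real_asymp
    then show ?thesis using LIMSEQ_subseq_LIMSEQ[OF _ r, of "\<lambda>i. 2 ^ b / real (Suc i)"] by (simp add: o_def)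
  qed
  have le2: "cmod (f i - z0) \<le> 2" if "z0 \<in> S" for i z0
    using norm_triangle_ineq4[of "f i" z0] f1[of i] that by (simp add: S_def)
  obtain z1 where z1: "z1 \<in> S" using ne by blast
  have lim_p: "(\<lambda>i. cmod (poly q (f (r i)))) \<longlonglongrightarrow> cmod (poly q w)" for q
  proof -
    have "isCont (\<lambda>z. cmod (poly q z)) w" by (intro continuous_intros)
    then show ?thesis using lim isCont_tendsto_compose[of w "\<lambda>z. cmod (poly q z)"] by (simp add: o_def)
  qed
  have "cmod (poly p w) \<le> 0"
  proof (rule LIMSEQ_le[OF lim_p rinv], intro exI allI impI)
    fix i :: nat assume "0 \<le> i"
    have "cmod (poly p (f (r i))) \<le> 1 / real (Suc (r i)) * cmod (f (r i) - z1) ^ b" using f2[OF z1, of "r i"] by simp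
    also have "\<dots> \<le> 1 / real (Suc (r i)) * 2 ^ b"
      using le2[OF z1] by (intro mult_left_mono power_mono) auto
    finally show "cmod (poly p (f (r i))) \<le> 2 ^ b / real (Suc (r i))" by simp
  qed
  then have wS: "w \<in> S" using w by (simp add: S_def)
  define o' where "o' = Polynomial.order w p"
  obtain q where q: "p = [:- w, 1:] ^ o' * q" "\<not> [:- w, 1:] dvd q"
    using order_decomp[OF p, of w] unfolding o'_def by blast
  have qw: "poly q w \<noteq> 0" using q(2) by (simp add: poly_eq_0_iff_dvd)
  have o'b: "o' \<le> b" unfolding o'_def by (rule b[OF wS])
  have "cmod (poly q w) \<le> 0"
  proof (rule LIMSEQ_le[OF lim_p rinv], intro exI allI impI)
    fix i :: nat assume "0 \<le> i"
    let ?z = "f (r i)"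
    have lt: "cmod (?z - w) ^ o' * cmod (poly q ?z) < 1 / real (Suc (r i)) * cmod (?z - w) ^ b"
      using f2[OF wS, of "r i"] unfolding q(1) by (simp add: norm_mult norm_power poly_power)
    have "1 / real (Suc (r i)) * cmod (?z - w) ^ b = cmod (?z - w) ^ o' * (cmod (?z - w) ^ (b - o') / real (Suc (r i)))"
      using o'b by (simp add: power_add[symmetric])
    then have "cmod (?z - w) ^ o' * cmod (poly q ?z) < cmod (?z - w) ^ o' * (cmod (?z - w) ^ (b - o') / real (Suc (r i)))"
      using lt by simp
    then have "cmod (poly q ?z) < cmod (?z - w) ^ (b - o') / real (Suc (r i))"
      by (rule mult_left_less_imp_less) simp
    also have "\<dots> \<le> 2 ^ b / real (Suc (r i))"
    proof (rule divide_right_mono)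
      have "cmod (?z - w) ^ (b - o') \<le> 2 ^ (b - o')" using le2[OF wS] by (intro power_mono) auto
      also have "\<dots> \<le> 2 ^ b" by (intro power_increasing) auto
      finally show "cmod (?z - w) ^ (b - o') \<le> 2 ^ b" .
    qed simp
    finally show "cmod (poly q ?z) \<le> 2 ^ b / real (Suc (r i))" by simp
  qed
  then show False using qw by simp
qed

section \<open>Counting functions of eigenvalue lists\<close>

lemma length_filter_le_split:
  "\<forall>e\<in>set xs. 0 \<le> e \<Longrightarrow> 0 \<le> (a::real) \<Longrightarrow>
    length (filter (\<lambda>e. e \<le> a) xs) = count_list xs 0 + length (filter (\<lambda>e. 0 < e \<and> e \<le> a) xs)"
  by (induction xs) auto

lemma count_list_le_length_filter_diff:
  "0 < (a::real) \<Longrightarrow> count_list xs a + length (filter (\<lambda>e. e \<le> 0) xs) \<le> length (filter (\<lambda>e. e \<le> a) xs)"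
  by (induction xs) auto

lemma sum_indicator_card: "(\<Sum>k<m. if P k then c else 0) = of_nat (card {k. k < (m::nat) \<and> P k}) * (c::'a::semiring_1)"
proof -
  have "(\<Sum>k<m. if P k then c else 0) = (\<Sum>k\<in>{k \<in> {..<m}. P k}. c)" by (rule sum.inter_filter[symmetric]) simp
  then show ?thesis by (simp add: lessThan_def Collect_conj_eq)
qed

definition eigs :: "(complex \<Rightarrow> real list) \<Rightarrow> nat \<Rightarrow> real list" where
  "eigs es m = concat (map (\<lambda>k. es (unit_root m k)) [0..<m])"

definition eig_count :: "(complex \<Rightarrow> real list) \<Rightarrow> nat \<Rightarrow> real \<Rightarrow> nat" where
  "eig_count es m a = length (filter (\<lambda>e. e \<le> a) (eigs es m))"

definition min_pos_eig :: "(complex \<Rightarrow> real list) \<Rightarrow> nat \<Rightarrow> real" where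
  "min_pos_eig es m = Min {e \<in> set (eigs es m). 0 < e}"

text \<open>The alpha number of the quotient by \<open>Z m\<close>: its index is
  \<open>d * m\<close>, and the square root appears because the lists contain squares of singular
  values.\<close>

definition eig_alpha :: "(complex \<Rightarrow> real list) \<Rightarrow> nat \<Rightarrow> nat \<Rightarrow> real" where
  "eig_alpha es d m = ln (real (count_list (eigs es m) (min_pos_eig es m)) / (real d * real m)) / ln (sqrt (min_pos_eig es m))"

lemma eig_count_eq: "eig_count es m a = (\<Sum>k<m. length (filter (\<lambda>e. e \<le> a) (es (unit_root m k))))"
  by (simp add: eig_count_def eigs_def filter_concat length_concat o_def interv_sum_list_conv_sum_set_nat atLeast0LessThan)

lemma set_eigs: "set (eigs es m) = (\<Union>k<m. set (es (unit_root m k)))"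
  by (simp add: eigs_def atLeast0LessThan)

lemma card_roots_in_finite:
  assumes "finite X"
  shows "card {k. k < m \<and> unit_root m k \<in> X} \<le> card X"
proof (rule card_inj_on_le[OF _ _ assms])
  show "inj_on (unit_root m) {k. k < m \<and> unit_root m k \<in> X}"
    by (rule inj_on_subset[OF unit_root_inj]) auto
qed auto

text \<open>The output of \<open>smallest_eigenvalue_comparable\<close> in the case
  \<open>k0 < n\<close>. Over the points of \<open>X\<close> only the length and the signs of the
  lists are known.\<close>

locale circle_spectrum =
  fixes es :: "complex \<Rightarrow> real list" and n k0 :: nat and X :: "complex set" and p :: "complex poly" and c1 c2 :: real
  assumes len: "\<And>z. cmod z = 1 \<Longrightarrow> length (es z) = n"
    and nonneg: "\<And>z e. cmod z = 1 \<Longrightarrow> e \<in> set (es z) \<Longrightarrow> 0 \<le> e"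
    and finX: "finite X" and p0: "p \<noteq> 0" and c1: "0 < c1" and c2: "0 < c2" and k0n: "k0 < n"
    and count0: "\<And>z. cmod z = 1 \<Longrightarrow> z \<notin> X \<Longrightarrow> count_list (es z) 0 = k0"
    and lower: "\<And>z e. cmod z = 1 \<Longrightarrow> z \<notin> X \<Longrightarrow> e \<in> set (es z) \<Longrightarrow> 0 < e \<Longrightarrow> c1 * cmod (poly p z) \<le> e"
    and upper: "\<And>z. cmod z = 1 \<Longrightarrow> z \<notin> X \<Longrightarrow> \<exists>e\<in>set (es z). 0 < e \<and> e \<le> c2 * cmod (poly p z)"
begin

abbreviation evs where "evs \<equiv> eigs es"
abbreviation cnt where "cnt \<equiv> eig_count es"

definition S :: "complex set" where
  "S = {z. cmod z = 1 \<and> poly p z = 0}"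

definition b :: nat where
  "b = Max ((\<lambda>z. Polynomial.order z p) ` S)"

abbreviation sig2 where "sig2 \<equiv> min_pos_eig es"

text \<open>At a zero of \<open>p\<close> off \<open>X\<close>, \<open>upper\<close> would provide a
  positive eigenvalue that is at most 0.\<close>

lemma S_subset_X: "S \<subseteq> X"
  using upper unfolding S_def by fastforce

lemma finS: "finite S"
  using S_subset_X finX by (rule finite_subset)

lemmas card_roots_X = card_roots_in_finite[OF finX]

text \<open>A list off \<open>X\<close> has \<open>k0\<close> zeros, and further entries up to
  \<open>a\<close> only where \<open>p\<close> is small. Lists over \<open>X\<close> are counted in
  full; at most \<open>card X\<close> of them occur, since the \<open>m\<close>-th roots of unity
  are distinct.\<close>

lemma cnt_le: 
  assumes a: "0 \<le> a"
  shows "real (cnt m a) \<le> k0 * m + n * card X + n * card {k. k < m \<and> c1 * cmod (poly p (unit_root m k)) \<le> a}"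
proof -
  have "length (filter (\<lambda>e. e \<le> a) (es (unit_root m k))) \<le> k0 + (if unit_root m k \<in> X then n else 0) + (if c1 * cmod (poly p (unit_root m k)) \<le> a then n else 0)" for k
  proof (cases "unit_root m k \<in> X \<or> c1 * cmod (poly p (unit_root m k)) \<le> a")
    case True
    have "length (filter (\<lambda>e. e \<le> a) (es (unit_root m k))) \<le> n"
      using length_filter_le[of "\<lambda>e. e \<le> a" "es (unit_root m k)"] len[of "unit_root m k"] by simp
    then show ?thesis using True by auto
  next
    case False
    have "filter (\<lambda>e. 0 < e \<and> e \<le> a) (es (unit_root m k)) = []"
      unfolding filter_empty_conv using lower[of "unit_root m k"] False by fastforce
    then show ?thesis using False count0[of "unit_root m k"] nonneg[of "unit_root m k"]
      by (simp add: length_filter_le_split[OF _ a])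
  qed
  then have "cnt m a \<le> (\<Sum>k<m. k0 + (if unit_root m k \<in> X then n else 0) + (if c1 * cmod (poly p (unit_root m k)) \<le> a then n else 0))"
    unfolding eig_count_eq by (rule sum_mono)
  also have "\<dots> = k0 * m + card {k. k < m \<and> unit_root m k \<in> X} * n + card {k. k < m \<and> c1 * cmod (poly p (unit_root m k)) \<le> a} * n"
    by (simp add: sum.distrib sum_indicator_card)
  also have "\<dots> \<le> k0 * m + card X * n + card {k. k < m \<and> c1 * cmod (poly p (unit_root m k)) \<le> a} * n"
    using card_roots_X[of m] by simp
  finally have "real (cnt m a) \<le> real (k0 * m + card X * n + card {k. k < m \<and> c1 * cmod (poly p (unit_root m k)) \<le> a} * n)"
    by (rule of_nat_mono)
  then show ?thesis by (simp add: mult_ac)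
qed

lemma cnt_ge:
  assumes a: "0 \<le> a"
  shows "k0 * m + card {k. k < m \<and> c2 * cmod (poly p (unit_root m k)) \<le> a} \<le> cnt m a + (k0 + 1) * card X"
proof -
  have "k0 + (if c2 * cmod (poly p (unit_root m k)) \<le> a then 1 else 0) \<le> length (filter (\<lambda>e. e \<le> a) (es (unit_root m k))) + (if unit_root m k \<in> X then k0 + 1 else 0)" for k
  proof (cases "unit_root m k \<in> X")
    case False
    obtain e where e: "e \<in> set (es (unit_root m k))" "0 < e" "e \<le> c2 * cmod (poly p (unit_root m k))"
      using upper[of "unit_root m k"] False by auto
    have "1 \<le> length (filter (\<lambda>e. 0 < e \<and> e \<le> a) (es (unit_root m k)))" if "c2 * cmod (poly p (unit_root m k)) \<le> a"
    proof -
      have "e \<in> set (filter (\<lambda>e. 0 < e \<and> e \<le> a) (es (unit_root m k)))" using e that by simp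
      then show ?thesis by (metis length_pos_if_in_set Suc_leI One_nat_def)
    qed
    then show ?thesis using False count0[of "unit_root m k"] nonneg[of "unit_root m k"]
      by (simp add: length_filter_le_split[OF _ a])
  qed simp
  then have "(\<Sum>k<m. k0 + (if c2 * cmod (poly p (unit_root m k)) \<le> a then 1 else 0)) \<le>
    (\<Sum>k<m. length (filter (\<lambda>e. e \<le> a) (es (unit_root m k))) + (if unit_root m k \<in> X then k0 + 1 else 0))"
    by (rule sum_mono)
  then have "k0 * m + card {k. k < m \<and> c2 * cmod (poly p (unit_root m k)) \<le> a} \<le> cnt m a + card {k. k < m \<and> unit_root m k \<in> X} * (k0 + 1)"
    unfolding eig_count_eq by (simp only: sum.distrib sum_indicator_card sum_constant card_lessThan of_nat_id mult_1_right mult.commute)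
  also have "\<dots> \<le> cnt m a + card X * (k0 + 1)"
    using card_roots_X[of m] by (intro add_left_mono mult_le_mono1)
  finally show ?thesis by (simp add: mult_ac)
qed

lemma cnt_gap:
  assumes "S = {}"
  obtains a C where "0 < a" "\<And>m. real (cnt m a) \<le> k0 * m + C"
proof -
  obtain c where c: "0 < c" "\<And>z. cmod z = 1 \<Longrightarrow> c \<le> cmod (poly p z)"
    using poly_bounded_below_on_sphere[of p] assms unfolding S_def by blast
  show ?thesis
  proof (rule that[of "c1 * c / 2" "n * card X"])
    show pos: "0 < c1 * c / 2" using c1 c by simp
    fix m
    have "{k. k < m \<and> c1 * cmod (poly p (unit_root m k)) \<le> c1 * c / 2} = {}"
    proof (rule ccontr)
      assume "{k. k < m \<and> c1 * cmod (poly p (unit_root m k)) \<le> c1 * c / 2} \<noteq> {}"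
      then obtain k where "c1 * cmod (poly p (unit_root m k)) \<le> c1 * c / 2" by blast
      moreover have "c1 * c \<le> c1 * cmod (poly p (unit_root m k))" using c1 c by (intro mult_left_mono) auto
      ultimately show False using pos by linarith
    qed
    then have "card {k. k < m \<and> c1 * cmod (poly p (unit_root m k)) \<le> c1 * c / 2} = 0" by (simp only: card.empty)
    then show "real (cnt m (c1 * c / 2)) \<le> k0 * m + n * card X"
      using cnt_le[OF less_imp_le[OF pos], of m] by (simp only: mult_0_right of_nat_0 add_0_right)
  qed
qed

section \<open>Bounds in the presence of zeros on the circle\<close>

context
  assumes Sne: "S \<noteq> {}"
begin

lemma order_le_b: "z \<in> S \<Longrightarrow> Polynomial.order z p \<le> b"
  unfolding b_def by (rule Max_ge) (use finS in auto)

lemma b_pos: "0 < b"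
proof -
  obtain z where z: "z \<in> S" using Sne by blast
  then have "0 < Polynomial.order z p" using p0 by (auto simp: S_def order_root)
  then show ?thesis using order_le_b[OF z] by simp
qed

lemma poly_low: "\<exists>c>0. \<forall>z. cmod z = 1 \<longrightarrow> (\<exists>z0\<in>S. c * cmod (z - z0) ^ b \<le> cmod (poly p z))"
  using poly_lower_bound_on_circle[OF p0, of b] Sne order_le_b unfolding S_def by blast

lemma poly_up: "\<exists>z0\<in>S. \<exists>C>0. \<forall>z. cmod z = 1 \<longrightarrow> cmod (poly p z) \<le> C * cmod (z - z0) ^ b"
proof -
  have "b \<in> (\<lambda>z. Polynomial.order z p) ` S"
    unfolding b_def by (rule Max_in) (use finS Sne in auto)
  then obtain w where w: "w \<in> S" "Polynomial.order w p = b" by auto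
  obtain q where q: "p = [:- w, 1:] ^ b * q"
    using order_decomp[OF p0, of w] unfolding w(2) by blast
  obtain C where C: "0 < C" "\<And>z. cmod z = 1 \<Longrightarrow> cmod (poly q z) \<le> C"
    using poly_bounded_on_sphere[of q] by blast
  have "cmod (poly p z) \<le> C * cmod (z - w) ^ b" if "cmod z = 1" for z
  proof -
    have "cmod (poly p z) = cmod (poly q z) * cmod (z - w) ^ b" by (subst q) (simp add: norm_mult norm_power poly_power)
    then show ?thesis using C(2)[OF that] by (simp add: mult_right_mono)
  qed
  then show ?thesis using w C by blast
qed

lemma cnt_upper:
  obtains C where "0 < C" "\<And>m a. 0 < m \<Longrightarrow> 0 \<le> a \<Longrightarrow> real (cnt m a) \<le> k0 * m + C * (1 + m * a powr (1 / b))"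
proof -
  obtain c where c: "0 < c" "\<And>z. cmod z = 1 \<Longrightarrow> \<exists>z0\<in>S. c * cmod (z - z0) ^ b \<le> cmod (poly p z)"
    using poly_low by blast
  \<comment> \<open>From \<open>c1 * cmod (poly p z) \<le> a\<close> it follows that
    \<open>cmod (z - z0) ^ b \<le> a / (c * c1)\<close> for some zero \<open>z0\<close>; the
    resulting radius is \<open>K\<close> times the \<open>b\<close>-th root of
    \<open>a\<close>.\<close>
  define K where "K = (1 / (c * c1)) powr (1 / b)"
  define C where "C = real n * card X + n * card S * (2 * K + 3) + 1"
  have K0: "0 \<le> K" by (simp add: K_def)
  show ?thesis
  proof (rule that[of C])
    show "0 < C" using K0 by (auto simp: C_def intro!: add_nonneg_pos)
    fix m :: nat and a :: real assume m: "0 < m" and a: "0 \<le> a"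
    define \<rho> where "\<rho> = K * a powr (1 / b)"
    have \<rho>: "0 \<le> \<rho>" "\<rho> = (a / (c * c1)) powr (1 / b)"
      using K0 a c c1 by (simp_all add: \<rho>_def K_def powr_divide)
    have "{k. k < m \<and> c1 * cmod (poly p (unit_root m k)) \<le> a} \<subseteq> (\<Union>z0\<in>S. {k. k < m \<and> cmod (unit_root m k - z0) \<le> \<rho>})"
    proof
      fix k assume "k \<in> {k. k < m \<and> c1 * cmod (poly p (unit_root m k)) \<le> a}"
      then have k: "k < m" "c1 * cmod (poly p (unit_root m k)) \<le> a" by auto
      obtain z0 where z0: "z0 \<in> S" "c * cmod (unit_root m k - z0) ^ b \<le> cmod (poly p (unit_root m k))"
        using c(2)[of "unit_root m k"] by auto
      have "c1 * (c * cmod (unit_root m k - z0) ^ b) \<le> a"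
        using mult_left_mono[OF z0(2), of c1] c1 k(2) by linarith
      then have "cmod (unit_root m k - z0) ^ b \<le> a / (c * c1)" using c c1 by (simp add: field_simps)
      then have "cmod (unit_root m k - z0) \<le> \<rho>" unfolding \<rho>(2) by (intro le_powr_inverse b_pos) auto
      then show "k \<in> (\<Union>z0\<in>S. {k. k < m \<and> cmod (unit_root m k - z0) \<le> \<rho>})" using k(1) z0(1) by blast
    qed
    then have "card {k. k < m \<and> c1 * cmod (poly p (unit_root m k)) \<le> a} \<le> card (\<Union>z0\<in>S. {k. k < m \<and> cmod (unit_root m k - z0) \<le> \<rho>})"
      by (rule card_mono[rotated]) (use finS in auto)
    also have "\<dots> \<le> (\<Sum>z0\<in>S. card {k. k < m \<and> cmod (unit_root m k - z0) \<le> \<rho>})"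
      by (rule card_UN_le[OF finS])
    finally have "real (card {k. k < m \<and> c1 * cmod (poly p (unit_root m k)) \<le> a}) \<le> (\<Sum>z0\<in>S. real (card {k. k < m \<and> cmod (unit_root m k - z0) \<le> \<rho>}))"
      using of_nat_mono by fastforce
    also have "\<dots> \<le> (\<Sum>z0\<in>S. 2 * \<rho> * real m + 3)"
      by (intro sum_mono unit_root_near_card_le) (use \<rho> m in \<open>auto simp: S_def\<close>)
    also have "\<dots> = card S * (2 * \<rho> * m + 3)" by simp
    finally have "real (card {k. k < m \<and> c1 * cmod (poly p (unit_root m k)) \<le> a}) \<le> card S * (2 * \<rho> * m + 3)" .
    then have "n * real (card {k. k < m \<and> c1 * cmod (poly p (unit_root m k)) \<le> a}) \<le> n * (card S * (2 * \<rho> * m + 3))"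
      by (intro mult_left_mono) auto
    then have "real (cnt m a) \<le> k0 * m + (n * card X + n * card S * (2 * \<rho> * m + 3))"
      using cnt_le[OF a, of m] by (simp add: mult.assoc)
    also have "n * card X + n * card S * (2 * \<rho> * m + 3) \<le> C * (1 + m * a powr (1 / b))"
    proof -
      define t where "t = m * a powr (1 / b)"
      have t: "0 \<le> t" "2 * \<rho> * m = 2 * K * t" by (simp_all add: t_def \<rho>_def)
      have nn: "0 \<le> real n * card X * t" "0 \<le> real n * card S * (2 * K)" "0 \<le> real n * card S * 3 * t" using t K0 by simp_all
      have "C * (1 + t) = n * card X + n * card S * (2 * K * t + 3) + (n * card X * t + n * card S * (2 * K) + n * card S * 3 * t) + (1 + t)"
        by (simp add: C_def algebra_simps)
      then show ?thesis unfolding t(2) t_def[symmetric] using nn t(1) unfolding of_nat_mult of_nat_numeral by linarith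
    qed
    finally show "real (cnt m a) \<le> k0 * m + C * (1 + m * a powr (1 / b))" by simp
  qed
qed

lemma cnt_lower:
  obtains c C a0 where "0 < c" "0 < C" "0 < a0"
    "\<And>m a. 0 \<le> a \<Longrightarrow> a \<le> a0 \<Longrightarrow> k0 * m + c * m * a powr (1 / b) \<le> real (cnt m a) + C"
proof -
  obtain z0 C where z0: "z0 \<in> S" "0 < C" "\<And>z. cmod z = 1 \<Longrightarrow> cmod (poly p z) \<le> C * cmod (z - z0) ^ b"
    using poly_up by blast
  define c where "c = (1 / (C * c2)) powr (1 / b)"
  show ?thesis
  \<comment> \<open>The limit \<open>C * c2\<close> for \<open>a\<close> keeps the radius at most 1,
    as \<open>unit_root_near_card_ge\<close> demands. The additive constant collects the exceptional
    points and the loss of 1 in counting roots of unity.\<close>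
  proof (rule that[of "c / 7" "(k0 + 1) * card X + 1" "C * c2"])
    show "0 < c / 7" "0 < C * c2" using z0(2) c2 by (simp_all add: c_def)
    show "0 < real ((k0 + 1) * card X + 1)" by linarith
    fix m :: nat and a :: real assume a: "0 \<le> a" "a \<le> C * c2"
    define \<rho> where "\<rho> = c * a powr (1 / b)"
    have \<rho>: "0 \<le> \<rho>" "\<rho> = (a / (C * c2)) powr (1 / b)"
      using a z0(2) c2 by (simp_all add: \<rho>_def c_def powr_divide)
    have \<rho>1: "\<rho> \<le> 1"
      unfolding \<rho>(2) using a z0(2) c2 by (intro powr_le1) auto
    have \<rho>b: "\<rho> ^ b = a / (C * c2)" unfolding \<rho>(2) by (rule powr_inverse_pow) (use a z0(2) c2 b_pos in auto)
    have "{k. k < m \<and> cmod (unit_root m k - z0) \<le> \<rho>} \<subseteq> {k. k < m \<and> c2 * cmod (poly p (unit_root m k)) \<le> a}"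
    proof
      fix k assume "k \<in> {k. k < m \<and> cmod (unit_root m k - z0) \<le> \<rho>}"
      then have k: "k < m" "cmod (unit_root m k - z0) \<le> \<rho>" by auto
      have "cmod (poly p (unit_root m k)) \<le> C * cmod (unit_root m k - z0) ^ b" by (rule z0(3)) simp
      also have "\<dots> \<le> C * \<rho> ^ b" using k z0(2) by (intro mult_left_mono power_mono) auto
      also have "\<dots> = a / c2" unfolding \<rho>b using z0(2) by simp
      finally show "k \<in> {k. k < m \<and> c2 * cmod (poly p (unit_root m k)) \<le> a}" using k c2 by (simp add: field_simps)
    qed
    then have "card {k. k < m \<and> cmod (unit_root m k - z0) \<le> \<rho>} \<le> card {k. k < m \<and> c2 * cmod (poly p (unit_root m k)) \<le> a}"
      by (rule card_mono[rotated]) simp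
    then have "real (card {k. k < m \<and> cmod (unit_root m k - z0) \<le> \<rho>}) \<le> real (card {k. k < m \<and> c2 * cmod (poly p (unit_root m k)) \<le> a})"
      by (rule of_nat_mono)
    moreover have "\<rho> * m / 7 - 1 \<le> real (card {k. k < m \<and> cmod (unit_root m k - z0) \<le> \<rho>})"
      by (rule unit_root_near_card_ge) (use z0(1) \<rho> \<rho>1 in \<open>auto simp: S_def\<close>)
    moreover have "real (k0 * m + card {k. k < m \<and> c2 * cmod (poly p (unit_root m k)) \<le> a}) \<le> real (cnt m a + (k0 + 1) * card X)"
      by (rule of_nat_mono[OF cnt_ge[OF a(1)]])
    moreover have "c / 7 * m * a powr (1 / b) = \<rho> * m / 7" by (simp add: \<rho>_def)
    ultimately show "k0 * m + c / 7 * m * a powr (1 / b) \<le> real (cnt m a) + real ((k0 + 1) * card X + 1)"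
      by (simp only: of_nat_add of_nat_1)
  qed
qed

text \<open>Within a multiple of \<open>1 / m\<close> of a zero of order \<open>b\<close> there is
  an \<open>m\<close>-th root of unity off \<open>X\<close>, and it carries a positive eigenvalue of
  at most a multiple of \<open>m\<close> to the power \<open>- b\<close>. Up to this level
  \<open>cnt_upper\<close> exceeds \<open>k0 * m\<close> by a bounded amount only, which bounds the
  multiplicity.\<close>

lemma sig2_upper:
  obtains C M where "0 < C" "\<And>m. M \<le> m \<Longrightarrow> 0 < sig2 m \<and> sig2 m \<le> C * real m powr - real b \<and>
    sig2 m \<in> set (evs m) \<and> real (count_list (evs m) (sig2 m)) \<le> C"
proof -
  obtain z0 C where z0: "z0 \<in> S" "0 < C" "\<And>z. cmod z = 1 \<Longrightarrow> cmod (poly p z) \<le> C * cmod (z - z0) ^ b"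
    using poly_up by blast
  obtain D where D: "0 < D" "\<And>m a. 0 < m \<Longrightarrow> 0 \<le> a \<Longrightarrow> real (cnt m a) \<le> k0 * m + D * (1 + m * a powr (1 / b))"
    using cnt_upper by blast
  \<comment> \<open>At least \<open>r / 7 - 1 = card X + 1\<close> roots of unity lie within
    \<open>r / m\<close> of the zero, one more than \<open>X\<close> can absorb.\<close>
  define r where "r = 7 * (card X + 2)"
  define C1 where "C1 = c2 * (C * real r ^ b)"
  have C1: "0 < C1" using c2 z0(2) by (simp add: C1_def r_def)
  define C2 where "C2 = D * (1 + C1 powr (1 / b)) + (k0 + 1) * card X"
  show ?thesis
  proof (rule that[of "max C1 C2" r])
    show "0 < max C1 C2" using C1 by simp
    fix m assume m: "r \<le> m"
    have m0: "0 < m" using m by (simp add: r_def)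
    define \<rho> where "\<rho> = real r / real m"
    have \<rho>: "0 \<le> \<rho>" "\<rho> \<le> 1" "\<rho> * m = r" using m m0 by (simp_all add: \<rho>_def)
    have "\<rho> * m / 7 - 1 \<le> real (card {k. k < m \<and> cmod (unit_root m k - z0) \<le> \<rho>})"
      by (rule unit_root_near_card_ge) (use z0(1) \<rho> in \<open>auto simp: S_def\<close>)
    moreover have "real r / 7 = real (card X) + 2" by (simp add: r_def)
    ultimately have "card X < card {k. k < m \<and> cmod (unit_root m k - z0) \<le> \<rho>}" unfolding \<rho>(3) by linarith
    then have "\<not> {k. k < m \<and> cmod (unit_root m k - z0) \<le> \<rho>} \<subseteq> {k. k < m \<and> unit_root m k \<in> X}"
      using card_mono[of "{k. k < m \<and> unit_root m k \<in> X}" "{k. k < m \<and> cmod (unit_root m k - z0) \<le> \<rho>}"] card_roots_X[of m] by auto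
    then obtain k where k: "k < m" "cmod (unit_root m k - z0) \<le> \<rho>" "unit_root m k \<notin> X" by blast
    obtain e where e: "e \<in> set (es (unit_root m k))" "0 < e" "e \<le> c2 * cmod (poly p (unit_root m k))"
      using upper[OF _ k(3)] by auto
    let ?E = "{e \<in> set (evs m). 0 < e}"
    have eE: "e \<in> ?E" using e k(1) by (auto simp: set_eigs)
    have "finite ?E" by simp
    then have sE: "sig2 m \<in> ?E" and se: "sig2 m \<le> e" unfolding min_pos_eig_def using eE Min_in[of ?E] Min_le[of ?E e] by blast+
    have "sig2 m \<le> C1 * real m powr - real b"
    proof -
      note se
      also note e(3)
      also have "c2 * cmod (poly p (unit_root m k)) \<le> c2 * (C * cmod (unit_root m k - z0) ^ b)"
        using c2 z0(3)[of "unit_root m k"] by (intro mult_left_mono) auto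
      also have "\<dots> \<le> c2 * (C * \<rho> ^ b)" using k c2 z0(2) by (intro mult_left_mono power_mono) auto
      also have "\<dots> = C1 * real m powr - real b"
        using m0 by (simp add: C1_def \<rho>_def power_divide powr_minus powr_realpow) (simp add: divide_inverse)
      finally show ?thesis .
    qed
    note s_le = this
    have "real (count_list (evs m) (sig2 m)) \<le> C2"
    proof -
      have "count_list (evs m) (sig2 m) + cnt m 0 \<le> cnt m (sig2 m)"
        unfolding eig_count_def by (rule count_list_le_length_filter_diff) (use sE in simp)
      then have "real (count_list (evs m) (sig2 m)) + real (cnt m 0) \<le> real (cnt m (sig2 m))" by linarith
      also have "\<dots> \<le> k0 * m + D * (1 + m * (sig2 m) powr (1 / b))" by (rule D(2)) (use m0 sE in auto)
      also have "\<dots> \<le> k0 * m + D * (1 + C1 powr (1 / b))"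
      proof -
        have "m * (sig2 m) powr (1 / b) \<le> m * (C1 * real m powr - real b) powr (1 / b)"
          using s_le sE b_pos by (intro mult_left_mono powr_mono2) auto
        also have "\<dots> = C1 powr (1 / b)"
          using m0 C1 b_pos by (simp add: powr_mult powr_powr)
        finally show ?thesis using D(1) by simp
      qed
      finally have "real (count_list (evs m) (sig2 m)) + real (cnt m 0) \<le> k0 * m + D * (1 + C1 powr (1 / b))" .
      moreover have "k0 * m \<le> cnt m 0 + (k0 + 1) * card X" using cnt_ge[of 0 m] by linarith
      then have "real (k0 * m) \<le> real (cnt m 0 + (k0 + 1) * card X)" by (rule of_nat_mono)
      ultimately show ?thesis unfolding C2_def by simp
    qed
    moreover have "C1 * real m powr - real b \<le> max C1 C2 * real m powr - real b" by (intro mult_right_mono) auto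
    ultimately show "0 < sig2 m \<and> sig2 m \<le> max C1 C2 * real m powr - real b \<and>
      sig2 m \<in> set (evs m) \<and> real (count_list (evs m) (sig2 m)) \<le> max C1 C2"
      using sE s_le by auto
  qed
qed

lemma sig2_lower:
  assumes \<delta>: "0 < \<delta>"
  obtains c where "0 < c" "\<And>m. 0 < m \<Longrightarrow> (\<forall>z\<in>S. \<forall>\<omega>. \<omega> ^ m = 1 \<longrightarrow> \<omega> \<noteq> z \<longrightarrow> \<delta> / real m \<le> cmod (\<omega> - z)) \<Longrightarrow>
    \<forall>e\<in>set (evs m). 0 < e \<longrightarrow> c * real m powr - real b \<le> e"
proof -
  obtain c where c: "0 < c" "\<And>z. cmod z = 1 \<Longrightarrow> \<exists>z0\<in>S. c * cmod (z - z0) ^ b \<le> cmod (poly p z)"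
    using poly_low by blast
  define E where "E = insert 1 {e \<in> (\<Union>z\<in>{z \<in> X. cmod z = 1}. set (es z)). 0 < e}"
  have finE: "finite E" using finX by (simp add: E_def)
  define d where "d = min (Min E) (c1 * c * \<delta> ^ b)"
  have "Min E \<in> E" by (rule Min_in[OF finE]) (simp add: E_def)
  then have d: "0 < d" using c c1 \<delta> by (auto simp: d_def E_def)
  show ?thesis
  proof (rule that[OF d], intro ballI impI)
    fix m e assume m: "0 < m" and sep: "\<forall>z\<in>S. \<forall>\<omega>. \<omega> ^ m = 1 \<longrightarrow> \<omega> \<noteq> z \<longrightarrow> \<delta> / real m \<le> cmod (\<omega> - z)"
      and e: "e \<in> set (evs m)" "0 < e"
    obtain k where k: "k < m" "e \<in> set (es (unit_root m k))" using e(1) by (auto simp: set_eigs)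
    show "d * real m powr - real b \<le> e"
    proof (cases "unit_root m k \<in> X")
      case True
      then have "e \<in> E" using k e by (auto simp: E_def)
      then have "d \<le> e" using Min_le[OF finE] unfolding d_def by fastforce
      moreover have "real m powr - real b \<le> 1" using m by (simp add: powr_minus powr_realpow inverse_le_1_iff)
      then have "d * real m powr - real b \<le> d * 1" using d by (intro mult_left_mono) auto
      ultimately show ?thesis by simp
    next
      case False
      obtain z0 where z0: "z0 \<in> S" "c * cmod (unit_root m k - z0) ^ b \<le> cmod (poly p (unit_root m k))"
        using c(2)[of "unit_root m k"] by auto
      have "unit_root m k \<noteq> z0" using False S_subset_X z0 by blast
      then have sp: "\<delta> / real m \<le> cmod (unit_root m k - z0)" using sep z0(1) unit_root_pow[OF m] by blast
      have "d * real m powr - real b \<le> c1 * c * \<delta> ^ b * real m powr - real b"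
        by (intro mult_right_mono) (auto simp: d_def)
      also have "\<dots> = c1 * (c * (\<delta> / real m) ^ b)"
        using m by (simp add: power_divide powr_minus powr_realpow) (simp add: divide_inverse)
      also have "\<dots> \<le> c1 * (c * cmod (unit_root m k - z0) ^ b)"
        using sp c c1 \<delta> by (intro mult_left_mono power_mono) auto
      also have "\<dots> \<le> c1 * cmod (poly p (unit_root m k))" using z0 c1 by (intro mult_left_mono) auto
      also have "\<dots> \<le> e" by (rule lower[OF _ False k(2) e(2)]) simp
      finally show ?thesis .
    qed
  qed
qed

end

end

section \<open>Exponents\<close>

text \<open>For large \<open>m\<close> the denominator is negative, so the quotient grows when \<mu>
  is lowered to 1 and \<sigma> is raised to its bound. The square root halves \<open>s\<close>,
  which gives the limit \<open>2 / s\<close>.\<close>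

lemma log_ratio_upper:
  fixes C s d \<epsilon> :: real
  assumes "0 < C" "0 < s" "0 < d" "0 < \<epsilon>"
  shows "\<exists>M. \<forall>m\<ge>M. \<forall>\<sigma> \<mu>. 0 < \<sigma> \<longrightarrow> \<sigma> \<le> C * real m powr - s \<longrightarrow> 1 \<le> \<mu> \<longrightarrow>
    ln (\<mu> / (d * real m)) / ln (sqrt \<sigma>) \<le> 2 / s + \<epsilon>"
proof -
  have "(\<lambda>m::nat. ln (d * real m) / ((s * ln (real m) - ln C) / 2)) \<longlonglongrightarrow> 2 / s"
    using assms by real_asymp
  then have "\<forall>\<^sub>F m in sequentially. ln (d * real m) / ((s * ln (real m) - ln C) / 2) < 2 / s + \<epsilon>"
    by (rule order_tendstoD) (use assms in simp)
  moreover have "\<forall>\<^sub>F m::nat in sequentially. 0 < (s * ln (real m) - ln C) / 2" using assms by real_asymp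
  moreover have "\<forall>\<^sub>F m::nat in sequentially. 0 < ln (d * real m)" using assms by real_asymp
  moreover have "\<forall>\<^sub>F m::nat in sequentially. 0 < m" by (rule eventually_gt_at_top)
  ultimately have "\<forall>\<^sub>F m::nat in sequentially. \<forall>\<sigma> \<mu>. 0 < \<sigma> \<longrightarrow> \<sigma> \<le> C * real m powr - s \<longrightarrow> 1 \<le> \<mu> \<longrightarrow>
    ln (\<mu> / (d * real m)) / ln (sqrt \<sigma>) \<le> 2 / s + \<epsilon>"
  proof eventually_elim
    fix m :: nat
    let ?D = "(s * ln (real m) - ln C) / 2"
    assume b: "ln (d * real m) / ?D < 2 / s + \<epsilon>" and D: "0 < ?D" and l: "0 < ln (d * real m)" and m: "0 < m"
    show "\<forall>\<sigma> \<mu>. 0 < \<sigma> \<longrightarrow> \<sigma> \<le> C * real m powr - s \<longrightarrow> 1 \<le> \<mu> \<longrightarrow> ln (\<mu> / (d * real m)) / ln (sqrt \<sigma>) \<le> 2 / s + \<epsilon>"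
    proof (intro allI impI)
      fix \<sigma> \<mu> :: real assume \<sigma>: "0 < \<sigma>" "\<sigma> \<le> C * real m powr - s" and \<mu>: "1 \<le> \<mu>"
      have "ln \<sigma> \<le> ln (C * real m powr - s)" using \<sigma> by (intro ln_mono) auto
      also have "\<dots> = ln C - s * ln (real m)" using assms m by (simp add: ln_mult ln_powr)
      finally have L: "?D \<le> - ln (sqrt \<sigma>)" using \<sigma> by (simp add: ln_sqrt)
      have num: "ln (\<mu> / (d * real m)) = ln \<mu> - ln (d * real m)" using \<mu> m assms by (simp add: ln_div)
      have "ln (\<mu> / (d * real m)) / ln (sqrt \<sigma>) = (ln (d * real m) - ln \<mu>) / (- ln (sqrt \<sigma>))"
        unfolding num by (metis minus_diff_eq minus_divide_divide)
      also have "\<dots> \<le> ln (d * real m) / (- ln (sqrt \<sigma>))" using L D \<mu> by (intro divide_right_mono) auto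
      also have "\<dots> \<le> ln (d * real m) / ?D" using L D l by (intro divide_left_mono mult_pos_pos) auto
      also have "\<dots> \<le> 2 / s + \<epsilon>" using b by simp
      finally show "ln (\<mu> / (d * real m)) / ln (sqrt \<sigma>) \<le> 2 / s + \<epsilon>" .
    qed
  qed
  then show ?thesis unfolding eventually_sequentially .
qed

text \<open>Dually to \<open>log_ratio_upper\<close>, \<mu> is raised to \<open>C\<close> and
  \<sigma> is lowered to its bound; \<open>\<sigma> < 1\<close> makes the denominator
  negative.\<close>

lemma log_ratio_lower:
  fixes c C s d \<epsilon> :: real
  assumes "0 < c" "0 < C" "0 < s" "0 < d" "0 < \<epsilon>"
  shows "\<exists>M. \<forall>m\<ge>M. \<forall>\<sigma> \<mu>. c * real m powr - s \<le> \<sigma> \<longrightarrow> \<sigma> < 1 \<longrightarrow> 1 \<le> \<mu> \<longrightarrow> \<mu> \<le> C \<longrightarrow>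
    2 / s - \<epsilon> \<le> ln (\<mu> / (d * real m)) / ln (sqrt \<sigma>)"
proof -
  have "(\<lambda>m::nat. (ln (d * real m) - ln C) / ((s * ln (real m) - ln c) / 2)) \<longlonglongrightarrow> 2 / s"
    using assms by real_asymp
  then have "\<forall>\<^sub>F m in sequentially. 2 / s - \<epsilon> < (ln (d * real m) - ln C) / ((s * ln (real m) - ln c) / 2)"
    by (rule order_tendstoD) (use assms in simp)
  moreover have "\<forall>\<^sub>F m::nat in sequentially. 0 < ln (d * real m) - ln C" using assms by real_asymp
  moreover have "\<forall>\<^sub>F m::nat in sequentially. 0 < m" by (rule eventually_gt_at_top)
  ultimately have "\<forall>\<^sub>F m::nat in sequentially. \<forall>\<sigma> \<mu>. c * real m powr - s \<le> \<sigma> \<longrightarrow> \<sigma> < 1 \<longrightarrow> 1 \<le> \<mu> \<longrightarrow> \<mu> \<le> C \<longrightarrow>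
    2 / s - \<epsilon> \<le> ln (\<mu> / (d * real m)) / ln (sqrt \<sigma>)"
  proof eventually_elim
    fix m :: nat
    let ?D = "(s * ln (real m) - ln c) / 2"
    assume b: "2 / s - \<epsilon> < (ln (d * real m) - ln C) / ?D" and l: "0 < ln (d * real m) - ln C" and m: "0 < m"
    show "\<forall>\<sigma> \<mu>. c * real m powr - s \<le> \<sigma> \<longrightarrow> \<sigma> < 1 \<longrightarrow> 1 \<le> \<mu> \<longrightarrow> \<mu> \<le> C \<longrightarrow>
      2 / s - \<epsilon> \<le> ln (\<mu> / (d * real m)) / ln (sqrt \<sigma>)"
    proof (intro allI impI)
      fix \<sigma> \<mu> :: real assume \<sigma>: "c * real m powr - s \<le> \<sigma>" "\<sigma> < 1" and \<mu>: "1 \<le> \<mu>" "\<mu> \<le> C"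
      have cm: "0 < c * real m powr - s" using assms m by simp
      have \<sigma>0: "0 < \<sigma>" using cm \<sigma> by linarith
      have "ln c - s * ln (real m) = ln (c * real m powr - s)" using assms m by (simp add: ln_mult ln_powr)
      also have "\<dots> \<le> ln \<sigma>" using \<sigma> cm by (intro ln_mono) auto
      finally have L: "- ln (sqrt \<sigma>) \<le> ?D" using \<sigma>0 by (simp add: ln_sqrt)
      have P: "0 < - ln (sqrt \<sigma>)" using \<sigma>0 \<sigma> by (simp add: ln_sqrt)
      have num: "ln (\<mu> / (d * real m)) = ln \<mu> - ln (d * real m)" using \<mu> m assms by (simp add: ln_div)
      have "2 / s - \<epsilon> \<le> (ln (d * real m) - ln C) / ?D" using b by simp
      also have "\<dots> \<le> (ln (d * real m) - ln C) / (- ln (sqrt \<sigma>))"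
        using L P l by (intro divide_left_mono mult_pos_pos) auto
      also have "\<dots> \<le> (ln (d * real m) - ln \<mu>) / (- ln (sqrt \<sigma>))"
      proof (rule divide_right_mono)
        have "ln \<mu> \<le> ln C" using \<mu> by (intro ln_mono) auto
        then show "ln (d * real m) - ln C \<le> ln (d * real m) - ln \<mu>" by simp
      qed (use P in simp)
      also have "\<dots> = ln (\<mu> / (d * real m)) / ln (sqrt \<sigma>)"
        unfolding num by (metis minus_diff_eq minus_divide_divide)
      finally show "2 / s - \<epsilon> \<le> ln (\<mu> / (d * real m)) / ln (sqrt \<sigma>)" .
    qed
  qed
  then show ?thesis unfolding eventually_sequentially .
qed

text \<open>The distribution at \<open>l\<close> is the mass up to \<open>l\<^sup>2\<close>, which
  doubles the exponent. The constants disappear on division by \<open>ln l\<close>, which tends to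
  minus infinity.\<close>

lemma log_growth_exponent:
  fixes D :: "real \<Rightarrow> real"
  assumes "0 < c" "0 < C" "0 < s" "0 < a1"
    and b: "\<And>a. 0 < a \<Longrightarrow> a \<le> a1 \<Longrightarrow> c * a powr s \<le> D a - D 0 \<and> D a - D 0 \<le> C * a powr s"
  shows "((\<lambda>l. ln (D (l\<^sup>2) - D 0) / ln l) \<longlongrightarrow> 2 * s) (at_right 0)"
proof (rule tendsto_sandwich)
  have ev: "\<forall>\<^sub>F l in at_right 0. 0 < l \<and> l < 1 \<and> l\<^sup>2 \<le> (a1::real)"
  proof (intro eventually_conj)
    show "\<forall>\<^sub>F l in at_right 0. (0::real) < l" by (simp add: eventually_at_filter)
    show "\<forall>\<^sub>F l in at_right 0. l < (1::real)" by real_asymp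
    show "\<forall>\<^sub>F l in at_right 0. l\<^sup>2 \<le> a1" using assms(4) by real_asymp
  qed
  have pw: "ln (k * (l\<^sup>2) powr s) = ln k + 2 * s * ln l" if "0 < k" "0 < l" for k l :: real
    using that by (simp add: ln_mult ln_powr ln_realpow)
  show "\<forall>\<^sub>F l in at_right 0. (ln C + 2 * s * ln l) / ln l \<le> ln (D (l\<^sup>2) - D 0) / ln l"
    using ev
  proof eventually_elim
    fix l :: real assume l: "0 < l \<and> l < 1 \<and> l\<^sup>2 \<le> a1"
    then have B: "c * (l\<^sup>2) powr s \<le> D (l\<^sup>2) - D 0" "D (l\<^sup>2) - D 0 \<le> C * (l\<^sup>2) powr s" using b[of "l\<^sup>2"] by auto
    have "0 < c * (l\<^sup>2) powr s" using assms l by simp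
    then have "ln (D (l\<^sup>2) - D 0) \<le> ln (C * (l\<^sup>2) powr s)" using B by (intro ln_mono) linarith+
    then have "ln (D (l\<^sup>2) - D 0) \<le> ln C + 2 * s * ln l" using pw[of C l] assms l by simp
    then show "(ln C + 2 * s * ln l) / ln l \<le> ln (D (l\<^sup>2) - D 0) / ln l"
      using l by (intro divide_right_mono_neg) auto
  qed
  show "\<forall>\<^sub>F l in at_right 0. ln (D (l\<^sup>2) - D 0) / ln l \<le> (ln c + 2 * s * ln l) / ln l"
    using ev
  proof eventually_elim
    fix l :: real assume l: "0 < l \<and> l < 1 \<and> l\<^sup>2 \<le> a1"
    then have B: "c * (l\<^sup>2) powr s \<le> D (l\<^sup>2) - D 0" using b[of "l\<^sup>2"] by auto
    have "0 < c * (l\<^sup>2) powr s" using assms l by simp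
    then have "ln (c * (l\<^sup>2) powr s) \<le> ln (D (l\<^sup>2) - D 0)" using B by (intro ln_mono) linarith+
    then have "ln c + 2 * s * ln l \<le> ln (D (l\<^sup>2) - D 0)" using pw[of c l] assms l by simp
    then show "ln (D (l\<^sup>2) - D 0) / ln l \<le> (ln c + 2 * s * ln l) / ln l"
      using l by (intro divide_right_mono_neg) auto
  qed
  show "((\<lambda>l. (ln C + 2 * s * ln l) / ln l) \<longlongrightarrow> 2 * s) (at_right 0)" by real_asymp
  show "((\<lambda>l. (ln c + 2 * s * ln l) / ln l) \<longlongrightarrow> 2 * s) (at_right 0)" by real_asymp
qed

text \<open>Convergence of \<open>N m / (d * m)\<close> to \<open>D\<close> in the form that weak
  convergence supplies: the functions are compared at two arguments \<open>x < y\<close>, because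
  \<open>D\<close> may jump. At 0 the distance between them is removed by right continuity.\<close>

locale counting_limit =
  fixes D :: "real \<Rightarrow> real" and N :: "nat \<Rightarrow> real \<Rightarrow> nat" and d :: nat
  assumes d: "0 < d"
    and mono: "\<And>x y. 0 \<le> x \<Longrightarrow> x \<le> y \<Longrightarrow> D x \<le> D y"
    and right_cont: "(D \<longlongrightarrow> D 0) (at_right 0)"
    and below: "\<And>x y \<epsilon>. 0 \<le> x \<Longrightarrow> x < y \<Longrightarrow> 0 < \<epsilon> \<Longrightarrow> \<exists>M. \<forall>m\<ge>M. D x \<le> N m y / (d * m) + \<epsilon>"
    and above: "\<And>x y \<epsilon>. 0 \<le> x \<Longrightarrow> x < y \<Longrightarrow> 0 < \<epsilon> \<Longrightarrow> \<exists>M. \<forall>m\<ge>M. N m x / (d * m) \<le> D y + \<epsilon>"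
begin

lemma D_le:
  assumes xy: "0 \<le> x" "x < y" and N: "\<And>m. 0 < m \<Longrightarrow> real (N m y) \<le> k * m + C"
  shows "D x \<le> k / d"
proof (rule field_le_epsilon)
  fix \<epsilon> :: real assume \<epsilon>: "0 < \<epsilon>"
  obtain M where M: "\<And>m. M \<le> m \<Longrightarrow> D x \<le> N m y / (d * m) + \<epsilon>" using below[OF xy \<epsilon>] by blast
  define d' where "d' = real d"
  have d': "0 < d'" using d by (simp add: d'_def)
  have lim: "(\<lambda>m::nat. (k * real m + C) / (d' * real m) + \<epsilon>) \<longlonglongrightarrow> k / d' + \<epsilon>"
    unfolding divide_inverse[of k] using d' by real_asymp
  have "D x \<le> k / d' + \<epsilon>"
  proof (rule tendsto_lowerbound[OF lim])
    show "\<forall>\<^sub>F m in sequentially. D x \<le> (k * real m + C) / (d' * real m) + \<epsilon>"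
      unfolding eventually_sequentially
    proof (intro exI[of _ "max M 1"] allI impI)
      fix m assume "max M 1 \<le> m"
      then have m: "M \<le> m" "0 < m" by auto
      have "N m y / (d * m) \<le> (k * m + C) / (d' * m)"
        using N[OF m(2)] by (simp add: d'_def divide_right_mono)
      then show "D x \<le> (k * real m + C) / (d' * real m) + \<epsilon>" using M[OF m(1)] by linarith
    qed
  qed simp
  then show "D x \<le> k / d + \<epsilon>" by (simp add: d'_def)
qed

lemma D_ge:
  assumes xy: "0 \<le> x" "x < y" and N: "\<And>m. 0 < m \<Longrightarrow> k * m \<le> real (N m x) + C"
  shows "k / d \<le> D y"
proof (rule field_le_epsilon)
  fix \<epsilon> :: real assume \<epsilon>: "0 < \<epsilon>"
  obtain M where M: "\<And>m. M \<le> m \<Longrightarrow> N m x / (d * m) \<le> D y + \<epsilon>" using above[OF xy \<epsilon>] by blast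
  define d' where "d' = real d"
  have d': "0 < d'" using d by (simp add: d'_def)
  have lim: "(\<lambda>m::nat. (k * real m - C) / (d' * real m)) \<longlonglongrightarrow> k / d'"
    unfolding divide_inverse[of k] using d' by real_asymp
  have "k / d' \<le> D y + \<epsilon>"
  proof (rule tendsto_upperbound[OF lim])
    show "\<forall>\<^sub>F m in sequentially. (k * real m - C) / (d' * real m) \<le> D y + \<epsilon>"
      unfolding eventually_sequentially
    proof (intro exI[of _ "max M 1"] allI impI)
      fix m assume "max M 1 \<le> m"
      then have m: "M \<le> m" "0 < m" by auto
      have "(k * m - C) / (d' * m) \<le> N m x / (d * m)"
        using N[OF m(2)] by (simp add: d'_def divide_right_mono)
      then show "(k * real m - C) / (d' * real m) \<le> D y + \<epsilon>" using M[OF m(1)] by linarith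
    qed
  qed simp
  then show "k / d \<le> D y + \<epsilon>" by (simp add: d'_def)
qed

lemma D_zero_ge:
  assumes N: "\<And>m. 0 < m \<Longrightarrow> k * m \<le> real (N m 0) + C"
  shows "k / d \<le> D 0"
proof (rule tendsto_lowerbound[OF right_cont])
  show "\<forall>\<^sub>F y in at_right 0. k / d \<le> D y"
    unfolding eventually_at_filter using D_ge[of 0, OF _ _ N] by (intro always_eventually) auto
qed simp

lemma gap:
  assumes a: "0 < a" and up: "\<And>m. 0 < m \<Longrightarrow> real (N m a) \<le> k * m + C"
    and lo: "\<And>m. 0 < m \<Longrightarrow> k * m \<le> real (N m 0) + C'"
  shows "D (a / 2) = D 0"
proof (rule antisym)
  have "D (a / 2) \<le> k / d" by (rule D_le[OF _ _ up]) (use a in auto)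
  also have "\<dots> \<le> D 0" by (rule D_zero_ge[OF lo])
  finally show "D (a / 2) \<le> D 0" .
qed (use a mono[of 0 "a / 2"] in simp)

end

locale circle_spectrum_limit = circle_spectrum es n k0 X p c1 c2 + counting_limit D "eig_count es" d
  for es n k0 X p c1 c2 D d
begin

lemma cnt0_ge: "real k0 * m \<le> real (cnt m 0) + real ((k0 + 1) * card X)"
proof -
  have "k0 * m \<le> cnt m 0 + (k0 + 1) * card X" using cnt_ge[of 0 m] by linarith
  then have "real (k0 * m) \<le> real (cnt m 0 + (k0 + 1) * card X)" by (rule of_nat_mono)
  then show ?thesis by (simp only: of_nat_mult of_nat_add)
qed

lemma gap_if_no_zero:
  assumes "S = {}"
  shows "\<exists>a>0. D a = D 0"
proof -
  obtain a C where a: "0 < a" "\<And>m. real (cnt m a) \<le> k0 * m + C" using cnt_gap[OF assms] by blast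
  have "real (cnt m a) \<le> real k0 * m + real C" for m using a(2)[of m] by simp
  then have "D (a / 2) = D 0" by (rule gap[OF a(1)]) (rule cnt0_ge)
  then show ?thesis using a(1) by (intro exI[of _ "a / 2"]) simp
qed

text \<open>The counting functions are bounded up to additive constants independent of
  \<open>m\<close>, which vanish in the average. The required change of argument is made with
  \<open>a / 2\<close> and \<open>2 * a\<close>, at the cost of constant factors.\<close>

lemma distribution_growth:
  assumes Sne: "S \<noteq> {}"
  shows "\<exists>c C a1. 0 < c \<and> 0 < C \<and> 0 < a1 \<and>
    (\<forall>a. 0 < a \<longrightarrow> a \<le> a1 \<longrightarrow> c * a powr (1 / b) \<le> D a - D 0 \<and> D a - D 0 \<le> C * a powr (1 / b))"
proof -
  obtain C where C: "0 < C" "\<And>m a. 0 < m \<Longrightarrow> 0 \<le> a \<Longrightarrow> real (cnt m a) \<le> k0 * m + C * (1 + m * a powr (1 / b))"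
    using cnt_upper[OF Sne] by blast
  obtain c C' a0 where c: "0 < c" "0 < C'" "0 < a0"
    "\<And>m a. 0 \<le> a \<Longrightarrow> a \<le> a0 \<Longrightarrow> k0 * m + c * m * a powr (1 / b) \<le> real (cnt m a) + C'"
    using cnt_lower[OF Sne] by blast
  define s where "s = 1 / real b"
  have s: "0 < s" using b_pos[OF Sne] by (simp add: s_def)
  have up: "D x \<le> (k0 + C * y powr s) / d" if xy: "0 \<le> x" "x < y" for x y
    by (rule D_le[OF xy, of _ C]) (use C(2)[of _ y] xy in \<open>simp add: s_def algebra_simps\<close>)
  have lo: "(k0 + c * x powr s) / d \<le> D y" if xy: "0 \<le> x" "x < y" "x \<le> a0" for x y
    by (rule D_ge[OF xy(1,2), of _ C']) (use c(4)[of x] xy in \<open>simp add: s_def algebra_simps\<close>)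
  have D0: "D 0 = k0 / d"
  proof (rule antisym)
    show "k0 / d \<le> D 0" by (rule D_zero_ge[OF cnt0_ge])
    have lim: "((\<lambda>y. (real k0 + C * y powr s) / real d) \<longlongrightarrow> (real k0 + C * 0) / real d) (at_right 0)"
    proof (intro tendsto_intros)
      show "((\<lambda>y. y powr s) \<longlongrightarrow> 0) (at_right 0)" using s by real_asymp
    qed (use d in simp)
    have "D 0 \<le> (real k0 + C * 0) / real d"
      by (rule tendsto_lowerbound[OF lim]) (auto simp: eventually_at_filter intro!: always_eventually up)
    then show "D 0 \<le> k0 / d" by simp
  qed
  show ?thesis
    unfolding s_def[symmetric]
  proof (intro exI conjI allI impI)
    show "0 < c * (1 / 2) powr s / d" "0 < C * 2 powr s / d" "0 < a0" using c C d by simp_all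
    fix a assume a: "0 < a" "a \<le> a0"
    have "(k0 + c * (a / 2) powr s) / d \<le> D a" by (rule lo) (use a in auto)
    moreover have "(a / 2) powr s = (1 / 2) powr s * a powr s" using a powr_mult[of "1 / 2" a s] by simp
    ultimately show "c * (1 / 2) powr s / d * a powr s \<le> D a - D 0"
      unfolding D0 by (simp add: add_divide_distrib algebra_simps)
    have "D a \<le> (k0 + C * (2 * a) powr s) / d" by (rule up) (use a in auto)
    moreover have "(2 * a) powr s = 2 powr s * a powr s" using a by (simp add: powr_mult)
    ultimately show "D a - D 0 \<le> C * 2 powr s / d * a powr s"
      unfolding D0 by (simp add: add_divide_distrib algebra_simps)
  qed
qed

lemma distribution_exponent:
  assumes "S \<noteq> {}"
  shows "((\<lambda>l. ln (D (l\<^sup>2) - D 0) / ln l) \<longlongrightarrow> 2 / b) (at_right 0)" "\<forall>a>0. D a \<noteq> D 0"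
proof -
  obtain c C a1 where c: "0 < c" "0 < C" "0 < a1"
    "\<And>a. 0 < a \<Longrightarrow> a \<le> a1 \<Longrightarrow> c * a powr (1 / b) \<le> D a - D 0 \<and> D a - D 0 \<le> C * a powr (1 / b)"
    using distribution_growth[OF assms] by blast
  have "0 < 1 / real b" using b_pos[OF assms] by simp
  from log_growth_exponent[OF c(1,2) this c(3,4)]
  show "((\<lambda>l. ln (D (l\<^sup>2) - D 0) / ln l) \<longlongrightarrow> 2 / b) (at_right 0)" by simp
  show "\<forall>a>0. D a \<noteq> D 0"
  proof (intro allI impI)
    fix a :: real assume a: "0 < a"
    define x where "x = min a a1"
    have x: "0 < x" "x \<le> a1" "x \<le> a" using a c(3) by (auto simp: x_def)
    have "0 < c * x powr (1 / b)" using c(1) x by simp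
    then have "D 0 < D x" using c(4)[OF x(1,2)] by linarith
    then show "D a \<noteq> D 0" using mono[of x a] x by simp
  qed
qed

end

context circle_spectrum
begin

abbreviation alph where "alph \<equiv> eig_alpha es"

lemma eig_alpha_upper:
  assumes Sne: "S \<noteq> {}" and d: "0 < d" and \<epsilon>: "0 < \<epsilon>"
  shows "\<exists>M. \<forall>m\<ge>M. alph d m \<le> 2 / b + \<epsilon>"
proof -
  obtain C M where C: "0 < C" "\<And>m. M \<le> m \<Longrightarrow> 0 < sig2 m \<and> sig2 m \<le> C * real m powr - real b \<and>
    sig2 m \<in> set (evs m) \<and> real (count_list (evs m) (sig2 m)) \<le> C"
    using sig2_upper[OF Sne] by blast
  have b0: "0 < real b" using b_pos[OF Sne] by simp
  have d0: "0 < real d" using d by simp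
  obtain M' where M': "\<And>m \<sigma> \<mu>. M' \<le> m \<Longrightarrow> 0 < \<sigma> \<Longrightarrow> \<sigma> \<le> C * real m powr - real b \<Longrightarrow> 1 \<le> \<mu> \<Longrightarrow>
    ln (\<mu> / (real d * real m)) / ln (sqrt \<sigma>) \<le> 2 / b + \<epsilon>"
    using log_ratio_upper[OF C(1) b0 d0 \<epsilon>] by blast
  show ?thesis
  proof (intro exI[of _ "max M M'"] allI impI)
    fix m assume "max M M' \<le> m"
    then have m: "M \<le> m" "M' \<le> m" by auto
    have "count_list (evs m) (sig2 m) \<noteq> 0" using C(2)[OF m(1)] by (simp add: count_list_0_iff)
    then show "alph d m \<le> 2 / b + \<epsilon>" unfolding eig_alpha_def using C(2)[OF m(1)] by (intro M' m) auto
  qed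
qed

text \<open>For the \<open>m\<close> provided by \<open>roots_of_unity_avoid\<close> the smallest
  positive eigenvalue is at least a multiple of \<open>m\<close> to the power \<open>- b\<close>,
  while its multiplicity is bounded, so \<open>log_ratio_lower\<close> applies. Divisibility by
  \<open>k\<close> makes these \<open>m\<close> cofinal in the net.\<close>

lemma eig_alpha_lower:
  assumes Sne: "S \<noteq> {}" and d: "0 < d" and \<epsilon>: "0 < \<epsilon>" and k: "0 < k"
  shows "\<exists>m>0. k dvd m \<and> 2 / b - \<epsilon> \<le> alph d m"
proof -
  obtain C M where C: "0 < C" "\<And>m. M \<le> m \<Longrightarrow> 0 < sig2 m \<and> sig2 m \<le> C * real m powr - real b \<and>
    sig2 m \<in> set (evs m) \<and> real (count_list (evs m) (sig2 m)) \<le> C"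
    using sig2_upper[OF Sne] by blast
  have b0: "0 < real b" using b_pos[OF Sne] by simp
  have d0: "0 < real d" using d by simp
  obtain k' \<delta> where k': "0 < k'" "k dvd k'" "0 < \<delta>"
    "\<And>M. \<exists>j>M. \<forall>z\<in>S. \<forall>\<omega>. \<omega> ^ (k' * j) = 1 \<longrightarrow> \<omega> \<noteq> z \<longrightarrow> \<delta> / real (k' * j) \<le> cmod (\<omega> - z)"
    by (rule roots_of_unity_avoid[OF finS _ k]) (auto simp: S_def)
  obtain c where c: "0 < c" "\<And>m. 0 < m \<Longrightarrow> (\<forall>z\<in>S. \<forall>\<omega>. \<omega> ^ m = 1 \<longrightarrow> \<omega> \<noteq> z \<longrightarrow> \<delta> / real m \<le> cmod (\<omega> - z)) \<Longrightarrow>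
    \<forall>e\<in>set (evs m). 0 < e \<longrightarrow> c * real m powr - real b \<le> e"
    using sig2_lower[OF Sne k'(3)] by blast
  obtain M' where M': "\<And>m \<sigma> \<mu>. M' \<le> m \<Longrightarrow> c * real m powr - real b \<le> \<sigma> \<Longrightarrow> \<sigma> < 1 \<Longrightarrow> 1 \<le> \<mu> \<Longrightarrow> \<mu> \<le> C \<Longrightarrow>
    2 / b - \<epsilon> \<le> ln (\<mu> / (real d * real m)) / ln (sqrt \<sigma>)"
    using log_ratio_lower[OF c(1) C(1) b0 d0 \<epsilon>] by blast
  have "(\<lambda>m::nat. C * real m powr - real b) \<longlonglongrightarrow> 0" using b0 by real_asymp
  then have "\<forall>\<^sub>F m in sequentially. C * real m powr - real b < 1" by (rule order_tendstoD) simp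
  then obtain M2 where M2: "\<And>m. M2 \<le> m \<Longrightarrow> C * real m powr - real b < 1" unfolding eventually_sequentially by blast
  obtain j where j: "j > M + M' + M2" "\<forall>z\<in>S. \<forall>\<omega>. \<omega> ^ (k' * j) = 1 \<longrightarrow> \<omega> \<noteq> z \<longrightarrow> \<delta> / real (k' * j) \<le> cmod (\<omega> - z)"
    using k'(4) by blast
  define m where "m = k' * j"
  have "j \<le> m" using k'(1) by (simp add: m_def)
  then have m: "M \<le> m" "M' \<le> m" "M2 \<le> m" "0 < m" using j(1) by auto
  note sm = C(2)[OF m(1)]
  have "c * real m powr - real b \<le> sig2 m" using c(2)[OF m(4)] j(2) sm unfolding m_def by blast
  moreover have "sig2 m < 1" using sm M2[OF m(3)] by linarith
  moreover have "count_list (evs m) (sig2 m) \<noteq> 0" using sm by (simp add: count_list_0_iff)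
  ultimately have "2 / b - \<epsilon> \<le> alph d m" unfolding eig_alpha_def using sm by (intro M' m) auto
  moreover have "k dvd m" using k'(2) by (simp add: m_def)
  ultimately show ?thesis using m(4) by blast
qed

end

section \<open>Spectral distributions as limits of counting functions\<close>

text \<open>A polynomial involves finitely many moments, so for large \<open>m\<close> both sides
  agree exactly on it. Approximating \<open>f\<close> uniformly within \<eta> costs at most
  \<open>\<eta> * n\<close> for the lists and \<open>\<eta> * W\<close> for the measures.\<close>

lemma averages_tendsto:
  fixes N :: "nat \<Rightarrow> real measure" and L :: "nat \<Rightarrow> real list"
  assumes N: "\<And>k. k < r \<Longrightarrow> finite_on R (N k)"
    and L: "\<And>m e. e \<in> set (L m) \<Longrightarrow> e \<in> {-R..R}" and len: "\<And>m. length (L m) = n * m" and d: "0 < d"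
    and mom: "\<And>j. \<forall>\<^sub>F m in sequentially. (\<Sum>e\<leftarrow>L m. e ^ j) / (d * m) = (\<Sum>k<r. \<integral>t. t ^ j \<partial>N k)"
    and f: "continuous_on UNIV f"
  shows "(\<lambda>m. (\<Sum>e\<leftarrow>L m. f e) / real (d * m)) \<longlonglongrightarrow> (\<Sum>k<r. \<integral>t. f t \<partial>N k)"
proof (rule LIMSEQ_I)
  fix \<epsilon> :: real assume \<epsilon>: "0 < \<epsilon>"
  define W where "W = (\<Sum>k<r. measure (N k) UNIV)"
  have W: "0 \<le> W" by (simp add: W_def sum_nonneg)
  define \<eta> where "\<eta> = \<epsilon> / (W + real n + 1)"
  have \<eta>: "0 < \<eta>" using \<epsilon> W by (simp add: \<eta>_def)
  have fR: "continuous_on {-R..R} f" using f by (rule continuous_on_subset) simp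
  obtain p where "real_polynomial_function p" and p: "\<And>x. x \<in> {-R..R} \<Longrightarrow> \<bar>f x - p x\<bar> < \<eta>"
    using Stone_Weierstrass_real_polynomial_function[OF compact_Icc fR \<eta>] by blast
  then obtain a and J :: nat where pa: "p = (\<lambda>x. \<Sum>i\<le>J. a i * x ^ i)"
    unfolding real_polynomial_function_iff_sum by blast
  have pc: "continuous_on UNIV p" unfolding pa by (intro continuous_intros)
  have "\<forall>\<^sub>F m in sequentially. \<forall>j\<in>{..J}. (\<Sum>e\<leftarrow>L m. e ^ j) / (d * m) = (\<Sum>k<r. \<integral>t. t ^ j \<partial>N k)"
    by (rule eventually_ball_finite) (use mom in auto)
  then obtain M where M: "\<And>m j. M \<le> m \<Longrightarrow> j \<le> J \<Longrightarrow> (\<Sum>e\<leftarrow>L m. e ^ j) / (d * m) = (\<Sum>k<r. \<integral>t. t ^ j \<partial>N k)"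
    unfolding eventually_sequentially by auto
  have sum_p: "(\<Sum>e\<leftarrow>xs. p e) = (\<Sum>j\<le>J. a j * (\<Sum>e\<leftarrow>xs. e ^ j))" for xs
    by (induction xs) (simp_all add: pa sum.distrib ring_distribs)
  have int_p: "(\<integral>t. p t \<partial>N k) = (\<Sum>j\<le>J. a j * (\<integral>t. t ^ j \<partial>N k))" if k: "k < r" for k
    unfolding pa using bdd_on_integrable[OF N[OF k] bdd_on_power] by simp
  have int_diff: "\<bar>(\<integral>t. p t \<partial>N k) - (\<integral>t. f t \<partial>N k)\<bar> \<le> \<eta> * measure (N k) UNIV" if k: "k < r" for k
  proof -
    interpret finite_measure "N k" using N[OF k] by (rule finite_onD)
    note ip = bdd_on_integrable[OF N[OF k] bdd_on_continuous[OF pc]] and if' = bdd_on_integrable[OF N[OF k] bdd_on_continuous[OF f]]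
    have "\<bar>\<integral>t. p t - f t \<partial>N k\<bar> \<le> (\<integral>t. \<eta> \<partial>N k)"
    proof (rule order_trans[OF integral_abs_bound], rule integral_mono_AE)
      show "integrable (N k) (\<lambda>t. \<bar>p t - f t\<bar>)" using ip if' by (intro integrable_abs Bochner_Integration.integrable_diff)
      show "AE t in N k. \<bar>p t - f t\<bar> \<le> \<eta>"
        using finite_on_AE[OF N[OF k]] by (rule AE_mp) (use p in \<open>fastforce simp: abs_minus_commute\<close>)
    qed simp
    then show ?thesis using ip if' finite_onD(4)[OF N[OF k]] by (simp add: mult.commute)
  qed
  have "norm ((\<Sum>e\<leftarrow>L m. f e) / real (d * m) - (\<Sum>k<r. \<integral>t. f t \<partial>N k)) < \<epsilon>" if m: "max M 1 \<le> m" for m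
  proof -
    have m': "M \<le> m" "0 < m" using m by auto
    have "(\<Sum>e\<leftarrow>L m. p e) / real (d * m) = (\<Sum>j\<le>J. a j * ((\<Sum>e\<leftarrow>L m. e ^ j) / (d * m)))"
      unfolding sum_p sum_divide_distrib by simp
    also have "\<dots> = (\<Sum>j\<le>J. \<Sum>k<r. a j * (\<integral>t. t ^ j \<partial>N k))"
      by (intro sum.cong refl) (use M[OF m'(1)] in \<open>simp add: sum_distrib_left\<close>)
    also have "\<dots> = (\<Sum>k<r. \<integral>t. p t \<partial>N k)"
      by (subst sum.swap) (simp add: int_p)
    finally have eq: "(\<Sum>e\<leftarrow>L m. p e) / real (d * m) = (\<Sum>k<r. \<integral>t. p t \<partial>N k)" .
    have "\<bar>(\<Sum>k<r. \<integral>t. p t \<partial>N k) - (\<Sum>k<r. \<integral>t. f t \<partial>N k)\<bar> \<le> (\<Sum>k<r. \<eta> * measure (N k) UNIV)"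
      unfolding sum_subtractf[symmetric] by (rule order_trans[OF sum_abs]) (intro sum_mono int_diff, simp)
    also have "\<dots> = \<eta> * W" by (simp add: W_def sum_distrib_left)
    finally have 1: "\<bar>(\<Sum>k<r. \<integral>t. p t \<partial>N k) - (\<Sum>k<r. \<integral>t. f t \<partial>N k)\<bar> \<le> \<eta> * W" .
    have list: "\<bar>(\<Sum>e\<leftarrow>xs. f e) - (\<Sum>e\<leftarrow>xs. p e)\<bar> \<le> \<eta> * length xs" if "set xs \<subseteq> {-R..R}" for xs
      using that
    proof (induction xs)
      case (Cons x xs)
      then have "\<bar>f x - p x\<bar> < \<eta>" using p by auto
      then show ?case using Cons by (simp add: ring_distribs) 
    qed simp
    have "\<bar>(\<Sum>e\<leftarrow>L m. f e) - (\<Sum>e\<leftarrow>L m. p e)\<bar> \<le> \<eta> * (n * m)"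
    proof -
      have "set (L m) \<subseteq> {-R..R}" using L by blast
      from list[OF this] show ?thesis by (simp add: len)
    qed
    then have "\<bar>(\<Sum>e\<leftarrow>L m. f e) - (\<Sum>e\<leftarrow>L m. p e)\<bar> / (d * m) \<le> \<eta> * (n * m) / (d * m)"
      by (intro divide_right_mono) auto
    also have "\<eta> * (n * m) / (d * m) = \<eta> * n / d" using m' by simp
    also have "\<dots> \<le> \<eta> * n / 1" using d \<eta> by (intro divide_left_mono) auto
    finally have 2: "\<bar>(\<Sum>e\<leftarrow>L m. f e) / (d * m) - (\<Sum>e\<leftarrow>L m. p e) / (d * m)\<bar> \<le> \<eta> * n"
      by (simp add: diff_divide_distrib[symmetric] abs_divide)
    have "\<bar>(\<Sum>e\<leftarrow>L m. f e) / (d * m) - (\<Sum>k<r. \<integral>t. f t \<partial>N k)\<bar> \<le> \<eta> * n + \<eta> * W"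
      using 1 2 eq by linarith
    also have "\<dots> < \<eta> * (W + real n + 1)" using \<eta> by (simp add: algebra_simps)
    also have "\<dots> = \<epsilon>" using W by (simp add: \<eta>_def)
    finally show ?thesis by simp
  qed
  then show "\<exists>no. \<forall>m\<ge>no. norm ((\<Sum>e\<leftarrow>L m. f e) / real (d * m) - (\<Sum>k<r. \<integral>t. f t \<partial>N k)) < \<epsilon>" by blast
qed

lemma sum_list_indicator_bounds:
  fixes f :: "real \<Rightarrow> real"
  assumes "\<And>e. 0 \<le> f e \<and> f e \<le> (1::real)"
  shows "(\<And>e. e \<le> x \<Longrightarrow> f e = 1) \<Longrightarrow> real (length (filter (\<lambda>e. e \<le> x) xs)) \<le> (\<Sum>e\<leftarrow>xs. f e)"
    and "(\<And>e. y \<le> e \<Longrightarrow> f e = 0) \<Longrightarrow> (\<Sum>e\<leftarrow>xs. f e) \<le> real (length (filter (\<lambda>e. e \<le> y) xs))"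
proof -
  show "real (length (filter (\<lambda>e. e \<le> x) xs)) \<le> (\<Sum>e\<leftarrow>xs. f e)" if "\<And>e. e \<le> x \<Longrightarrow> f e = 1"
  proof (induction xs)
    case (Cons e xs)
    then show ?case using assms[of e] that[of e] by auto
  qed simp
  show "(\<Sum>e\<leftarrow>xs. f e) \<le> real (length (filter (\<lambda>e. e \<le> y) xs))" if "\<And>e. y \<le> e \<Longrightarrow> f e = 0"
  proof (induction xs)
    case (Cons e xs)
    show ?case
    proof (cases "e \<le> y")
      case False
      then have "y \<le> e" by linarith
      then have "f e = 0" by (rule that)
      then show ?thesis using Cons False by simp
    qed (use Cons assms[of e] in auto)
  qed simp
qed

theorem counting_limit_of_moments:
  fixes N :: "nat \<Rightarrow> real measure" and es :: "complex \<Rightarrow> real list"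
  assumes N: "\<And>k. k < r \<Longrightarrow> finite_on R (N k)"
    and len: "\<And>z. cmod z = 1 \<Longrightarrow> length (es z) = n"
    and es: "\<And>z e. cmod z = 1 \<Longrightarrow> e \<in> set (es z) \<Longrightarrow> 0 \<le> e \<and> e \<le> R" and d: "0 < d"
    and mom: "\<And>j. \<forall>\<^sub>F m in sequentially. (\<Sum>e\<leftarrow>eigs es m. e ^ j) / (d * m) = (\<Sum>k<r. \<integral>t. t ^ j \<partial>N k)"
  shows "counting_limit (\<lambda>x. \<Sum>k<r. measure (N k) {0..x}) (eig_count es) d"
proof -
  have L: "0 \<le> e \<and> e \<in> {-R..R}" if "e \<in> set (eigs es m)" for m e
  proof -
    obtain k where "e \<in> set (es (unit_root m k))" using \<open>e \<in> set (eigs es m)\<close> by (auto simp: set_eigs)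
    then show ?thesis using es[of "unit_root m k" e] by auto
  qed
  have lenL: "length (eigs es m) = n * m" for m
    by (simp add: eigs_def length_concat o_def len sum_list_triv mult.commute)
  have lim: "(\<lambda>m. (\<Sum>e\<leftarrow>eigs es m. f e) / real (d * m)) \<longlonglongrightarrow> (\<Sum>k<r. \<integral>t. f t \<partial>N k)" if "continuous_on UNIV f" for f
    by (rule averages_tendsto[OF N _ lenL d mom that]) (use L in blast)+
  have intg: "integrable (N k) f" if "k < r" "continuous_on UNIV f" for k and f :: "real \<Rightarrow> real"
    by (rule bdd_on_integrable[OF N[OF that(1)] bdd_on_continuous[OF that(2)]])
  \<comment> \<open>The support condition allows negative arguments, whereas the distribution counts
    from 0. The continuous function \<open>max 0 (- t)\<close> vanishes on all the lists, so in the
    limit the measures have no mass below 0.\<close>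
  have neg: "measure (N k) {..<0} = 0" if k: "k < r" for k
  proof -
    let ?f = "\<lambda>t::real. max 0 (- t)"
    have c: "continuous_on UNIV ?f" by (intro continuous_intros)
    have "(\<Sum>e\<leftarrow>eigs es m. ?f e) = 0" for m
    proof -
      have "map ?f (eigs es m) = map (\<lambda>_. 0) (eigs es m)" using L[of _ m] by (intro map_cong) auto
      then show ?thesis by (simp only: sum_list_0)
    qed
    then have "(\<lambda>m::nat. 0::real) \<longlonglongrightarrow> (\<Sum>k<r. \<integral>t. ?f t \<partial>N k)" using lim[OF c] by simp
    then have "(\<Sum>k<r. \<integral>t. ?f t \<partial>N k) = 0" by (simp only: LIMSEQ_const_iff)
    then have "(\<integral>t. ?f t \<partial>N k) = 0"
      by (subst (asm) sum_nonneg_eq_0_iff) (use k in \<open>auto intro!: integral_nonneg\<close>)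
    then have "AE t in N k. ?f t = 0"
      by (subst (asm) integral_nonneg_eq_0_iff_AE[OF intg[OF k c]]) simp_all
    moreover have "{t \<in> space (N k). \<not> ?f t = 0} = {..<0}" using finite_onD(4)[OF N[OF k]] by auto
    ultimately have "emeasure (N k) {..<0} = 0"
      using finite_onD(2)[OF N[OF k]] by (subst (asm) AE_iff_measurable[of "{..<0}"]) auto
    then show ?thesis by (simp add: measure_def)
  qed
  have atMost: "measure (N k) {0..x} = measure (N k) {..x}" if k: "k < r" and x: "0 \<le> x" for k x
  proof -
    interpret finite_measure "N k" using N[OF k] by (rule finite_onD)
    have "measure (N k) ({..<0} \<union> {0..x}) = measure (N k) {..<0} + measure (N k) {0..x}"
      by (rule finite_measure_Union) (use finite_onD(2)[OF N[OF k]] in auto)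
    moreover have "{..<0} \<union> {0..x} = {..x}" using x by auto
    ultimately show ?thesis using neg[OF k] by simp
  qed
  define D where "D x = (\<Sum>k<r. measure (N k) {0..x})" for x
  have D: "D x = (\<Sum>k<r. measure (N k) {..x})" if "0 \<le> x" for x
    unfolding D_def by (intro sum.cong refl atMost) (use that in auto)
  \<comment> \<open>A continuous function between the indicators of \<open>{..x}\<close> and
    \<open>{..y}\<close> turns convergence of integrals into the two comparisons at distinct
    arguments.\<close>
  have test: "\<exists>f. continuous_on UNIV f \<and> (\<forall>e. 0 \<le> f e \<and> f e \<le> 1) \<and> (\<forall>e\<le>x. f e = 1) \<and> (\<forall>e\<ge>y. f e = (0::real))"
    if "x < y" for x y :: real
  proof (intro exI conjI allI impI)
    let ?f = "\<lambda>t. max 0 (min 1 ((y - t) / (y - x)))"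
    show "continuous_on UNIV ?f" by (intro continuous_intros) (use that in simp)
    fix e show "0 \<le> ?f e" "?f e \<le> 1" by simp_all
    show "?f e = 1" if "e \<le> x" using that \<open>x < y\<close> by (simp add: min_def max_def field_simps)
    show "?f e = 0" if "y \<le> e" 
    proof -
      have "(y - e) / (y - x) \<le> 0" using that \<open>x < y\<close> by (intro divide_nonpos_pos) auto
      then show ?thesis by simp
    qed
  qed
  have meas: "measure (N k) {..x} = (\<integral>t. indicator {..x} t \<partial>N k)" if "k < r" for k x
    using finite_onD(2,4)[OF N[OF that]] by simp
  have ind: "integrable (N k) (indicator {..x} :: real \<Rightarrow> real)" if "k < r" for k x
    by (rule bdd_on_integrable[OF N[OF that] bdd_on_indicator]) simp
  have "counting_limit D (eig_count es) d"
  proof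
    show "0 < d" by (rule d)
    show "D x \<le> D y" if "0 \<le> x" "x \<le> y" for x y
      unfolding D_def
    proof (rule sum_mono)
      fix k assume "k \<in> {..<r}"
      then have k: "k < r" by simp
      interpret finite_measure "N k" using N[OF k] by (rule finite_onD)
      show "measure (N k) {0..x} \<le> measure (N k) {0..y}"
        by (rule finite_measure_mono) (use that finite_onD(2)[OF N[OF k]] in auto)
    qed
    have rc: "((\<lambda>x. \<Sum>k<r. measure (N k) {..x}) \<longlongrightarrow> (\<Sum>k<r. measure (N k) {..0})) (at_right 0)"
    proof (rule tendsto_sum)
      fix k assume "k \<in> {..<r}"
      then have k: "k < r" by simp
      interpret finite_measure "N k" using N[OF k] by (rule finite_onD)
      interpret finite_borel_measure "N k" by standard (use finite_onD(2)[OF N[OF k]] in simp)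
      show "((\<lambda>x. measure (N k) {..x}) \<longlongrightarrow> measure (N k) {..0}) (at_right 0)"
        using cdf_is_right_cont[of 0] unfolding continuous_within cdf_def .
    qed
    have ev: "\<forall>\<^sub>F x in at_right 0. (\<Sum>k<r. measure (N k) {..x}) = D x"
      unfolding eventually_at_filter by (intro always_eventually) (simp add: D)
    show "(D \<longlongrightarrow> D 0) (at_right 0)" using Lim_transform_eventually[OF rc ev] by (simp add: D)
    fix x y \<epsilon> :: real assume xy: "0 \<le> x" "x < y" and \<epsilon>: "0 < \<epsilon>"
    obtain f where f: "continuous_on UNIV f" "\<And>e. 0 \<le> f e \<and> f e \<le> 1" "\<And>e. e \<le> x \<Longrightarrow> f e = 1" "\<And>e. y \<le> e \<Longrightarrow> f e = (0::real)"
      using test[OF xy(2)] by blast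
    obtain M where M: "\<And>m. M \<le> m \<Longrightarrow> \<bar>(\<Sum>e\<leftarrow>eigs es m. f e) / real (d * m) - (\<Sum>k<r. \<integral>t. f t \<partial>N k)\<bar> < \<epsilon>"
      using LIMSEQ_D[OF lim[OF f(1)] \<epsilon>] by auto
    have Dx: "D x \<le> (\<Sum>k<r. \<integral>t. f t \<partial>N k)"
      unfolding D[OF xy(1)]
    proof (rule sum_mono)
      fix k assume "k \<in> {..<r}"
      then have k: "k < r" by simp
      show "measure (N k) {..x} \<le> (\<integral>t. f t \<partial>N k)"
        unfolding meas[OF k] by (rule integral_mono[OF ind[OF k] intg[OF k f(1)]]) (use f in \<open>auto simp: indicator_def\<close>)
    qed
    have Dy: "(\<Sum>k<r. \<integral>t. f t \<partial>N k) \<le> D y"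
      unfolding D[OF less_imp_le[OF le_less_trans[OF xy]]]
    proof (rule sum_mono)
      fix k assume "k \<in> {..<r}"
      then have k: "k < r" by simp
      show "(\<integral>t. f t \<partial>N k) \<le> measure (N k) {..y}"
        unfolding meas[OF k] by (rule integral_mono[OF intg[OF k f(1)] ind[OF k]]) (use f in \<open>auto simp: indicator_def\<close>)
    qed
    have "D x \<le> eig_count es m y / (d * m) + \<epsilon>" if "M \<le> m" for m
    proof -
      have "(\<Sum>e\<leftarrow>eigs es m. f e) / real (d * m) \<le> eig_count es m y / (d * m)"
        unfolding eig_count_def by (intro divide_right_mono sum_list_indicator_bounds(2)) (use f in auto)
      then show ?thesis using M[OF that] Dx by linarith
    qed
    then show "\<exists>M. \<forall>m\<ge>M. D x \<le> eig_count es m y / (d * m) + \<epsilon>" by blast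
    have "eig_count es m x / (d * m) \<le> D y + \<epsilon>" if "M \<le> m" for m
    proof -
      have "eig_count es m x / (d * m) \<le> (\<Sum>e\<leftarrow>eigs es m. f e) / real (d * m)"
        unfolding eig_count_def by (intro divide_right_mono sum_list_indicator_bounds(1)) (use f in auto)
      then show ?thesis using M[OF that] Dy by linarith
    qed
    then show "\<exists>M. \<forall>m\<ge>M. eig_count es m x / (d * m) \<le> D y + \<epsilon>" by blast
  qed
  then show ?thesis unfolding D_def[abs_def] .
qed

section \<open>Novikov--Shubin numbers and alpha numbers of virtually cyclic groups\<close>

lemma sum_eigs: "(\<Sum>e\<leftarrow>eigs es m. f e) = (\<Sum>k<m. \<Sum>e\<leftarrow>es (unit_root m k). f e)" for f :: "real \<Rightarrow> 'b::comm_monoid_add"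
proof -
  have "(\<Sum>e\<leftarrow>concat (map g xs). f e) = (\<Sum>k\<leftarrow>xs. \<Sum>e\<leftarrow>g k. f e)" for g and xs :: "nat list"
    by (induction xs) simp_all
  then show ?thesis by (simp add: eigs_def interv_sum_list_conv_sum_set_nat atLeast0LessThan)
qed

context group
begin

lemma gsum_eq_at_one:
  assumes a: "a \<in> GR G" and \<phi>: "\<And>g. g \<in> carrier G \<Longrightarrow> a g \<noteq> 0 \<Longrightarrow> g \<noteq> \<one> \<Longrightarrow> \<phi> g = 0"
  shows "gsum G a \<phi> = a \<one> * \<phi> \<one>"
proof -
  have fin: "finite {g \<in> carrier G. a g \<noteq> 0}" by (rule GR_finite[OF a])
  have "gsum G a \<phi> = (\<Sum>g\<in>insert \<one> {g \<in> carrier G. a g \<noteq> 0}. a g * \<phi> g)"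
    by (rule gsum_superset) (use fin in auto)
  also have "\<dots> = (\<Sum>g\<in>{\<one>}. a g * \<phi> g)"
    by (rule sum.mono_neutral_right) (use fin \<phi> in auto)
  finally show ?thesis by simp
qed

text \<open>The \<open>k\<close>-th measure is the scalar measure of the unit vector at
  \<open>(k, \<one>)\<close>. Its moments are coefficients at the neutral element of the powers of
  \<open>gr_mult G A (gr_star G A)\<close>, so the lists must have these traces as normalized power
  sums. Both the circle and a finite group supply such lists.\<close>

lemma counting_limit_of_traces:
  fixes es :: "complex \<Rightarrow> real list"
  assumes A: "A \<in> GM r s"
    and len: "\<And>z. cmod z = 1 \<Longrightarrow> length (es z) = n"
    and nonneg: "\<And>z. cmod z = 1 \<Longrightarrow> \<forall>e\<in>set (es z). 0 \<le> e"
    and bounded: "\<exists>K. \<forall>z e. cmod z = 1 \<longrightarrow> e \<in> set (es z) \<longrightarrow> e \<le> K"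
    and d: "0 < d"
    and traces: "\<And>j. \<forall>\<^sub>F m in sequentially. (\<Sum>e\<leftarrow>eigs es m. e ^ j) / (d * m) =
      (\<Sum>k<r. Re ((gr_pow (gr_mult G A (gr_star G A)) j $$ (k, k)) \<one>))"
  shows "\<exists>D. counting_limit D (eig_count es) d \<and> (\<forall>l. spectral_distribution G A l = D (l\<^sup>2))"
proof -
  let ?C = "gr_mult G A (gr_star G A)"
  have C_GM: "?C \<in> GM r r" by (rule gr_mult_GM[OF A gr_star_GM[OF A]])
  let ?I = "index_set G r" and ?T = "right_mult G ?C"
  obtain R0 where pos: "positive_operator ?I ?T R0" using right_mult_positive[OF A] by blast
  interpret PP: positive_operator ?I ?T R0 by (rule pos)
  define F where "F = spectral_projection ?I ?T"
  have F: "spectral_measure ?I ?T F"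
    unfolding F_def spectral_projection_def by (rule someI[of _ PP.E]) (rule PP.spectral_measure_E)
  interpret PO: positive_operator_spectral ?I ?T R0 F
    using pos F by (simp add: positive_operator_spectral_def positive_operator_spectral_axioms_def)
  define N where "N k = PO.N (unit_fun (k, \<one>))" for k :: nat
  have u: "unit_fun (k, \<one>) \<in> ell2 ?I" if "k < r" for k using that by (intro ell2_unit_fun) auto
  obtain K where K: "\<And>z e. cmod z = 1 \<Longrightarrow> e \<in> set (es z) \<Longrightarrow> e \<le> K" using bounded by blast
  define R where "R = max PO.S K"
  have lim: "counting_limit (\<lambda>x. \<Sum>k<r. measure (N k) {0..x}) (eig_count es) d"
  proof (rule counting_limit_of_moments[where R = R])
    show "finite_on R (N k)" if "k < r" for k
      unfolding N_def by (rule finite_on_mono[OF PO.finite_on_N[OF u[OF that]]]) (simp add: R_def)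
    show "length (es z) = n" if "cmod z = 1" for z by (rule len[OF that])
    show "0 \<le> e \<and> e \<le> R" if "cmod z = 1" "e \<in> set (es z)" for z e
      using nonneg[OF that(1)] K[OF that] that(2) by (auto simp: R_def)
    show "0 < d" by (rule d)
    fix j
    have mom: "(\<integral>t. t ^ j \<partial>N k) = Re ((gr_pow ?C j $$ (k, k)) \<one>)" if k: "k < r" for k
    proof -
      have "(\<integral>t. t ^ j \<partial>N k) = Re (((?T ^^ j) (unit_fun (k, \<one>))) (k, \<one>))"
        unfolding N_def PO.N_moment[OF u[OF k]] using k by (subst ell2_inner_unit_right) auto
      then show ?thesis using k by (simp add: right_mult_pow_unit[OF C_GM k])
    qed
    show "\<forall>\<^sub>F m in sequentially. (\<Sum>e\<leftarrow>eigs es m. e ^ j) / (d * m) = (\<Sum>k<r. \<integral>t. t ^ j \<partial>N k)"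
      using traces[of j] by (simp add: mom)
  qed
  have "spectral_distribution G A l = (\<Sum>k<r. measure (N k) {0..l\<^sup>2})" for l
  proof -
    have "spectral_distribution G A l = (\<Sum>k<r. Re (ell2_inner ?I (F {0..l\<^sup>2} (unit_fun (k, \<one>))) (unit_fun (k, \<one>))))"
      using GM_dim(1)[OF A] by (simp add: spectral_distribution_def vn_trace_def F_def)
    also have "\<dots> = (\<Sum>k<r. measure (N k) {0..l\<^sup>2})"
      by (intro sum.cong refl) (simp add: N_def PO.measure_N u)
    finally show ?thesis .
  qed
  then show ?thesis using lim by blast
qed

end

locale virtually_Z_matrix = virtually_Z G t d rp for G (structure) and t d rp +
  fixes A :: "('a \<Rightarrow> complex) mat" and r s :: nat
  assumes A: "A \<in> GM r s"
begin

abbreviation "C \<equiv> gr_mult G A (gr_star G A)"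

definition symbol :: "complex \<Rightarrow> complex mat" where
  "symbol z = unitary_rep.rep_mat G d (zrep z) A"

lemma C_GM: "C \<in> GM r r"
  by (rule gr_mult_GM[OF A gr_star_GM[OF A]])

lemma symbol_carrier: "cmod z = 1 \<Longrightarrow> symbol z \<in> carrier_mat (r * d) (s * d)"
  unfolding symbol_def by (rule unitary_rep.rep_mat_carrier[OF zrep_unitary A])

text \<open>The lists are chosen separately for each \<open>z\<close>; regularity in
  \<open>z\<close> is asked of the characteristic polynomial and of the trace only.\<close>

definition es :: "complex \<Rightarrow> real list" where
  "es z = (SOME es. length es = r * d \<and> (\<forall>e\<in>set es. 0 \<le> e) \<and>
    char_poly (symbol z * mat_adjoint (symbol z)) = (\<Prod>e\<leftarrow>es. [:- complex_of_real e, 1:]) \<and>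
    (\<forall>j. mtrace ((symbol z * mat_adjoint (symbol z)) ^\<^sub>m j) = complex_of_real (\<Sum>e\<leftarrow>es. e ^ j)))"

lemma es:
  assumes z: "cmod z = 1"
  shows "length (es z) = r * d" "\<forall>e\<in>set (es z). 0 \<le> e"
    "char_poly (symbol z * mat_adjoint (symbol z)) = (\<Prod>e\<leftarrow>es z. [:- complex_of_real e, 1:])"
    "mtrace ((symbol z * mat_adjoint (symbol z)) ^\<^sub>m j) = complex_of_real (\<Sum>e\<leftarrow>es z. e ^ j)"
proof -
  have "\<exists>es. length es = r * d \<and> (\<forall>e\<in>set es. 0 \<le> e) \<and>
    char_poly (symbol z * mat_adjoint (symbol z)) = (\<Prod>e\<leftarrow>es. [:- complex_of_real e, 1:]) \<and>
    (\<forall>j. mtrace ((symbol z * mat_adjoint (symbol z)) ^\<^sub>m j) = complex_of_real (\<Sum>e\<leftarrow>es. e ^ j))"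
    by (rule gram_eigenvalues[OF symbol_carrier[OF z]]) blast
  from someI_ex[OF this] show "length (es z) = r * d" "\<forall>e\<in>set (es z). 0 \<le> e"
    "char_poly (symbol z * mat_adjoint (symbol z)) = (\<Prod>e\<leftarrow>es z. [:- complex_of_real e, 1:])"
    "mtrace ((symbol z * mat_adjoint (symbol z)) ^\<^sub>m j) = complex_of_real (\<Sum>e\<leftarrow>es z. e ^ j)"
    unfolding es_def[symmetric] by blast+
qed

text \<open>By \<open>sum_charac\<close> the traces at all \<open>m\<close>-th roots of unity add up
  to the expression that \<open>mtrace_regular_matrix\<close> gives for the quotient by
  \<open>Z m\<close>.\<close>

lemma eigs_power:
  assumes m: "0 < m"
  shows "complex_of_real (\<Sum>e\<leftarrow>eigs es m. e ^ j) =
    (\<Sum>k<r. gsum G (gr_pow C j $$ (k, k)) (\<lambda>g. if g \<in> Z m then of_nat (d * m) else 0))"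
proof -
  have "complex_of_real (\<Sum>e\<leftarrow>eigs es m. e ^ j) =
    (\<Sum>i<m. \<Sum>k<r. gsum G (gr_pow C j $$ (k, k)) (unitary_rep.charac d (zrep (unit_root m i))))"
    unfolding sum_eigs of_real_sum
  proof (rule sum.cong[OF refl])
    fix i
    show "complex_of_real (\<Sum>e\<leftarrow>es (unit_root m i). e ^ j) =
      (\<Sum>k<r. gsum G (gr_pow C j $$ (k, k)) (unitary_rep.charac d (zrep (unit_root m i))))"
      unfolding es(4)[OF norm_unit_root, symmetric] symbol_def
      by (rule unitary_rep.mtrace_gram_pow[OF zrep_unitary[OF norm_unit_root] A])
  qed
  also have "\<dots> = (\<Sum>k<r. gsum G (gr_pow C j $$ (k, k)) (\<lambda>g. \<Sum>i<m. unitary_rep.charac d (zrep (unit_root m i)) g))"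
    by (subst sum.swap) (simp add: gsum_sum)
  also have "\<dots> = (\<Sum>k<r. gsum G (gr_pow C j $$ (k, k)) (\<lambda>g. if g \<in> Z m then of_nat (d * m) else 0))"
    by (intro sum.cong refl gsum_cong) (simp only: sum_charac[OF m])
  finally show ?thesis .
qed

lemma eventually_not_mem_Z:
  assumes g: "g \<noteq> \<one>"
  shows "\<forall>\<^sub>F m in sequentially. g \<notin> Z m"
proof (cases "\<exists>l::int. g = t [^] l")
  case True
  then obtain l :: int where l: "g = t [^] l" by blast
  then have "l \<noteq> 0" using g by auto
  then have "\<not> int m dvd l" if "nat \<bar>l\<bar> + 1 \<le> m" for m
    using that dvd_imp_le_int[of l "int m"] by auto
  then show ?thesis unfolding eventually_sequentially l tpow_mem_Z by blast
next
  case False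
  then show ?thesis by (auto simp: Z_def)
qed

text \<open>The nontrivial group elements on the diagonal of the \<open>j\<close>-th power are
  finite in number and lie outside \<open>Z m\<close> for large \<open>m\<close>, so only the
  neutral element contributes.\<close>

lemma moments_eventually:
  "\<forall>\<^sub>F m in sequentially. (\<Sum>e\<leftarrow>eigs es m. e ^ j) / (d * m) = (\<Sum>k<r. Re ((gr_pow C j $$ (k, k)) \<one>))"
proof -
  define F where "F = (\<Union>k<r. {g \<in> carrier G. (gr_pow C j $$ (k, k)) g \<noteq> 0}) - {\<one>}"
  have fin: "finite {g \<in> carrier G. (gr_pow C j $$ (k, k)) g \<noteq> 0}" if "k < r" for k
    by (rule GR_finite[OF GM_entry[OF gr_pow_GM[OF C_GM] that that]])
  then have "finite F" by (simp add: F_def)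
  then have "\<forall>\<^sub>F m in sequentially. \<forall>g\<in>F. g \<notin> Z m"
    by (rule eventually_ball_finite) (auto simp: F_def intro: eventually_not_mem_Z)
  moreover have "\<forall>\<^sub>F m::nat in sequentially. 0 < m" by (rule eventually_gt_at_top)
  ultimately show ?thesis
  proof eventually_elim
    fix m :: nat assume F: "\<forall>g\<in>F. g \<notin> Z m" and m: "0 < m"
    have one: "\<one> \<in> Z m" using subgroup.one_closed[OF Z_subgroup] .
    have "gsum G (gr_pow C j $$ (k, k)) (\<lambda>g. if g \<in> Z m then of_nat (d * m) else 0) =
      of_nat (d * m) * (gr_pow C j $$ (k, k)) \<one>" if k: "k < r" for k
    proof -
      have "gsum G (gr_pow C j $$ (k, k)) (\<lambda>g. if g \<in> Z m then of_nat (d * m) else 0) =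
        (gr_pow C j $$ (k, k)) \<one> * (if \<one> \<in> Z m then of_nat (d * m) else 0)"
        by (rule gsum_eq_at_one[OF GM_entry[OF gr_pow_GM[OF C_GM] k k]]) (use F k in \<open>auto simp: F_def\<close>)
      then show ?thesis using one by simp
    qed
    then have "complex_of_real (\<Sum>e\<leftarrow>eigs es m. e ^ j) = of_nat (d * m) * (\<Sum>k<r. (gr_pow C j $$ (k, k)) \<one>)"
      unfolding eigs_power[OF m] sum_distrib_left by (intro sum.cong) auto
    note eq = this
    have re: "Re (of_nat n * z) = real n * Re z" for n z by simp
    note arg_cong[OF eq, of Re]
    then have "(\<Sum>e\<leftarrow>eigs es m. e ^ j) = real (d * m) * (\<Sum>k<r. Re ((gr_pow C j $$ (k, k)) \<one>))"
      unfolding Re_complex_of_real re Re_sum .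
    then show "(\<Sum>e\<leftarrow>eigs es m. e ^ j) / (d * m) = (\<Sum>k<r. Re ((gr_pow C j $$ (k, k)) \<one>))"
      using m d by simp
  qed
qed

text \<open>The value off the circle is a filler of the right size, since
  \<open>laurent_char_poly\<close> speaks of a matrix for every \<open>z\<close>.\<close>

definition gram :: "complex \<Rightarrow> complex mat" where
  "gram z = (if cmod z = 1 then symbol z * mat_adjoint (symbol z) else 0\<^sub>m (r * d) (r * d))"

lemma gram_carrier: "gram z \<in> carrier_mat (r * d) (r * d)"
  using symbol_carrier[of z] mat_adjoint_carrier[OF symbol_carrier[of z]] by (auto simp: gram_def)

text \<open>On the circle the Gram matrix is the image of the single group ring matrix
  \<open>C\<close>, so its entries are combinations of integer powers of \<open>z\<close>, without
  conjugates.\<close>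

lemma laurent_gram:
  assumes kl: "k < r * d" "l < r * d"
  shows "laurent (\<lambda>z. gram z $$ (k, l))"
proof -
  let ?a = "C $$ (k div d, l div d)" and ?i = "k mod d" and ?j = "l mod d"
  have "laurent (\<lambda>z. \<Sum>g\<in>{g \<in> carrier G. ?a g \<noteq> 0}. ?a g * zrep z g ?i ?j)"
  proof (intro laurent_sum laurent_mult laurent_const)
    fix g
    show "laurent (\<lambda>z. zrep z g ?i ?j)"
      unfolding zrep_def by (cases "co (rp ?i \<otimes> g) = ?j") (simp_all add: laurent_powi laurent_const)
  qed
  then show ?thesis
  proof (rule laurent_cong)
    fix z :: complex assume z: "cmod z = 1"
    interpret U: unitary_rep G d "zrep z" by (rule zrep_unitary[OF z])
    have "gram z = U.rep_mat C"
      unfolding gram_def symbol_def using z U.rep_mat_mult[OF A gr_star_GM[OF A]] U.rep_mat_star[OF A] by simp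
    then show "(\<Sum>g\<in>{g \<in> carrier G. ?a g \<noteq> 0}. ?a g * zrep z g ?i ?j) = gram z $$ (k, l)"
      using kl GM_dim[OF C_GM] by (simp add: U.rep_mat_def U.lin_def gsum_def)
  qed
qed

lemma laurent_trace: "laurent (\<lambda>z. complex_of_real (\<Sum>e\<leftarrow>es z. e))"
proof -
  have "laurent (\<lambda>z. \<Sum>i<r * d. gram z $$ (i, i))" by (intro laurent_sum laurent_gram) auto
  then show ?thesis
  proof (rule laurent_cong)
    fix z :: complex assume z: "cmod z = 1"
    have "gram z ^\<^sub>m 1 = gram z" using gram_carrier[of z] by simp
    then show "(\<Sum>i<r * d. gram z $$ (i, i)) = complex_of_real (\<Sum>e\<leftarrow>es z. e)"
      using es(4)[OF z, of 1] gram_carrier[of z] symbol_carrier[OF z] z by (auto simp: mtrace_def gram_def)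
  qed
qed

lemma es_bounded: "\<exists>K. \<forall>z e. cmod z = 1 \<longrightarrow> e \<in> set (es z) \<longrightarrow> e \<le> K"
proof -
  obtain K where K: "\<And>z. cmod z = 1 \<Longrightarrow> cmod (complex_of_real (\<Sum>e\<leftarrow>es z. e)) \<le> K"
    using laurent_bounded[OF laurent_trace] by blast
  have "e \<le> K" if "cmod z = 1" "e \<in> set (es z)" for z e
    using member_le_sum_list_nonneg[OF that(2) es(2)[OF that(1)]] K[OF that(1)] by simp
  then show ?thesis by blast
qed

lemma spectrum_data:
  "\<exists>k0 X p c1 c2. finite X \<and> p \<noteq> 0 \<and> 0 < c1 \<and> 0 < c2 \<and> k0 \<le> r * d \<and>
    (\<forall>z. cmod z = 1 \<longrightarrow> z \<notin> X \<longrightarrow> count_list (es z) 0 = k0 \<and>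
      (k0 < r * d \<longrightarrow> (\<forall>e\<in>set (es z). 0 < e \<longrightarrow> c1 * cmod (poly p z) \<le> e) \<and>
        (\<exists>e\<in>set (es z). 0 < e \<and> e \<le> c2 * cmod (poly p z))))"
proof (rule smallest_eigenvalue_comparable[where B = gram])
  show "laurent_poly (\<lambda>z. char_poly (gram z))"
    by (rule laurent_char_poly[OF gram_carrier laurent_gram])
  show "laurent (\<lambda>z. complex_of_real (\<Sum>e\<leftarrow>es z. e))" by (rule laurent_trace)
qed (use es(1,2,3) in \<open>auto simp: gram_def\<close>)

lemma spectral_distribution_counting_limit:
  "\<exists>D. counting_limit D (eig_count es) d \<and> (\<forall>l. spectral_distribution G A l = D (l\<^sup>2))"
  by (rule counting_limit_of_traces[OF A es(1,2) es_bounded d moments_eventually])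

text \<open>The Gram matrix of the finite quotient and the lists at the \<open>m\<close>-th roots of
  unity have the same power sums, which determine the eigenvalues with their multiplicities.\<close>

lemma regular_matrix_eigs:
  assumes m: "0 < m"
  defines "M \<equiv> regular_matrix (G Mod Z m) (quotient_mat G (Z m) A)"
  shows "eigenvalue (M * mat_adjoint M) (complex_of_real x) \<longleftrightarrow> x \<in> set (eigs es m)"
    and "kernel_dim (M * mat_adjoint M - complex_of_real x \<cdot>\<^sub>m 1\<^sub>m (dim_row M)) = count_list (eigs es m) x"
proof -
  note T = mtrace_regular_matrix[OF Z_index(1)[OF m] A, folded M_def]
  obtain fs where fs: "\<forall>j. mtrace ((M * mat_adjoint M) ^\<^sub>m j) = complex_of_real (\<Sum>e\<leftarrow>fs. e ^ j)"
    "\<forall>x. kernel_dim (M * mat_adjoint M - complex_of_real x \<cdot>\<^sub>m 1\<^sub>m (r * group_index G (Z m))) = count_list fs x"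
    "\<forall>x. eigenvalue (M * mat_adjoint M) (complex_of_real x) \<longleftrightarrow> x \<in> set fs"
    using gram_eigenvalues[OF T(1)] by metis
  have "mset fs = mset (eigs es m)"
  proof (rule power_sums_determine_mset)
    fix j
    have "complex_of_real (\<Sum>e\<leftarrow>fs. e ^ j) = complex_of_real (\<Sum>e\<leftarrow>eigs es m. e ^ j)"
      unfolding eigs_power[OF m] fs(1)[rule_format, symmetric] T(2) Z_index(2)[OF m] ..
    then show "(\<Sum>e\<leftarrow>fs. e ^ j) = (\<Sum>e\<leftarrow>eigs es m. e ^ j)" by (simp only: of_real_eq_iff)
  qed
  then have "set fs = set (eigs es m)" "count_list fs x = count_list (eigs es m) x"
    by (auto dest: mset_eq_setD simp flip: count_mset)
  moreover have "dim_row M = r * group_index G (Z m)" using T(1) by auto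
  ultimately show "eigenvalue (M * mat_adjoint M) (complex_of_real x) \<longleftrightarrow> x \<in> set (eigs es m)"
    "kernel_dim (M * mat_adjoint M - complex_of_real x \<cdot>\<^sub>m 1\<^sub>m (dim_row M)) = count_list (eigs es m) x"
    using fs by auto
qed

lemma alpha_number_Z:
  assumes m: "0 < m" and ne: "e \<in> set (eigs es m)" "0 < e"
  shows "alpha_number G A (Z m) = eig_alpha es d m"
proof -
  define M where "M = regular_matrix (G Mod Z m) (quotient_mat G (Z m) A)"
  note E = regular_matrix_eigs[OF m, folded M_def]
  let ?E = "{e \<in> set (eigs es m). 0 < e}"
  have fin: "finite ?E" "?E \<noteq> {}" using ne by auto
  have "{t \<in> singular_values M. 0 < t} = sqrt ` ?E"
  proof (intro equalityI subsetI)
    fix t assume "t \<in> {t \<in> singular_values M. 0 < t}"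
    then have "t\<^sup>2 \<in> ?E" "t = sqrt (t\<^sup>2)" by (auto simp: singular_values_def E(1) simp del: of_real_power)
    then show "t \<in> sqrt ` ?E" by (rule rev_image_eqI)
  next
    fix t assume "t \<in> sqrt ` ?E"
    then show "t \<in> {t \<in> singular_values M. 0 < t}" by (auto simp: singular_values_def E(1) simp del: of_real_power)
  qed
  then have sp: "sigma_plus M = sqrt (min_pos_eig es m)"
    unfolding sigma_plus_def min_pos_eig_def
    using mono_Min_commute[of sqrt ?E] fin by (simp add: mono_def)
  have "min_pos_eig es m \<in> ?E" unfolding min_pos_eig_def by (rule Min_in[OF fin])
  then have "(sigma_plus M)\<^sup>2 = min_pos_eig es m" unfolding sp by simp
  then have "m_plus M = count_list (eigs es m) (min_pos_eig es m)"
    unfolding m_plus_def E(2) by simp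
  then show ?thesis
    unfolding alpha_number_def M_def[symmetric] Let_def Z_index(2)[OF m] sp eig_alpha_def by simp
qed

end

locale virtually_Z_spectrum = virtually_Z_matrix G t d rp A r s +
  CS: circle_spectrum "virtually_Z_matrix.es G t d rp A r" "r * d" k0 X p c1 c2
  for G (structure) and t d rp A r s k0 X p c1 c2
begin

lemma no_gap_zeros: "\<not> spectral_gap G A \<Longrightarrow> CS.S \<noteq> {}"
proof
  assume gap: "\<not> spectral_gap G A" and S: "CS.S = {}"
  obtain D where D: "counting_limit D (eig_count es) d" "\<And>l. spectral_distribution G A l = D (l\<^sup>2)"
    using spectral_distribution_counting_limit by blast
  interpret L: circle_spectrum_limit es "r * d" k0 X p c1 c2 D d
    using D(1) CS.circle_spectrum_axioms by (simp add: circle_spectrum_limit_def)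
  obtain a where "0 < a" "D a = D 0" using L.gap_if_no_zero[OF S] by blast
  then have "spectral_distribution G A (sqrt a) = spectral_distribution G A 0" "0 < sqrt a" by (simp_all add: D(2))
  then show False using gap unfolding spectral_gap_def by blast
qed

lemma NS_numbers:
  assumes S: "CS.S \<noteq> {}"
  shows "upper_NS G A = NS (ereal (2 / CS.b))" "lower_NS G A = NS (ereal (2 / CS.b))"
proof -
  obtain D where D: "counting_limit D (eig_count es) d" "\<And>l. spectral_distribution G A l = D (l\<^sup>2)"
    using spectral_distribution_counting_limit by blast
  interpret L: circle_spectrum_limit es "r * d" k0 X p c1 c2 D d
    using D(1) CS.circle_spectrum_axioms by (simp add: circle_spectrum_limit_def)
  note lim = tendsto_ereal[OF L.distribution_exponent(1)[OF S]]
  have ng: "\<not> spectral_gap G A"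
    unfolding spectral_gap_def D(2) using L.distribution_exponent(2)[OF S] by auto
  show "upper_NS G A = NS (ereal (2 / CS.b))" "lower_NS G A = NS (ereal (2 / CS.b))"
    using lim_imp_Limsup[OF _ lim] lim_imp_Liminf[OF _ lim] ng
    by (simp_all add: upper_NS_def lower_NS_def D(2))
qed

lemma limsup_alpha:
  assumes S: "CS.S \<noteq> {}"
  shows "limsup_fin G (alpha_number G A) = ereal (2 / CS.b)"
proof -
  obtain C' M where "0 < C'" and M: "\<And>m. M \<le> m \<Longrightarrow> 0 < CS.sig2 m \<and> CS.sig2 m \<le> C' * real m powr - real CS.b \<and>
    CS.sig2 m \<in> set (CS.evs m) \<and> real (count_list (CS.evs m) (CS.sig2 m)) \<le> C'"
    using CS.sig2_upper[OF S] by blast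
  have alpha: "alpha_number G A (Z m) = eig_alpha es d m" if "M \<le> m" "0 < m" for m
    using alpha_number_Z[OF that(2)] M[OF that(1)] by blast
  show ?thesis
  proof (rule antisym)
    show "limsup_fin G (alpha_number G A) \<le> ereal (2 / CS.b)"
    proof (rule ereal_le_epsilon2)
      fix \<epsilon> :: real assume \<epsilon>: "0 < \<epsilon>"
      obtain M' where M': "\<And>m. M' \<le> m \<Longrightarrow> eig_alpha es d m \<le> 2 / CS.b + \<epsilon>"
        using CS.eig_alpha_upper[OF S d \<epsilon>] by blast
      define k where "k = max (max M M') 1"
      have k: "M \<le> k" "M' \<le> k" "0 < k" by (auto simp: k_def)
      have "(SUP N\<in>{N \<in> finite_index_normal G. N \<subseteq> Z k}. ereal (alpha_number G A N)) \<le> ereal (2 / CS.b + \<epsilon>)"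
      proof (rule SUP_least)
        fix N assume "N \<in> {N \<in> finite_index_normal G. N \<subseteq> Z k}"
        then obtain m where m: "0 < m" "k dvd m" "N = Z m" using finite_index_subset_Z by blast
        have "k \<le> m" using m by (intro dvd_imp_le)
        then show "ereal (alpha_number G A N) \<le> ereal (2 / CS.b + \<epsilon>)"
          using alpha[of m] M'[of m] k m by simp
      qed
      then show "limsup_fin G (alpha_number G A) \<le> ereal (2 / CS.b) + ereal \<epsilon>"
        unfolding limsup_fin_def plus_ereal.simps(1) by (rule INF_lower2[OF Z_index(1)[OF k(3)]])
    qed
    show "ereal (2 / CS.b) \<le> limsup_fin G (alpha_number G A)"
      unfolding limsup_fin_def
    proof (rule INF_greatest)
      fix N assume N: "N \<in> finite_index_normal G"
      obtain k where k: "0 < k" "Z k \<subseteq> N" using Z_subset_finite_index[OF N] by blast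
      show "ereal (2 / CS.b) \<le> (SUP N'\<in>{N' \<in> finite_index_normal G. N' \<subseteq> N}. ereal (alpha_number G A N'))"
      proof (rule ereal_le_epsilon2)
        fix \<epsilon> :: real assume \<epsilon>: "0 < \<epsilon>"
        \<comment> \<open>The factor \<open>max M 1\<close> forces \<open>M \<le> m\<close>, where
          \<open>alpha\<close> identifies the alpha number.\<close>
        have "0 < k * max M 1" using k by simp
        then obtain m where m: "0 < m" "k * max M 1 dvd m" "2 / CS.b - \<epsilon> \<le> eig_alpha es d m"
          using CS.eig_alpha_lower[OF S d \<epsilon>] by blast
        have "max M 1 dvd m" "k dvd m" using m(2) by (auto elim: dvd_mult_left dvd_mult_right)
        then have "M \<le> m" "Z m \<subseteq> N" using m(1) dvd_imp_le[of "max M 1" m] Z_antimono[of k m] k(2) by auto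
        then have "ereal (2 / CS.b - \<epsilon>) \<le> ereal (alpha_number G A (Z m))" "Z m \<in> {N' \<in> finite_index_normal G. N' \<subseteq> N}"
          using alpha m Z_index(1) by auto
        then have "ereal (2 / CS.b - \<epsilon>) \<le> (SUP N'\<in>{N' \<in> finite_index_normal G. N' \<subseteq> N}. ereal (alpha_number G A N'))"
          by (rule SUP_upper2[rotated])
        then show "ereal (2 / CS.b) \<le> (SUP N'\<in>{N' \<in> finite_index_normal G. N' \<subseteq> N}. ereal (alpha_number G A N')) + ereal \<epsilon>"
          by (metis add_right_mono diff_add_cancel plus_ereal.simps(1))
      qed
    qed
  qed
qed

end

context virtually_Z_matrix
begin

theorem upper_NS_limsup_alpha:
  assumes "\<not> spectral_gap G A"
  shows "upper_NS G A = NS (limsup_fin G (alpha_number G A))"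
proof -
  obtain k0 X p c1 c2 where X: "finite X" and p: "p \<noteq> 0" "0 < c1" "0 < c2" and k0: "k0 \<le> r * d"
    and sp: "\<And>z. cmod z = 1 \<Longrightarrow> z \<notin> X \<Longrightarrow> count_list (es z) 0 = k0 \<and>
      (k0 < r * d \<longrightarrow> (\<forall>e\<in>set (es z). 0 < e \<longrightarrow> c1 * cmod (poly p z) \<le> e) \<and>
        (\<exists>e\<in>set (es z). 0 < e \<and> e \<le> c2 * cmod (poly p z)))"
    using spectrum_data by blast
  show ?thesis
  proof (cases "k0 < r * d")
    case True
    interpret V: virtually_Z_spectrum G t d rp A r s k0 X p c1 c2
    proof
      fix z e assume "cmod z = 1" "e \<in> set (es z)"
      then show "0 \<le> e" using es(2) by blast
    qed (use True X p sp es(1) in auto)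
    have "V.CS.S \<noteq> {}" by (rule V.no_gap_zeros[OF assms])
    then show ?thesis using V.NS_numbers(1) V.limsup_alpha by simp
  next
    case False
    obtain D where D: "counting_limit D (eig_count es) d" "\<And>l. spectral_distribution G A l = D (l\<^sup>2)"
      using spectral_distribution_counting_limit by blast
    interpret L: counting_limit D "eig_count es" d by (rule D(1))
    \<comment> \<open>Here all eigenvalues vanish off finitely many points of the circle. The count
      at 1 is at most \<open>r * d * m\<close> and the count at 0 falls short of it by a bounded
      amount, so there is a spectral gap, contrary to the assumption.\<close>
    have "D (1 / 2) = D 0"
    proof (rule L.gap[of 1 "real (r * d)" 0 "real (r * d * card X)"])
      fix m :: nat
      have "eig_count es m 1 \<le> (\<Sum>k<m. r * d)"
        unfolding eig_count_eq by (intro sum_mono) (metis es(1) length_filter_le norm_unit_root)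
      also have "\<dots> = r * d * m" by simp
      finally have "real (eig_count es m 1) \<le> real (r * d * m)" by (rule of_nat_mono)
      then show "real (eig_count es m 1) \<le> real (r * d) * m + 0" by simp
      have "(\<Sum>k<m. r * d) \<le> (\<Sum>k<m. length (filter (\<lambda>e. e \<le> 0) (es (unit_root m k))) + (if unit_root m k \<in> X then r * d else 0))"
      proof (rule sum_mono)
        fix k
        show "r * d \<le> length (filter (\<lambda>e. e \<le> 0) (es (unit_root m k))) + (if unit_root m k \<in> X then r * d else 0)"
          using sp[of "unit_root m k"] es(2)[of "unit_root m k"] False k0
          by (auto simp: length_filter_le_split)
      qed
      also have "\<dots> = eig_count es m 0 + card {k. k < m \<and> unit_root m k \<in> X} * (r * d)"
        by (simp only: eig_count_eq sum.distrib sum_indicator_card of_nat_id)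
      also have "\<dots> \<le> eig_count es m 0 + card X * (r * d)"
        using card_roots_in_finite[OF X] by (intro add_left_mono mult_le_mono1)
      finally have "r * d * m \<le> eig_count es m 0 + r * d * card X" by (simp add: mult_ac)
      then have "real (r * d * m) \<le> real (eig_count es m 0 + r * d * card X)" by (rule of_nat_mono)
      then show "real (r * d) * m \<le> real (eig_count es m 0) + real (r * d * card X)" by simp
    qed simp
    then have "spectral_distribution G A (sqrt (1 / 2)) = spectral_distribution G A 0" "0 < sqrt (1 / 2)"
      by (simp_all add: D(2))
    then show ?thesis using assms unfolding spectral_gap_def by blast
  qed
qed

end

section \<open>Finite groups and a counterexample for lower limits\<close>

text \<open>The trivial subgroup has finite index, so \<open>A\<close> has one finite matrix with
  finitely many eigenvalues. Its list, taken at every point of the circle, is a constant family to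
  which the counting argument applies with \<open>q\<close> in place of \<open>d\<close>. Below the
  smallest positive eigenvalue the counting functions are constant.\<close>

lemma (in group) finite_group_spectral_gap:
  assumes fin: "finite (carrier G)" and A: "A \<in> GM r s"
  shows "spectral_gap G A"
proof -
  let ?C = "gr_mult G A (gr_star G A)"
  have C: "?C \<in> GM r r" by (rule gr_mult_GM[OF A gr_star_GM[OF A]])
  have "rcosets {\<one>} \<subseteq> Pow (carrier G)" using rcosets_subset_PowG[OF normal_imp_subgroup[OF one_is_normal]] .
  then have "finite (rcosets {\<one>})" by (rule finite_subset) (use fin in simp)
  then have N: "{\<one>} \<in> finite_index_normal G" by (simp add: finite_index_normal_def one_is_normal)
  define q where "q = group_index G {\<one>}"
  have "{\<one>} #> \<one> \<in> rcosets {\<one>}" by (rule rcosetsI) simp_all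
  then have q: "0 < q" using \<open>finite (rcosets {\<one>})\<close> by (auto simp: q_def group_index_def card_gt_0_iff)
  note T = mtrace_regular_matrix[OF N A]
  obtain fs where fs: "length fs = r * q" "\<forall>e\<in>set fs. 0 \<le> e"
    "\<And>j. mtrace ((regular_matrix (G Mod {\<one>}) (quotient_mat G {\<one>} A) *
      mat_adjoint (regular_matrix (G Mod {\<one>}) (quotient_mat G {\<one>} A))) ^\<^sub>m j) = complex_of_real (\<Sum>e\<leftarrow>fs. e ^ j)"
    using gram_eigenvalues[OF T(1)] unfolding q_def by metis
  define es where "es z = fs" for z :: complex
  have tr: "(\<Sum>e\<leftarrow>fs. e ^ j) = real q * (\<Sum>k<r. Re ((gr_pow ?C j $$ (k, k)) \<one>))" for j
  proof -
    have "complex_of_real (\<Sum>e\<leftarrow>fs. e ^ j) = (\<Sum>k<r. of_nat q * (gr_pow ?C j $$ (k, k)) \<one>)"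
      unfolding fs(3)[symmetric] T(2)
    proof (rule sum.cong[OF refl])
      fix k assume "k \<in> {..<r}"
      then have k: "k < r" by simp
      have "gsum G (gr_pow ?C j $$ (k, k)) (\<lambda>g. if g \<in> {\<one>} then of_nat (group_index G {\<one>}) else 0) =
        (gr_pow ?C j $$ (k, k)) \<one> * (if \<one> \<in> {\<one>} then of_nat (group_index G {\<one>}) else 0)"
        by (rule gsum_eq_at_one[OF GM_entry[OF gr_pow_GM[OF C] k k]]) auto
      then show "gsum G (gr_pow ?C j $$ (k, k)) (\<lambda>g. if g \<in> {\<one>} then of_nat (group_index G {\<one>}) else 0) =
        of_nat q * (gr_pow ?C j $$ (k, k)) \<one>" by (simp add: q_def)
    qed
    note eq = this
    have re: "Re (of_nat n * z) = real n * Re z" for n z by simp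
    from arg_cong[OF eq, of Re] show ?thesis unfolding Re_complex_of_real Re_sum re sum_distrib_left .
  qed
  have "\<exists>D. counting_limit D (eig_count es) q \<and> (\<forall>l. spectral_distribution G A l = D (l\<^sup>2))"
  proof (rule counting_limit_of_traces[OF A _ _ _ q])
    show "length (es z) = r * q" for z by (simp add: es_def fs(1))
    show "\<forall>e\<in>set (es z). 0 \<le> e" for z using fs(2) by (simp add: es_def)
    show "\<exists>K. \<forall>z e. cmod z = 1 \<longrightarrow> e \<in> set (es z) \<longrightarrow> e \<le> K"
      using member_le_sum_list_nonneg[OF _ fs(2)] unfolding es_def by blast
    fix j
    have "(\<Sum>e\<leftarrow>eigs es m. e ^ j) / (q * m) = (\<Sum>k<r. Re ((gr_pow ?C j $$ (k, k)) \<one>))" if "0 < m" for m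
      using that q by (simp add: sum_eigs es_def tr)
    then show "\<forall>\<^sub>F m in sequentially. (\<Sum>e\<leftarrow>eigs es m. e ^ j) / (q * m) = (\<Sum>k<r. Re ((gr_pow ?C j $$ (k, k)) \<one>))"
      using eventually_gt_at_top[of "0::nat"] by (rule eventually_mono[rotated])
  qed
  then obtain D where D: "counting_limit D (eig_count es) q" "\<And>l. spectral_distribution G A l = D (l\<^sup>2)" by blast
  interpret L: counting_limit D "eig_count es" q by (rule D(1))
  define E where "E = insert 1 {e \<in> set fs. 0 < e}"
  define a where "a = Min E / 2"
  have E: "finite E" "E \<noteq> {}" by (auto simp: E_def)
  have "Min E \<in> E" by (rule Min_in[OF E])
  then have a: "0 < a" by (auto simp: a_def E_def)
  have "a < e" if "e \<in> set fs" "0 < e" for e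
  proof -
    have "Min E \<le> e" by (rule Min_le[OF E(1)]) (use that in \<open>simp add: E_def\<close>)
    then show ?thesis using a by (simp add: a_def)
  qed
  then have "filter (\<lambda>e. e \<le> a) fs = filter (\<lambda>e. e \<le> 0) fs"
    using a by (intro filter_cong refl) (meson not_le order_trans less_imp_le)
  then have same: "eig_count es m a = length (filter (\<lambda>e. e \<le> 0) fs) * m"
    "eig_count es m 0 = length (filter (\<lambda>e. e \<le> 0) fs) * m" for m
    by (simp_all add: eig_count_eq es_def mult.commute)
  have "D (a / 2) = D 0"
    by (rule L.gap[OF a, of "real (length (filter (\<lambda>e. e \<le> 0) fs))" 0 0]) (simp_all add: same)
  then have "spectral_distribution G A (sqrt (a / 2)) = spectral_distribution G A 0" "0 < sqrt (a / 2)"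
    using a by (simp_all add: D(2))
  then show ?thesis unfolding spectral_gap_def by blast
qed

theorem upper_NS_eq_limsup_alpha:
  assumes G: "virtually_cyclic G" and A: "A \<in> group_ring_mats UNIV G r s" and ns: "upper_NS G A < \<infinity>\<^sup>+"
  shows "upper_NS G A = NS (limsup_fin G (alpha_number G A))"
proof -
  interpret group G using G by (simp add: virtually_cyclic_def)
  have gap: "\<not> spectral_gap G A" using ns by (auto simp: less_InfPlus_iff upper_NS_def)
  then have "infinite (carrier G)" using finite_group_spectral_gap[OF _ A] by blast
  then obtain t d rp where "virtually_Z G t d rp" using virtually_Z_exists[OF G] by blast
  then have "virtually_Z_matrix G t d rp A r s"
    using A by (simp add: virtually_Z_matrix_def virtually_Z_matrix_axioms_def)
  then show ?thesis using gap by (rule virtually_Z_matrix.upper_NS_limsup_alpha)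
qed

text \<open>The zeros of \<open>5 + 6 z + 5 z^2\<close> are the negatives of this number and of its
  conjugate. The Pythagorean triple 3, 4, 5 makes it a point of the circle with rational
  coordinates.\<close>

definition gauss_unit :: complex where "gauss_unit = Complex (3 / 5) (4 / 5)"

text \<open>Since \<open>(3 + 4 \<i>)\<^sup>2 = - 7 + 24 \<i>\<close>, all powers of \<open>3 + 4 \<i>\<close> are congruent to it modulo \<open>5\<close>.\<close>

lemma gauss_unit_pow: "\<exists>a b :: int. (5 * gauss_unit) ^ Suc n = Complex (real_of_int (5 * a + 3)) (real_of_int (5 * b + 4))"
proof (induction n)
  case 0
  show ?case by (rule exI[of _ 0], rule exI[of _ 0]) (simp add: gauss_unit_def complex_eq_iff)
next
  case (Suc n)
  then obtain a b :: int where ab: "(5 * gauss_unit) ^ Suc n = Complex (real_of_int (5 * a + 3)) (real_of_int (5 * b + 4))" by blast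
  have "(5 * gauss_unit) ^ Suc (Suc n) = (5 * gauss_unit) * Complex (real_of_int (5 * a + 3)) (real_of_int (5 * b + 4))"
    by (simp only: power_Suc[of "5 * gauss_unit" "Suc n"] ab)
  also have "\<dots> = Complex (real_of_int (5 * (3 * a - 4 * b - 2) + 3)) (real_of_int (5 * (3 * b + 4 * a + 4) + 4))"
    by (simp add: gauss_unit_def complex_eq_iff)
  finally show ?case by blast
qed

lemma gauss_unit_not_root_of_unity: "0 < n \<Longrightarrow> gauss_unit ^ n \<noteq> 1"
proof
  assume n: "0 < n" and w1: "gauss_unit ^ n = 1"
  obtain n' where n': "n = Suc n'" using n by (cases n) auto
  obtain a b :: int where ab: "(5 * gauss_unit) ^ n = Complex (real_of_int (5 * a + 3)) (real_of_int (5 * b + 4))"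
    using gauss_unit_pow[of n'] n' by blast
  have "(5 * gauss_unit) ^ n = complex_of_real (5 ^ n)" by (simp add: power_mult_distrib w1)
  then have "real_of_int (5 * b + 4) = 0" using ab by (metis Im_complex_of_real complex.sel(2))
  then have "5 * b + 4 = 0" by (simp only: of_int_eq_0_iff)
  then show False by presburger
qed

definition example_poly :: "complex poly" where "example_poly = [:5, 6, 5:]"

lemma example_poly_factor: "poly example_poly z = 5 * (z + gauss_unit) * (z + cnj gauss_unit)"
proof -
  have gu: "gauss_unit + cnj gauss_unit = 6 / 5" "gauss_unit * cnj gauss_unit = 1" by (simp_all add: gauss_unit_def complex_eq_iff)
  have "5 * (z + gauss_unit) * (z + cnj gauss_unit) = 5 * (z * z + (gauss_unit + cnj gauss_unit) * z + gauss_unit * cnj gauss_unit)" by (simp add: algebra_simps)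
  also have "\<dots> = poly example_poly z" unfolding gu by (simp add: example_poly_def algebra_simps)
  finally show ?thesis by simp
qed

text \<open>An even exponent removes the sign of the zeros, and conjugates of roots of unity are
  roots of unity, so the claim reduces to \<open>gauss_unit\<close>.\<close>

lemma example_poly_root_not_root_of_unity:
  assumes "poly example_poly z = 0" "0 < n"
  shows "z ^ n \<noteq> 1"
proof
  assume z: "z ^ n = 1"
  have z2: "z ^ (2 * n) = 1" by (simp add: power_mult_distrib mult.commute[of 2] power_mult z)
  have "z = - gauss_unit \<or> z = - cnj gauss_unit" using assms(1) by (auto simp: example_poly_factor add_eq_0_iff2)
  then have "gauss_unit ^ (2 * n) = 1"
  proof
    assume "z = - cnj gauss_unit"
    then have "gauss_unit = - cnj z" by simp
    then have "gauss_unit ^ (2 * n) = (- cnj z) ^ (2 * n)" by (simp only:)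
    also have "\<dots> = cnj (z ^ (2 * n))" by simp
    finally show ?thesis by (simp add: z2)
  qed (use z2 in simp)
  then show False using gauss_unit_not_root_of_unity[of "2 * n"] assms(2) by simp
qed

text \<open>The square is the \<open>p\<close> of the example, as the eigenvalue of a 1 by 1 Gram
  matrix is a squared modulus. The zeros of \<open>example_poly\<close> are simple: its derivative
  vanishes only at \<open>- 3 / 5\<close>, which is not one of them.\<close>

lemma example_poly_order: "Polynomial.order z (example_poly ^ 2) \<le> 2"
proof -
  have nz: "example_poly \<noteq> 0" by (simp add: example_poly_def)
  have "rsquarefree example_poly"
    unfolding rsquarefree_roots
  proof (intro allI notI)
    fix a assume a: "poly example_poly a = 0 \<and> poly (pderiv example_poly) a = 0"
    then have "6 + 10 * a = 0" by (simp add: example_poly_def pderiv_pCons algebra_simps)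
    then have "a = - 3 / 5" by (simp add: field_simps add_eq_0_iff)
    then show False using a by (simp add: example_poly_def)
  qed
  then have "Polynomial.order z example_poly \<le> 1" using nz unfolding rsquarefree_def by (metis le_refl zero_le)
  then show ?thesis using nz by (simp add: power2_eq_square order_mult)
qed

lemma cis_int_div: "0 < m \<Longrightarrow> cis (2 * pi * (real_of_int h / real m)) = unit_root m (nat (h mod int m))"
proof -
  assume m: "0 < m"
  have "real_of_int h = real m * real_of_int (h div int m) + real_of_int (h mod int m)"
    by (metis mult_div_mod_eq of_int_add of_int_mult of_int_of_nat_eq)
  then have "2 * pi * (real_of_int h / real m) = 2 * pi * real_of_int (h div int m) + 2 * pi * real (nat (h mod int m)) / real m"
    using m by (simp add: field_simps)
  then have "cis (2 * pi * (real_of_int h / real m)) = cis (2 * pi * real_of_int (h div int m)) * unit_root m (nat (h mod int m))"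
    by (simp only: unit_root_def cis_mult)
  then show ?thesis by (simp add: cis_multiple_2pi)
qed

text \<open>Dirichlet's theorem is applied to \<open>k\<close> times the angle, so that the
  denominator \<open>m = k * q\<close> is a multiple of \<open>k\<close>. An error below
  \<open>1 / q = k / m\<close> for \<open>m\<close> times the angle becomes a distance of order
  \<open>k / m\<^sup>2\<close>.\<close>

lemma root_of_unity_close:
  fixes z0 :: complex
  assumes z0: "cmod z0 = 1" "\<And>n. 0 < n \<Longrightarrow> z0 ^ n \<noteq> 1" and k: "0 < k"
  shows "\<exists>m\<ge>M. 0 < m \<and> k dvd m \<and> (\<exists>i<m. cmod (unit_root m i - z0) \<le> 2 * pi * real k / (real m)\<^sup>2)"
proof -
  define \<theta> where "\<theta> = Arg2pi z0 / (2 * pi)"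
  have z0\<theta>: "z0 = cis (2 * pi * \<theta>)"
  proof -
    have "z0 = rcis (cmod z0) (Arg2pi z0)" using Arg2pi_eq[of z0] by (simp add: rcis_def cis_conv_exp)
    then show ?thesis by (simp add: \<theta>_def rcis_def z0(1))
  qed
  \<comment> \<open>Dirichlet's theorem by itself does not make \<open>m\<close> large. As
    \<open>z0\<close> is no root of unity, it has a positive distance \<delta> from the finite set
    \<open>U\<close> of roots of unity of small order, and \<open>N\<close> is taken so large that
    the approximation is closer than \<delta>.\<close>
  define U where "U = (\<lambda>(m, i). unit_root m i) ` ({1..M} \<times> {..M})"
  have "finite U" by (simp add: U_def)
  then obtain \<delta> where \<delta>: "0 < \<delta>" "\<And>u. u \<in> U \<Longrightarrow> u \<noteq> z0 \<Longrightarrow> \<delta> \<le> dist z0 u" using finite_set_avoid[of U z0] by blast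
  obtain N :: nat where N: "2 * pi / \<delta> < real N" using reals_Archimedean2 by blast
  have "0 < 2 * pi / \<delta>" using \<delta>(1) by simp
  then have N0: "0 < N" using N by (metis less_trans of_nat_0_less_iff)
  obtain h q where q: "0 < q" "q \<le> int N" "\<bar>real_of_int q * (real k * \<theta>) - real_of_int h\<bar> < 1 / real N"
    by (rule Dirichlet_approx[OF N0, of "real k * \<theta>"]) blast
  define m where "m = k * nat q"
  have m: "0 < m" "k dvd m" using k q(1) by (simp_all add: m_def)
  have mq: "real m = real k * real_of_int q" using q(1) by (simp add: m_def)
  define i where "i = nat (h mod int m)"
  have i: "i < m" using m(1) by (simp add: i_def nat_less_iff)
  have "cmod (unit_root m i - z0) = 2 * \<bar>sin ((2 * pi * (real_of_int h / real m) - 2 * pi * \<theta>) / 2)\<bar>"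
    unfolding i_def cis_int_div[OF m(1), symmetric] z0\<theta> cmod_cis_diff ..
  also have "\<dots> \<le> 2 * \<bar>(2 * pi * (real_of_int h / real m) - 2 * pi * \<theta>) / 2\<bar>"
    by (rule mult_left_mono[OF abs_sin_x_le_abs_x]) simp
  also have "\<dots> = 2 * pi * (\<bar>real_of_int q * (real k * \<theta>) - real_of_int h\<bar> / real m)"
  proof -
    have "2 * \<bar>(2 * pi * (real_of_int h / real m) - 2 * pi * \<theta>) / 2\<bar> = \<bar>2 * pi * ((real_of_int h - real m * \<theta>) / real m)\<bar>"
      using m(1) by (simp add: field_simps)
    also have "\<dots> = 2 * pi * (\<bar>real_of_int h - real m * \<theta>\<bar> / real m)" by (simp add: abs_mult)
    also have "\<bar>real_of_int h - real m * \<theta>\<bar> = \<bar>real_of_int q * (real k * \<theta>) - real_of_int h\<bar>"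
      unfolding mq by (simp add: abs_minus_commute mult_ac)
    finally show ?thesis .
  qed
  finally have close: "cmod (unit_root m i - z0) \<le> 2 * pi * (\<bar>real_of_int q * (real k * \<theta>) - real_of_int h\<bar> / real m)" .
  have le1: "cmod (unit_root m i - z0) \<le> 2 * pi * (1 / real N / real m)"
    by (rule order_trans[OF close]) (use q(3) in \<open>intro mult_left_mono divide_right_mono; simp\<close>)
  have "1 / real N \<le> 1 / real_of_int q" using q by (intro divide_left_mono) auto
  also have "\<dots> = real k / real m" using k q(1) by (simp add: mq)
  finally have kN: "1 / real N \<le> real k / real m" .
  have le2: "cmod (unit_root m i - z0) \<le> 2 * pi * real k / (real m)\<^sup>2"
  proof -
    have "2 * pi * (1 / real N / real m) \<le> 2 * pi * (real k / real m / real m)"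
      using kN by (intro mult_left_mono divide_right_mono) auto
    then show ?thesis using le1 by (simp add: power2_eq_square)
  qed
  have "M \<le> m"
  proof (rule ccontr)
    assume "\<not> M \<le> m"
    then have "unit_root m i \<in> U" using m(1) i unfolding U_def by force
    moreover have "unit_root m i \<noteq> z0" using unit_root_pow[OF m(1)] z0(2)[OF m(1)] by metis
    ultimately have "\<delta> \<le> cmod (unit_root m i - z0)" using \<delta>(2) by (metis dist_commute dist_norm)
    also have "\<dots> \<le> 2 * pi * (1 / real N / real m)" by (rule le1)
    also have "\<dots> \<le> 2 * pi * (1 / real N / 1)" using m(1) by (intro mult_left_mono divide_left_mono) auto
    also have "\<dots> < \<delta>" using N N0 \<delta>(1) by (simp add: field_simps)
    finally show False by simp
  qed
  then show ?thesis using m i le2 by blast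
qed

section \<open>The example over the integers\<close>

lemma virtually_Z_integer_group: "virtually_Z integer_group 1 1 (\<lambda>_. 0)"
  by (simp add: virtually_Z_def virtually_Z_axioms_def)

definition example_elem :: "int \<Rightarrow> complex" where
  "example_elem g = (if g = 0 then 5 else if g = 1 then 6 else if g = 2 then 5 else 0)"

definition example_mat :: "(int \<Rightarrow> complex) mat" where
  "example_mat = Matrix.mat 1 1 (\<lambda>_. example_elem)"

lemma example_mat_mem:
  assumes "subfield K (class_ring :: complex ring)"
  shows "example_mat \<in> group_ring_mats K integer_group 1 1"
proof -
  have sub: "subring K (class_ring :: complex ring)" using assms by (simp add: subfieldE subcring.axioms(1) subfieldE(1))
  have K: "0 \<in> K" "1 \<in> K" "\<And>x y. x \<in> K \<Longrightarrow> y \<in> K \<Longrightarrow> x + y \<in> K"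
    using subringE[OF sub] by (simp_all add: class_ring_simps)
  have "2 \<in> K" using K(3)[OF K(2) K(2)] by simp
  have "3 \<in> K" using K(3)[OF K(2) \<open>2 \<in> K\<close>] by simp
  have "5 \<in> K" using K(3)[OF \<open>2 \<in> K\<close> \<open>3 \<in> K\<close>] by simp
  moreover have "6 \<in> K" using K(3)[OF \<open>3 \<in> K\<close> \<open>3 \<in> K\<close>] by simp
  ultimately have "range example_elem \<subseteq> K" using K(1) by (auto simp: example_elem_def)
  moreover have "finite {g. example_elem g \<noteq> 0}" by (rule finite_subset[of _ "{0, 1, 2}"]) (auto simp: example_elem_def)
  ultimately show ?thesis by (simp add: group_ring_mats_def group_ring_def example_mat_def)
qed

lemma example_mat_GM: "example_mat \<in> group_ring_mats UNIV integer_group 1 1"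
proof -
  have "finite {g. example_elem g \<noteq> 0}" by (rule finite_subset[of _ "{0, 1, 2}"]) (auto simp: example_elem_def)
  then show ?thesis by (simp add: group_ring_mats_def group_ring_def example_mat_def)
qed

interpretation Example: virtually_Z_matrix integer_group 1 1 "\<lambda>_. 0" example_mat 1 1
  using virtually_Z_integer_group example_mat_GM by (simp add: virtually_Z_matrix_def virtually_Z_matrix_axioms_def)

lemma example_es:
  assumes z: "cmod z = 1"
  shows "Example.es z = [(cmod (poly example_poly z))\<^sup>2]"
proof -
  interpret U: unitary_rep integer_group 1 "Example.zrep z" by (rule Example.zrep_unitary[OF z])
  have co: "Example.co g = 0" for g using Example.coord(1)[of g] by simp
  have ex: "Example.ex g = g" for g using Example.coord(2)[of g] by simp
  have "U.lin example_elem 0 0 = (\<Sum>g\<in>{0, 1, 2}. example_elem g * z powi g)"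
    unfolding U.lin_def by (subst gsum_superset[of "{0, 1, 2}"]) (auto simp: example_elem_def Example.zrep_def co ex simp del: One_nat_def)
  also have "\<dots> = poly example_poly z" by (simp add: example_elem_def example_poly_def algebra_simps power2_eq_square)
  finally have lin: "U.lin example_elem 0 0 = poly example_poly z" .
  have sy: "Example.symbol z \<in> carrier_mat 1 1" using Example.symbol_carrier[OF z] by (simp del: One_nat_def)
  have ent: "Example.symbol z $$ (0, 0) = poly example_poly z"
    unfolding Example.symbol_def U.rep_mat_def using lin by (simp add: example_mat_def)
  have "(Example.symbol z * mat_adjoint (Example.symbol z)) ^\<^sub>m 1 = Example.symbol z * mat_adjoint (Example.symbol z)"
    using sy mat_adjoint_carrier[OF sy] by simp
  then have "complex_of_real (\<Sum>e\<leftarrow>Example.es z. e) = mtrace (Example.symbol z * mat_adjoint (Example.symbol z))"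
    using Example.es(4)[OF z, of 1] by simp
  also have "\<dots> = poly example_poly z * cnj (poly example_poly z)"
    using gram_entry[OF sy, of 0 0] sy ent by (auto simp: mtrace_def)
  also have "\<dots> = complex_of_real ((cmod (poly example_poly z))\<^sup>2)" by (simp only: complex_norm_square)
  finally have sum: "(\<Sum>e\<leftarrow>Example.es z. e) = (cmod (poly example_poly z))\<^sup>2" by (simp only: of_real_eq_iff)
  have "length (Example.es z) = Suc 0" using Example.es(1)[OF z] by simp
  then show ?thesis using sum by (auto simp: length_Suc_conv)
qed

text \<open>The single eigenvalue is the modulus of \<open>example_poly ^ 2\<close>, so both
  comparison constants are 1, and 0 is an eigenvalue only at the zeros, which form the exceptional
  set.\<close>

interpretation Example_Spectrum: virtually_Z_spectrum integer_group 1 1 "\<lambda>_. 0" example_mat 1 1 0 "{z. poly example_poly z = 0}" "example_poly ^ 2" 1 1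
proof
  show "finite {z. poly example_poly z = 0}" by (rule poly_roots_finite) (simp add: example_poly_def)
qed (auto simp: example_es example_poly_def norm_power poly_power simp del: One_nat_def)

lemma minus_gauss_unit_zero: "- gauss_unit \<in> Example_Spectrum.CS.S"
  by (simp add: Example_Spectrum.CS.S_def poly_power example_poly_factor) (simp add: gauss_unit_def cmod_def power2_eq_square)

text \<open>At a distance of order \<open>1 / m\<^sup>2\<close> from a simple zero the eigenvalue, a
  squared modulus, is at most a multiple of \<open>m\<close> to the power \<open>- 4\<close>. So
  \<open>log_ratio_upper\<close> with \<open>s = 4\<close> gives the bound \<open>2 / 4\<close>, for
  some \<open>m\<close> below every member of the net.\<close>

lemma liminf_alpha_le: "liminf_fin integer_group (alpha_number integer_group example_mat) \<le> ereal (1 / 2)"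
  unfolding liminf_fin_def
proof (rule SUP_least, rule ereal_le_epsilon2)
  fix N and \<epsilon> :: real assume N: "N \<in> finite_index_normal (integer_group :: int monoid)" and \<epsilon>: "0 < \<epsilon>"
  obtain k where k: "0 < k" "Example.Z k \<subseteq> N" using Example.Z_subset_finite_index[OF N] by blast
  have S: "Example_Spectrum.CS.S \<noteq> {}" using minus_gauss_unit_zero by blast
  obtain C M where M: "0 < C" "\<And>m. M \<le> m \<Longrightarrow> 0 < Example_Spectrum.CS.sig2 m \<and> Example_Spectrum.CS.sig2 m \<le> C * real m powr - real Example_Spectrum.CS.b \<and>
    Example_Spectrum.CS.sig2 m \<in> set (Example_Spectrum.CS.evs m) \<and> real (count_list (Example_Spectrum.CS.evs m) (Example_Spectrum.CS.sig2 m)) \<le> C"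
    using Example_Spectrum.CS.sig2_upper[OF S] by blast
  \<comment> \<open>The factor 10 is the leading coefficient 5 times the bound 2 for the distance to
    the other zero; the exponent turns the modulus into the eigenvalue.\<close>
  define C' where "C' = (10 * (2 * pi * real k))\<^sup>2"
  have C': "0 < C'" using k(1) by (simp add: C'_def)
  obtain M' where M': "\<And>m \<sigma> \<mu>. M' \<le> m \<Longrightarrow> 0 < \<sigma> \<Longrightarrow> \<sigma> \<le> C' * real m powr - 4 \<Longrightarrow> 1 \<le> \<mu> \<Longrightarrow>
    ln (\<mu> / (1 * real m)) / ln (sqrt \<sigma>) \<le> 2 / 4 + \<epsilon>"
    using log_ratio_upper[of C' 4 1 \<epsilon>] C' \<epsilon> by auto
  have w1: "cmod (- gauss_unit) = 1" using minus_gauss_unit_zero by (simp add: Example_Spectrum.CS.S_def)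
  have wn: "(- gauss_unit) ^ n \<noteq> 1" if "0 < n" for n
    by (rule example_poly_root_not_root_of_unity[OF _ that]) (simp add: example_poly_factor)
  obtain m i where m: "max M M' \<le> m" "0 < m" "k dvd m" and i: "i < m" "cmod (unit_root m i - - gauss_unit) \<le> 2 * pi * real k / (real m)\<^sup>2"
    using root_of_unity_close[OF w1 wn k(1), of "max M M'"] by blast
  let ?e = "(cmod (poly example_poly (unit_root m i)))\<^sup>2"
  have "poly example_poly (unit_root m i) \<noteq> 0" using example_poly_root_not_root_of_unity[OF _ m(2)] unit_root_pow[OF m(2)] by blast
  then have e: "?e \<in> {e \<in> set (Example_Spectrum.CS.evs m). 0 < e}" using i(1) by (auto simp: set_eigs example_es simp del: One_nat_def intro!: bexI[of _ i])
  have "cmod (poly example_poly (unit_root m i)) \<le> 5 * (2 * pi * real k / (real m)\<^sup>2) * 2"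
    unfolding example_poly_factor norm_mult
  proof (intro mult_mono)
    have "cmod (unit_root m i + cnj gauss_unit) \<le> cmod (unit_root m i) + cmod (cnj gauss_unit)" by (rule norm_triangle_ineq)
    then show "cmod (unit_root m i + cnj gauss_unit) \<le> 2" using w1 by simp
  qed (use i(2) in auto)
  then have "?e \<le> (5 * (2 * pi * real k / (real m)\<^sup>2) * 2)\<^sup>2" by (intro power_mono) auto
  also have "\<dots> = C' / ((real m)\<^sup>2)\<^sup>2" by (simp add: C'_def power_mult_distrib power_divide)
  also have "\<dots> = C' * real m powr - 4" using m(2) by (simp add: powr_minus divide_inverse flip: power_mult)
  finally have "?e \<le> C' * real m powr - 4" .
  moreover have "Example_Spectrum.CS.sig2 m \<le> ?e" unfolding min_pos_eig_def by (rule Min_le[OF _ e]) simp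
  ultimately have sm: "Example_Spectrum.CS.sig2 m \<le> C' * real m powr - 4" by linarith
  have m': "M \<le> m" "M' \<le> m" using m(1) by auto
  note sg = M(2)[OF m'(1)]
  have "count_list (Example_Spectrum.CS.evs m) (Example_Spectrum.CS.sig2 m) \<noteq> 0" using sg by (simp add: count_list_0_iff)
  then have "ln (real (count_list (Example_Spectrum.CS.evs m) (Example_Spectrum.CS.sig2 m)) / (1 * real m)) / ln (sqrt (Example_Spectrum.CS.sig2 m)) \<le> 2 / 4 + \<epsilon>"
    using sg sm m'(2) by (intro M') auto
  then have "eig_alpha Example.es 1 m \<le> 1 / 2 + \<epsilon>" by (simp add: eig_alpha_def)
  moreover have "alpha_number integer_group example_mat (Example.Z m) = eig_alpha Example.es 1 m"
    by (rule Example.alpha_number_Z[OF m(2)]) (use sg in auto)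
  ultimately have al: "ereal (alpha_number integer_group example_mat (Example.Z m)) \<le> ereal (1 / 2) + ereal \<epsilon>" by simp
  have "Example.Z m \<in> {M \<in> finite_index_normal integer_group. M \<subseteq> N}"
    using Example.Z_index(1)[OF m(2)] Example.Z_antimono[OF m(3)] k(2) by auto
  then show "(INF M\<in>{M \<in> finite_index_normal integer_group. M \<subseteq> N}. ereal (alpha_number integer_group example_mat M)) \<le> ereal (1 / 2) + ereal \<epsilon>"
    using al by (rule INF_lower2)
qed

lemma virtually_cyclic_integer_group: "virtually_cyclic integer_group"
  unfolding virtually_cyclic_def
proof (intro conjI exI)
  interpret group "integer_group :: int monoid" by simp
  show "group (integer_group :: int monoid)" by simp
  show "subgroup (carrier integer_group) (integer_group :: int monoid)" by unfold_locales auto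
  show "cyclic_group (integer_group\<lparr>carrier := carrier integer_group\<rparr>)"
  proof -
    have eq: "integer_group\<lparr>carrier := carrier integer_group\<rparr> = integer_group" by (simp add: integer_group_def)
    show ?thesis unfolding eq by (rule cyclic_integer_group)
  qed
  show "finite (rcosets\<^bsub>integer_group\<^esub> carrier (integer_group :: int monoid))"
  proof (rule finite_subset)
    show "rcosets\<^bsub>integer_group\<^esub> carrier (integer_group :: int monoid) \<subseteq> {UNIV}"
    proof
      fix c :: "int set" assume "c \<in> rcosets\<^bsub>integer_group\<^esub> carrier (integer_group :: int monoid)"
      then obtain a where c: "c = (\<Union>h. {h + a})" by (auto simp: RCOSETS_def r_coset_def)
      have "x \<in> c" for x unfolding c by (rule UN_I[of "x - a"]) simp_all
      then show "c \<in> {UNIV}" by blast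
    qed
  qed simp
qed

theorem lower_NS_neq_liminf_alpha:
  "upper_NS integer_group example_mat < \<infinity>\<^sup>+"
  "lower_NS integer_group example_mat \<noteq> NS (liminf_fin integer_group (alpha_number integer_group example_mat))"
proof -
  have S: "Example_Spectrum.CS.S \<noteq> {}" using minus_gauss_unit_zero by blast
  show "upper_NS integer_group example_mat < \<infinity>\<^sup>+" by (simp add: less_InfPlus_iff Example_Spectrum.NS_numbers(1)[OF S])
  have "Example_Spectrum.CS.b \<le> 2" unfolding Example_Spectrum.CS.b_def using Example_Spectrum.CS.finS S example_poly_order by (subst Max_le_iff) auto
  moreover have "0 < Example_Spectrum.CS.b" by (rule Example_Spectrum.CS.b_pos[OF S])
  ultimately have "1 \<le> 2 / real Example_Spectrum.CS.b" by (simp add: field_simps)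
  then have "ereal (1 / 2) < ereal (2 / real Example_Spectrum.CS.b)" by simp
  then have "liminf_fin integer_group (alpha_number integer_group example_mat) \<noteq> ereal (2 / real Example_Spectrum.CS.b)"
    using liminf_alpha_le by auto
  then show "lower_NS integer_group example_mat \<noteq> NS (liminf_fin integer_group (alpha_number integer_group example_mat))"
    by (simp add: Example_Spectrum.NS_numbers(2)[OF S])
qed

theorem theorem5:
  fixes K :: "complex set"
  assumes K: "subfield K (class_ring :: complex ring)"
  shows "(\<forall>(G :: 'a monoid) r s A.
            virtually_cyclic G \<and> 0 < r \<and> 0 < s \<and> A \<in> group_ring_mats K G r s \<and>
            upper_NS G A < \<infinity>\<^sup>+ \<longrightarrow>
            upper_NS G A = NS (limsup_fin G (alpha_number G A))) \<and>
         (\<exists>(G :: int monoid) r s A.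
            virtually_cyclic G \<and> 0 < r \<and> 0 < s \<and> A \<in> group_ring_mats K G r s \<and>
            upper_NS G A < \<infinity>\<^sup>+ \<and>
            lower_NS G A \<noteq> NS (liminf_fin G (alpha_number G A)))"
proof (intro conjI allI impI)
  fix G :: "'a monoid" and r s A
  assume asm: "virtually_cyclic G \<and> 0 < r \<and> 0 < s \<and> A \<in> group_ring_mats K G r s \<and> upper_NS G A < \<infinity>\<^sup>+"
  \<comment> \<open>The first part holds for all complex coefficients and so for those in
    \<open>K\<close>. The coefficients of the example are sums of ones and therefore lie in every
    \<open>K\<close>.\<close>
  then have "A \<in> group_ring_mats UNIV G r s" by (auto simp: group_ring_mats_def group_ring_def)
  then show "upper_NS G A = NS (limsup_fin G (alpha_number G A))"
    using upper_NS_eq_limsup_alpha asm by blast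
next
  show "\<exists>(G :: int monoid) r s A. virtually_cyclic G \<and> 0 < r \<and> 0 < s \<and> A \<in> group_ring_mats K G r s \<and>
      upper_NS G A < \<infinity>\<^sup>+ \<and> lower_NS G A \<noteq> NS (liminf_fin G (alpha_number G A))"
    using virtually_cyclic_integer_group example_mat_mem[OF K] lower_NS_neq_liminf_alpha
    by (intro exI[of _ integer_group] exI[of _ 1] exI[of _ example_mat]) auto
qed

end
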